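(* Let $d\ge 1$ be an integer, $\beta>-1$ and $a>0$. (i) If $d\ge1$ and $\beta>(d-3)/2$, then $$S_{\lambda}(u_{\beta,a})(0)=u_{\beta,a}(0)+r_d(a:0)\left(L_{\beta,a}+o(1)\right)\lambda^{-\beta}+O\left(\lambda^{\frac{d-3}2-\beta}\right)\quad\text{as }\lambda\to\infty.$$ (ii) If $d\ge 2$ and $-1<\beta\le(d-3)/2$, then (this behaviour is called the Pinsky phenomenon for $S_\lambda(u_{\beta,a})$) $$S_{\lambda}(u_{\beta,a})(0)=u_{\beta,a}(0)+\big(\sigma_{\lambda}(U_{\beta,a})(0)-U_{\beta,a}(0)\big)+r_d(a:0)\,(L_{\beta,a}+o(1))\,\lambda^{-\beta}+o\left(\lambda^{\frac{d-3}2-\beta}\right)\quad\text{as }\lambda\to\infty,$$ where $$\sigma_{\lambda}(U_{\beta,a})(0)-U_{\beta,a}(0)=-P_{\beta,a}^{[d]}\cos\left(2\pi a\lambda-\frac{d-1+2\beta}4\pi\right)\lambda^{\frac{d-3}2-\beta}+O\left(\lambda^{\frac{d-5}2-\beta}\right)\quad\text{as }\lambda\to\infty.$$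
   Context: $\mathbb{T}^d$ is identified with $(-1/2,1/2]^d\subset\mathbb{R}^d$; $|\cdot|$ is the Euclidean norm and $\xi x$ denotes the inner product. For $\beta>-1$, $a>0$: $U_{\beta,a}(x)=(a^2-|x|^2)^{\beta}$ if $|x|<a$ and $U_{\beta,a}(x)=0$ if $|x|\ge a$ ($x\in\mathbb{R}^d$), and its periodization is $u_{\beta,a}(x)=\sum_{m\in\mathbb{Z}^d}U_{\beta,a}(x+m)$, $x\in\mathbb{T}^d$. For integrable $F$ on $\mathbb{R}^d$: $\hat F(\xi)=\int_{\mathbb{R}^d}F(x)e^{-2\pi i\xi x}\,dx$ and $\sigma_\lambda(F)(x)=\int_{|\xi|<\lambda}\hat F(\xi)e^{2\pi i\xi x}\,d\xi$. For integrable $f$ on $\mathbb{T}^d$: $\hat f(m)=\int_{\mathbb{T}^d}f(x)e^{-2\pi imx}\,dx$ ($m\in\mathbb{Z}^d$) and $S_\lambda(f)(x)=\sum_{m\in\mathbb{Z}^d,\,|m|<\lambda}\hat f(m)e^{2\pi imx}$. Here $\lambda$ is a real parameter. $r_d(a:x)=\#\{m\in\mathbb{Z}^d:|x-m|=a\}$. Constants: $P_{\beta,a}^{[d]}=\dfrac{\Gamma(\beta+1)}{\Gamma(d/2)}\,a^{(d-3)/2+\beta}\,\pi^{(d-4)/2-\beta}$ and $L_{\beta,a}=\dfrac{\Gamma(\beta+1)}2\left(\dfrac a\pi\right)^{\beta}\dfrac{\sin(\beta\pi/2)}{\beta\pi/2}$, where $\frac{\sin(\beta\pi/2)}{\beta\pi/2}$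 is read as $1$ if $\beta=0$. *)

theory Defs
  imports "HOL-Analysis.Analysis" "HOL-Library.Landau_Symbols"
begin

definition int_lattice :: "(real ^ 'n) set" where
  "int_lattice = {m. \<forall>i. m $ i \<in> \<int>}"

definition torus :: "(real ^ 'n) set" where
  "torus = {x. \<forall>i. - 1 / 2 < x $ i \<and> x $ i \<le> 1 / 2}"

definition ball_power :: "real \<Rightarrow> real \<Rightarrow> real ^ 'n \<Rightarrow> complex" where
  "ball_power \<beta> a x =
     (if norm x < a then complex_of_real ((a\<^sup>2 - (norm x)\<^sup>2) powr \<beta>) else 0)"

(* For every x only finitely many summands are nonzero, so no convergence issue arises. *)
definition periodized_ball_power :: "real \<Rightarrow> real \<Rightarrow> real ^ 'n \<Rightarrow> complex" where
  "periodized_ball_power \<beta> a x = (\<Sum>\<^sub>\<infinity>m\<in>int_lattice. ball_power \<beta> a (x + m))"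

definition fourier_transform :: "(real ^ 'n \<Rightarrow> complex) \<Rightarrow> real ^ 'n \<Rightarrow> complex" where
  "fourier_transform F \<xi> = (LINT x|lebesgue. F x * cis (- 2 * pi * (\<xi> \<bullet> x)))"

definition fourier_partial_integral ::
    "real \<Rightarrow> (real ^ 'n \<Rightarrow> complex) \<Rightarrow> real ^ 'n \<Rightarrow> complex" where
  "fourier_partial_integral R F x =
     (LINT \<xi>:{\<xi>. norm \<xi> < R}|lebesgue. fourier_transform F \<xi> * cis (2 * pi * (\<xi> \<bullet> x)))"

(* A function on the torus is represented by its values on the fundamental cube. *)
definition fourier_coeff :: "(real ^ 'n \<Rightarrow> complex) \<Rightarrow> real ^ 'n \<Rightarrow> complex" where
  "fourier_coeff f m = (LINT x:torus|lebesgue. f x * cis (- 2 * pi * (m \<bullet> x)))"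

definition fourier_partial_sum ::
    "real \<Rightarrow> (real ^ 'n \<Rightarrow> complex) \<Rightarrow> real ^ 'n \<Rightarrow> complex" where
  "fourier_partial_sum R f x =
     (\<Sum>m\<in>{m \<in> int_lattice. norm m < R}. fourier_coeff f m * cis (2 * pi * (m \<bullet> x)))"

definition lattice_sphere_count :: "real \<Rightarrow> real ^ 'n \<Rightarrow> nat" where
  "lattice_sphere_count a x = card {m \<in> int_lattice. norm (x - m) = a}"

definition P_const :: "nat \<Rightarrow> real \<Rightarrow> real \<Rightarrow> real" where
  "P_const d \<beta> a =
     Gamma (\<beta> + 1) / Gamma (real d / 2)
       * a powr ((real d - 3) / 2 + \<beta>) * pi powr ((real d - 4) / 2 - \<beta>)"

definition L_const :: "real \<Rightarrow> real \<Rightarrow> real" where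
  "L_const \<beta> a =
     Gamma (\<beta> + 1) / 2 * (a / pi) powr \<beta>
       * (if \<beta> = 0 then 1 else sin (\<beta> * pi / 2) / (\<beta> * pi / 2))"

end

theory Submission
  imports Defs "HOL-Complex_Analysis.Cauchy_Integral_Theorem"
begin

text \<open>Write $U$ for the ball power and $\hat U$ for its Fourier transform, a Bessel function that decays like
  $|\xi|^{-(d+1)/2-\beta}$. The sharp cutoff $1_{|\xi|<\lambda}$ is smoothed by convolution with a kernel of width
  $1/b$ whose Fourier transform has compact support. Poisson summation then turns the smoothed lattice sum of $\hat U$
  into a finite sum over lattice points $k$ of the inversion integrals of $U$ at $k$, and the latter are radial, hence
  one-dimensional: at $k=0$ the integral carries the Pinsky term, for $|k|=a$ the two Bessel factors resonate and produce
  $L_{\beta,a}\lambda^{-\beta}$, and all others converge at rate $\lambda^{-1-\beta}$, to a limit that is identified by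
  Abel summation. Smoothing costs $O(\lambda^{(d-3)/2-\beta})$. For $d\ge2$ a second application of Poisson summation
  bounds the number of lattice points in thin shells, so that this cost is $o(\lambda^{(d-3)/2-\beta})$ as
  $b\to\infty$.\<close>

text \<open>The order of the choices decides the result. The dual points k, and with them all
  constants at k \<noteq> 0, multiply as b grows, but these terms have size \<lambda>^(-1-\<beta>)
  only; the constant of the smoothing cost does not depend on b. Hence b is chosen from the
  admissible error, and \<lambda> tends to infinity for this b. That cost is the decay
  \<lambda>^(-(d+1)/2-\<beta>) of the transform times the number of lattice points near the sphere,
  at most of order \<lambda>^(d-1).

  At k = 0 the inversion integral need not converge absolutely. Integration by parts in the radius
  expresses it for \<beta> by the one for \<beta> + 1 and a boundary term. Iteration reaches
  exponents with an integrable transform, and the boundary term of the step from \<beta> is the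
  Pinsky oscillation.

  Polar coordinates are obtained without a surface measure: 1 + cos(2 pi \<xi> x) is a nonnegative
  density, and the law of |x| under it is determined by integrals over balls.

  The terms on the sphere |k| = a are never replaced by their asymptotics: the o(1) of the theorem
  is defined as their exact deviation from L.\<close>

abbreviation Borel :: "('a::topological_space \<Rightarrow> 'b::topological_space) set" where
  "Borel \<equiv> borel_measurable borel"

lemma card_pos: "CARD('n::finite) \<ge> 1"
  using zero_less_card_finite[where 'a = 'n] by (simp add: Suc_le_eq)

lemma powr_mult_powr: "a + b = c \<Longrightarrow> x powr a * x powr b = x powr c" for x :: real
  by (auto simp: powr_add)

section \<open>Bessel functions\<close>

text \<open>The entire function with $\mathrm{clifford}_\nu(z^2) = z^{-\nu} J_\nu(2z)$.\<close>

definition clifford_coeff :: "real \<Rightarrow> nat \<Rightarrow> real" where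
  "clifford_coeff \<nu> j = (- 1) ^ j * rGamma (\<nu> + 1 + real j) / fact j"

definition clifford :: "real \<Rightarrow> real \<Rightarrow> real" where
  "clifford \<nu> w = (\<Sum>j. clifford_coeff \<nu> j * w ^ j)"

lemma rGamma_real_Suc: "rGamma (x::real) = x * rGamma (x + 1)"
  by (simp add: rGamma_plus1)

text \<open>As soon as x + j >= 1, the relation rGamma(y) = y rGamma(y + 1) makes the absolute
  values decrease in j, so finitely many initial terms bound the sequence. The order of the Bessel
  functions is an arbitrary real number, hence no sign condition on x.\<close>

lemma rGamma_shift_bounded: "\<exists>K>0. \<forall>j. \<bar>rGamma (x + real j)\<bar> \<le> K"
proof -
  obtain N :: nat where N: "real N \<ge> 1 - x"
    using real_nat_ceiling_ge by blast
  define K where "K = (\<Sum>i\<le>N. \<bar>rGamma (x + real i)\<bar>) + 1"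
  have "\<bar>rGamma (x + real j)\<bar> \<le> K" for j
  proof (induction j)
    case 0
    have "\<bar>rGamma (x + real 0)\<bar> \<le> (\<Sum>i\<le>N. \<bar>rGamma (x + real i)\<bar>)"
      by (rule member_le_sum) auto
    then show ?case by (simp add: K_def)
  next
    case (Suc j)
    show ?case
    proof (cases "Suc j \<le> N")
      case True
      have "\<bar>rGamma (x + real (Suc j))\<bar> \<le> (\<Sum>i\<le>N. \<bar>rGamma (x + real i)\<bar>)"
        by (rule member_le_sum) (use True in auto)
      then show ?thesis by (simp add: K_def)
    next
      case False
      have ge: "x + real j \<ge> 1" using N False by linarith
      have "rGamma (x + real j) = (x + real j) * rGamma (x + real (Suc j))"
        using rGamma_real_Suc[of "x + real j"] by (simp add: algebra_simps)
      then have "\<bar>rGamma (x + real j)\<bar> = (x + real j) * \<bar>rGamma (x + real (Suc j))\<bar>"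
        using ge by (simp add: abs_mult)
      moreover have "1 * \<bar>rGamma (x + real (Suc j))\<bar> \<le> (x + real j) * \<bar>rGamma (x + real (Suc j))\<bar>"
        using ge by (intro mult_right_mono) auto
      ultimately show ?thesis using Suc by linarith
    qed
  qed
  moreover have "K > 0" by (simp add: K_def add_nonneg_pos sum_nonneg)
  ultimately show ?thesis by blast
qed

lemma summable_abs_clifford: "summable (\<lambda>j. \<bar>clifford_coeff \<nu> j * w ^ j\<bar>)"
proof -
  obtain K where K: "K > 0" "\<And>j. \<bar>rGamma (\<nu> + 1 + real j)\<bar> \<le> K"
    using rGamma_shift_bounded[of "\<nu> + 1"] by auto
  have "summable (\<lambda>j. K * (inverse (fact j) * \<bar>w\<bar> ^ j))"
    by (intro summable_mult summable_exp)
  then show ?thesis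
  proof (rule summable_comparison_test'[where N = 0])
    fix j :: nat
    show "norm \<bar>clifford_coeff \<nu> j * w ^ j\<bar> \<le> K * (inverse (fact j) * \<bar>w\<bar> ^ j)"
      using mult_right_mono[OF K(2)[of j], of "inverse (fact j) * \<bar>w\<bar> ^ j"]
      by (simp add: clifford_coeff_def abs_mult power_abs field_simps)
  qed
qed

lemma summable_clifford: "summable (\<lambda>j. clifford_coeff \<nu> j * w ^ j)"
  by (rule summable_rabs_cancel[OF summable_abs_clifford])

text \<open>The Bessel relation (x^(-\<nu>) J_\<nu>)' = - x^(-\<nu>) J_(\<nu>+1). In the variable w
  = z^2 it loses all prefactors, which is the reason to work with \<open>clifford\<close> instead of
  J.\<close>

lemma DERIV_clifford: "(clifford \<nu> has_real_derivative - clifford (\<nu> + 1) w) (at w)"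
proof -
  have "diffs (clifford_coeff \<nu>) j = - clifford_coeff (\<nu> + 1) j" for j
  proof -
    have "x * ((- 1) ^ Suc j * R / (x * F)) = - ((- 1) ^ j * R / F)" if "x \<noteq> 0" for x F R :: real
      using that by simp
    moreover have "\<nu> + 1 + real (Suc j) = \<nu> + 1 + 1 + real j" by simp
    moreover have "real (Suc j) \<noteq> 0" by simp
    ultimately show ?thesis
      unfolding diffs_def clifford_coeff_def fact_Suc by (simp only:)
  qed
  then have eq: "diffs (clifford_coeff \<nu>) = (\<lambda>j. - clifford_coeff (\<nu> + 1) j)" by blast
  have "((\<lambda>x. \<Sum>n. clifford_coeff \<nu> n * x ^ n) has_real_derivative
      (\<Sum>n. diffs (clifford_coeff \<nu>) n * w ^ n)) (at w)"
    by (rule termdiffs_strong_converges_everywhere) (rule summable_clifford)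
  moreover have "(\<Sum>n. diffs (clifford_coeff \<nu>) n * w ^ n) = - clifford (\<nu> + 1) w"
    unfolding eq clifford_def mult_minus_left by (rule suminf_minus[OF summable_clifford])
  moreover have "(\<lambda>x. \<Sum>n. clifford_coeff \<nu> n * x ^ n) = clifford \<nu>"
    by (rule ext) (rule clifford_def[symmetric])
  ultimately show ?thesis by (simp only:)
qed

lemma continuous_on_clifford: "continuous_on A (clifford \<nu>)"
  using DERIV_clifford DERIV_isCont by (intro continuous_at_imp_continuous_on ballI) blast

lemma continuous_on_clifford' [continuous_intros]:
  fixes A :: "'a::topological_space set"
  assumes "continuous_on A f"
  shows "continuous_on A (\<lambda>x. clifford \<nu> (f x))"
  by (rule continuous_on_compose2[OF continuous_on_clifford[of UNIV] assms subset_UNIV])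

lemma borel_measurable_clifford [measurable]: "clifford \<nu> \<in> Borel"
  by (intro borel_measurable_continuous_onI continuous_on_clifford)

lemma clifford_0: "clifford \<nu> 0 = rGamma (\<nu> + 1)"
proof -
  have "clifford \<nu> 0 = clifford_coeff \<nu> 0"
    unfolding clifford_def by (simp add: powser_zero)
  then show ?thesis by (simp add: clifford_coeff_def)
qed

text \<open>The three-term relation J_(\<nu>-1)(x) + J_(\<nu>+1)(x) = (2 \<nu> / x) J_\<nu>(x) at x
  = 2z, by comparison of coefficients.\<close>

lemma clifford_recurrence: "clifford (\<nu> - 1) w = \<nu> * clifford \<nu> w - w * clifford (\<nu> + 1) w"
proof -
  \<comment> \<open>The series of order \<nu> + 1 delayed by one index: after multiplication by w
    its powers agree index by index with those of the other two series.\<close>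
  define g where "g j = (case j of 0 \<Rightarrow> 0 | Suc i \<Rightarrow> clifford_coeff (\<nu> + 1) i * w ^ i)" for j
  have s1: "(\<lambda>j. \<nu> * (clifford_coeff \<nu> j * w ^ j)) sums (\<nu> * clifford \<nu> w)"
    unfolding clifford_def by (intro sums_mult summable_sums summable_clifford)
  have "(\<lambda>j. g (Suc j)) sums clifford (\<nu> + 1) w"
    unfolding g_def clifford_def by (simp add: summable_sums summable_clifford)
  then have "g sums clifford (\<nu> + 1) w"
    by (subst (asm) sums_Suc_iff) (simp add: g_def)
  then have s2: "(\<lambda>j. w * g j) sums (w * clifford (\<nu> + 1) w)" by (rule sums_mult)
  have eq: "\<nu> * (clifford_coeff \<nu> j * w ^ j) - w * g j = clifford_coeff (\<nu> - 1) j * w ^ j" for j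
  proof (cases j)
    case 0
    then show ?thesis
      by (simp add: g_def clifford_coeff_def rGamma_plus1)
  next
    case (Suc i)
    have "rGamma (\<nu> + 1 + real i) = (\<nu> + 1 + real i) * rGamma (\<nu> + 2 + real i)"
      using rGamma_real_Suc[of "\<nu> + 1 + real i"] by (simp add: algebra_simps)
    moreover have "rGamma (\<nu> + 1 + real j) = rGamma (\<nu> + 2 + real i)"
      "rGamma (\<nu> - 1 + 1 + real j) = rGamma (\<nu> + 1 + real i)"
      "rGamma (\<nu> + 1 + 1 + real i) = rGamma (\<nu> + 2 + real i)"
      using Suc by (simp_all add: algebra_simps)
    moreover have "fact j = real j * fact i" "real j = 1 + real i" "w ^ j = w * w ^ i"
      "(-1::real) ^ j = - ((-1) ^ i)" "real j \<noteq> 0" "(fact i :: real) \<noteq> 0"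
      using Suc by simp_all
    moreover have "g j = clifford_coeff (\<nu> + 1) i * w ^ i" using Suc by (simp add: g_def)
    ultimately show ?thesis
      unfolding clifford_coeff_def by (simp add: divide_simps) (simp add: algebra_simps)
  qed
  have "(\<lambda>j. clifford_coeff (\<nu> - 1) j * w ^ j) sums (\<nu> * clifford \<nu> w - w * clifford (\<nu> + 1) w)"
    using sums_diff[OF s1 s2] unfolding eq .
  then show ?thesis unfolding clifford_def[of "\<nu> - 1"] by (rule sums_unique[symmetric])
qed

text \<open>The duplication formula of Gamma at half-integers; it turns the series of order -1/2
  into the cosine series.\<close>

lemma rGamma_half_plus: "rGamma (1 / 2 + real j) / fact j = 4 ^ j / (sqrt pi * fact (2 * j))"
proof (induction j)
  case 0
  then show ?case by (simp add: rGamma_inverse_Gamma Gamma_one_half_real field_simps)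
next
  case (Suc j)
  have "rGamma (1/2 + real j) = (1/2 + real j) * rGamma (1/2 + real (Suc j))"
    using rGamma_real_Suc[of "1/2 + real j"] by (simp add: algebra_simps)
  moreover have "1/2 + real j \<noteq> 0" "fact (Suc j) = (real j + 1) * fact j" "real j + 1 \<noteq> 0"
    using of_nat_0_le_iff[of j, where ?'a = real] by (linarith | simp add: algebra_simps)+
  ultimately have "rGamma (1/2 + real (Suc j)) / fact (Suc j)
      = (rGamma (1/2 + real j) / fact j) / ((1/2 + real j) * (real j + 1))"
    by (simp del: fact_Suc of_nat_Suc)
  also have "\<dots> = 4 ^ Suc j / (sqrt pi * fact (2 * Suc j))"
    unfolding Suc by (simp add: divide_simps) (simp add: algebra_simps)
  finally show ?case .
qed

lemma cos_eq_clifford: "cos (2 * z) = sqrt pi * clifford (- 1 / 2) (z^2)"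
proof -
  have "(\<lambda>n. (- 1) ^ n / fact (2 * n) * (2 * z) ^ (2 * n)) sums cos (2 * z)"
    by (rule cos_paired)
  moreover have "(- 1) ^ n / fact (2 * n) * (2 * z) ^ (2 * n)
      = sqrt pi * (clifford_coeff (- 1 / 2) n * (z^2) ^ n)" for n
  proof -
    have "clifford_coeff (- 1 / 2) n = (-1)^n * (rGamma (1 / 2 + real n) / fact n)"
      by (simp add: clifford_coeff_def)
    also have "\<dots> = (-1)^n * (4 ^ n / (sqrt pi * fact (2 * n)))" by (simp only: rGamma_half_plus)
    finally have "sqrt pi * clifford_coeff (- 1 / 2) n = (-1)^n * 4 ^ n / fact (2 * n)"
      by (simp add: field_simps)
    moreover have "(2 * z) ^ (2 * n) = 4 ^ n * (z^2) ^ n"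
      by (simp add: power_mult power_mult_distrib)
    ultimately show ?thesis by (simp add: field_simps)
  qed
  ultimately have "(\<lambda>n. sqrt pi * (clifford_coeff (- 1 / 2) n * (z^2) ^ n)) sums cos (2 * z)" by simp
  moreover have "(\<lambda>n. sqrt pi * (clifford_coeff (- 1 / 2) n * (z^2) ^ n)) sums (sqrt pi * clifford (- 1 / 2) (z^2))"
    unfolding clifford_def by (intro sums_mult summable_sums summable_clifford)
  ultimately show ?thesis by (rule sums_unique2)
qed

section \<open>Beta integrals and Sonine's formula\<close>

lemma Beta_real_pos: "x > 0 \<Longrightarrow> y > 0 \<Longrightarrow> Beta x y > (0::real)"
  unfolding Beta_def by (intro divide_pos_pos mult_pos_pos Gamma_real_pos) auto

text \<open>The Beta integral under the substitution t = r^2. It is carried out for nonnegative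
  integrals, where no integrability has to be known beforehand.\<close>

lemma has_bochner_integral_half_Beta:
  fixes b q :: real
  assumes b: "b > -1" and q: "q > -1"
  shows "has_bochner_integral lborel
    (\<lambda>r. indicator {0<..<1} r * ((1 - r^2) powr b * r powr q)) (Beta ((q + 1) / 2) (b + 1) / 2)"
proof (rule has_bochner_integral_nn_integral)
  let ?f = "\<lambda>x :: real. indicator {0<..<1} x * ((1 - x^2) powr b * x powr q)"
  let ?B = "Beta ((q + 1) / 2) (b + 1)"
  show "(\<lambda>r::real. indicator {0<..<1} r * ((1 - r^2) powr b * r powr q)) \<in> borel_measurable lborel"
    by measurable
  show "AE r in lborel. 0 \<le> indicator {0<..<1} r * ((1 - r^2) powr b * r powr q)"
    by simp
  have pos: "(q + 1) / 2 > 0" "b + 1 > 0" using b q by auto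
  show "0 \<le> ?B / 2"
    using Beta_real_pos[OF pos] by linarith
  have H: "((\<lambda>t. t powr ((q - 1) / 2) * (1 - t) powr b) has_integral ?B) {0..1}"
    using has_integral_Beta_real[OF pos] by (simp add: diff_divide_distrib add_divide_distrib)
  have "ennreal (?B) =
      (\<integral>\<^sup>+t. ennreal (t powr ((q - 1) / 2) * (1 - t) powr b * indicator {0^2..1^2} t) \<partial>lborel)"
    using nn_integral_has_integral_lebesgue[OF _ H] by (simp add: mult_ac ennreal_mult' ennreal_indicator)
  also have "\<dots> = (\<integral>\<^sup>+ x. ennreal ((x^2) powr ((q - 1) / 2) * (1 - x^2) powr b * (2 * x) * indicator {0..1} x) \<partial>lborel)"
  proof (rule nn_integral_substitution[where g = "\<lambda>x. x ^ 2" and g' = "\<lambda>x. 2 * x"])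
    show "set_borel_measurable borel {0\<^sup>2..1\<^sup>2} (\<lambda>t::real. t powr ((q - 1) / 2) * (1 - t) powr b)"
      unfolding set_borel_measurable_def by measurable
    show "((\<lambda>x::real. x\<^sup>2) has_real_derivative 2 * x) (at x)" for x
      by (auto intro!: derivative_eq_intros)
  qed (auto intro!: continuous_intros)
  also have "\<dots> = (\<integral>\<^sup>+ x. 2 * ennreal (?f x) \<partial>lborel)"
  proof (intro nn_integral_cong_AE AE_I[of _ _ "{0,1}"])
    show "{x \<in> space lborel. ennreal ((x^2) powr ((q - 1) / 2) * (1 - x^2) powr b * (2 * x) * indicator {0..1} x)
       \<noteq> 2 * ennreal (?f x)} \<subseteq> {0,1}"
    proof
      fix x :: real
      assume x: "x \<in> {x \<in> space lborel. ennreal ((x^2) powr ((q - 1) / 2) * (1 - x^2) powr b * (2 * x) * indicator {0..1} x)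
       \<noteq> 2 * ennreal (?f x)}"
      show "x \<in> {0,1}"
      proof (rule ccontr)
        assume n: "x \<notin> {0,1}"
        have "(x^2) powr ((q - 1) / 2) * x = x powr q" if "x > 0"
        proof -
          have "(x^2) powr ((q - 1) / 2) = x powr (q - 1)"
            using that powr_powr[of x 2 "(q-1)/2"] by (simp add: powr_numeral diff_divide_distrib)
          then show ?thesis using that powr_mult_base[of x "q - 1"] by (simp add: mult.commute)
        qed
        then have "ennreal ((x^2) powr ((q - 1) / 2) * (1 - x^2) powr b * (2 * x) * indicator {0..1} x)
          = ennreal (2 * ?f x)"
          using n by (auto simp: indicator_def mult_ac)
        then show False using x by (auto simp: ennreal_mult')
      qed
    qed
  qed (auto intro: emeasure_lborel_countable)
  also have "\<dots> = 2 * (\<integral>\<^sup>+ x. ennreal (?f x) \<partial>lborel)"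
    by (subst nn_integral_cmult) auto
  finally have E: "2 * (\<integral>\<^sup>+ x. ennreal (?f x) \<partial>lborel)
     = ennreal (?B)" by simp
  have "2 * ennreal (?B / 2) = ennreal (?B)"
    using Beta_real_pos[OF pos] ennreal_mult'[of 2 "?B / 2"] by simp
  with E have "2 * (\<integral>\<^sup>+ x. ennreal (?f x) \<partial>lborel)
     = 2 * ennreal (?B / 2)" by (simp only:)
  then show "(\<integral>\<^sup>+ x. ennreal (?f x) \<partial>lborel)
     = ennreal (?B / 2)"
    unfolding ennreal_mult_cancel_left by simp
qed

text \<open>Sonine's first finite integral. In the power series of the Bessel function the term
  r^(2j) integrates to a Beta value, whose factor Gamma(\<nu> + 1 + j) cancels the coefficient
  \<open>rGamma\<close> and leaves the coefficient of order \<nu> + b + 1. At \<nu> = -1/2 this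
  becomes Poisson's integral, at \<nu> = n/2 - 1 the Fourier transform of the ball power.\<close>

lemma sonine:
  fixes b \<nu> w :: real
  assumes b: "b > -1" and nu: "\<nu> > -1"
  shows "has_bochner_integral lborel
    (\<lambda>r. indicator {0<..<1} r * ((1 - r^2) powr b * r powr (2 * \<nu> + 1) * clifford \<nu> (w * r^2)))
    (Gamma (b + 1) / 2 * clifford (\<nu> + b + 1) w)"
proof -
  let ?q = "\<lambda>j. 2 * \<nu> + 1 + 2 * real j"
  define h where "h j r = clifford_coeff \<nu> j * w ^ j *
     (indicator {0<..<1} r * ((1 - r^2) powr b * r powr (?q j)))" for j r
  have val: "clifford_coeff \<nu> j * w ^ j * (Beta ((?q j + 1) / 2) (b + 1) / 2)
      = Gamma (b + 1) / 2 * (clifford_coeff (\<nu> + b + 1) j * w ^ j)" for j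
  proof -
    have g: "Gamma (\<nu> + 1 + real j) \<noteq> 0" using nu
      using Gamma_real_pos[of "\<nu> + 1 + real j"] nu by linarith
    have e: "(?q j + 1) / 2 = \<nu> + 1 + real j" by (simp add: field_simps)
    have "Beta ((?q j + 1) / 2) (b + 1)
      = Gamma (\<nu> + 1 + real j) * Gamma (b + 1) * rGamma (\<nu> + 1 + real j + (b + 1))"
      unfolding e Beta_def rGamma_inverse_Gamma by (simp only: divide_inverse)
    moreover have "\<nu> + 1 + real j + (b + 1) = \<nu> + b + 1 + 1 + real j" by simp
    moreover have "rGamma (\<nu> + 1 + real j) * Gamma (\<nu> + 1 + real j) = 1"
      using g by (simp add: rGamma_inverse_Gamma)
    moreover have "s * r / F * w' * (G * g * r2 / 2) = g / 2 * (s * r2 / F * w')"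
      if "r * G = 1" for s r F w' G g r2 :: real
    proof -
      have "s * r / F * w' * (G * g * r2 / 2) = (r * G) * (g / 2 * (s * r2 / F * w'))" by (simp add: mult_ac)
      then show ?thesis using that by simp
    qed
    ultimately show ?thesis
      unfolding clifford_coeff_def by (simp only:)
  qed
  have hi: "has_bochner_integral lborel (h j) (Gamma (b + 1) / 2 * (clifford_coeff (\<nu> + b + 1) j * w ^ j))" for j
    unfolding val[symmetric] h_def[abs_def]
    by (intro has_bochner_integral_mult_right has_bochner_integral_half_Beta b) (use nu in linarith)
  \<comment> \<open>The integral of the absolute value of a term is the absolute value of a term of
    the resulting series. That series converges absolutely, which justifies the termwise
    integration.\<close>
  have ni: "(LBINT r. norm (h j r)) = \<bar>Gamma (b + 1) / 2 * (clifford_coeff (\<nu> + b + 1) j * w ^ j)\<bar>" for j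
  proof -
    have "(LBINT r. norm (h j r)) = (LBINT r. \<bar>clifford_coeff \<nu> j * w ^ j\<bar> *
      (indicator {0<..<1} r * ((1 - r^2) powr b * r powr (?q j))))"
      unfolding h_def by (intro Bochner_Integration.integral_cong) (auto simp: abs_mult indicator_def)
    also have "\<dots> = \<bar>clifford_coeff \<nu> j * w ^ j\<bar> * (Beta ((?q j + 1) / 2) (b + 1) / 2)"
      by (subst integral_mult_right_zero, subst has_bochner_integral_integral_eq[OF has_bochner_integral_half_Beta])
         (use b nu in auto)
    also have "\<dots> = \<bar>clifford_coeff \<nu> j * w ^ j * (Beta ((?q j + 1) / 2) (b + 1) / 2)\<bar>"
      using b nu Beta_real_pos[of "(?q j + 1) / 2" "b + 1"] by (simp add: abs_mult)
    finally show ?thesis unfolding val .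
  qed
  have sumh: "(\<Sum>j. h j r) = indicator {0<..<1} r * ((1 - r^2) powr b * r powr (2 * \<nu> + 1) * clifford \<nu> (w * r^2))"
    and absh: "summable (\<lambda>j. norm (h j r))" for r
  proof -
    have hh: "h j r = indicator {0<..<1} r * ((1 - r^2) powr b * r powr (2 * \<nu> + 1)) *
        (clifford_coeff \<nu> j * (w * r^2) ^ j)" for j
    proof (cases "r > 0")
      case True
      have "r powr (?q j) = r powr (2 * \<nu> + 1) * r powr (real (2 * j))"
        by (simp add: powr_add)
      also have "r powr (real (2 * j)) = (r^2) ^ j" using True by (subst powr_realpow) (auto simp: power_mult)
      finally show ?thesis by (simp add: h_def power_mult_distrib)
    qed (auto simp: h_def)
    show "(\<Sum>j. h j r) = indicator {0<..<1} r * ((1 - r^2) powr b * r powr (2 * \<nu> + 1) * clifford \<nu> (w * r^2))"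
      unfolding hh by (subst suminf_mult) (auto simp: summable_clifford clifford_def)
    show "summable (\<lambda>j. norm (h j r))"
      unfolding hh norm_mult[of "indicator {0<..<1} r * ((1 - r^2) powr b * r powr (2 * \<nu> + 1))"]
      by (intro summable_mult) (use summable_abs_clifford in auto)
  qed
  have sm: "summable (\<lambda>j. \<integral>r. norm (h j r) \<partial>lborel)"
    unfolding ni abs_mult[of "Gamma (b + 1) / 2"] by (intro summable_mult summable_abs_clifford)
  have int: "integrable lborel (h j)" for j using hi has_bochner_integral_iff by blast
  have i1: "integrable lborel (\<lambda>r. \<Sum>j. h j r)"
    by (rule integrable_suminf[OF int _ sm]) (use absh in auto)
  have "(LBINT r. (\<Sum>j. h j r)) = (\<Sum>j. integral\<^sup>L lborel (h j))"
    by (rule integral_suminf[OF int _ sm]) (use absh in auto)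
  also have "\<dots> = (\<Sum>j. Gamma (b + 1) / 2 * (clifford_coeff (\<nu> + b + 1) j * w ^ j))"
    using hi has_bochner_integral_integral_eq by metis
  also have "\<dots> = Gamma (b + 1) / 2 * clifford (\<nu> + b + 1) w"
    unfolding clifford_def by (intro suminf_mult summable_clifford)
  finally show ?thesis using i1 unfolding sumh has_bochner_integral_iff by blast
qed

section \<open>Asymptotics of Bessel functions\<close>

lemma has_integral_powr_exp:
  fixes p z :: real
  assumes p: "p > -1" and z: "z > 0"
  shows "((\<lambda>y. y powr p * exp (- 2 * z * y)) has_integral Gamma (p + 1) / (2 * z) powr (p + 1)) {0..}"
proof -
  have "nn_integral lborel (\<lambda>t. ennreal (indicator {0..} t * t powr p / exp t)) = ennreal (Gamma (p + 1))"
    using Gamma_conv_nn_integral_real[of "p + 1"] p by simp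
  then have "has_bochner_integral lborel (\<lambda>t. indicator {0..} t * t powr p / exp t) (Gamma (p + 1))"
    using p by (intro has_bochner_integral_nn_integral) (auto intro: less_imp_le Gamma_real_pos)
  then have "has_bochner_integral lborel
      (\<lambda>t. indicator {0..} (0 + 2 * z * t) * (0 + 2 * z * t) powr p / exp (0 + 2 * z * t)) (Gamma (p + 1) /\<^sub>R \<bar>2 * z\<bar>)"
    using z by (subst (asm) lborel_has_bochner_integral_real_affine_iff[of "2 * z" _ _ 0]) auto
  also have "(\<lambda>t. indicator {0..} (0 + 2 * z * t) * (0 + 2 * z * t) powr p / exp (0 + 2 * z * t))
      = (\<lambda>t. (2 * z) powr p * (indicator {0..} t * (t powr p * exp (- 2 * z * t))))"
    using z by (intro ext) (auto simp: indicator_def powr_mult exp_minus zero_le_mult_iff field_simps)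
  finally have "has_bochner_integral lborel
     (\<lambda>t. inverse ((2 * z) powr p) * ((2 * z) powr p * (indicator {0..} t * (t powr p * exp (- 2 * z * t)))))
     (inverse ((2 * z) powr p) * (Gamma (p + 1) /\<^sub>R \<bar>2 * z\<bar>))"
    by (rule has_bochner_integral_mult_right)
  moreover have "inverse ((2 * z) powr p) * (Gamma (p + 1) /\<^sub>R \<bar>2 * z\<bar>) = Gamma (p + 1) / (2 * z) powr (p + 1)"
    using z by (simp add: powr_add field_simps)
  moreover have canc: "inverse ((2 * z) powr p) * ((2 * z) powr p * x) = x" for x
    using z by simp
  ultimately have "has_bochner_integral lborel
     (\<lambda>t. indicator {0..} t * (t powr p * exp (- 2 * z * t))) (Gamma (p + 1) / (2 * z) powr (p + 1))"
    by (simp only: canc)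
  then have "((\<lambda>t. indicator {0..} t * (t powr p * exp (- 2 * z * t))) has_integral
      Gamma (p + 1) / (2 * z) powr (p + 1)) UNIV"
    using has_integral_integral_lborel[of "\<lambda>t. indicator {0..} t * (t powr p * exp (- 2 * z * t))"]
    unfolding has_bochner_integral_iff by simp
  then have "((\<lambda>t. if t \<in> {0..} then t powr p * exp (- 2 * z * t) else 0) has_integral
      Gamma (p + 1) / (2 * z) powr (p + 1)) UNIV"
    by (rule has_integral_eq[rotated]) (auto simp: indicator_def)
  then show ?thesis by (simp only: has_integral_restrict_UNIV)
qed

lemma integrable_powr_exp:
  fixes p z :: real
  assumes p: "p \<ge> 0"
  shows "(\<lambda>y. y powr p * exp (- 2 * z * y)) integrable_on {0..1}"
proof (cases "p = 0")
  case True
  have "(\<lambda>y. exp (- 2 * z * y)) integrable_on {0..1}"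
    by (intro integrable_continuous_real continuous_intros)
  then show ?thesis
    by (rule integrable_spike_finite[of "{0}", rotated 2]) (auto simp: True)
next
  case False
  then show ?thesis using p
    by (intro integrable_continuous_real continuous_on_mult continuous_on_powr' continuous_on_exp
        continuous_intros) auto
qed

text \<open>On y >= 1 one has y^p <= y^(p+1), so the missing tail is at most the full Gamma integral
  of exponent p + 1, which is smaller than the main term by a factor of order 1/z.\<close>

lemma powr_exp_tail:
  fixes p z :: real
  assumes p: "p \<ge> 0" and z: "z > 0"
  shows "\<bar>integral {0..1} (\<lambda>y. y powr p * exp (- 2 * z * y)) - Gamma (p + 1) / (2 * z) powr (p + 1)\<bar>
    \<le> Gamma (p + 2) / (2 * z) powr (p + 2)"
proof -
  let ?F = "\<lambda>y. y powr p * exp (- 2 * z * y)"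
  let ?I = "integral {0..1} ?F"
  have "(?F has_integral ?I) {0..1}"
    using integrable_powr_exp[OF p] by (rule integrable_integral)
  then have "((\<lambda>y. if y \<in> {0..1} then ?F y else 0) has_integral ?I) {0..}"
    by (subst has_integral_restrict) auto
  then have d: "((\<lambda>y. ?F y - (if y \<in> {0..1} then ?F y else 0)) has_integral (Gamma (p + 1) / (2 * z) powr (p + 1) - ?I)) {0..}"
    by (intro has_integral_diff has_integral_powr_exp) (use p z in auto)
  have up: "((\<lambda>y. y powr (p + 1) * exp (- 2 * z * y)) has_integral Gamma (p + 1 + 1) / (2 * z) powr (p + 1 + 1)) {0..}"
    by (rule has_integral_powr_exp) (use p z in auto)
  have "0 \<le> Gamma (p + 1) / (2 * z) powr (p + 1) - ?I"
    by (rule has_integral_nonneg[OF d]) auto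
  moreover have "Gamma (p + 1) / (2 * z) powr (p + 1) - ?I \<le> Gamma (p + 1 + 1) / (2 * z) powr (p + 1 + 1)"
  proof (rule has_integral_le[OF d up])
    fix y :: real assume "y \<in> {0..}"
    then show "?F y - (if y \<in> {0..1} then ?F y else 0) \<le> y powr (p + 1) * exp (- 2 * z * y)"
      by (auto intro!: powr_mono)
  qed
  ultimately show ?thesis by (simp add: add.assoc)
qed

text \<open>The constant is the maximum of z^p e^(-2z), attained at z = p/2; the inequality ln x <=
  x - 1 at x = 2z/p expresses this.\<close>

lemma exp_minus_le_powr:
  fixes p :: real
  assumes p: "p > 0"
  shows "\<exists>K>0. \<forall>z>0. exp (- 2 * z) \<le> K * z powr (- p)"
proof (intro exI conjI allI impI)
  show "exp (p * ln (p / 2) - p) > 0" by simp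
  fix z :: real assume z: "z > 0"
  have "ln (z / (p/2)) \<le> z / (p/2) - 1" using z p by (intro ln_le_minus_one) auto
  then have "p * ln (z / (p/2)) \<le> p * (z / (p/2) - 1)" using p by (intro mult_left_mono) auto
  moreover have "p * (z / (p/2) - 1) = 2 * z - p" using p by (simp add: field_simps)
  moreover have "p * ln (z / (p/2)) = p * ln z - p * ln (p/2)"
    using z p by (subst ln_div) (auto simp: right_diff_distrib)
  ultimately have "- 2 * z \<le> (p * ln (p / 2) - p) + (- p * ln z)" by linarith
  then have "exp (- 2 * z) \<le> exp ((p * ln (p / 2) - p) + (- p * ln z))" by (simp only: exp_le_cancel_iff)
  also have "\<dots> = exp (p * ln (p / 2) - p) * z powr (- p)"
    using z unfolding exp_add powr_def by simp
  finally show "exp (- 2 * z) \<le> exp (p * ln (p / 2) - p) * z powr (- p)" .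
qed

text \<open>The integrand is deformed from the segment from 0 to 1 to the three other sides of the square on it;
  the side on the imaginary axis contributes nothing to the real part.\<close>

lemma cos_integral_contour:
  fixes b z :: real
  assumes b: "b > 0" and z: "z > 0"
  defines "f \<equiv> \<lambda>w. (1 - w) powr of_real b * (1 + w) powr of_real b * exp (2 * \<i> * of_real z * w)"
  shows "\<exists>T. cmod T \<le> 6 powr b * exp (- 2 * z) \<and>
    integral {0..1} (\<lambda>t. (1 - t^2) powr b * cos (2 * z * t))
      = Re T - Re (\<i> * integral {0..1} (\<lambda>y. f (Complex 1 y)))"
proof -
  let ?I = "contour_integral (linepath 0 1) f"
  let ?J = "contour_integral (linepath 1 (1 + \<i>)) f"
  let ?K = "contour_integral (linepath (1 + \<i>) \<i>) f"
  define S where "S = cbox 0 (Complex 1 1)"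
  have S: "w \<in> S \<longleftrightarrow> 0 \<le> Re w \<and> Re w \<le> 1 \<and> 0 \<le> Im w \<and> Im w \<le> 1" for w
    by (auto simp: S_def in_cbox_complex_iff)
  \<comment> \<open>At the corner w = 1 the power of 1 - w is continuous, because b > 0, but not
    holomorphic. Cauchy's theorem for the square asks for differentiability in the interior
    only.\<close>
  have cf: "continuous_on S f"
    unfolding f_def using b by (intro continuous_intros) (auto simp: S)
  have df: "f field_differentiable at w" if "w \<in> interior S - {}" for w
  proof -
    have w: "0 < Re w \<and> Re w < 1 \<and> 0 < Im w \<and> Im w < 1"
      using that by (auto simp: S_def interior_cbox in_box_complex_iff)
    have "f holomorphic_on {w. 0 < Re w \<and> Re w < 1}"
      unfolding f_def by (auto intro!: holomorphic_intros simp: complex_nonpos_Reals_iff)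
    moreover have "open {w. 0 < Re w \<and> Re w < 1}"
      by (intro open_Collect_conj open_halfspace_Re_gt open_halfspace_Re_lt)
    ultimately show ?thesis using w by (auto intro: holomorphic_on_imp_differentiable_at)
  qed
  define g where "g = linepath 0 1 +++ linepath 1 (1 + \<i>) +++ linepath (1 + \<i>) \<i> +++ linepath \<i> 0"
  have conv: "convex S" by (simp add: S_def)
  have seg: "closed_segment u v \<subseteq> S" if "u \<in> S" "v \<in> S" for u v
    using that conv by (rule closed_segment_subset)
  have pts: "0 \<in> S" "1 \<in> S" "1 + \<i> \<in> S" "\<i> \<in> S" by (auto simp: S)
  have ci: "(f has_contour_integral contour_integral (linepath u v) f) (linepath u v)" if "u \<in> S" "v \<in> S" for u v
    using contour_integrable_continuous_linepath[OF continuous_on_subset[OF cf seg[OF that]]]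
    by (rule has_contour_integral_integral)
  have "(f has_contour_integral 0) g"
    by (rule Cauchy_theorem_convex[OF cf conv finite.emptyI df])
       (use pts in \<open>simp_all add: g_def path_image_join valid_path_join seg\<close>)
  moreover have "(f has_contour_integral (?I + (?J
     + (?K + contour_integral (linepath \<i> 0) f)))) g"
    unfolding g_def by (intro has_contour_integral_join ci pts valid_path_join valid_path_linepath) auto
  ultimately have zero: "?I + (?J
     + (?K + contour_integral (linepath \<i> 0) f)) = 0"
    by (rule has_contour_integral_unique[symmetric])
  have e1: "Re (?I) = integral {0..1} (\<lambda>t. (1 - t^2) powr b * cos (2 * z * t))"
  proof -
    have "((\<lambda>t. f (linepath 0 1 t) * (1 - 0)) has_integral ?I) {0..1}"
      using ci[of 0 1] pts by (simp only: has_contour_integral_linepath)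
    then have hi: "((\<lambda>t. Re (f (linepath 0 1 t) * (1 - 0))) has_integral Re (?I)) {0..1}"
      by (rule has_integral_Re)
    have fe: "Re (f (linepath 0 1 t) * (1 - 0)) = (1 - t^2) powr b * cos (2 * z * t)" if "t \<in> {0..1}" for t
    proof -
      have "(1 - complex_of_real t) powr of_real b = of_real ((1 - t) powr b)"
        "(1 + complex_of_real t) powr of_real b = of_real ((1 + t) powr b)"
        using that powr_of_real[of "1 - t" b] powr_of_real[of "1 + t" b] by auto
      moreover have "(1 - t) powr b * (1 + t) powr b = (1 - t^2) powr b"
        using that by (subst powr_mult[symmetric]) (auto simp: algebra_simps power2_eq_square)
      moreover have "exp (2 * \<i> * of_real z * of_real t) = cis (2 * z * t)"
        by (simp add: cis_conv_exp mult_ac)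
      ultimately have "f (of_real t) = of_real ((1 - t^2) powr b) * cis (2 * z * t)"
        unfolding f_def by (simp flip: of_real_mult)
      then show ?thesis by (simp add: linepath_def scaleR_conv_of_real)
    qed
    have "((\<lambda>t. (1 - t^2) powr b * cos (2 * z * t)) has_integral Re (?I)) {0..1}"
      by (rule has_integral_eq[OF fe hi])
    then show ?thesis by (simp add: integral_unique)
  qed
  have e2: "?J = \<i> * integral {0..1} (\<lambda>y. f (Complex 1 y))"
  proof -
    have "((\<lambda>y. f (Complex 1 y)) has_integral (-\<i> * ?J)) {0..1}"
      using ci[of 1 "1 + \<i>"] pts by (subst (asm) has_contour_integral_linepath_same_Re_iff[of _ 1 _ 0 1]) auto
    then have "integral {0..1} (\<lambda>y. f (Complex 1 y)) = -\<i> * ?J"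
      by (rule integral_unique)
    then show ?thesis by simp
  qed
  \<comment> \<open>On the imaginary axis 1 - iy and 1 + iy are conjugate and the exponential is
    real. Thus f is real there, while dw is imaginary.\<close>
  have e3: "Re (contour_integral (linepath \<i> 0) f) = 0"
  proof -
    have "((\<lambda>y. f (Complex 0 y)) has_integral (-\<i> * contour_integral (linepath 0 \<i>) f)) {0..1}"
      using ci[of 0 "\<i>"] pts by (subst (asm) has_contour_integral_linepath_same_Re_iff[of _ 0 _ 0 1]) auto
    then have "((\<lambda>y. Im (f (Complex 0 y))) has_integral Im (-\<i> * contour_integral (linepath 0 \<i>) f)) {0..1}"
      by (rule has_integral_Im)
    moreover have "Im (f (Complex 0 y)) = 0" for y
    proof -
      have "Complex 0 y = \<i> * of_real y" by (simp add: complex_eq_iff)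
      then have "f (Complex 0 y) = ((1 - \<i> * y) powr of_real b * (1 + \<i> * y) powr of_real b) * of_real (exp (- 2 * z * y))"
        by (simp add: f_def exp_of_real[symmetric] mult_ac)
      moreover have "(1 - \<i> * y) powr of_real b = cnj ((1 + \<i> * y) powr of_real b)"
        by (subst cnj_powr) (auto simp: complex_nonpos_Reals_iff)
      moreover have "cnj X * X = of_real ((cmod X)^2)" for X
        by (subst mult.commute) (rule complex_norm_square[symmetric])
      ultimately have "f (Complex 0 y)
          = of_real ((cmod ((1 + \<i> * y) powr of_real b))^2) * of_real (exp (- 2 * z * y))"
        by (simp only:)
      then show ?thesis by (simp only: of_real_mult[symmetric] Im_complex_of_real)
    qed
    ultimately have "Im (-\<i> * contour_integral (linepath 0 \<i>) f) = 0"
      using has_integral_unique[OF _ has_integral_0] by auto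
    then have "Re (contour_integral (linepath 0 \<i>) f) = 0" by simp
    moreover have "contour_integral (linepath \<i> 0) f = - contour_integral (linepath 0 \<i>) f"
      using contour_integral_reversepath[of "linepath 0 \<i>" f] by simp
    ultimately show ?thesis by simp
  qed
  \<comment> \<open>On the top side Im w = 1, so the exponential has modulus e^(-2z). The 6 is 2
    times 3, crude bounds for |1 - w| and |1 + w|.\<close>
  have e4: "cmod (?K) \<le> 6 powr b * exp (- 2 * z)"
  proof -
    have "cmod (?K) \<le> (6 powr b * exp (- 2 * z)) * cmod (\<i> - (1 + \<i>))"
    proof (rule has_contour_integral_bound_linepath[OF ci])
      fix w assume "w \<in> closed_segment (1 + \<i>) \<i>"
      then obtain u where u: "w = (1 - u) *\<^sub>R (1 + \<i>) + u *\<^sub>R \<i>" "0 \<le> u" "u \<le> 1"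
        by (auto simp: closed_segment_def)
      have im: "Im w = 1" and re: "0 \<le> Re w" "Re w \<le> 1" using u by simp_all
      have n1: "cmod (1 - w) \<le> 2" using cmod_le[of "1 - w"] im re by simp
      have n2: "cmod (1 + w) \<le> 3" using cmod_le[of "1 + w"] im re by simp
      have "cmod (f w) = cmod (1 - w) powr b * cmod (1 + w) powr b * exp (- 2 * z)"
        using im by (simp add: f_def norm_mult norm_powr_real_powr')
      also have "\<dots> \<le> 2 powr b * 3 powr b * exp (- 2 * z)"
        using n1 n2 b by (intro mult_right_mono mult_mono powr_mono2) auto
      also have "2 powr b * 3 powr b = (6::real) powr b" by (subst powr_mult[symmetric]) auto
      finally show "cmod (f w) \<le> 6 powr b * exp (- 2 * z)" .
    qed (use pts in auto)
    then show ?thesis by simp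
  qed
  show ?thesis
  proof (intro exI[of _ "- ?K"] conjI)
    have "Re (?I + (?J
     + (?K + contour_integral (linepath \<i> 0) f))) = 0"
      unfolding zero by simp
    then show "integral {0..1} (\<lambda>t. (1 - t^2) powr b * cos (2 * z * t))
      = Re (- ?K) - Re (\<i> * integral {0..1} (\<lambda>y. f (Complex 1 y)))"
      unfolding e1[symmetric] e2[symmetric] using e3 by simp
  qed (use e4 in simp)
qed

text \<open>Needed on the contour side w = 1 + iy, where 1 + w = 2 + iy: to first order the factor
  (1 + w)^b is the constant 2^b. Points of the segment from 2 to 2 + iy have modulus at most 3, and
  b >= 1 makes the derivative largest there.\<close>

lemma powr_two_Lipschitz:
  assumes b: "b \<ge> 1" and y: "0 \<le> y" "y \<le> 1"
  shows "cmod ((2 + \<i> * of_real y) powr of_real b - of_real (2 powr b)) \<le> b * 3 powr (b - 1) * y"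
proof -
  have "cmod ((2 + \<i> * of_real y) powr of_real b - 2 powr of_real b) \<le> b * 3 powr (b - 1) * cmod (2 + \<i> * of_real y - 2)"
  proof (rule field_differentiable_bound[of "closed_segment 2 (2 + \<i> * of_real y)" _ "\<lambda>w. of_real b * w powr (of_real b - 1)"])
    fix w assume "w \<in> closed_segment 2 (2 + \<i> * of_real y)"
    then obtain u where u: "w = (1 - u) *\<^sub>R 2 + u *\<^sub>R (2 + \<i> * of_real y)" "0 \<le> u" "u \<le> 1"
      by (auto simp: closed_segment_def)
    have re: "Re w = 2" using u by (simp add: algebra_simps)
    have im: "Im w = u * y" using u by simp
    then have im': "0 \<le> Im w" "Im w \<le> 1" using u y by (auto simp: mult_le_one)
    show "((\<lambda>w. w powr of_real b) has_field_derivative of_real b * w powr (of_real b - 1)) (at w within closed_segment 2 (2 + \<i> * of_real y))"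
      by (rule has_field_derivative_at_within, rule has_field_derivative_powr)
         (use re in \<open>auto simp: complex_nonpos_Reals_iff\<close>)
    have "cmod w \<le> 3" using cmod_le[of w] re im' by simp
    then have "cmod w powr (b - 1) \<le> 3 powr (b - 1)" using b by (intro powr_mono2) auto
    moreover have "cmod (w powr of_real (b - 1)) = cmod w powr (b - 1)"
      by (subst norm_powr_real_powr') simp_all
    then have "cmod (w powr (of_real b - 1)) = cmod w powr (b - 1)" by (simp only: of_real_diff of_real_1)
    moreover have "cmod (of_real b) = b" using b by simp
    ultimately show "cmod (of_real b * w powr (of_real b - 1)) \<le> b * 3 powr (b - 1)"
      using b by (simp only: norm_mult) (intro mult_left_mono; simp)
  qed (auto)
  moreover have "2 powr complex_of_real b = of_real (2 powr b)"
    using powr_of_real[of 2 b] by simp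
  ultimately show ?thesis using y by (simp add: norm_mult)
qed

text \<open>Poisson's integral for the order b + 1/2: in Sonine's formula at \<nu> = -1/2 the inner
  Bessel function is a cosine and the weight r^(2\<nu>+1) is 1.\<close>

lemma clifford_Poisson:
  assumes b: "b > -1"
  shows "has_bochner_integral lborel (\<lambda>t. indicator {0<..<1} t * ((1 - t^2) powr b * cos (2 * z * t)))
    (sqrt pi * Gamma (b + 1) / 2 * clifford (b + 1 / 2) (z^2))"
proof -
  have "has_bochner_integral lborel
    (\<lambda>r. sqrt pi * (indicator {0<..<1} r * ((1 - r^2) powr b * r powr (2 * (- 1 / 2) + 1) * clifford (- 1 / 2) (z^2 * r^2))))
    (sqrt pi * (Gamma (b + 1) / 2 * clifford (- 1 / 2 + b + 1) (z^2)))"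
    by (intro has_bochner_integral_mult_right sonine b) simp
  also have "(\<lambda>r. sqrt pi * (indicator {0<..<1} r * ((1 - r^2) powr b * r powr (2 * (- 1 / 2) + 1) * clifford (- 1 / 2) (z^2 * r^2))))
    = (\<lambda>t. indicator {0<..<1} t * ((1 - t^2) powr b * cos (2 * z * t)))"
  proof
    fix t :: real
    show "sqrt pi * (indicator {0<..<1} t * ((1 - t^2) powr b * t powr (2 * (- 1 / 2) + 1) * clifford (- 1 / 2) (z^2 * t^2)))
      = indicator {0<..<1} t * ((1 - t^2) powr b * cos (2 * z * t))"
      using cos_eq_clifford[of "z * t"] by (simp add: indicator_def power_mult_distrib mult.assoc)
  qed
  finally show ?thesis by (simp add: algebra_simps)
qed

lemma integral_cos_clifford:
  assumes b: "b > 0"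
  shows "integral {0..1} (\<lambda>t. (1 - t^2) powr b * cos (2 * z * t))
    = sqrt pi * Gamma (b + 1) / 2 * clifford (b + 1 / 2) (z^2)"
proof -
  have b': "b > -1" using b by simp
  let ?f = "\<lambda>t. indicator {0<..<1} t * ((1 - t^2) powr b * cos (2 * z * t))"
  have "(?f has_integral (sqrt pi * Gamma (b + 1) / 2 * clifford (b + 1 / 2) (z^2))) UNIV"
    using has_integral_integral_lborel[of ?f] clifford_Poisson[OF b', of z]
    unfolding has_bochner_integral_iff by simp
  then have "((\<lambda>t. if t \<in> {0<..<1} then (1 - t^2) powr b * cos (2 * z * t) else 0) has_integral
      (sqrt pi * Gamma (b + 1) / 2 * clifford (b + 1 / 2) (z^2))) UNIV"
    by (rule has_integral_eq[rotated]) (auto simp: indicator_def)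
  then have "((\<lambda>t. (1 - t^2) powr b * cos (2 * z * t)) has_integral
      (sqrt pi * Gamma (b + 1) / 2 * clifford (b + 1 / 2) (z^2))) {0<..<1}"
    by (simp only: has_integral_restrict_UNIV)
  then show ?thesis by (simp add: has_integral_Icc_iff_Ioo[symmetric] integral_unique)
qed

text \<open>This is J_\<nu>(x) = sqrt(2/(pi x)) cos(x - pi \<nu>/2 - pi/4) + O(x^(-3/2)) at x = 2z.
  It is a predicate of \<nu>, so that it can be carried from large orders down to all
  orders.\<close>

definition clifford_asymp :: "real \<Rightarrow> bool" where
  "clifford_asymp \<nu> \<longleftrightarrow> (\<exists>K\<ge>0. \<forall>z\<ge>1. \<bar>clifford \<nu> (z^2)
     - z powr (- \<nu> - 1 / 2) * cos (2 * z - pi * \<nu> / 2 - pi / 4) / sqrt pi\<bar> \<le> K * z powr (- \<nu> - 3 / 2))"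

text \<open>The principal argument of -iy is -pi/2. On the side w = 1 + iy this is the factor (1 -
  w)^b, and it is the source of the phase pi \<nu>/2 in the asymptotics.\<close>

lemma minus_ii_powr:
  assumes "y > 0"
  shows "(- \<i> * of_real y) powr of_real b = of_real (y powr b) * cis (- (pi * b / 2))"
proof -
  have "exp (of_real (ln y) - \<i> * of_real (pi / 2)) = - \<i> * of_real y"
  proof -
    have e: "exp (\<i> * of_real (pi / 2)) = \<i>" by (simp only: cis_conv_exp[symmetric] cis_pi_half)
    show ?thesis unfolding exp_diff exp_of_real e using assms by (simp add: field_simps)
  qed
  then have "Ln (- \<i> * of_real y) = of_real (ln y) - \<i> * of_real (pi / 2)"
    by (rule Ln_unique) (use pi_gt_zero in \<open>simp_all, linarith?\<close>)
  then have "of_real b * Ln (- \<i> * of_real y) = of_real (b * ln y) + \<i> * of_real (- (pi * b / 2))"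
    by (simp only:) (simp add: right_diff_distrib)
  then have "(- \<i> * of_real y) powr of_real b = exp (of_real (b * ln y) + \<i> * of_real (- (pi * b / 2)))"
    using assms unfolding powr_def by simp
  also have "\<dots> = of_real (exp (b * ln y)) * cis (- (pi * b / 2))"
    by (simp only: exp_add exp_of_real cis_conv_exp)
  finally show ?thesis using assms by (simp add: powr_def)
qed

text \<open>Poisson's integral with b = \<nu> - 1/2, moved to the contour of
  \<open>cos_integral_contour\<close>. Only the side w = 1 + iy matters: there the integrand is
  e^(2iz) times a Laplace integrand in y, so the behaviour at y = 0 decides. The bound \<nu> >= 3/2
  is the b >= 1 of the Lipschitz estimate.\<close>

lemma clifford_asymp_large:
  assumes nu: "\<nu> \<ge> 3 / 2"
  shows "clifford_asymp \<nu>"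
proof -
  define b where "b = \<nu> - 1 / 2"
  have b: "b \<ge> 1" and nub: "\<nu> = b + 1 / 2" using nu by (auto simp: b_def)
  obtain E where E: "E > 0" "\<And>z. z > 0 \<Longrightarrow> exp (- 2 * z) \<le> E * z powr (- (b + 2))"
    using exp_minus_le_powr[of "b + 2"] b by auto
  define K1 where "K1 = b * 3 powr (b - 1)"
  define D where "D = (K1 + 2 powr b) * Gamma (b + 2) / 2 powr (b + 2)"
  have G1: "Gamma (b + 1) > 0" "Gamma (b + 2) > 0" using b by (auto intro: Gamma_real_pos)
  have K1: "K1 \<ge> 0" using b by (simp add: K1_def)
  have D: "D \<ge> 0" using K1 G1 by (simp add: D_def)
  define K where "K = 2 / (sqrt pi * Gamma (b + 1)) * (6 powr b * E + D)"
  have K: "K \<ge> 0" using E G1 D by (simp add: K_def)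
  have "\<bar>clifford \<nu> (z^2) - z powr (- \<nu> - 1 / 2) * cos (2 * z - pi * \<nu> / 2 - pi / 4) / sqrt pi\<bar>
     \<le> K * z powr (- \<nu> - 3 / 2)" if z1: "z \<ge> 1" for z
  proof -
    have z: "z > 0" using z1 by simp
    let ?k = "\<lambda>y. complex_of_real (2 powr b) * of_real (y powr b * exp (- 2 * z * y))"
    let ?e = "\<lambda>y. y powr (b + 1) * exp (- 2 * z * y)"
    define f where "f w = (1 - w) powr of_real b * (1 + w) powr of_real b * exp (2 * \<i> * of_real z * w)" for w
    obtain T where T: "cmod T \<le> 6 powr b * exp (- 2 * z)"
      "integral {0..1} (\<lambda>t. (1 - t^2) powr b * cos (2 * z * t))
      = Re T - Re (\<i> * integral {0..1} (\<lambda>y. f (Complex 1 y)))"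
      using cos_integral_contour[of b z] b z unfolding f_def by auto
    \<comment> \<open>The constant phase on the side w = 1 + iy: 2z from the exponential at w = 1
      and -pi b/2 from the power of -iy.\<close>
    define \<theta> where "\<theta> = 2 * z - pi * b / 2"
    define h where "h y = of_real (y powr b * exp (- 2 * z * y)) * (2 + \<i> * of_real y) powr of_real b" for y :: real
    define W where "W = integral {0..1} h"
    have fy: "f (Complex 1 y) = cis \<theta> * h y" if "y \<in> {0..1}" for y
    proof (cases "y = 0")
      case True
      then have "Complex 1 y = 1" by (simp add: complex_eq_iff)
      then show ?thesis using True b by (simp add: f_def h_def)
    next
      case False
      have e: "Complex 1 y = 1 + \<i> * of_real y" by (simp add: complex_eq_iff)
      have "1 - Complex 1 y = - \<i> * of_real y" "1 + Complex 1 y = 2 + \<i> * of_real y"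
        by (simp_all add: complex_eq_iff)
      moreover have "exp (2 * \<i> * of_real z * Complex 1 y) = cis (2 * z) * of_real (exp (- 2 * z * y))"
      proof -
        have "2 * \<i> * of_real z * Complex 1 y = \<i> * of_real (2 * z) + of_real (- 2 * z * y)"
          by (simp add: complex_eq_iff)
        then show ?thesis by (simp only: exp_add cis_conv_exp exp_of_real)
      qed
      moreover have "(- \<i> * of_real y) powr of_real b = of_real (y powr b) * cis (- (pi * b / 2))"
        using that False by (intro minus_ii_powr) auto
      moreover have "cis \<theta> = cis (2 * z) * cis (- (pi * b / 2))"
        by (simp add: \<theta>_def cis_mult)
      ultimately show ?thesis unfolding f_def h_def of_real_mult by (simp only: mult_ac)
    qed
    have V: "integral {0..1} (\<lambda>y. f (Complex 1 y)) = cis \<theta> * W"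
    proof -
      have "integral {0..1} (\<lambda>y. f (Complex 1 y)) = integral {0..1} (\<lambda>y. cis \<theta> * h y)"
        by (rule integral_cong) (rule fy)
      then show ?thesis by (simp add: W_def)
    qed
    have hint: "h integrable_on {0..1}"
      unfolding h_def using b
      by (intro integrable_continuous_real continuous_on_mult continuous_on_of_real continuous_on_powr'
          continuous_on_powr_complex continuous_intros) auto
    have gint: "(\<lambda>y. ?k y) integrable_on {0..1}"
      using b by (intro integrable_continuous_real continuous_on_mult continuous_on_of_real continuous_on_powr'
          continuous_intros) auto
    define I where "I = integral {0..1} (\<lambda>y. y powr b * exp (- 2 * z * y))"
    have I: "integral {0..1} (\<lambda>y. ?k y) = of_real (2 powr b * I)"
    proof -
      have "((\<lambda>y. y powr b * exp (- 2 * z * y)) has_integral I) {0..1}"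
        unfolding I_def using b by (intro integrable_integral integrable_powr_exp) simp
      then have "((\<lambda>y. complex_of_real (y powr b * exp (- 2 * z * y))) has_integral of_real I) {0..1}"
        by (rule has_integral_of_real)
      then have "((\<lambda>y. ?k y) has_integral of_real (2 powr b) * of_real I) {0..1}"
        by (rule has_integral_mult_right)
      from integral_unique[OF this] show ?thesis by (simp only: of_real_mult)
    qed
    define R where "R = Gamma (b + 2) / (2 * z) powr (b + 2)"
    have tail: "\<bar>I - Gamma (b + 1) / (2 * z) powr (b + 1)\<bar> \<le> R"
      unfolding I_def R_def using b z by (intro powr_exp_tail) auto
    have WI: "cmod (W - of_real (2 powr b * I)) \<le> K1 * R"
    proof -
      have "W - of_real (2 powr b * I) = integral {0..1} (\<lambda>y. h y - ?k y)"
        unfolding W_def I[symmetric] using hint gint by (simp add: integral_diff)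
      also have "cmod \<dots> \<le> integral {0..1} (\<lambda>y. K1 * (?e y))"
      proof (rule integral_norm_bound_integral)
        show "(\<lambda>y. h y - ?k y) integrable_on {0..1}"
          using hint gint by (rule integrable_diff)
        show "(\<lambda>y. K1 * (?e y)) integrable_on {0..1}"
          using integrable_on_cmult_left[OF integrable_powr_exp[of "b+1" z], of K1] b by simp
        fix y :: real assume y: "y \<in> {0..1}"
        have "h y - ?k y
          = of_real (y powr b * exp (- 2 * z * y)) * ((2 + \<i> * of_real y) powr of_real b - of_real (2 powr b))"
          by (simp add: h_def algebra_simps)
        then have "cmod (h y - ?k y)
          = (y powr b * exp (- 2 * z * y)) * cmod ((2 + \<i> * of_real y) powr of_real b - of_real (2 powr b))"
          by (simp only: norm_mult norm_of_real) simp
        also have "\<dots> \<le> (y powr b * exp (- 2 * z * y)) * (K1 * y)"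
          unfolding K1_def using y b by (intro mult_left_mono powr_two_Lipschitz) auto
        also have "\<dots> = K1 * (?e y)"
          using y powr_mult_base[of y b] by (simp add: mult_ac add.commute)
        finally show "cmod (h y - ?k y)
          \<le> K1 * (?e y)" .
      qed
      also have "\<dots> = K1 * integral {0..1} (\<lambda>y. ?e y)" by simp
      also have "\<dots> \<le> K1 * R"
      proof (rule mult_left_mono[OF _ K1])
        have "integral {0..1} (\<lambda>y. ?e y) \<le> integral {0..} (\<lambda>y. ?e y)"
        proof (rule integral_subset_le)
          show "(\<lambda>y. ?e y) integrable_on {0..1}"
            using b by (intro integrable_powr_exp) simp
          show "(\<lambda>y. ?e y) integrable_on {0..}"
            by (rule has_integral_integrable, rule has_integral_powr_exp) (use b z in auto)
        qed auto
        also have "\<dots> = R" using integral_unique[OF has_integral_powr_exp[of "b+1" z]] b z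
          by (simp add: R_def add.assoc)
        finally show "integral {0..1} (\<lambda>y. ?e y) \<le> R" .
      qed
      finally show ?thesis .
    qed
    \<comment> \<open>The leading value of W: (2 + iy)^b is replaced by 2^b and the interval [0,1]
      by the half-line. Both replacements cost O(R), one power of z below the main term.\<close>
    define w0 where "w0 = 2 powr b * (Gamma (b + 1) / (2 * z) powr (b + 1))"
    have "cmod (of_real (2 powr b * I) - of_real w0) = 2 powr b * \<bar>I - Gamma (b + 1) / (2 * z) powr (b + 1)\<bar>"
      unfolding of_real_diff[symmetric] norm_of_real w0_def right_diff_distrib[symmetric] abs_mult by simp
    also have "\<dots> \<le> 2 powr b * R" using tail by (intro mult_left_mono) auto
    finally have I0: "cmod (of_real (2 powr b * I) - of_real w0) \<le> 2 powr b * R" .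
    have W0: "cmod (W - of_real w0) \<le> (K1 + 2 powr b) * R"
      using norm_triangle_le[OF add_mono[OF WI I0]] by (simp add: algebra_simps)
    have R: "(K1 + 2 powr b) * R = D * z powr (- (b + 2))"
      using z powr_minus_divide[of z "b + 2"] unfolding R_def D_def by (simp add: powr_mult)
    have main: "\<bar>(Re T - Re (\<i> * (cis \<theta> * W))) - sin \<theta> * w0\<bar> \<le> (6 powr b * E + D) * z powr (- (b + 2))"
    proof -
      have "(Re T - Re (\<i> * (cis \<theta> * W))) - sin \<theta> * w0 = Re (T - \<i> * cis \<theta> * (W - of_real w0))"
        by (simp add: algebra_simps)
      also have "\<bar>\<dots>\<bar> \<le> cmod (T - \<i> * cis \<theta> * (W - of_real w0))" by (rule abs_Re_le_cmod)
      also have "\<dots> \<le> cmod T + cmod (W - of_real w0)"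
        using norm_triangle_ineq4[of T "\<i> * cis \<theta> * (W - of_real w0)"] by (simp add: norm_mult)
      also have "\<dots> \<le> 6 powr b * exp (- 2 * z) + D * z powr (- (b + 2))"
        using T(1) W0 R by linarith
      also have "6 powr b * exp (- 2 * z) \<le> 6 powr b * (E * z powr (- (b + 2)))"
        using E(2)[OF z] by (intro mult_left_mono) auto
      finally show ?thesis by (simp add: algebra_simps)
    qed
    define c where "c = 2 / (sqrt pi * Gamma (b + 1))"
    have c: "c > 0" using G1 by (simp add: c_def)
    have C: "clifford \<nu> (z^2) = c * (Re T - Re (\<i> * (cis \<theta> * W)))"
    proof -
      have "x = s * g / 2 * y \<Longrightarrow> s \<noteq> 0 \<Longrightarrow> g \<noteq> 0 \<Longrightarrow> y = 2 / (s * g) * x" for x s g y :: real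
        by (simp add: field_simps)
      from this[OF integral_cos_clifford[of b z, unfolded T(2) V]] show ?thesis
        using b G1 unfolding nub c_def by simp
    qed
    have L: "z powr (- \<nu> - 1 / 2) * cos (2 * z - pi * \<nu> / 2 - pi / 4) / sqrt pi = c * (sin \<theta> * w0)"
    proof -
      have "2 * z - pi * \<nu> / 2 - pi / 4 = - (pi / 2 - \<theta>)"
        by (simp add: \<theta>_def nub field_simps)
      then have "cos (2 * z - pi * \<nu> / 2 - pi / 4) = sin \<theta>"
        by (simp only: cos_minus) (simp add: cos_diff)
      moreover have "z powr (- \<nu> - 1 / 2) / sqrt pi = c * w0"
      proof -
        have "w0 = Gamma (b + 1) / (2 * z powr (b + 1))"
          using z by (simp add: w0_def powr_mult powr_add)
        moreover have "z powr (- \<nu> - 1 / 2) = 1 / z powr (b + 1)"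
        proof -
          have "- \<nu> - 1 / 2 = - (b + 1)" by (simp add: nub)
          then show ?thesis by (simp only: powr_minus_divide)
        qed
        ultimately show ?thesis using G1 by (simp add: c_def)
      qed
      ultimately show ?thesis
        using times_divide_eq_left[of "z powr (- \<nu> - 1 / 2)" "sqrt pi" "sin \<theta>"] by (simp only: mult_ac)
    qed
    have "\<bar>clifford \<nu> (z^2) - z powr (- \<nu> - 1 / 2) * cos (2 * z - pi * \<nu> / 2 - pi / 4) / sqrt pi\<bar>
      = c * \<bar>(Re T - Re (\<i> * (cis \<theta> * W))) - sin \<theta> * w0\<bar>"
      unfolding C L right_diff_distrib[symmetric] abs_mult using c by simp
    also have "\<dots> \<le> c * ((6 powr b * E + D) * z powr (- (b + 2)))"
      using main c by (intro mult_left_mono) auto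
    also have "\<dots> = K * z powr (- \<nu> - 3 / 2)"
    proof -
      have "- \<nu> - 3 / 2 = - (b + 2)" by (simp add: nub)
      then show ?thesis by (simp only: K_def c_def mult.assoc)
    qed
    finally show ?thesis .
  qed
  then show ?thesis unfolding clifford_asymp_def using K by blast
qed

text \<open>In the recurrence the term z^2 J-part of order \<nu> + 1 is dominant and the one of
  order \<nu> is one power of z smaller, so it goes into the error. The phases of orders \<nu> - 1
  and \<nu> + 1 differ by pi, which accounts for the minus sign of the recurrence.\<close>

lemma clifford_asymp_down:
  assumes "clifford_asymp \<nu>" "clifford_asymp (\<nu> + 1)"
  shows "clifford_asymp (\<nu> - 1)"
proof -
  let ?p = "\<lambda>z :: real. z powr (- (\<nu> - 1) - 3 / 2)"
  obtain K L where K: "K \<ge> 0" "\<And>z. z \<ge> 1 \<Longrightarrow> \<bar>clifford \<nu> (z^2)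
     - z powr (- \<nu> - 1 / 2) * cos (2 * z - pi * \<nu> / 2 - pi / 4) / sqrt pi\<bar> \<le> K * z powr (- \<nu> - 3 / 2)"
    and L: "L \<ge> 0" "\<And>z. z \<ge> 1 \<Longrightarrow> \<bar>clifford (\<nu> + 1) (z^2)
     - z powr (- (\<nu> + 1) - 1 / 2) * cos (2 * z - pi * (\<nu> + 1) / 2 - pi / 4) / sqrt pi\<bar> \<le> L * z powr (- (\<nu> + 1) - 3 / 2)"
    using assms unfolding clifford_asymp_def by metis
  define M where "M = \<bar>\<nu>\<bar> * (K + 1) + L"
  have "\<bar>clifford (\<nu> - 1) (z^2) - z powr (- (\<nu> - 1) - 1 / 2) * cos (2 * z - pi * (\<nu> - 1) / 2 - pi / 4) / sqrt pi\<bar>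
     \<le> M * ?p z" if z: "z \<ge> 1" for z
  proof -
    let ?c = "cos (2 * z - pi * \<nu> / 2 - pi / 4)" and ?d = "cos (2 * z - pi * (\<nu> + 1) / 2 - pi / 4)"
    have cd: "cos (2 * z - pi * (\<nu> - 1) / 2 - pi / 4) = - ?d"
    proof -
      have "2 * z - pi * (\<nu> - 1) / 2 - pi / 4 = (2 * z - pi * (\<nu> + 1) / 2 - pi / 4) + pi"
        by (simp add: field_simps)
      then show ?thesis by (simp only: cos_periodic_pi)
    qed
    have p1: "z powr (- (\<nu> - 1) - 1 / 2) = z^2 * z powr (- (\<nu> + 1) - 1 / 2)"
      and p2: "z\<^sup>2 * z powr (- (\<nu> + 1) - 3 / 2) = ?p z"
      using z powr_add[of z 2 "- (\<nu> + 1) - 1 / 2"] powr_add[of z 2 "- (\<nu> + 1) - 3 / 2"]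
      by (simp_all add: powr_numeral)
    have p3: "z powr (- \<nu> - 1 / 2) = ?p z"
      by (rule arg_cong[where f = "\<lambda>p. z powr p"]) simp
    have p4: "z powr (- \<nu> - 3 / 2) \<le> ?p z" using z by (intro powr_mono) auto
    have sp: "sqrt pi \<ge> 1" using pi_ge_two by simp
    have "\<bar>z powr (- \<nu> - 1 / 2) * ?c / sqrt pi\<bar> = z powr (- \<nu> - 1 / 2) * (\<bar>?c\<bar> / sqrt pi)"
      by (simp add: abs_mult)
    also have "\<dots> \<le> z powr (- \<nu> - 1 / 2) * 1"
      using order_trans[OF abs_cos_le_one[of "2 * z - pi * \<nu> / 2 - pi / 4"] sp]
      by (intro mult_left_mono) (auto simp: divide_le_eq)
    finally have "\<bar>clifford \<nu> (z^2)\<bar> \<le> z powr (- \<nu> - 1 / 2) + K * z powr (- \<nu> - 3 / 2)"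
      using K(2)[OF z] by linarith
    also have "\<dots> \<le> ?p z + K * ?p z"
      unfolding p3 using p4 K(1) by (intro add_left_mono mult_left_mono)
    also have "\<dots> = (K + 1) * ?p z" by (simp add: algebra_simps)
    finally have b1: "\<bar>\<nu> * clifford \<nu> (z^2)\<bar> \<le> \<bar>\<nu>\<bar> * ((K + 1) * ?p z)"
      unfolding abs_mult by (intro mult_left_mono) auto
    have "z\<^sup>2 * \<bar>clifford (\<nu> + 1) (z^2) - z powr (- (\<nu> + 1) - 1 / 2) * ?d / sqrt pi\<bar>
      \<le> z\<^sup>2 * (L * z powr (- (\<nu> + 1) - 3 / 2))"
      using L(2)[OF z] by (intro mult_left_mono) auto
    also have "\<dots> = L * ?p z" unfolding p2[symmetric] by simp
    finally have b2: "z\<^sup>2 * \<bar>clifford (\<nu> + 1) (z^2) - z powr (- (\<nu> + 1) - 1 / 2) * ?d / sqrt pi\<bar>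
      \<le> L * ?p z" .
    have "clifford (\<nu> - 1) (z^2) - z powr (- (\<nu> - 1) - 1 / 2) * cos (2 * z - pi * (\<nu> - 1) / 2 - pi / 4) / sqrt pi
      = \<nu> * clifford \<nu> (z^2) - z^2 * (clifford (\<nu> + 1) (z^2) - z powr (- (\<nu> + 1) - 1 / 2) * ?d / sqrt pi)"
    proof -
      have gen: "A - w * B - w * p * (- d) / s = A - w * (B - p * d / s)" for A w B p d s :: real
        by (simp add: algebra_simps)
      show ?thesis unfolding cd p1 clifford_recurrence[of \<nu>] by (rule gen)
    qed
    also have "\<bar>\<dots>\<bar> \<le> \<bar>\<nu> * clifford \<nu> (z^2)\<bar> + z^2 * \<bar>clifford (\<nu> + 1) (z^2) - z powr (- (\<nu> + 1) - 1 / 2) * ?d / sqrt pi\<bar>"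
      using abs_triangle_ineq4[of "\<nu> * clifford \<nu> (z^2)"
          "z\<^sup>2 * (clifford (\<nu> + 1) (z^2) - z powr (- (\<nu> + 1) - 1 / 2) * ?d / sqrt pi)"]
      by (simp only: abs_mult abs_power2)
    also have "\<dots> \<le> \<bar>\<nu>\<bar> * ((K + 1) * ?p z) + L * ?p z"
      using b1 b2 by (rule add_mono)
    also have "\<dots> = M * ?p z" unfolding M_def by (simp only: distrib_right mult.assoc)
    finally show ?thesis .
  qed
  moreover have "M \<ge> 0" using K(1) L(1) by (simp add: M_def)
  ultimately show ?thesis unfolding clifford_asymp_def by blast
qed

text \<open>Downward induction in steps of 1: n applications of the recurrence reach every \<nu> >=
  3/2 - n.\<close>

lemma clifford_asymp: "clifford_asymp \<nu>"
proof -
  have "\<forall>\<nu>. \<nu> \<ge> 3 / 2 - real n \<longrightarrow> clifford_asymp \<nu>" for n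
  proof (induction n)
    case 0
    then show ?case using clifford_asymp_large by simp
  next
    case (Suc n)
    show ?case
    proof (intro allI impI)
      fix \<nu> :: real assume "\<nu> \<ge> 3 / 2 - real (Suc n)"
      then have "clifford_asymp (\<nu> + 1)" "clifford_asymp (\<nu> + 1 + 1)" using Suc by auto
      then show "clifford_asymp \<nu>" using clifford_asymp_down[of "\<nu> + 1"] by simp
    qed
  qed
  moreover obtain n :: nat where "real n \<ge> 3 / 2 - \<nu>" using real_nat_ceiling_ge by blast
  then have "\<nu> \<ge> 3 / 2 - real n" by linarith
  ultimately show ?thesis by blast
qed

text \<open>The asymptotics control z >= 1 and compactness controls [0,1]; the base 1 + z lets one
  power serve on both ranges.\<close>

lemma clifford_bound: "\<exists>K>0. \<forall>z\<ge>0. \<bar>clifford \<nu> (z^2)\<bar> \<le> K * (1 + z) powr (- \<nu> - 1 / 2)"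
proof -
  let ?b = "\<lambda>z :: real. (1 + z) powr (- \<nu> - 1 / 2)"
  obtain K where K: "K \<ge> 0" "\<And>z. z \<ge> 1 \<Longrightarrow> \<bar>clifford \<nu> (z^2)
     - z powr (- \<nu> - 1 / 2) * cos (2 * z - pi * \<nu> / 2 - pi / 4) / sqrt pi\<bar> \<le> K * z powr (- \<nu> - 3 / 2)"
    using clifford_asymp[of \<nu>] unfolding clifford_asymp_def by metis
  have "compact ((\<lambda>z. clifford \<nu> (z^2) / ?b z) ` {0..1})"
    by (intro compact_continuous_image continuous_intros) auto
  then obtain B where B: "\<And>z. z \<in> {0..1} \<Longrightarrow> \<bar>clifford \<nu> (z^2) / ?b z\<bar> \<le> B"
    by (metis (no_types, lifting) compact_imp_bounded bounded_iff image_eqI real_norm_def)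
  \<comment> \<open>Compares powers of z and of 1 + z for z >= 1. The exponent may have either sign:
    one sign needs 1 + z <= 2z, the other only z <= 1 + z.\<close>
  define M where "M = max 1 (2 powr (\<nu> + 1 / 2))"
  define K' where "K' = \<bar>B\<bar> + (K + 1) * M + 1"
  have M: "z powr (- \<nu> - 1 / 2) \<le> M * ?b z" if "z \<ge> 1" for z
  proof (cases "\<nu> + 1 / 2 \<ge> 0")
    case True
    have "(1 + z) powr (\<nu> + 1 / 2) \<le> (2 * z) powr (\<nu> + 1 / 2)" using that True by (intro powr_mono2) auto
    also have "\<dots> = 2 powr (\<nu> + 1 / 2) * z powr (\<nu> + 1 / 2)" using that by (intro powr_mult)
    also have "\<dots> \<le> M * z powr (\<nu> + 1 / 2)" by (intro mult_right_mono) (auto simp: M_def)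
    finally have "(1 + z) powr (\<nu> + 1 / 2) \<le> M * z powr (\<nu> + 1 / 2)" .
    moreover have "z powr (- \<nu> - 1 / 2) = 1 / z powr (\<nu> + 1 / 2)" "?b z = 1 / (1 + z) powr (\<nu> + 1 / 2)"
      by (simp_all add: powr_minus_divide[symmetric])
    moreover have "z powr (\<nu> + 1 / 2) > 0" "(1 + z) powr (\<nu> + 1 / 2) > 0" using that by auto
    moreover have "1 / y \<le> M * (1 / x)" if "x \<le> M * y" "x > 0" "y > 0" for x y :: real
      using that by (simp add: divide_simps mult.commute)
    ultimately show ?thesis by (simp only:)
  next
    case False
    have "z powr (- \<nu> - 1 / 2) \<le> 1 * ?b z" using that False by (simp add: powr_mono2)
    also have "\<dots> \<le> M * ?b z" by (intro mult_right_mono) (auto simp: M_def)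
    finally show ?thesis .
  qed
  have "\<bar>clifford \<nu> (z^2)\<bar> \<le> K' * ?b z" if z: "z \<ge> 0" for z
  proof (cases "z \<le> 1")
    case True
    have p: "?b z > 0" using z by simp
    have "\<bar>clifford \<nu> (z^2)\<bar> \<le> B * ?b z"
      using B[of z] z True p by (simp add: abs_div field_simps)
    also have "\<dots> \<le> K' * ?b z"
    proof (rule mult_right_mono)
      have "(K + 1) * M \<ge> 0" using K(1) by (simp add: M_def)
      then show "B \<le> K'" by (simp add: K'_def)
    qed simp
    finally show ?thesis .
  next
    case False
    then have z1: "z \<ge> 1" by simp
    have sp: "sqrt pi \<ge> 1" using pi_ge_two by simp
    have "\<bar>z powr (- \<nu> - 1 / 2) * cos (2 * z - pi * \<nu> / 2 - pi / 4) / sqrt pi\<bar>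
       = z powr (- \<nu> - 1 / 2) * (\<bar>cos (2 * z - pi * \<nu> / 2 - pi / 4)\<bar> / sqrt pi)"
      by (simp add: abs_mult)
    also have "\<dots> \<le> z powr (- \<nu> - 1 / 2) * 1"
      using order_trans[OF abs_cos_le_one[of "2 * z - pi * \<nu> / 2 - pi / 4"] sp]
      by (intro mult_left_mono) (auto simp: divide_le_eq)
    finally have "\<bar>clifford \<nu> (z^2)\<bar> \<le> z powr (- \<nu> - 1 / 2) + K * z powr (- \<nu> - 3 / 2)"
      using K(2)[OF z1] by linarith
    also have "\<dots> \<le> z powr (- \<nu> - 1 / 2) + K * z powr (- \<nu> - 1 / 2)"
      using z1 K(1) by (intro add_left_mono mult_left_mono powr_mono) auto
    also have "\<dots> = (K + 1) * z powr (- \<nu> - 1 / 2)" by (simp add: algebra_simps)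
    also have "\<dots> \<le> (K + 1) * (M * ?b z)"
      using K(1) M[OF z1] by (intro mult_left_mono) auto
    also have "\<dots> \<le> K' * ?b z"
      unfolding mult.assoc[symmetric] by (intro mult_right_mono) (auto simp: K'_def)
    finally show ?thesis .
  qed
  moreover have "K' > 0" using K(1) by (simp add: K'_def M_def add_nonneg_pos)
  ultimately show ?thesis by blast
qed

section \<open>Fourier transforms of radial functions\<close>

text \<open>By uniqueness of Haar measure, the image of Lebesgue measure under an orthogonal map is a multiple of it;
  balls fix the factor. (The change of variables formula for linear maps needs a well-ordered index type.)\<close>

lemma nn_integral_lborel_translate:
  fixes f :: "'a::euclidean_space \<Rightarrow> ennreal"
  assumes [measurable]: "f \<in> Borel"
  shows "(\<integral>\<^sup>+x. f (x + c) \<partial>lborel) = (\<integral>\<^sup>+x. f x \<partial>lborel)"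
proof -
  have "(\<integral>\<^sup>+x. f x \<partial>lborel) = (\<integral>\<^sup>+x. f x \<partial>distr lborel borel ((+) c))"
    by (simp add: lborel_distr_plus)
  also have "\<dots> = (\<integral>\<^sup>+x. f (c + x) \<partial>lborel)"
    by (rule nn_integral_distr) auto
  finally show ?thesis by (simp add: add.commute)
qed

lemma lborel_distr_orthogonal:
  fixes f :: "real ^ 'n \<Rightarrow> real ^ 'n"
  assumes f: "orthogonal_transformation f"
  shows "distr lborel borel f = lborel"
proof (rule measure_eqI)
  let ?m = "lborel :: (real ^ 'n) measure"
  show "sets (distr lborel borel f) = sets lborel" by simp
  fix A assume "A \<in> sets (distr lborel borel f)"
  then have [measurable]: "A \<in> sets borel" by simp
  have lin: "linear f" using f by (rule orthogonal_transformation_linear)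
  then have "continuous_on UNIV f" by (rule linear_continuous_on_compose[OF continuous_on_id, simplified])
  then have [measurable]: "f \<in> Borel" by (rule borel_measurable_continuous_onI)
  obtain g where g: "\<And>y. f (g y) = y"
    using orthogonal_transformation_surj[OF f] by (metis surj_f_inv_f)
  have nf: "norm (f x) = norm x" for x using f by (simp add: orthogonal_transformation_norm)
  have pf: "f (x + y) = f x + f y" for x y using lin by (rule linear_add)
  define B where "B = (cball 0 1 :: (real ^ 'n) set)"
  \<comment> \<open>The double integral of 1_B(y) 1_A(f x + y) is computed in both orders. With x
    inside, translating x by a preimage of y removes y; with y inside, translating y by f x turns
    the integrand into \<open>?u\<close>.\<close>
  let ?u = "\<lambda>x y. indicator B (y - f x) * indicator A y :: ennreal"
  let ?v = "\<lambda>x y. indicator B y * indicator A (f x + y) :: ennreal"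
  have [measurable]: "B \<in> sets borel" by (simp add: B_def)
  have "(\<integral>\<^sup>+x. indicator A (f x) \<partial>lborel) * (\<integral>\<^sup>+y. indicator B y \<partial>lborel)
     = (\<integral>\<^sup>+y. \<integral>\<^sup>+x. indicator B y * indicator A (f x) \<partial>lborel \<partial>lborel)"
    by (simp add: nn_integral_cmult nn_integral_multc mult.commute)
  also have "\<dots> = (\<integral>\<^sup>+y. \<integral>\<^sup>+x. ?v x y \<partial>lborel \<partial>lborel)"
  proof (rule nn_integral_cong)
    fix y :: "real ^ 'n"
    have "(\<integral>\<^sup>+x. indicator B y * indicator A (f (x + g y)) \<partial>lborel) = (\<integral>\<^sup>+x. indicator B y * indicator A (f x) \<partial>lborel)"
      by (rule nn_integral_lborel_translate) measurable
    then show "(\<integral>\<^sup>+x. indicator B y * indicator A (f x) \<partial>lborel) = (\<integral>\<^sup>+x. ?v x y \<partial>lborel)"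
      by (simp add: pf g)
  qed
  also have "\<dots> = (\<integral>\<^sup>+x. \<integral>\<^sup>+y. ?v x y \<partial>lborel \<partial>lborel)"
    by (rule lborel_pair.Fubini') measurable
  also have "\<dots> = (\<integral>\<^sup>+x. \<integral>\<^sup>+y. ?u x y \<partial>lborel \<partial>lborel)"
  proof (rule nn_integral_cong)
    fix x :: "real ^ 'n"
    have "(\<integral>\<^sup>+y. indicator B (y + f x - f x) * indicator A (y + f x) \<partial>lborel) = (\<integral>\<^sup>+y. ?u x y \<partial>lborel)"
      by (rule nn_integral_lborel_translate) measurable
    then show "(\<integral>\<^sup>+y. ?v x y \<partial>lborel) = (\<integral>\<^sup>+y. ?u x y \<partial>lborel)"
      by (simp add: add.commute)
  qed
  also have "\<dots> = (\<integral>\<^sup>+y. \<integral>\<^sup>+x. ?u x y \<partial>lborel \<partial>lborel)"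
    by (rule lborel_pair.Fubini'[symmetric]) measurable
  also have "\<dots> = (\<integral>\<^sup>+y. (\<integral>\<^sup>+x. indicator B x \<partial>lborel) * indicator A y \<partial>lborel)"
  proof (rule nn_integral_cong)
    fix y :: "real ^ 'n"
    \<comment> \<open>For every y the remaining x-integral is the volume of B: a preimage of y is
      translated away, and B is symmetric and invariant under f.\<close>
    have "(\<integral>\<^sup>+x. ?u x y \<partial>lborel) = (\<integral>\<^sup>+x. indicator B (y - f x) \<partial>lborel) * indicator A y"
      by (rule nn_integral_multc) measurable
    also have "(\<integral>\<^sup>+x. indicator B (y - f x) \<partial>lborel) = (\<integral>\<^sup>+x. indicator B (y - f (x + g y)) \<partial>?m)"
      by (rule nn_integral_lborel_translate[symmetric]) measurable
    also have "\<dots> = (\<integral>\<^sup>+x. indicator B x \<partial>?m)"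
      by (rule nn_integral_cong) (simp add: pf g B_def indicator_def nf)
    finally show "(\<integral>\<^sup>+x. ?u x y \<partial>lborel)
      = (\<integral>\<^sup>+x. indicator B x \<partial>?m) * indicator A y" .
  qed
  also have "\<dots> = emeasure lborel B * emeasure lborel A"
    by (simp add: nn_integral_cmult)
  finally have E: "emeasure lborel B * emeasure (distr lborel borel f) A = emeasure lborel B * emeasure lborel A"
  proof -
    assume a: "(\<integral>\<^sup>+x. indicator A (f x) \<partial>lborel) * (\<integral>\<^sup>+y. indicator B y \<partial>lborel) = emeasure lborel B * emeasure lborel A"
    have "emeasure (distr lborel borel f) A = (\<integral>\<^sup>+x. indicator A x \<partial>distr lborel borel f)" by simp
    also have "\<dots> = (\<integral>\<^sup>+x. indicator A (f x) \<partial>lborel)" by (rule nn_integral_distr) auto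
    finally show ?thesis using a by (simp add: mult.commute)
  qed
  have "emeasure lborel B = ennreal (unit_ball_vol CARD('n))"
    by (simp add: B_def emeasure_cball)
  moreover have "unit_ball_vol (real CARD('n)) \<noteq> 0"
    using unit_ball_vol_pos[of "real CARD('n)"] by linarith
  ultimately show "emeasure (distr lborel borel f) A = emeasure lborel A"
    using E by (simp add: ennreal_mult_cancel_left)
qed

section \<open>Fourier integrals over balls\<close>

lemma has_bochner_integral_even:
  fixes f :: "real \<Rightarrow> real"
  assumes f: "has_bochner_integral lborel (\<lambda>t. indicator {0<..<1} t * f t) I" and ev: "\<And>t. f (- t) = f t"
  shows "has_bochner_integral lborel (\<lambda>t. indicator {-1..1} t * f t) (2 * I)"
proof -
  let ?u = "\<lambda>t :: real. indicator {0<..<1} t * f t + indicator {0<..<1} (- t) * f t"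
  have "has_bochner_integral lborel (\<lambda>t. indicator {0<..<1} (0 + - 1 * t) * f (0 + - 1 * t)) (I /\<^sub>R \<bar>- 1\<bar>)"
    using f by (subst (asm) lborel_has_bochner_integral_real_affine_iff[of "- 1" _ _ 0]) auto
  then have "has_bochner_integral lborel (\<lambda>t. indicator {0<..<1} (- t) * f t) I"
    by (simp add: ev)
  from has_bochner_integral_add[OF f this]
  have "has_bochner_integral lborel (\<lambda>t. ?u t) (2 * I)" by simp
  moreover have "AE t in lborel. ?u t = indicator {-1..1} t * f t"
  proof (rule AE_I[of _ _ "{-1, 0, 1}"])
    show "emeasure lborel {-1, 0, 1::real} = 0" by (rule emeasure_lborel_countable) auto
  qed (auto simp: indicator_def)
  moreover have "(\<lambda>t. ?u t) \<in> borel_measurable lborel"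
    using calculation(1) by (rule borel_measurable_has_bochner_integral)
  moreover have "(\<lambda>t. indicator {-1..1} t * f t) \<in> borel_measurable lborel"
  proof -
    have "(\<lambda>t. ?u t + indicator {-1,0,1} t * f t) \<in> borel_measurable lborel"
    proof (rule borel_measurable_add)
      have "(\<lambda>t::real. indicator {-1,0,1} t * f t) = (\<lambda>t. indicator {-1} t * f (-1) + indicator {0} t * f 0 + indicator {1} t * f 1)"
        by (auto simp: indicator_def)
      then show "(\<lambda>t. indicator {-1,0,1} t * f t) \<in> borel_measurable lborel" by simp
    qed fact
    also have "(\<lambda>t. ?u t + indicator {-1,0,1} t * f t)
      = (\<lambda>t. indicator {-1..1} t * f t)" by (auto simp: indicator_def fun_eq_iff)
    finally show ?thesis .
  qed
  ultimately show ?thesis by (subst has_bochner_integral_cong_AE[symmetric]) auto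
qed

lemma clifford_Poisson_scaled:
  assumes b: "b > -1" and r: "r > 0"
  shows "has_bochner_integral lborel (\<lambda>y. indicator {-r..r} y * ((r^2 - y^2) powr b * cos (2 * z * y)))
    (r powr (2 * b + 1) * sqrt pi * Gamma (b + 1) * clifford (b + 1 / 2) ((r * z)^2))"
proof -
  let ?f = "\<lambda>y :: real. indicator {-1..1} (0 + (1 / r) * y) * ((1 - (0 + (1 / r) * y)^2) powr b * cos (2 * (r * z) * (0 + (1 / r) * y)))"
  let ?g = "\<lambda>y :: real. indicator {-r..r} y * ((r^2 - y^2) powr b * cos (2 * z * y))"
  have "has_bochner_integral lborel (\<lambda>t. indicator {-1..1} t * ((1 - t^2) powr b * cos (2 * (r * z) * t)))
    (2 * (sqrt pi * Gamma (b + 1) / 2 * clifford (b + 1 / 2) ((r * z)^2)))"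
    by (rule has_bochner_integral_even[OF clifford_Poisson[OF b]]) simp
  then have "has_bochner_integral lborel (\<lambda>y. ?f y)
    ((2 * (sqrt pi * Gamma (b + 1) / 2 * clifford (b + 1 / 2) ((r * z)^2))) /\<^sub>R \<bar>1 / r\<bar>)"
    using r by (subst (asm) lborel_has_bochner_integral_real_affine_iff[of "1 / r" _ _ 0]) auto
  from has_bochner_integral_mult_right[OF this, of "r powr (2 * b)"]
  have "has_bochner_integral lborel (\<lambda>y. r powr (2 * b) * (?f y))
    (r powr (2 * b) * ((2 * (sqrt pi * Gamma (b + 1) / 2 * clifford (b + 1 / 2) ((r * z)^2))) /\<^sub>R \<bar>1 / r\<bar>))" .
  also have "(\<lambda>y. r powr (2 * b) * (?f y))
    = (\<lambda>y. ?g y)"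
  proof
    fix y
    have "r powr (2 * b) * (1 - (y / r)^2) powr b = (r^2 - y^2) powr b" if "y \<in> {-r..r}"
    proof -
      have "r powr (2 * b) = (r^2) powr b" using r powr_powr[of r 2 b] by (simp add: powr_numeral)
      moreover have "1 - (y / r)^2 \<ge> 0"
        using that r by (simp add: abs_square_le_1 abs_le_iff divide_le_eq le_divide_eq)
      moreover have "r\<^sup>2 * (1 - (y / r)^2) = r^2 - y^2" using r by (simp add: field_simps power2_eq_square)
      ultimately show ?thesis using powr_mult[of "r\<^sup>2" "1 - (y / r)^2" b] by simp
    qed
    moreover have "(indicator {-1..1} (0 + (1 / r) * y) :: real) = indicator {-r..r} y"
      using r by (auto simp: indicator_def field_simps)
    ultimately show "r powr (2 * b) * (?f y)
      = ?g y"
      using r by (cases "y \<in> {-r..r}") (simp_all add: mult.assoc[symmetric])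
  qed
  also have "r powr (2 * b) * ((2 * (sqrt pi * Gamma (b + 1) / 2 * clifford (b + 1 / 2) ((r * z)^2))) /\<^sub>R \<bar>1 / r\<bar>)
     = r powr (2 * b + 1) * sqrt pi * Gamma (b + 1) * clifford (b + 1 / 2) ((r * z)^2)"
    using r by (simp add: powr_add)
  finally show ?thesis .
qed

text \<open>Tonelli over the coordinate along b: the slice of the ball at height y is a ball of one
  dimension less and of radius sqrt(r^2 - y^2).\<close>

lemma nn_integral_ball_slice:
  fixes b :: "'a::euclidean_space" and h :: "real \<Rightarrow> ennreal"
  assumes b: "b \<in> Basis" and r: "r > 0" and [measurable]: "h \<in> Borel"
  shows "(\<integral>\<^sup>+x. h (x \<bullet> b) * indicator (cball 0 r) x \<partial>(lborel :: 'a measure))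
    = (\<integral>\<^sup>+y. h y * (indicator {-r..r} y * ennreal (unit_ball_vol (real (DIM('a) - 1)) * sqrt (r^2 - y^2) ^ (DIM('a) - 1))) \<partial>lborel)"
proof -
  interpret product_sigma_finite "\<lambda>_::'a. lborel :: real measure" by standard
  have [measurable]: "(cball 0 r :: 'a set) \<in> sets borel" by simp
  define A where "A = Basis - {b}"
  let ?I = "\<lambda>y f. indicator {x. sqrt x \<le> r} (y^2 + (\<Sum>i\<in>A. (f i)^2)) :: ennreal"
  have A: "finite A" "b \<notin> A" "insert b A = Basis" "card A = DIM('a) - 1" using b by (auto simp: A_def)
  have sumb: "(\<Sum>c\<in>Basis. f c *\<^sub>R c) \<bullet> b = f b" for f :: "'a \<Rightarrow> real"
    using b by (rule inner_sum_left_Basis)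
  have nrm: "norm (\<Sum>c\<in>Basis. f c *\<^sub>R c :: 'a) = sqrt (\<Sum>i\<in>Basis. (f i)^2)" for f
  proof -
    have "dist 0 (\<Sum>c\<in>Basis. f c *\<^sub>R c :: 'a) = sqrt (\<Sum>i\<in>Basis. (f i)^2)"
      by (subst euclidean_dist_l2) (auto simp: L2_set_def)
    then show ?thesis by simp
  qed
  have "(\<integral>\<^sup>+x. h (x \<bullet> b) * indicator (cball 0 r) x \<partial>(lborel :: 'a measure))
    = (\<integral>\<^sup>+x. h (x \<bullet> b) * indicator (cball 0 r) x \<partial>distr (Pi\<^sub>M Basis (\<lambda>_. lborel)) borel (\<lambda>f. \<Sum>b\<in>Basis. f b *\<^sub>R b :: 'a))"
    by (subst lborel_eq) simp
  also have "\<dots> = (\<integral>\<^sup>+f. h ((\<Sum>b\<in>Basis. f b *\<^sub>R b :: 'a) \<bullet> b) * indicator (cball 0 r) (\<Sum>b\<in>Basis. f b *\<^sub>R b :: 'a) \<partial>Pi\<^sub>M Basis (\<lambda>_. lborel))"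
    by (rule nn_integral_distr) measurable
  also have "\<dots> = (\<integral>\<^sup>+f. h (f b) * indicator {x. sqrt x \<le> r} ((f b)^2 + (\<Sum>i\<in>A. (f i)^2)) \<partial>Pi\<^sub>M (insert b A) (\<lambda>_. lborel))"
  proof -
    have "(\<Sum>i\<in>Basis. (f i)^2) = (f b)^2 + (\<Sum>i\<in>A. (f i)^2)" for f :: "'a \<Rightarrow> real"
      using A by (metis sum.insert)
    then show ?thesis unfolding A(3)
      by (intro nn_integral_cong) (simp add: sumb indicator_def nrm)
  qed
  also have "\<dots> = (\<integral>\<^sup>+y. \<integral>\<^sup>+f. h y * ?I y f \<partial>Pi\<^sub>M A (\<lambda>_. lborel) \<partial>lborel)"
  proof (subst product_nn_integral_insert_rev)
    have [measurable]: "b \<in> insert b A" by simp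
    have [measurable]: "{x. sqrt x \<le> r} \<in> sets borel" by measurable
    show "(\<lambda>f. h (f b) * indicator {x. sqrt x \<le> r} ((f b)^2 + (\<Sum>i\<in>A. (f i)^2))) \<in> borel_measurable (Pi\<^sub>M (insert b A) (\<lambda>_. lborel))"
      by measurable
    have "(\<Sum>i\<in>A. ((f(b := y)) i)^2) = (\<Sum>i\<in>A. (f i)^2)" for f :: "'a \<Rightarrow> real" and y
      using A(2) by (intro sum.cong) auto
    then show "(\<integral>\<^sup>+ y. \<integral>\<^sup>+ x. h ((x(b := y)) b) * indicator {x. sqrt x \<le> r} (((x(b := y)) b)^2 + (\<Sum>i\<in>A. ((x(b := y)) i)^2)) \<partial>Pi\<^sub>M A (\<lambda>_. lborel) \<partial>lborel)
      = (\<integral>\<^sup>+ y. \<integral>\<^sup>+ f. h y * ?I y f \<partial>Pi\<^sub>M A (\<lambda>_. lborel) \<partial>lborel)"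
      by simp
  qed (use A in auto)
  also have "\<dots> = (\<integral>\<^sup>+y. h y * (indicator {-r..r} y * ennreal (unit_ball_vol (real (card A)) * sqrt (r^2 - y^2) ^ card A)) \<partial>lborel)"
  proof (rule nn_integral_cong_AE)
    \<comment> \<open>Slices of radius 0 occur at the two excluded heights only; all others are
      balls of positive radius or empty.\<close>
    have "AE y in lborel. y \<notin> {-r,r}"
      by (intro AE_not_in countable_imp_null_set_lborel) auto
    then show "AE y in lborel. (\<integral>\<^sup>+f. h y * ?I y f \<partial>Pi\<^sub>M A (\<lambda>_. lborel))
      = h y * (indicator {-r..r} y * ennreal (unit_ball_vol (real (card A)) * sqrt (r^2 - y^2) ^ card A))"
    proof eventually_elim
      case (elim y)
      let ?S = "{f. sqrt (\<Sum>i\<in>A. (f i)^2) \<le> sqrt (r^2 - y^2)} \<inter> space (Pi\<^sub>M A (\<lambda>_. lborel :: real measure))"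
      have S[measurable]: "?S \<in> sets (Pi\<^sub>M A (\<lambda>_. lborel :: real measure))" by measurable
      show ?case
      proof (cases "y \<in> {-r<..<r}")
        case True
        then have y: "y\<^sup>2 < r^2" by (subst real_sqrt_less_iff [symmetric]) auto
        have "(\<integral>\<^sup>+f. h y * ?I y f \<partial>Pi\<^sub>M A (\<lambda>_. lborel))
          = (\<integral>\<^sup>+f. h y * indicator ?S f \<partial>Pi\<^sub>M A (\<lambda>_. lborel))"
        proof (rule nn_integral_cong)
          fix f :: "'a \<Rightarrow> real" assume f: "f \<in> space (Pi\<^sub>M A (\<lambda>_. lborel :: real measure))"
          have "sqrt (y^2 + (\<Sum>i\<in>A. (f i)^2)) \<le> r \<longleftrightarrow> (\<Sum>i\<in>A. (f i)^2) \<le> r\<^sup>2 - y^2"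
            using r by (subst real_sqrt_le_iff') (auto simp: sum_nonneg add_nonneg_nonneg)
          then show "h y * ?I y f = h y * indicator ?S f"
            using f by (simp add: indicator_def)
        qed
        also have "\<dots> = h y * emeasure (Pi\<^sub>M A (\<lambda>_. lborel)) ?S" by (simp add: nn_integral_cmult)
        also have "emeasure (Pi\<^sub>M A (\<lambda>_. lborel)) ?S = ennreal (unit_ball_vol (real (card A)) * sqrt (r^2 - y^2) ^ card A)"
          using y A by (intro emeasure_cball_aux) auto
        finally show ?thesis using True by (simp add: indicator_def)
      next
        case False
        then have "y\<^sup>2 > r\<^sup>2" using elim r by (auto simp: abs_le_square_iff[symmetric] not_le[symmetric])
        then have "\<not> sqrt (y^2 + (\<Sum>i\<in>A. (f i)^2)) \<le> r" for f :: "'a \<Rightarrow> real"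
          using r sum_nonneg[of A "\<lambda>i. (f i)^2"] by (subst real_sqrt_le_iff') auto
        moreover have "y \<notin> {-r..r}" using False elim by auto
        ultimately show ?thesis by (simp add: indicator_def)
      qed
    qed
  qed
  finally show ?thesis by (simp add: A)
qed

lemma nn_integral_eq_integral_value:
  assumes "has_bochner_integral M f v" "\<And>x. f x \<ge> (0::real)"
  shows "(\<integral>\<^sup>+x. ennreal (f x) \<partial>M) = ennreal v"
  using nn_integral_eq_integral[of M f] assms by (auto simp: has_bochner_integral_iff)

text \<open>The added 1 keeps the integrand nonnegative, so that measures and Tonelli suffice. A
  rotation takes \<xi> to a coordinate axis, the ball is sliced across this axis, and the slice
  volumes form the weight of Poisson's integral.\<close>

lemma ball_one_plus_cos:
  fixes \<xi> :: "real ^ 'n"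
  assumes r: "r > 0"
  defines "d \<equiv> real CARD('n)"
  shows "(\<integral>\<^sup>+x. ennreal (1 + cos (2 * pi * (\<xi> \<bullet> x))) * indicator (cball 0 r) x \<partial>lborel)
    = ennreal (pi powr (d / 2) * r ^ CARD('n) * (clifford (d / 2) 0 + clifford (d / 2) ((pi * r * norm \<xi>)^2)))"
proof -
  let ?p = "\<lambda>y. (r^2 - y^2) powr ((d - 1) / 2)"
  let ?c = "\<lambda>y. cos (2 * (pi * norm \<xi>) * y)"
  let ?g = "\<lambda>y. indicator {-r..r} y * (?p y * cos (2 * 0 * y)) + indicator {-r..r} y * (?p y * ?c y)"
  let ?C = "\<lambda>w. r powr (2 * ((d - 1) / 2) + 1) * sqrt pi * Gamma ((d - 1) / 2 + 1) * clifford ((d - 1) / 2 + 1 / 2) w"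
  let ?h = "\<lambda>y. indicator {-r..r} y * ennreal (unit_ball_vol (real (DIM(real ^ 'n) - 1)) * sqrt (r^2 - y^2) ^ (DIM(real ^ 'n) - 1))"
  obtain k :: 'n where True by blast
  define b :: "real ^ 'n" where "b = axis k 1"
  have b: "b \<in> Basis" "norm b = 1" by (auto simp: b_def)
  have "norm (norm \<xi> *\<^sub>R b) = norm \<xi>" using b by simp
  then obtain f where f: "orthogonal_transformation f" "f (norm \<xi> *\<^sub>R b) = \<xi>"
    by (rule orthogonal_transformation_exists)
  have [measurable]: "f \<in> Borel"
    using linear_continuous_on_compose[OF continuous_on_id orthogonal_transformation_linear[OF f(1)]]
    by (intro borel_measurable_continuous_onI) simp
  have [measurable]: "(cball 0 r :: (real ^ 'n) set) \<in> sets borel" by simp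
  define n where "n = CARD('n)"
  have n: "n \<ge> 1" unfolding n_def using zero_less_card_finite by (simp add: Suc_le_eq)
  define V where "V = unit_ball_vol (real (n - 1))"
  have V: "V \<ge> 0" by (simp add: V_def)
  have "(\<integral>\<^sup>+x. ennreal (1 + cos (2 * pi * (\<xi> \<bullet> x))) * indicator (cball 0 r) x \<partial>lborel)
    = (\<integral>\<^sup>+x. ennreal (1 + cos (2 * pi * (\<xi> \<bullet> x))) * indicator (cball 0 r) x \<partial>distr lborel borel f)"
    by (simp add: lborel_distr_orthogonal[OF f(1)])
  also have "\<dots> = (\<integral>\<^sup>+x. ennreal (1 + cos (2 * pi * (\<xi> \<bullet> f x))) * indicator (cball 0 r) (f x) \<partial>lborel)"
    by (rule nn_integral_distr) auto
  also have "\<dots> = (\<integral>\<^sup>+x. ennreal (1 + cos (2 * (pi * norm \<xi>) * (x \<bullet> b))) * indicator (cball 0 r) x \<partial>lborel)"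
  proof (rule nn_integral_cong)
    fix x :: "real ^ 'n"
    have "\<xi> \<bullet> f x = norm \<xi> * (x \<bullet> b)"
      using f unfolding orthogonal_transformation_def by (metis inner_commute inner_scaleR_right)
    moreover have "norm (f x) = norm x" using f(1) by (simp add: orthogonal_transformation_norm)
    ultimately show "ennreal (1 + cos (2 * pi * (\<xi> \<bullet> f x))) * indicator (cball 0 r) (f x)
      = ennreal (1 + cos (2 * (pi * norm \<xi>) * (x \<bullet> b))) * indicator (cball 0 r) x"
      by (simp add: indicator_def mult.assoc)
  qed
  also have "\<dots> = (\<integral>\<^sup>+y. ennreal (1 + ?c y) * ?h y \<partial>lborel)"
    by (rule nn_integral_ball_slice[OF b(1) r]) measurable
  also have "\<dots> = (\<integral>\<^sup>+y. ennreal (V * (?g y)) \<partial>lborel)"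
  proof (rule nn_integral_cong_AE)
    have "AE y in lborel. y \<notin> {-r,r}"
      by (intro AE_not_in countable_imp_null_set_lborel) auto
    then show "AE y in lborel. ennreal (1 + ?c y) * ?h y
      = ennreal (V * (?g y))"
    proof eventually_elim
      case (elim y)
      show ?case
      proof (cases "y \<in> {-r<..<r}")
        case True
        then have y: "y\<^sup>2 < r^2" by (subst real_sqrt_less_iff [symmetric]) auto
        have "sqrt (r^2 - y^2) ^ (n - 1) = sqrt (r^2 - y^2) powr (real (n - 1))"
          using y by (subst powr_realpow) auto
        also have "\<dots> = ?p y"
          using y n by (simp add: powr_half_sqrt[symmetric] powr_powr d_def n_def of_nat_diff)
        finally have e: "sqrt (r^2 - y^2) ^ (n - 1) = ?p y" .
        have cos1: "1 + ?c y \<ge> 0"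
          using cos_ge_minus_one[of "2 * (pi * norm \<xi>) * y"] by linarith
        have "ennreal (1 + ?c y) * ?h y
          = ennreal (1 + ?c y) * ennreal (V * ?p y)"
          using True e by (simp add: V_def n_def)
        also have "\<dots> = ennreal ((1 + ?c y) * (V * ?p y))"
          using cos1 V by (subst ennreal_mult) auto
        also have "(1 + ?c y) * (V * ?p y)
          = V * (?g y)"
          using True by (simp add: algebra_simps)
        finally show ?thesis .
      qed (use elim in auto)
    qed
  qed
  also have "\<dots> = ennreal (V * (?C ((r * 0)^2)
      + ?C ((r * (pi * norm \<xi>))^2)))"
  proof (rule nn_integral_eq_integral_value)
    show "has_bochner_integral lborel (\<lambda>y. V * (?g y))
     (V * (?C ((r * 0)^2)
      + ?C ((r * (pi * norm \<xi>))^2)))"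
      using r n by (intro has_bochner_integral_mult_right has_bochner_integral_add clifford_Poisson_scaled)
        (auto simp: d_def n_def)
    fix y :: real
    have "?p y * ?c y \<ge> - (?p y)"
      using mult_left_mono[OF cos_ge_minus_one[of "2 * (pi * norm \<xi>) * y"], of "?p y"] by simp
    then show "0 \<le> V * (?g y)"
      using V by (intro mult_nonneg_nonneg) (auto simp: indicator_def)
  qed
  also have "V * (?C ((r * 0)^2)
      + ?C ((r * (pi * norm \<xi>))^2))
    = pi powr (d / 2) * r ^ CARD('n) * (clifford (d / 2) 0 + clifford (d / 2) ((pi * r * norm \<xi>)^2))"
  proof -
    have "(d - 1) / 2 + 1 / 2 = d / 2" "2 * ((d - 1) / 2) + 1 = real n" by (simp_all add: d_def n_def field_simps)
    moreover have "r powr real n = r ^ n" using r by (rule powr_realpow)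
    moreover have "V * sqrt pi * Gamma ((d - 1) / 2 + 1) = pi powr (d / 2)"
    proof -
      have "d \<ge> 1" using n by (simp add: d_def n_def)
      then have "Gamma ((d - 1) / 2 + 1) > 0" by (intro Gamma_real_pos add_nonneg_pos) simp_all
      moreover have "real (n - 1) = d - 1" using n by (simp add: d_def n_def of_nat_diff)
      moreover have "pi powr ((d - 1) / 2) * sqrt pi = pi powr (d / 2)"
        by (simp add: powr_half_sqrt[symmetric] powr_add[symmetric] field_simps)
      ultimately show ?thesis unfolding V_def unit_ball_vol_def by simp
    qed
    moreover have "V * (R * q * G * X + R * q * G * Y) = (V * q * G) * R * (X + Y)" for R q G X Y
      by (simp add: algebra_simps)
    moreover have "(r * 0)^2 = 0" "r * (pi * norm \<xi>) = pi * r * norm \<xi>" by simp_all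
    ultimately show ?thesis by (simp only: n_def)
  qed
  finally show ?thesis .
qed

text \<open>The integral of $e^{2\pi i\xi x}$ over the sphere of radius $r$, for $|\xi| = s$.\<close>

definition radial_weight :: "nat \<Rightarrow> real \<Rightarrow> real \<Rightarrow> real" where
  "radial_weight n s r = 2 * pi powr (real n / 2) * r ^ (n - 1) * clifford (real n / 2 - 1) ((pi * r * s)^2)"

section \<open>Polar coordinates\<close>

lemma borel_measurable_radial_weight [measurable]: "radial_weight n s \<in> Borel"
  unfolding radial_weight_def by measurable

text \<open>A sphere integral is the derivative of the ball integral in the radius; the recurrence
  lowers the order from n/2 to n/2 - 1.\<close>

lemma DERIV_ball_clifford:
  assumes n: "n \<ge> 1"
  shows "((\<lambda>r. pi powr (real n / 2) * r ^ n * clifford (real n / 2) ((pi * r * s)^2)) has_real_derivative radial_weight n s r) (at r)"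
proof -
  define P where "P = pi powr (real n / 2)"
  have D: "((\<lambda>r. P * r ^ n * clifford (real n / 2) ((pi * r * s)^2)) has_real_derivative
     P * (real n * r ^ (n - 1) * clifford (real n / 2) ((pi * r * s)^2)
       + r ^ n * (- clifford (real n / 2 + 1) ((pi * r * s)^2) * (2 * (pi * r * s) * (pi * s))))) (at r)"
    by (rule derivative_eq_intros refl DERIV_chain2[OF DERIV_clifford] | simp add: algebra_simps)+
  have rn: "r ^ n = r * r ^ (n - 1)" using n by (cases n) auto
  have "P * (real n * r ^ (n - 1) * clifford (real n / 2) ((pi * r * s)^2)
       + r ^ n * (- clifford (real n / 2 + 1) ((pi * r * s)^2) * (2 * (pi * r * s) * (pi * s))))
    = 2 * P * r ^ (n - 1) * (real n / 2 * clifford (real n / 2) ((pi * r * s)^2) - (pi * r * s)^2 * clifford (real n / 2 + 1) ((pi * r * s)^2))"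
    unfolding rn by (simp add: algebra_simps power2_eq_square)
  also have "\<dots> = radial_weight n s r"
    unfolding radial_weight_def P_def clifford_recurrence[of "real n / 2"] ..
  finally have eq: "P * (real n * r ^ (n - 1) * clifford (real n / 2) ((pi * r * s)^2)
       + r ^ n * (- clifford (real n / 2 + 1) ((pi * r * s)^2) * (2 * (pi * r * s) * (pi * s)))) = radial_weight n s r" .
  show ?thesis using D unfolding eq unfolding P_def .
qed

lemma radial_weight_0: "radial_weight n 0 r = 2 * pi powr (real n / 2) * rGamma (real n / 2) * r ^ (n - 1)"
  by (simp add: radial_weight_def clifford_0)

lemma rGamma_real_pos: "x > 0 \<Longrightarrow> rGamma (x::real) > 0"
  by (simp add: rGamma_inverse_Gamma Gamma_real_pos)

lemma radial_weight_0_nonneg: "n \<ge> 1 \<Longrightarrow> r \<ge> 0 \<Longrightarrow> radial_weight n 0 r \<ge> 0"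
  unfolding radial_weight_0 using rGamma_real_pos[of "real n / 2"] by simp

text \<open>Both measures on the line are determined by their values on the half-lines {..a}. On the
  left these are ball integrals of 1 + cos, on the right the fundamental theorem applied to their
  derivative in the radius. The density on the right is nonnegative because the ball integrals
  increase with the radius.\<close>

lemma radial_density:
  fixes \<xi> :: "real ^ 'n"
  defines "n \<equiv> CARD('n)"
  shows "\<And>r. r \<ge> 0 \<Longrightarrow> radial_weight n 0 r + radial_weight n (norm \<xi>) r \<ge> 0"
    and "distr (density lborel (\<lambda>x. ennreal (1 + cos (2 * pi * (\<xi> \<bullet> x))))) borel norm
      = density lborel (\<lambda>r. ennreal (indicator {0..} r * (radial_weight n 0 r + radial_weight n (norm \<xi>) r)))"
proof -
  let ?c = "\<lambda>x. ennreal (1 + cos (2 * pi * (\<xi> \<bullet> x)))"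
  let ?w = "\<lambda>r. radial_weight n 0 r + radial_weight n (norm \<xi>) r"
  have n: "n \<ge> 1" unfolding n_def using zero_less_card_finite by (simp add: Suc_le_eq)
  have [measurable]: "(cball 0 r :: (real ^ 'n) set) \<in> sets borel" for r by simp
  define F where "F r = pi powr (real n / 2) * r ^ n * clifford (real n / 2) ((pi * r * 0)^2)
     + pi powr (real n / 2) * r ^ n * clifford (real n / 2) ((pi * r * norm \<xi>)^2)" for r
  define w where "w r = ?w r" for r
  have DF: "(F has_real_derivative w r) (at r)" for r
    unfolding F_def w_def by (intro DERIV_add DERIV_ball_clifford n)
  have F: "(\<integral>\<^sup>+x. ?c x * indicator (cball 0 r) x \<partial>lborel) = ennreal (F r)" if "r > 0" for r
    using ball_one_plus_cos[OF that, of \<xi>] by (simp add: F_def n_def algebra_simps)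
  have Fpos: "F r > 0 \<or> F r = 0 \<or> F r < 0" for r by linarith
  \<comment> \<open>An equation between \<open>ennreal\<close> values says nothing about a negative
    F, hence the second alternative; \<open>Fnn\<close> excludes it.\<close>
  have Fm: "F r \<le> F s \<or> F s < 0" if "0 < r" "r \<le> s" for r s
  proof -
    have "ennreal (F r) \<le> ennreal (F s)"
      unfolding F[OF that(1), symmetric] F[OF order_less_le_trans[OF that], symmetric]
      by (intro nn_integral_mono mult_left_mono) (use that in \<open>auto simp: indicator_def\<close>)
    then show ?thesis by (cases "F s \<ge> 0") auto
  qed
  \<comment> \<open>If F were negative, the ball integral would vanish as an extended nonnegative
    number; but the density is positive near the origin.\<close>
  have Fnn: "F s \<ge> 0" if s: "s > 0" for s
  proof (rule ccontr)
    assume neg: "\<not> F s \<ge> 0"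
    have "(\<integral>\<^sup>+x. ?c x * indicator (cball 0 s) x \<partial>lborel) = 0"
      using F[OF s] neg by (simp add: ennreal_neg)
    then have ae: "AE x in lborel. ?c x * indicator (cball 0 s) x = 0"
      by (subst (asm) nn_integral_0_iff_AE) auto
    \<comment> \<open>On the ball of this radius |2 pi \<xi> x| <= pi/4, so the cosine is positive
      there.\<close>
    define e where "e = min s (1 / (8 * (1 + norm \<xi>)))"
    have e: "e > 0" "e \<le> s" using s by (auto simp: e_def add_pos_nonneg)
    have cpos: "1 + cos (2 * pi * (\<xi> \<bullet> x)) > 0" if x: "norm x \<le> e" for x
    proof -
      have "\<bar>\<xi> \<bullet> x\<bar> \<le> norm \<xi> * norm x" by (rule Cauchy_Schwarz_ineq2)
      also have "\<dots> \<le> norm \<xi> * (1 / (8 * (1 + norm \<xi>)))"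
        using x by (intro mult_left_mono) (auto simp: e_def)
      also have "\<dots> \<le> 1 / 8" by (simp add: divide_simps add_pos_nonneg)
      finally have "\<bar>2 * pi * (\<xi> \<bullet> x)\<bar> \<le> 2 * pi * (1 / 8)" by (simp add: abs_mult)
      then have "- (pi / 2) < 2 * pi * (\<xi> \<bullet> x)" "2 * pi * (\<xi> \<bullet> x) < pi / 2"
        using pi_gt_zero unfolding abs_le_iff by linarith+
      then have "cos (2 * pi * (\<xi> \<bullet> x)) > 0" by (rule cos_gt_zero_pi)
      then show ?thesis by simp
    qed
    from ae have "AE x in lborel. x \<notin> ball (0 :: real ^ 'n) e"
    proof eventually_elim
      case (elim x)
      show ?case
      proof
        assume "x \<in> ball 0 e"
        then have "norm x \<le> e" "x \<in> cball 0 s" using e by auto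
        then show False using elim cpos[of x]
          by (simp add: ennreal_eq_0_iff)
      qed
    qed
    then have "ball (0 :: real ^ 'n) e \<in> null_sets lborel" by (subst AE_iff_null_sets) auto
    then have "emeasure lborel (ball (0 :: real ^ 'n) e) = 0" by blast
    then show False using e unit_ball_vol_pos[of "real CARD('n)", OF of_nat_0_le_iff]
      by (simp add: emeasure_ball ennreal_eq_0_iff mult_le_0_iff power_le_zero_eq not_le)
  qed
  show nonneg: "?w r \<ge> 0" if r: "r \<ge> 0" for r
  proof (cases "r = 0")
    case True
    have "radial_weight n (norm \<xi>) 0 = radial_weight n 0 0" by (simp add: radial_weight_def)
    then show ?thesis using True radial_weight_0_nonneg[OF n, of 0] by simp
  next
    case False
    have "mono_on {0<..} F"
      using Fm Fnn by (intro mono_onI) (metis greaterThan_iff less_le_trans not_le)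
    from mono_on_imp_deriv_nonneg[OF this DF[of r]] show ?thesis
      using False r by (simp add: interior_open w_def)
  qed
  let ?M = "distr (density lborel (\<lambda>x. ?c x)) borel norm"
  let ?N = "density lborel (\<lambda>r. ennreal (indicator {0..} r * w r))"
  have [measurable]: "w \<in> Borel" unfolding w_def by measurable
  have N: "emeasure ?N {..a} = ennreal (F a - F 0)" if a: "a \<ge> 0" for a
  proof -
    have "emeasure ?N {..a} = (\<integral>\<^sup>+r. ennreal (indicator {0..} r * w r) * indicator {..a} r \<partial>lborel)"
      by (rule emeasure_density) auto
    also have "\<dots> = (\<integral>\<^sup>+r. ennreal (w r) * indicator {0..a} r \<partial>lborel)"
      by (intro nn_integral_cong) (auto simp: indicator_def)
    also have "\<dots> = ennreal (F a - F 0)"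
      using a nonneg by (intro nn_integral_FTC_Icc DF) (auto simp: w_def)
    finally show ?thesis .
  qed
  have F0: "F 0 = 0" using n by (simp add: F_def)
  have M: "emeasure ?M {..a} = (\<integral>\<^sup>+x. ?c x * indicator (cball 0 a) x \<partial>lborel)" for a
  proof -
    have "emeasure ?M {..a} = emeasure (density lborel (\<lambda>x. ?c x)) (norm -` {..a} \<inter> space (density lborel (\<lambda>x. ?c x)))"
      by (rule emeasure_distr) auto
    also have "norm -` {..a} \<inter> space (density lborel (\<lambda>x. ?c x)) = cball 0 a"
      by auto
    also have "emeasure (density lborel (\<lambda>x. ?c x)) (cball 0 a)
      = (\<integral>\<^sup>+x. ?c x * indicator (cball 0 a) x \<partial>lborel)"
      by (rule emeasure_density) auto
    finally show ?thesis .
  qed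
  have "?M = ?N"
  proof (rule measure_eqI_generator_eq[where E = "range (\<lambda>a::real. {..a})" and \<Omega> = UNIV and A = "\<lambda>i. {..real i}"])
    show "Int_stable (range (\<lambda>a::real. {..a}))"
      by (auto simp: Int_stable_def Int_atMost)
    show "sets ?M = sigma_sets UNIV (range (\<lambda>a::real. {..a}))"
      "sets ?N = sigma_sets UNIV (range (\<lambda>a::real. {..a}))"
      by (simp_all add: borel_eq_atMost)
    show "(\<Union>i. {..real i}) = UNIV"
      by (auto intro: real_nat_ceiling_ge)
    show "emeasure ?M {..real i} \<noteq> \<infinity>" for i
    proof (cases "i = 0")
      case True
      then have "emeasure ?M {..real i} \<le> (\<integral>\<^sup>+x. ?c x * indicator (cball 0 1) x \<partial>lborel)"
        unfolding M by (intro nn_integral_mono mult_left_mono) (auto simp: indicator_def)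
      then show ?thesis using F[of 1] by (auto simp: top_unique)
    qed (use F in \<open>simp add: M\<close>)
    fix X :: "real set" assume "X \<in> range (\<lambda>a::real. {..a})"
    then obtain a where X: "X = {..a}" by auto
    consider "a < 0" | "a = 0" | "a > 0" by linarith
    then show "emeasure ?M X = emeasure ?N X"
    proof cases
      case 1
      then have "emeasure ?N {..a} = (\<integral>\<^sup>+r. 0 \<partial>(lborel :: real measure))"
      proof (subst emeasure_density)
        show "(\<integral>\<^sup>+r. ennreal (indicator {0..} r * w r) * indicator {..a} r \<partial>lborel) = (\<integral>\<^sup>+r. 0 \<partial>(lborel :: real measure))"
          using 1 by (intro nn_integral_cong) (auto simp: indicator_def)
      qed auto
      then show ?thesis using 1 unfolding X M by simp
    next
      case 2
      have "(\<integral>\<^sup>+x. ?c x * indicator (cball 0 0) x \<partial>lborel) = 0"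
        by (subst nn_integral_0_iff_AE)
          (auto intro!: AE_I[of _ _ "{0}"] simp: indicator_def emeasure_lborel_countable)
      then show ?thesis using 2 N[of 0] unfolding X M by simp
    next
      case 3
      then show ?thesis using N[of a] F[of a] F0 unfolding X M by simp
    qed
  qed auto
  then show "?M = density lborel (\<lambda>r. ennreal (indicator {0..} r * ?w r))"
    unfolding w_def .
qed

lemma
  fixes \<xi> :: "real ^ 'n" and f :: "real \<Rightarrow> real"
  assumes [measurable]: "f \<in> Borel"
  defines "n \<equiv> CARD('n)"
  shows integrable_radial_cos_iff:
      "integrable lborel (\<lambda>x. (1 + cos (2 * pi * (\<xi> \<bullet> x))) * f (norm x)) \<longleftrightarrow>
       integrable lborel (\<lambda>r. indicator {0..} r * (radial_weight n 0 r + radial_weight n (norm \<xi>) r) * f r)"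
    and integral_radial_cos:
      "(LBINT x. (1 + cos (2 * pi * (\<xi> \<bullet> x))) * f (norm x)) =
       (LBINT r. indicator {0..} r * (radial_weight n 0 r + radial_weight n (norm \<xi>) r) * f r)"
proof -
  let ?w = "\<lambda>r :: real. indicator {0..} r * (radial_weight n 0 r + radial_weight n (norm \<xi>) r)"
  let ?c = "\<lambda>x. 1 + cos (2 * pi * (\<xi> \<bullet> x))"
  note D = radial_density[where \<xi> = \<xi>, folded n_def]
  let ?D = "density lborel (\<lambda>x. ennreal (?c x))"
  let ?N = "density lborel (\<lambda>r. ennreal (?w r))"
  have c: "AE x in lborel. 0 \<le> 1 + cos (2 * pi * (\<xi> \<bullet> x))"
  proof (rule AE_I2)
    show "0 \<le> 1 + cos (2 * pi * (\<xi> \<bullet> x))" for x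
      using cos_ge_minus_one[of "2 * pi * (\<xi> \<bullet> x)"] by linarith
  qed
  have w: "AE r in lborel. 0 \<le> ?w r"
    using D(1) by (intro AE_I2) (simp add: indicator_def)
  have "integrable lborel (\<lambda>x. (?c x) *\<^sub>R f (norm x)) \<longleftrightarrow> integrable ?D (\<lambda>x. f (norm x))"
    by (rule integrable_density[symmetric]) (use c in auto)
  also have "\<dots> \<longleftrightarrow> integrable (distr ?D borel norm) f" by (rule integrable_distr_eq[symmetric]) auto
  also have "\<dots> \<longleftrightarrow> integrable ?N f" unfolding D(2) ..
  also have "\<dots> \<longleftrightarrow> integrable lborel (\<lambda>r. (?w r) *\<^sub>R f r)"
    by (rule integrable_density) (use w in auto)
  finally show "integrable lborel (\<lambda>x. (?c x) * f (norm x)) \<longleftrightarrow>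
       integrable lborel (\<lambda>r. ?w r * f r)" by simp
  have "(LBINT x. (?c x) *\<^sub>R f (norm x)) = (\<integral>x. f (norm x) \<partial>?D)"
    by (rule integral_density[symmetric]) (use c in auto)
  also have "\<dots> = integral\<^sup>L (distr ?D borel norm) f" by (rule integral_distr[symmetric]) auto
  also have "\<dots> = integral\<^sup>L ?N f" unfolding D(2) ..
  also have "\<dots> = (LBINT r. (?w r) *\<^sub>R f r)"
    by (rule integral_density) (use w in auto)
  finally show "(LBINT x. (?c x) * f (norm x)) =
       (LBINT r. ?w r * f r)" by simp
qed

lemma integrable_radial_iff:
  fixes f :: "real \<Rightarrow> real"
  assumes [measurable]: "f \<in> Borel"
  shows "integrable lborel (\<lambda>x :: real ^ 'n. f (norm x)) \<longleftrightarrow>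
    integrable lborel (\<lambda>r. indicator {0..} r * (radial_weight CARD('n) 0 r * f r))"
proof -
  have e: "indicator {0..} r * (radial_weight CARD('n) 0 r + radial_weight CARD('n) (norm (0 :: real ^ 'n)) r) * f r
    = 2 * (indicator {0..} r * (radial_weight CARD('n) 0 r * f r))" for r by simp
  show ?thesis
    using integrable_radial_cos_iff[OF assms, of "0 :: real ^ 'n"] unfolding e by simp
qed

text \<open>The added 1 is removed again by subtracting the case \<xi> = 0, in which the density is
  the constant 2.\<close>

lemma has_bochner_integral_radial:
  fixes \<xi> :: "real ^ 'n" and f :: "real \<Rightarrow> real"
  assumes f[measurable]: "f \<in> Borel" and int: "integrable lborel (\<lambda>x :: real ^ 'n. f (norm x))"
  shows "integrable lborel (\<lambda>r. indicator {0..} r * (radial_weight CARD('n) (norm \<xi>) r * f r))"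
    and "has_bochner_integral lborel (\<lambda>x. cos (2 * pi * (\<xi> \<bullet> x)) * f (norm x))
      (LBINT r. indicator {0..} r * (radial_weight CARD('n) (norm \<xi>) r * f r))"
proof -
  let ?r = "\<lambda>r :: real. indicator {0..} r * (radial_weight CARD('n) (norm \<xi>) r * f r)"
  let ?c = "\<lambda>x. cos (2 * pi * (\<xi> \<bullet> x))"
  have ic: "integrable lborel (\<lambda>x. ?c x * f (norm x))"
    by (rule Bochner_Integration.integrable_bound[OF int])
      (auto simp: abs_mult intro!: mult_left_le_one_le)
  have ip: "integrable lborel (\<lambda>x. (1 + ?c x) * f (norm x))"
    using Bochner_Integration.integrable_add[OF int ic] by (simp add: distrib_right)
  have i0: "integrable lborel (\<lambda>r. indicator {0..} r * (radial_weight CARD('n) 0 r * f r))"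
    using int integrable_radial_iff[OF f] by blast
  have i1: "integrable lborel (\<lambda>r. indicator {0..} r * (radial_weight CARD('n) 0 r + radial_weight CARD('n) (norm \<xi>) r) * f r)"
    using ip integrable_radial_cos_iff[OF f] by blast
  have e: "?r r
    = indicator {0..} r * (radial_weight CARD('n) 0 r + radial_weight CARD('n) (norm \<xi>) r) * f r
     - indicator {0..} r * (radial_weight CARD('n) 0 r * f r)" for r :: real
    by (simp add: algebra_simps)
  show i2: "integrable lborel (\<lambda>r. ?r r)"
    unfolding e using i1 i0 by (rule Bochner_Integration.integrable_diff)
  have "(LBINT x. (1 + cos (2 * pi * ((0 :: real ^ 'n) \<bullet> x))) * f (norm x)) =
       (LBINT r. indicator {0..} r * (radial_weight CARD('n) 0 r + radial_weight CARD('n) (norm (0 :: real ^ 'n)) r) * f r)"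
    by (rule integral_radial_cos[OF f])
  also have "(\<lambda>x :: real ^ 'n. (1 + cos (2 * pi * ((0 :: real ^ 'n) \<bullet> x))) * f (norm x)) = (\<lambda>x. 2 * f (norm x))" by simp
  also have "(\<lambda>r. indicator {0..} r * (radial_weight CARD('n) 0 r + radial_weight CARD('n) (norm (0 :: real ^ 'n)) r) * f r)
    = (\<lambda>r. 2 * (indicator {0..} r * (radial_weight CARD('n) 0 r * f r)))" by (auto simp: fun_eq_iff)
  finally have v0: "(LBINT x. f (norm (x :: real ^ 'n))) = (LBINT r. indicator {0..} r * (radial_weight CARD('n) 0 r * f r))"
    by simp
  have "(LBINT x. ?c x * f (norm x))
    = (LBINT x. (1 + ?c x) * f (norm x) - f (norm x))"
    by (simp add: distrib_right)
  also have "\<dots> = (LBINT x. (1 + ?c x) * f (norm x)) - (LBINT x. f (norm (x :: real ^ 'n)))"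
    using ip int by (rule Bochner_Integration.integral_diff)
  also have "\<dots> = (LBINT r. ?r r)"
    unfolding integral_radial_cos[OF f] v0 e using i1 i0 by (rule Bochner_Integration.integral_diff[symmetric])
  finally show "has_bochner_integral lborel (\<lambda>x. ?c x * f (norm x))
      (LBINT r. ?r r)"
    using ic by (simp add: has_bochner_integral_iff)
qed

definition ball_profile :: "real \<Rightarrow> real \<Rightarrow> real \<Rightarrow> real" where
  "ball_profile \<beta> a r = (if r < a then (a^2 - r^2) powr \<beta> else 0)"

lemma borel_measurable_ball_profile [measurable]: "ball_profile \<beta> a \<in> Borel"
  unfolding ball_profile_def by measurable

lemma ball_power_eq_profile: "ball_power \<beta> a x = of_real (ball_profile \<beta> a (norm x))"
  by (simp add: ball_power_def ball_profile_def)

text \<open>The Fourier transform of the ball power at a frequency of norm s, in classical notation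
  Gamma(\<beta>+1) pi^(-\<beta>) (a/s)^(n/2+\<beta>) J_(n/2+\<beta>)(2 pi a s). Written with
  \<open>clifford\<close> it is continuous at s = 0 as well.\<close>

definition ball_ft :: "nat \<Rightarrow> real \<Rightarrow> real \<Rightarrow> real \<Rightarrow> real" where
  "ball_ft n \<beta> a s = Gamma (\<beta> + 1) * pi powr (real n / 2) * a powr (real n + 2 * \<beta>)
     * clifford (real n / 2 + \<beta>) ((pi * a * s)^2)"

lemma borel_measurable_ball_ft [measurable]: "ball_ft n \<beta> a \<in> Borel"
  unfolding ball_ft_def by measurable

text \<open>Sonine's formula at order n/2 - 1, rescaled from radius 1 to radius a: the order rises
  by \<beta> + 1 to n/2 + \<beta>.\<close>

lemma has_bochner_integral_radial_ball_profile:
  assumes n: "n \<ge> 1" and \<beta>: "\<beta> > -1" and a: "a > 0"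
  shows "has_bochner_integral lborel (\<lambda>r. indicator {0..} r * (radial_weight n s r * ball_profile \<beta> a r)) (ball_ft n \<beta> a s)"
proof -
  define \<nu> where "\<nu> = real n / 2 - 1"
  define w where "w = (pi * a * s)^2"
  define C where "C = 2 * pi powr (real n / 2) * a powr (2 * \<beta>) * a ^ (n - 1)"
  have "has_bochner_integral lborel
    (\<lambda>r. indicator {0<..<1} r * ((1 - r^2) powr \<beta> * r powr (2 * \<nu> + 1) * clifford \<nu> (w * r^2)))
    (Gamma (\<beta> + 1) / 2 * clifford (\<nu> + \<beta> + 1) w)"
    using n by (intro sonine \<beta>) (simp add: \<nu>_def)
  then have "has_bochner_integral lborel
    (\<lambda>r. indicator {0<..<1} (0 + (1 / a) * r) * ((1 - (0 + (1 / a) * r)^2) powr \<beta> * (0 + (1 / a) * r) powr (2 * \<nu> + 1) * clifford \<nu> (w * (0 + (1 / a) * r)^2)))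
    ((Gamma (\<beta> + 1) / 2 * clifford (\<nu> + \<beta> + 1) w) /\<^sub>R \<bar>1 / a\<bar>)"
    using a by (subst (asm) lborel_has_bochner_integral_real_affine_iff[of "1 / a" _ _ 0]) auto
  from has_bochner_integral_mult_right[OF this, of C]
  have H: "has_bochner_integral lborel
    (\<lambda>r. C * (indicator {0<..<1} (0 + (1 / a) * r) * ((1 - (0 + (1 / a) * r)^2) powr \<beta> * (0 + (1 / a) * r) powr (2 * \<nu> + 1) * clifford \<nu> (w * (0 + (1 / a) * r)^2))))
    (C * ((Gamma (\<beta> + 1) / 2 * clifford (\<nu> + \<beta> + 1) w) /\<^sub>R \<bar>1 / a\<bar>))" .
  have val: "C * ((Gamma (\<beta> + 1) / 2 * clifford (\<nu> + \<beta> + 1) w) /\<^sub>R \<bar>1 / a\<bar>) = ball_ft n \<beta> a s"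
  proof -
    have e1: "\<nu> + \<beta> + 1 = real n / 2 + \<beta>" by (simp add: \<nu>_def)
    have e2: "a powr (real n + 2 * \<beta>) = a powr (2 * \<beta>) * (a * a ^ (n - 1))"
    proof -
      have "a powr (real n + 2 * \<beta>) = a powr (2 * \<beta>) * a powr (real n)" by (simp add: powr_add)
      also have "a powr (real n) = a * a ^ (n - 1)" using a n by (cases n) (simp_all add: powr_realpow del: of_nat_Suc)
      finally show ?thesis .
    qed
    show ?thesis unfolding C_def ball_ft_def w_def e1 e2 using a by simp
  qed
  have AE: "AE r in lborel. C * (indicator {0<..<1} (0 + (1 / a) * r) * ((1 - (0 + (1 / a) * r)^2) powr \<beta> * (0 + (1 / a) * r) powr (2 * \<nu> + 1) * clifford \<nu> (w * (0 + (1 / a) * r)^2)))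
    = indicator {0..} r * (radial_weight n s r * ball_profile \<beta> a r)"
  proof -
    have "AE r in lborel. r \<notin> {0::real}"
      by (intro AE_not_in countable_imp_null_set_lborel) auto
    then show ?thesis
    proof eventually_elim
      case (elim r)
      show ?case
      proof (cases "0 < r \<and> r < a")
        case True
        have "\<bar>r / a\<bar> < 1" using True by simp
        then have "(1 - (r / a)^2) > 0" unfolding abs_square_less_1[symmetric] by simp
        have e1: "a powr (2 * \<beta>) * (1 - (r / a)^2) powr \<beta> = (a^2 - r^2) powr \<beta>"
        proof -
          have "a powr (2 * \<beta>) = (a^2) powr \<beta>" using a powr_powr[of a 2 \<beta>] by (simp add: powr_numeral)
          moreover have "a\<^sup>2 * (1 - (r / a)^2) = a^2 - r^2" using a by (simp add: field_simps power2_eq_square)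
          ultimately show ?thesis using powr_mult[of "a\<^sup>2" "1 - (r / a)^2" \<beta>] \<open>(1 - (r / a)^2) > 0\<close> by simp
        qed
        have e2: "a ^ (n - 1) * (r / a) powr (2 * \<nu> + 1) = r ^ (n - 1)"
        proof -
          have "2 * \<nu> + 1 = real (n - 1)" using n by (simp add: \<nu>_def of_nat_diff)
          then have "(r / a) powr (2 * \<nu> + 1) = (r / a) ^ (n - 1)" using True a by (simp add: powr_realpow)
          then show ?thesis using a by (simp add: power_divide)
        qed
        have e3: "w * (r / a)^2 = (pi * r * s)^2" using a by (simp add: w_def power2_eq_square field_simps)
        have "C * ((1 - (r / a)^2) powr \<beta> * (r / a) powr (2 * \<nu> + 1) * clifford \<nu> (w * (r / a)^2))
          = 2 * pi powr (real n / 2) * (a powr (2 * \<beta>) * (1 - (r / a)^2) powr \<beta>) * (a ^ (n - 1) * (r / a) powr (2 * \<nu> + 1)) * clifford \<nu> (w * (r / a)^2)"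
          by (simp add: C_def mult_ac)
        also have "\<dots> = radial_weight n s r * ball_profile \<beta> a r"
          unfolding e1 e2 e3 using True by (simp add: radial_weight_def ball_profile_def \<nu>_def)
        finally show ?thesis using True a by (simp add: indicator_def)
      next
        case False
        then show ?thesis using elim a by (auto simp: indicator_def ball_profile_def field_simps)
      qed
    qed
  qed
  show ?thesis using H unfolding val
    by (subst (asm) has_bochner_integral_cong_AE[OF _ _ AE]) auto
qed

lemma integrable_ball_profile:
  assumes \<beta>: "\<beta> > -1" and a: "a > 0"
  shows "integrable lborel (\<lambda>x :: real ^ 'n. ball_profile \<beta> a (norm x))"
  using has_bochner_integral_radial_ball_profile[OF card_pos[where 'n = 'n] \<beta> a, of 0]
  by (subst integrable_radial_iff) (auto simp: has_bochner_integral_iff)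

section \<open>Poisson summation\<close>

definition ee :: "real \<Rightarrow> complex" where "ee t = cis (2 * pi * t)"

lemma ee_add: "ee (s + t) = ee s * ee t"
  by (simp add: ee_def cis_mult algebra_simps)

lemma ee_0 [simp]: "ee 0 = 1" by (simp add: ee_def)

lemma norm_ee [simp]: "norm (ee t) = 1" by (simp add: ee_def)

lemma ee_int: "t \<in> \<int> \<Longrightarrow> ee t = 1"
  unfolding ee_def using cis_multiple_2pi[of t] by (simp add: mult_ac)

lemma continuous_on_ee [continuous_intros]: "continuous_on A f \<Longrightarrow> continuous_on A (\<lambda>x. ee (f x))"
  unfolding ee_def cis_conv_exp by (intro continuous_intros)

lemma borel_measurable_ee [measurable]: "ee \<in> Borel"
  by (intro borel_measurable_continuous_onI continuous_intros)

section \<open>The integer lattice and its fundamental cube\<close>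

lemma int_lattice_iff: "m \<in> int_lattice \<longleftrightarrow> (\<forall>i. m $ i \<in> \<int>)" by (simp add: int_lattice_def)

lemma int_lattice_0 [simp]: "0 \<in> int_lattice" by (simp add: int_lattice_iff)

lemma int_lattice_add [intro]: "m \<in> int_lattice \<Longrightarrow> k \<in> int_lattice \<Longrightarrow> m + k \<in> int_lattice"
  by (simp add: int_lattice_iff)

lemma int_lattice_minus [simp]: "- m \<in> int_lattice \<longleftrightarrow> m \<in> int_lattice"
  by (simp add: int_lattice_iff)

lemma int_lattice_diff [intro]: "m \<in> int_lattice \<Longrightarrow> k \<in> int_lattice \<Longrightarrow> m - k \<in> int_lattice"
  by (simp add: int_lattice_iff)

lemma int_lattice_inner: "m \<in> int_lattice \<Longrightarrow> k \<in> int_lattice \<Longrightarrow> m \<bullet> k \<in> \<int>"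
  unfolding inner_vec_def int_lattice_iff by (auto intro!: Ints_sum)

lemma countable_int_lattice [simp]: "countable (int_lattice :: (real ^ 'n) set)"
proof -
  have "int_lattice \<subseteq> range (\<lambda>f :: int ^ 'n. (\<chi> i. of_int (f $ i)) :: real ^ 'n)"
  proof
    fix m :: "real ^ 'n" assume m: "m \<in> int_lattice"
    have "m = (\<chi> i. of_int ((\<chi> i. \<lfloor>m $ i\<rfloor>) $ i))"
      using m by (auto simp: vec_eq_iff int_lattice_iff elim!: Ints_cases)
    then show "m \<in> range (\<lambda>f :: int ^ 'n. (\<chi> i. of_int (f $ i)) :: real ^ 'n)" by (rule range_eqI)
  qed
  then show ?thesis by (rule countable_subset) auto
qed

lemma finite_int_lattice_ball: "finite {m \<in> int_lattice :: (real ^ 'n) set. norm m \<le> R}"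
proof -
  let ?A = "PiE (UNIV :: 'n set) (\<lambda>_. {-\<lceil>R\<rceil>..\<lceil>R\<rceil>})"
  have "{m \<in> int_lattice :: (real ^ 'n) set. norm m \<le> R} \<subseteq> (\<lambda>f. \<chi> i. of_int (f i)) ` ?A"
  proof
    fix m :: "real ^ 'n" assume m: "m \<in> {m \<in> int_lattice. norm m \<le> R}"
    have "\<bar>m $ i\<bar> \<le> R" for i using component_le_norm_cart[of m i] m by auto
    then have "\<lfloor>m $ i\<rfloor> \<in> {-\<lceil>R\<rceil>..\<lceil>R\<rceil>}" for i
      using m unfolding int_lattice_iff abs_le_iff
      by (auto elim!: Ints_cases) (smt (verit) Ints_cases floor_of_int int_lattice_iff le_of_int_ceiling of_int_le_iff of_int_minus)+
    moreover have "m = (\<chi> i. of_int \<lfloor>m $ i\<rfloor>)"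
      using m by (auto simp: vec_eq_iff int_lattice_iff elim!: Ints_cases)
    ultimately show "m \<in> (\<lambda>f. \<chi> i. of_int (f i)) ` ?A"
      by (intro image_eqI[of _ _ "\<lambda>i. \<lfloor>m $ i\<rfloor>"]) auto
  qed
  then show ?thesis by (rule finite_subset) (intro finite_imageI finite_PiE; simp)
qed

text \<open>The lattice point whose cube contains x. A ceiling is taken because the cube is open at
  -1/2 and closed at 1/2.\<close>

definition lattice_round :: "real ^ 'n \<Rightarrow> real ^ 'n" where
  "lattice_round x = (\<chi> i. of_int \<lceil>x $ i - 1 / 2\<rceil>)"

lemma torus_round:
  assumes "m \<in> int_lattice"
  shows "x - m \<in> torus \<longleftrightarrow> m = lattice_round x"
proof -
  have ceil: "- 1 / 2 < t - of_int k \<and> t - of_int k \<le> 1 / 2 \<longleftrightarrow> k = \<lceil>t - 1 / 2\<rceil>" for t :: real and k :: int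
  proof -
    have "k = \<lceil>t - 1 / 2\<rceil> \<longleftrightarrow> of_int k - 1 < t - 1 / 2 \<and> t - 1 / 2 \<le> of_int k"
      using ceiling_eq_iff[of "t - 1 / 2" k] by auto
    then show ?thesis by linarith
  qed
  have "- 1 / 2 < x $ i - m $ i \<and> x $ i - m $ i \<le> 1 / 2 \<longleftrightarrow> m $ i = of_int \<lceil>x $ i - 1 / 2\<rceil>" for i
  proof -
    obtain k where k: "m $ i = of_int k" using assms unfolding int_lattice_iff by (auto elim: Ints_cases)
    show ?thesis unfolding k ceil of_int_eq_iff ..
  qed
  then show ?thesis by (auto simp: torus_def lattice_round_def vec_eq_iff)
qed

lemma lattice_round_in [simp]: "lattice_round x \<in> int_lattice"
  by (simp add: lattice_round_def int_lattice_iff)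

lemma sets_torus [measurable]: "(torus :: (real ^ 'n) set) \<in> sets borel"
proof -
  have "(torus :: (real ^ 'n) set) = (\<Inter>i. {x. - 1 / 2 < x $ i} \<inter> {x. x $ i \<le> 1 / 2})"
    by (auto simp: torus_def)
  also have "\<dots> \<in> sets borel"
    by (intro sets.finite_INT sets.Int) (auto intro!: borel_open borel_closed open_halfspace_component_gt_cart closed_halfspace_component_le_cart)
  finally show ?thesis .
qed

lemma norm_torus: "x \<in> torus \<Longrightarrow> norm (x :: real ^ 'n) \<le> real CARD('n)"
proof -
  assume x: "x \<in> torus"
  have "\<bar>x $ i\<bar> \<le> 1" for i
  proof -
    have "- 1 / 2 < x $ i" "x $ i \<le> 1 / 2" using x by (auto simp: torus_def)
    then show ?thesis by linarith
  qed
  then have "(\<Sum>i\<in>UNIV. \<bar>x $ i\<bar>) \<le> (\<Sum>i\<in>(UNIV :: 'n set). 1)" by (intro sum_mono)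
  then show ?thesis using norm_le_l1_cart[of x] by simp
qed

lemma emeasure_torus: "emeasure lborel (torus :: (real ^ 'n) set) = 1"
proof -
  let ?l = "\<chi> i. - 1 / 2 :: real ^ 'n" and ?u = "\<chi> i. 1 / 2 :: real ^ 'n"
  have le: "?l \<bullet> b \<le> ?u \<bullet> b" "(?u - ?l) \<bullet> b = 1" if "b \<in> Basis" for b
    using that by (auto simp: Basis_vec_def inner_axis)
  have 1: "emeasure lborel (box ?l ?u) = 1" using le by (simp add: emeasure_lborel_box)
  have 2: "emeasure lborel (cbox ?l ?u) = 1" using le by (simp add: emeasure_lborel_cbox)
  have "box ?l ?u \<subseteq> torus" "torus \<subseteq> cbox ?l ?u"
    by (auto simp: torus_def mem_box_cart less_imp_le)
  then have "emeasure lborel (box ?l ?u) \<le> emeasure lborel (torus :: (real ^ 'n) set)"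
    "emeasure lborel (torus :: (real ^ 'n) set) \<le> emeasure lborel (cbox ?l ?u)"
    by (auto intro!: emeasure_mono)
  then show ?thesis using 1 2 by simp
qed

text \<open>Lattice sums are written as integrals for counting measure, so that Fubini and dominated
  convergence apply to them as to any integral.\<close>

abbreviation lat :: "(real ^ 'n) measure" where "lat \<equiv> count_space int_lattice"

section \<open>Unfolding integrals over the lattice\<close>

lemma nn_integral_unfold_aux:
  fixes f :: "real ^ 'n \<Rightarrow> ennreal"
  assumes [measurable]: "f \<in> Borel"
  shows "(\<integral>\<^sup>+m. \<integral>\<^sup>+x. f x * indicator torus (x - m) \<partial>lborel \<partial>lat) = (\<integral>\<^sup>+x. f x \<partial>lborel)"
proof -
  have "(\<integral>\<^sup>+m. \<integral>\<^sup>+x. f x * indicator torus (x - m) \<partial>lborel \<partial>lat)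
     = (\<integral>\<^sup>+x. \<integral>\<^sup>+m. f x * indicator torus (x - m) \<partial>lat \<partial>lborel)"
    by (rule nn_integral_count_space_nn_integral[symmetric]) (simp, measurable)
  also have "\<dots> = (\<integral>\<^sup>+x. f x \<partial>lborel)"
  proof (rule nn_integral_cong)
    fix x :: "real ^ 'n"
    have "(\<integral>\<^sup>+m. f x * indicator torus (x - m) \<partial>lat) = (\<integral>\<^sup>+m. f x * indicator {lattice_round x} m \<partial>lat)"
      by (intro nn_integral_cong) (auto simp: indicator_def torus_round)
    also have "\<dots> = f x * emeasure lat {lattice_round x}"
      by (rule nn_integral_cmult_indicator) simp
    also have "\<dots> = f x" by (simp add: emeasure_count_space)
    finally show "(\<integral>\<^sup>+m. f x * indicator torus (x - m) \<partial>lat) = f x" .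
  qed
  finally show ?thesis .
qed

text \<open>The lattice translates of the half-open cube tile the space, so every point is counted
  exactly once.\<close>

lemma nn_integral_unfold:
  fixes f :: "real ^ 'n \<Rightarrow> ennreal"
  assumes [measurable]: "f \<in> Borel"
  shows "(\<integral>\<^sup>+m. \<integral>\<^sup>+x. f (x + m) * indicator torus x \<partial>lborel \<partial>lat) = (\<integral>\<^sup>+x. f x \<partial>lborel)"
proof -
  have "(\<integral>\<^sup>+x. f (x + m) * indicator torus x \<partial>lborel) = (\<integral>\<^sup>+x. f x * indicator torus (x - m) \<partial>lborel)" for m
  proof -
    have "(\<integral>\<^sup>+x. f (x + m) * indicator torus (x + m - m) \<partial>lborel) = (\<integral>\<^sup>+x. f x * indicator torus (x - m) \<partial>lborel)"
      by (rule nn_integral_lborel_translate) measurable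
    then show ?thesis by simp
  qed
  then show ?thesis using nn_integral_unfold_aux[of f] by simp
qed

text \<open>Each value at a lattice point is spread over the unit cube around it and compared there
  with w.\<close>

lemma lattice_sum_le_integral:
  fixes v w :: "real ^ 'n \<Rightarrow> real"
  assumes [measurable]: "w \<in> Borel"
    and le: "\<And>x m. x \<in> torus \<Longrightarrow> m \<in> int_lattice \<Longrightarrow> v m \<le> w (x + m)"
  shows "(\<integral>\<^sup>+m. ennreal (v m) \<partial>lat) \<le> (\<integral>\<^sup>+x. ennreal (w x) \<partial>lborel)"
proof -
  have "(\<integral>\<^sup>+m. ennreal (v m) \<partial>lat) = (\<integral>\<^sup>+m. \<integral>\<^sup>+x. ennreal (v m) * indicator torus x \<partial>(lborel :: (real ^ 'n) measure) \<partial>lat)"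
    by (intro nn_integral_cong) (simp add: nn_integral_cmult_indicator emeasure_torus)
  also have "\<dots> \<le> (\<integral>\<^sup>+m. \<integral>\<^sup>+x. ennreal (w (x + m)) * indicator torus x \<partial>lborel \<partial>lat)"
    by (intro nn_integral_mono) (auto simp: indicator_def intro!: ennreal_leI le)
  also have "\<dots> = (\<integral>\<^sup>+x. ennreal (w x) \<partial>lborel)" by (rule nn_integral_unfold) measurable
  finally show ?thesis .
qed

interpretation lat_lborel: pair_sigma_finite "lat :: (real ^ 'n) measure" "lborel :: (real ^ 'n) measure"
  by (simp add: pair_sigma_finite_def sigma_finite_measure_count_space_countable lborel.sigma_finite_measure_axioms)

lemma lborel_integral_affine:
  fixes f :: "real ^ 'n \<Rightarrow> 'b::{banach, second_countable_topology}"
  assumes [measurable]: "f \<in> Borel" and c: "c \<noteq> 0"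
  shows "(LBINT x. f x) = \<bar>c\<bar> ^ CARD('n) *\<^sub>R (LBINT x. f (t + c *\<^sub>R x))"
proof -
  have "(LBINT x. f x) = (\<integral>x. f x \<partial>density (distr lborel borel (\<lambda>x :: real ^ 'n. t + c *\<^sub>R x)) (\<lambda>_. ennreal (\<bar>c\<bar> ^ DIM(real ^ 'n))))"
    using c by (subst lborel_affine[of c t]) auto
  also have "\<dots> = (\<integral>x. (\<bar>c\<bar> ^ DIM(real ^ 'n)) *\<^sub>R f x \<partial>distr lborel borel (\<lambda>x :: real ^ 'n. t + c *\<^sub>R x))"
    by (rule integral_density) auto
  also have "\<dots> = \<bar>c\<bar> ^ CARD('n) *\<^sub>R (LBINT x. f (t + c *\<^sub>R x))" by (simp add: integral_distr)
  finally show ?thesis .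
qed

lemma lborel_integral_translate:
  fixes f :: "'a::euclidean_space \<Rightarrow> 'b::{banach, second_countable_topology}"
  assumes [measurable]: "f \<in> Borel"
  shows "(LBINT x. f (x + c)) = (LBINT x. f x)"
proof -
  have "(LBINT x. f x) = (\<integral>x. f x \<partial>distr lborel borel ((+) c))"
    by (simp add: lborel_distr_plus)
  also have "\<dots> = (LBINT x. f (c + x))" by (rule integral_distr) auto
  finally show ?thesis by (simp add: add.commute)
qed

text \<open>The same tiling for integrable functions. The nonnegative version, applied to the norm,
  supplies the joint integrability on which both uses of Fubini rest.\<close>

lemma
  fixes F :: "real ^ 'n \<Rightarrow> complex"
  assumes F: "integrable lborel F"
  shows integrable_unfold: "integrable (lat \<Otimes>\<^sub>M lborel) (\<lambda>(m, x). indicator torus x *\<^sub>R F (x + m))"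
    and integral_unfold: "(LBINT x. F x) = (LBINT x. indicator torus x *\<^sub>R (\<integral>m. F (x + m) \<partial>lat))"
proof -
  let ?u = "\<lambda>m x. indicator torus (x - m) *\<^sub>R F x"
  let ?v = "\<lambda>m x. indicator torus x *\<^sub>R F (x + m)"
  have [measurable]: "F \<in> Borel" using F by simp
  have fin: "(\<integral>\<^sup>+x. ennreal (norm (F x)) \<partial>lborel) < \<infinity>"
    using F by (simp add: integrable_iff_bounded)
  have m1: "(\<lambda>(m, x). ?u m x) \<in> borel_measurable (lat \<Otimes>\<^sub>M lborel)"
    by (rule measurable_pair_measure_countable1) (auto simp: split_def)
  have m2: "(\<lambda>(m, x). ?v m x) \<in> borel_measurable (lat \<Otimes>\<^sub>M lborel)"
    by (rule measurable_pair_measure_countable1) (auto simp: split_def)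
  have i1: "integrable (lat \<Otimes>\<^sub>M lborel) (\<lambda>(m, x). ?u m x)"
  proof (rule integrableI_bounded[OF m1])
    have "(\<integral>\<^sup>+p. ennreal (norm (case p of (m, x) \<Rightarrow> ?u m x)) \<partial>(lat \<Otimes>\<^sub>M lborel))
      = (\<integral>\<^sup>+m. \<integral>\<^sup>+x. ennreal (norm (?u m x)) \<partial>lborel \<partial>lat)"
      by (subst lborel.nn_integral_fst[symmetric]) (use m1 in \<open>auto intro: borel_measurable_norm\<close>)
    also have "\<dots> = (\<integral>\<^sup>+m. \<integral>\<^sup>+x. ennreal (norm (F x)) * indicator torus (x - m) \<partial>lborel \<partial>lat)"
      by (intro nn_integral_cong) (auto simp: indicator_def)
    also have "\<dots> = (\<integral>\<^sup>+x. ennreal (norm (F x)) \<partial>lborel)" by (rule nn_integral_unfold_aux) measurable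
    finally show "(\<integral>\<^sup>+p. ennreal (norm (case p of (m, x) \<Rightarrow> ?u m x)) \<partial>(lat \<Otimes>\<^sub>M lborel)) < \<infinity>"
      using fin by simp
  qed
  show i2: "integrable (lat \<Otimes>\<^sub>M lborel) (\<lambda>(m, x). ?v m x)"
  proof (rule integrableI_bounded[OF m2])
    have "(\<integral>\<^sup>+p. ennreal (norm (case p of (m, x) \<Rightarrow> ?v m x)) \<partial>(lat \<Otimes>\<^sub>M lborel))
      = (\<integral>\<^sup>+m. \<integral>\<^sup>+x. ennreal (norm (?v m x)) \<partial>lborel \<partial>lat)"
      by (subst lborel.nn_integral_fst[symmetric]) (use m2 in \<open>auto intro: borel_measurable_norm\<close>)
    also have "\<dots> = (\<integral>\<^sup>+m. \<integral>\<^sup>+x. ennreal (norm (F (x + m))) * indicator torus x \<partial>lborel \<partial>lat)"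
      by (intro nn_integral_cong) (auto simp: indicator_def)
    also have "\<dots> = (\<integral>\<^sup>+x. ennreal (norm (F x)) \<partial>lborel)" by (rule nn_integral_unfold) measurable
    finally show "(\<integral>\<^sup>+p. ennreal (norm (case p of (m, x) \<Rightarrow> ?v m x)) \<partial>(lat \<Otimes>\<^sub>M lborel)) < \<infinity>"
      using fin by simp
  qed
  have "(LBINT x. F x) = (LBINT x. \<integral>m. ?u m x \<partial>lat)"
  proof (rule Bochner_Integration.integral_cong[OF refl])
    fix x :: "real ^ 'n"
    have "(\<integral>m. ?u m x \<partial>lat) = (\<integral>m. indicator {lattice_round x} m *\<^sub>R F x \<partial>lat)"
      by (intro Bochner_Integration.integral_cong) (auto simp: indicator_def torus_round)
    also have "\<dots> = measure lat {lattice_round x} *\<^sub>R F x"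
      by (rule has_bochner_integral_integral_eq[OF has_bochner_integral_indicator]) (auto simp: emeasure_count_space)
    also have "\<dots> = F x" by (simp add: measure_def emeasure_count_space)
    finally show "F x = (\<integral>m. ?u m x \<partial>lat)" by simp
  qed
  also have "\<dots> = (\<integral>m. \<integral>x. ?u m x \<partial>lborel \<partial>lat)"
    using lat_lborel.Fubini_integral[OF i1] by simp
  also have "\<dots> = (\<integral>m. \<integral>x. ?v m x \<partial>lborel \<partial>lat)"
  proof (rule Bochner_Integration.integral_cong[OF refl])
    fix m :: "real ^ 'n"
    have "(LBINT x. indicator torus (x + m - m) *\<^sub>R F (x + m)) = (LBINT x. ?u m x)"
      by (rule lborel_integral_translate) measurable
    then show "(LBINT x. ?u m x) = (LBINT x. ?v m x)" by simp
  qed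
  also have "\<dots> = (LBINT x. \<integral>m. ?v m x \<partial>lat)"
    using lat_lborel.Fubini_integral[OF i2] by simp
  finally show "(LBINT x. F x) = (LBINT x. indicator torus x *\<^sub>R (\<integral>m. F (x + m) \<partial>lat))" by simp
qed

abbreviation torus_integral :: "(real ^ 'n \<Rightarrow> complex) \<Rightarrow> complex" (binder "TINT " 10) where
  "torus_integral f \<equiv> LBINT x. indicator torus x *\<^sub>R f x"

lemma integrable_torus_bounded:
  fixes g :: "real ^ 'n \<Rightarrow> complex"
  assumes [measurable]: "g \<in> Borel" and B: "\<And>x. x \<in> torus \<Longrightarrow> norm (g x) \<le> B"
  shows "integrable lborel (\<lambda>x. indicator torus x *\<^sub>R g x)"
proof (rule Bochner_Integration.integrable_bound[where f = "\<lambda>x. indicator torus x *\<^sub>R B"])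
  show "integrable lborel (\<lambda>x :: real ^ 'n. indicator torus x *\<^sub>R B)"
    by (rule integrable_real_indicator[THEN integrable_scaleR_left]) (auto simp: emeasure_torus)
  show "AE x in lborel. norm (indicator torus x *\<^sub>R g x) \<le> norm (indicator torus x *\<^sub>R B)"
    using B by (intro AE_I2) (force simp: indicator_def)
qed measurable

text \<open>No computation in coordinates: a shift by v with m v = 1/2 changes the sign of the
  character, while the integral of a periodic function over the shifted cube equals that over the
  cube. So the integral is its own negative.\<close>

lemma integral_torus_ee:
  fixes m :: "real ^ 'n"
  assumes m: "m \<in> int_lattice"
  shows "(TINT x. ee (m \<bullet> x)) = (if m = 0 then 1 else 0)"
proof (cases "m = 0")
  case True
  then show ?thesis by (simp add: measure_def emeasure_torus)
next
  case False
  let ?I = "\<integral>x. indicator torus x *\<^sub>R ee (m \<bullet> x) \<partial>lborel"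
  obtain i where i: "m $ i \<noteq> 0" using False by (auto simp: vec_eq_iff)
  define v :: "real ^ 'n" where "v = axis i (1 / (2 * m $ i))"
  have mv: "m \<bullet> v = 1 / 2" using i by (simp add: v_def inner_axis)
  have "ee (1 / 2) = -1" by (simp add: ee_def)
  \<comment> \<open>The character restricted to the shifted cube, which is again a fundamental
    domain; its sum over lattice translates is the character itself.\<close>
  define F where "F x = indicator torus (x - v) *\<^sub>R ee (m \<bullet> x)" for x
  have int0: "integrable lborel (\<lambda>x. indicator torus x *\<^sub>R ee (m \<bullet> (x + v)))"
    by (rule integrable_torus_bounded[where B = 1]) auto
  have [measurable]: "F \<in> Borel" unfolding F_def by measurable
  have "integrable (distr lborel borel ((+) v)) F"
    by (subst integrable_distr_eq) (use int0 in \<open>auto simp: F_def add.commute\<close>)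
  then have int: "integrable lborel F" by (simp add: lborel_distr_plus)
  have "(LBINT x. F x) = (LBINT x. F (x + v))" by (rule lborel_integral_translate[symmetric]) measurable
  also have "\<dots> = - ?I"
    by (simp add: F_def inner_add_right ee_add mv \<open>ee (1 / 2) = -1\<close>)
  finally have 1: "(LBINT x. F x) = - ?I" .
  have "(\<integral>m. F (x + m) \<partial>lat) = ee (m \<bullet> x)" for x
  proof -
    have "(\<integral>k. F (x + k) \<partial>lat) = (\<integral>k. indicator {- lattice_round (x - v)} k *\<^sub>R ee (m \<bullet> x) \<partial>lat)"
    proof (rule Bochner_Integration.integral_cong[OF refl])
      fix k :: "real ^ 'n" assume "k \<in> space lat"
      then have k: "k \<in> int_lattice" by simp
      have "x + k - v \<in> torus \<longleftrightarrow> k = - lattice_round (x - v)"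
        proof -
        have keq: "k = - lattice_round (x - v) \<longleftrightarrow> - k = lattice_round (x - v)" by (metis minus_minus)
        have eq: "x + k - v = x - v - (- k)" by simp
        have "- k \<in> int_lattice" using k by simp
        from torus_round[OF this, of "x - v"] show ?thesis unfolding eq keq .
      qed
      moreover have "ee (m \<bullet> (x + k)) = ee (m \<bullet> x)"
        using ee_int[OF int_lattice_inner[OF m k]] by (simp add: inner_add_right ee_add)
      ultimately show "F (x + k) = indicator {- lattice_round (x - v)} k *\<^sub>R ee (m \<bullet> x)"
        by (simp add: F_def indicator_def)
    qed
    also have "\<dots> = measure lat {- lattice_round (x - v)} *\<^sub>R ee (m \<bullet> x)"
      by (rule has_bochner_integral_integral_eq[OF has_bochner_integral_indicator]) (auto simp: emeasure_count_space)
    also have "\<dots> = ee (m \<bullet> x)" by (simp add: measure_def emeasure_count_space)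
    finally show ?thesis .
  qed
  then have "(LBINT x. F x) = ?I" unfolding integral_unfold[OF int] by simp
  then have "?I = 0" using 1 by simp
  then show ?thesis using False by simp
qed

section \<open>Uniqueness of Fourier coefficients on the torus\<close>

lemma bounded_on_torus:
  fixes g :: "real ^ 'n \<Rightarrow> 'b::real_normed_vector"
  assumes "continuous_on UNIV g"
  shows "\<exists>B. \<forall>x\<in>torus. norm (g x) \<le> B"
proof -
  have "compact (g ` cball 0 (real CARD('n)))"
    by (intro compact_continuous_image continuous_on_subset[OF assms]) auto
  then obtain B where "\<And>y. y \<in> g ` cball 0 (real CARD('n)) \<Longrightarrow> norm y \<le> B"
    by (meson bounded_iff compact_imp_bounded)
  then show ?thesis using norm_torus[where ?'n = 'n] by (intro exI[of _ B]) auto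
qed

text \<open>Q collects the multipliers f for which h f still has only zero coefficients. It contains
  1 and is closed under sums, scalars and multiplication by characters, hence under multiplication
  by trigonometric polynomials; the functions of the claim are peaked at x0.\<close>

lemma torus_poly_orthogonal:
  fixes h :: "real ^ 'n \<Rightarrow> complex"
  assumes h: "continuous_on UNIV h"
    and orth: "\<And>m. m \<in> int_lattice \<Longrightarrow> (TINT x. (h x * ee (m \<bullet> x))) = 0"
  defines "Q \<equiv> {f. continuous_on UNIV f \<and>
    (\<forall>m\<in>int_lattice. (TINT x. (h x * f x * ee (m \<bullet> x))) = 0)}"
  shows "(\<lambda>x. (\<Prod>i\<in>UNIV. (1 + complex_of_real (cos (2 * pi * (x $ i - x0 $ i)))) / 2) ^ N) \<in> Q"
proof -
  let ?c = "\<lambda>i x. (1 + complex_of_real (cos (2 * pi * ((x :: real ^ 'n) $ i - x0 $ i)))) / 2"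
  have int: "integrable lborel (\<lambda>x. indicator torus x *\<^sub>R g x)" if "continuous_on UNIV g" for g :: "real ^ 'n \<Rightarrow> complex"
    using bounded_on_torus[OF that] that by (auto intro!: integrable_torus_bounded borel_measurable_continuous_onI)
  have one: "(\<lambda>x. 1) \<in> Q" using orth by (simp add: Q_def)
  have ch: "continuous_on UNIV (\<lambda>x. h x * f x * ee (m \<bullet> x))" if "continuous_on UNIV f" for f m
    by (intro continuous_intros that h)
  have add: "(\<lambda>x. f x + g x) \<in> Q" if "f \<in> Q" "g \<in> Q" for f g
  proof -
    have "(TINT x. (h x * (f x + g x) * ee (m \<bullet> x))) = 0" if m: "m \<in> int_lattice" for m
    proof -
      have "(TINT x. (h x * (f x + g x) * ee (m \<bullet> x)))
        = (LBINT x. indicator torus x *\<^sub>R (h x * f x * ee (m \<bullet> x)) + indicator torus x *\<^sub>R (h x * g x * ee (m \<bullet> x)))"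
        by (intro Bochner_Integration.integral_cong) (simp_all add: algebra_simps)
      also have "\<dots> = (TINT x. (h x * f x * ee (m \<bullet> x)))
          + (TINT x. (h x * g x * ee (m \<bullet> x)))"
        using \<open>f \<in> Q\<close> \<open>g \<in> Q\<close> by (intro Bochner_Integration.integral_add int ch) (auto simp: Q_def)
      finally show ?thesis using \<open>f \<in> Q\<close> \<open>g \<in> Q\<close> m by (simp add: Q_def)
    qed
    then show ?thesis using that by (auto simp: Q_def intro!: continuous_intros)
  qed
  have scale: "(\<lambda>x. c * f x) \<in> Q" if "f \<in> Q" for f c
  proof -
    have "(TINT x. (h x * (c * f x) * ee (m \<bullet> x))) = 0" if m: "m \<in> int_lattice" for m
    proof -
      have "(TINT x. (h x * (c * f x) * ee (m \<bullet> x)))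
        = (LBINT x. c * (indicator torus x *\<^sub>R (h x * f x * ee (m \<bullet> x))))"
        by (intro Bochner_Integration.integral_cong) (simp_all add: algebra_simps)
      also have "\<dots> = c * (TINT x. (h x * f x * ee (m \<bullet> x)))"
        by (rule integral_mult_right_zero)
      finally show ?thesis using \<open>f \<in> Q\<close> m by (simp add: Q_def)
    qed
    then show ?thesis using that by (auto simp: Q_def intro!: continuous_intros)
  qed
  have shift: "(\<lambda>x. f x * ee (k \<bullet> x)) \<in> Q" if f: "f \<in> Q" and k: "k \<in> int_lattice" for f k
  proof -
    have "(TINT x. (h x * (f x * ee (k \<bullet> x)) * ee (m \<bullet> x))) = 0" if m: "m \<in> int_lattice" for m
    proof -
      have "(TINT x. (h x * f x * ee ((k + m) \<bullet> x))) = 0"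
        using f int_lattice_add[OF k m] by (simp add: Q_def)
      then show ?thesis by (simp add: inner_add_left ee_add mult.assoc)
    qed
    then show ?thesis using f by (auto simp: Q_def intro!: continuous_intros)
  qed
  \<comment> \<open>Euler's formula: (1 + cos)/2 is 1/2 plus a quarter of each of two opposite
    characters.\<close>
  have cosf: "(\<lambda>x. f x * ?c i x) \<in> Q" if f: "f \<in> Q" for f i
  proof -
    let ?u = "axis i 1 :: real ^ 'n"
    let ?e = "\<lambda>x. (ee (- x0 $ i) / 4) * (f x * ee (?u \<bullet> x)) + (ee (x0 $ i) / 4) * (f x * ee (- ?u \<bullet> x))"
    have u: "?u \<in> int_lattice" "- ?u \<in> int_lattice" by (auto simp: int_lattice_iff axis_def)
    have "(\<lambda>x. (1 / 2) * f x + ?e x) \<in> Q"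
      by (intro add scale shift f u)
    also have "(\<lambda>x. (1 / 2) * f x + ?e x)
      = (\<lambda>x. f x * ?c i x)"
    proof
      fix x
      have c: "complex_of_real (cos (2 * pi * t)) = (ee t + ee (- t)) / 2" for t
        by (simp add: ee_def complex_eq_iff)
      have "ee (x $ i - x0 $ i) = ee (- x0 $ i) * ee (?u \<bullet> x)" "ee (- (x $ i - x0 $ i)) = ee (x0 $ i) * ee (- ?u \<bullet> x)"
        by (simp_all add: ee_add[symmetric] inner_axis' inner_minus_left)
      then show "(1 / 2) * f x + ?e x
        = f x * ?c i x"
        unfolding c by (simp add: algebra_simps)
    qed
    finally show ?thesis .
  qed
  have prodf: "(\<lambda>x. f x * (\<Prod>i\<in>S. ?c i x)) \<in> Q" if f: "f \<in> Q" and "finite S" for f S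
    using \<open>finite S\<close>
  proof (induction S rule: finite_induct)
    case empty
    then show ?case using f by simp
  next
    case (insert i S)
    have "(\<lambda>x. (f x * (\<Prod>i\<in>S. ?c i x)) * ?c i x) \<in> Q"
      by (rule cosf[OF insert.IH])
    then show ?case by (simp only: prod.insert[OF insert.hyps] mult_ac)
  qed
  show ?thesis
  proof (induction N)
    case 0
    then show ?case using one by simp
  next
    case (Suc N)
    then show ?case using prodf[OF Suc.IH, of UNIV] by (simp only: power_Suc2 finite_class.finite_UNIV)
  qed
qed

lemma cos_two_pi_abs: "cos (2 * pi * \<bar>t\<bar>) = cos (2 * pi * t)"
proof -
  have "2 * pi * \<bar>t\<bar> = \<bar>2 * pi * t\<bar>" by (simp add: abs_mult)
  then show ?thesis by (simp only: cos_abs_real)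
qed

text \<open>The peak argument: if h(y) \<noteq> 0, the real part g of conj(h(y)) h is positive near
  some point x0, and powers of a trigonometric polynomial T with maximum at x0 concentrate there.
  The integral of g T^N is zero by orthogonality and positive for large N.\<close>

lemma torus_Fourier_unique:
  fixes h :: "real ^ 'n \<Rightarrow> complex"
  assumes h: "continuous_on UNIV h"
    and per: "\<And>x m. m \<in> int_lattice \<Longrightarrow> h (x + m) = h x"
    and orth: "\<And>m. m \<in> int_lattice \<Longrightarrow> (TINT x. (h x * ee (m \<bullet> x))) = 0"
  shows "h x = 0"
proof (rule ccontr)
  assume "h x \<noteq> 0"
  define y where "y = x - lattice_round x"
  have hy: "h y \<noteq> 0" using per[of "- lattice_round x" x] \<open>h x \<noteq> 0\<close> by (simp add: y_def)
  have yt: "y \<in> torus" by (simp add: y_def torus_round)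
  define c where "c = cnj (h y)"
  define g where "g x = Re (c * h x)" for x
  have cg: "continuous_on UNIV g" unfolding g_def by (intro continuous_intros h)
  have gy: "g y > 0" using hy by (simp add: g_def c_def sum_squares_gt_zero_iff complex_eq_iff)
  define l u where "l = (\<chi> i. - 1 / 2 :: real ^ 'n)" and "u = (\<chi> i. 1 / 2 :: real ^ 'n)"
  have "open {x. g x > g y / 2}"
    by (intro open_Collect_less continuous_intros cg)
  moreover have "y \<in> {x. g x > g y / 2}" using gy by simp
  \<comment> \<open>The point y may lie on the boundary of the cube. A nearby interior point x0 at
    which g still exceeds half its value is used in its place.\<close>
  moreover have "y \<in> closure (box l u)"
  proof -
    have "(0 :: real ^ 'n) \<in> box l u" by (simp add: l_def u_def mem_box_cart)
    then have "closure (box l u) = cbox l u" by (intro closure_box) auto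
    then show ?thesis using yt by (auto simp: torus_def mem_box_cart l_def u_def less_imp_le)
  qed
  ultimately obtain x0 where x0: "x0 \<in> box l u" "g x0 > g y / 2"
    by (metis (no_types, lifting) closure_iff_nhds_not_empty disjoint_iff mem_Collect_eq order_refl)
  define e where "e = g y / 2"
  have e: "e > 0" "g x0 > e" using gy x0 by (auto simp: e_def)
  have "open {x. g x > e}" by (intro open_Collect_less continuous_intros cg)
  then obtain r0 where r0: "r0 > 0" "\<And>z. dist z x0 < r0 \<Longrightarrow> g z > e"
    using e(2) by (metis mem_Collect_eq open_dist)
  define n where "n = real CARD('n)"
  have n: "n \<ge> 1" unfolding n_def using zero_less_card_finite[where 'a = 'n] by (simp add: Suc_le_eq)
  have "\<exists>r1>0. \<forall>i. r1 \<le> 1 / 2 - \<bar>x0 $ i\<bar>"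
  proof -
    have "\<bar>x0 $ i\<bar> < 1 / 2" for i
    proof -
      have "- 1 / 2 < x0 $ i" "x0 $ i < 1 / 2" using x0(1) by (auto simp: l_def u_def mem_box_cart)
      then show ?thesis by linarith
    qed
    then show ?thesis
      by (intro exI[of _ "Min (range (\<lambda>i. 1 / 2 - \<bar>x0 $ i\<bar>))"]) (auto simp: Min_gr_iff)
  qed
  then obtain r1 where r1: "r1 > 0" "\<And>i. r1 \<le> 1 / 2 - \<bar>x0 $ i\<bar>" by blast
  \<comment> \<open>r0/(2n): coordinatewise distance below r implies distance below r0, by the l1
    bound of the norm. r1/2: x0 stays so far from the faces that coordinates in the cube never
    differ from it by more than 1 - r.\<close>
  define r where "r = min (r0 / (2 * n)) (r1 / 2)"
  have "r1 \<le> 1 / 2" using r1(2)[of undefined] abs_ge_zero[of "x0 $ undefined"] by linarith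
  moreover have "r \<le> r1 / 2" by (simp add: r_def)
  ultimately have r: "r > 0" "r < 1 / 2" using r0 r1(1) n by (auto simp: r_def)
  have rn: "n * r < r0" using r0 n by (auto simp: r_def min_def field_simps)
  have near: "g z > e" if "\<And>i. \<bar>z $ i - x0 $ i\<bar> < r" for z
  proof -
    have "norm (z - x0) \<le> (\<Sum>i\<in>UNIV. \<bar>(z - x0) $ i\<bar>)" by (rule norm_le_l1_cart)
    also have "\<dots> \<le> (\<Sum>i\<in>(UNIV :: 'n set). r)"
      using that by (intro sum_mono) (simp add: less_imp_le)
    also have "\<dots> < r0" using rn by (simp add: n_def)
    finally show ?thesis using r0(2) by (simp add: dist_norm)
  qed
  define T where "T x = (\<Prod>i\<in>UNIV. (1 + cos (2 * pi * (x $ i - x0 $ i))) / 2)" for x :: "real ^ 'n"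
  let ?h = "\<lambda>N x. h x * complex_of_real (T x ^ N)"
  have f01: "0 \<le> (1 + cos t) / 2" "(1 + cos t) / 2 \<le> 1" for t :: real
  proof -
    have "0 \<le> 1 + cos t" "1 + cos t \<le> 2" using cos_ge_minus_one[of t] cos_le_one[of t] by linarith+
    then show "0 \<le> (1 + cos t) / 2" "(1 + cos t) / 2 \<le> 1" by simp_all
  qed
  have T0: "0 \<le> T x" for x unfolding T_def by (intro prod_nonneg) (use f01 in auto)
  have T1: "T x \<le> 1" for x unfolding T_def by (intro prod_le_1) (use f01 in auto)
  define q where "q = (1 + cos (2 * pi * r)) / 2"
  have q: "0 \<le> q" "q < 1"
  proof -
    show "0 \<le> q" unfolding q_def by (rule f01)
    have "cos (2 * pi * r) < cos 0" using r by (intro cos_monotone_0_pi) auto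
    then show "q < 1" by (simp add: q_def)
  qed
  \<comment> \<open>One coordinate differs from that of x0 by an amount between r and 1 - r. Since
    the cosine is symmetric about half a period, its factor is at most q, and the other factors are
    at most 1.\<close>
  have far: "T z \<le> q" if z: "z \<in> torus" "\<not> (\<forall>i. \<bar>z $ i - x0 $ i\<bar> < r)" for z
  proof -
    obtain i where i: "\<bar>z $ i - x0 $ i\<bar> \<ge> r" using z(2) by (auto simp: not_less)
    have "- 1 / 2 < z $ i" "z $ i \<le> 1 / 2" using z(1) by (auto simp: torus_def)
    then have up: "\<bar>z $ i - x0 $ i\<bar> \<le> 1 - r"
      using r1(2)[of i] r1(1) unfolding r_def by linarith
    define t where "t = \<bar>z $ i - x0 $ i\<bar>"
    have "cos (2 * pi * (z $ i - x0 $ i)) = cos (2 * pi * t)"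
      unfolding t_def by (rule cos_two_pi_abs[symmetric])
    also have "\<dots> \<le> cos (2 * pi * r)"
    proof (cases "t \<le> 1 / 2")
      case True
      then show ?thesis using r i by (intro cos_monotone_0_pi_le) (auto simp: t_def)
    next
      case False
      have "cos (2 * pi * t) = cos (2 * pi * (1 - t))"
        using cos_periodic[of "- (2 * pi * t)"] by (simp add: algebra_simps)
      also have "\<dots> \<le> cos (2 * pi * r)"
        using r up False by (intro cos_monotone_0_pi_le) (auto simp: t_def)
      finally show ?thesis .
    qed
    finally have a: "(1 + cos (2 * pi * (z $ i - x0 $ i))) / 2 \<le> q" by (simp add: q_def)
    have "T z = ((1 + cos (2 * pi * (z $ i - x0 $ i))) / 2) * (\<Prod>j\<in>UNIV - {i}. (1 + cos (2 * pi * (z $ j - x0 $ j))) / 2)"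
      unfolding T_def by (rule prod.remove) auto
    also have "\<dots> \<le> q * 1"
      by (intro mult_mono a prod_le_1 prod_nonneg) (use f01 q in auto)
    finally show ?thesis by simp
  qed
  \<comment> \<open>A smaller cube on which T is bounded below by p > q: at x0 the function T equals
    1, which exceeds q.\<close>
  obtain \<rho> where \<rho>: "0 < \<rho>" "\<rho> < r" "((1 + cos (2 * pi * \<rho>)) / 2) ^ CARD('n) > q"
  proof -
    have "isCont (\<lambda>s. ((1 + cos (2 * pi * s)) / 2) ^ CARD('n)) 0" by (intro continuous_intros) auto
    then have "((\<lambda>s. ((1 + cos (2 * pi * s)) / 2) ^ CARD('n)) \<longlongrightarrow> 1) (at_right 0)"
      unfolding isCont_def by (simp add: filterlim_at_split)
    then have "eventually (\<lambda>s. ((1 + cos (2 * pi * s)) / 2) ^ CARD('n) > q) (at_right 0)"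
      using q by (intro order_tendstoD)
    moreover have "eventually (\<lambda>s. s < r) (at_right 0)" using r by (simp add: eventually_at_right_less eventually_at_right_field) (use r in blast)
    moreover have "eventually (\<lambda>s. 0 < s) (at_right (0::real))" by (rule eventually_at_right_less)
    ultimately have "eventually (\<lambda>s. 0 < s \<and> s < r \<and> ((1 + cos (2 * pi * s)) / 2) ^ CARD('n) > q) (at_right 0)"
      by eventually_elim auto
    then obtain s where "0 < s \<and> s < r \<and> ((1 + cos (2 * pi * s)) / 2) ^ CARD('n) > q"
      using eventually_happens[of _ "at_right (0::real)"] by auto
    then show ?thesis using that by blast
  qed
  define p where "p = ((1 + cos (2 * pi * \<rho>)) / 2) ^ CARD('n)"
  have p: "p > q" "p > 0" using \<rho> q by (auto simp: p_def)
  define U where "U = box (x0 - (\<chi> i. \<rho>)) (x0 + (\<chi> i. \<rho>))"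
  have U: "z \<in> U \<longleftrightarrow> (\<forall>i. \<bar>z $ i - x0 $ i\<bar> < \<rho>)" for z
    unfolding U_def mem_box_cart by (auto simp: abs_less_iff) (smt (verit))+
  have [measurable]: "U \<in> sets borel" by (simp add: U_def)
  have UT: "p \<le> T z" if "z \<in> U" for z
  proof -
    have "(1 + cos (2 * pi * \<rho>)) / 2 \<le> (1 + cos (2 * pi * (z $ i - x0 $ i))) / 2" for i
    proof -
      define t where "t = \<bar>z $ i - x0 $ i\<bar>"
      have "cos (2 * pi * (z $ i - x0 $ i)) = cos (2 * pi * t)"
        unfolding t_def by (rule cos_two_pi_abs[symmetric])
      moreover have "cos (2 * pi * \<rho>) \<le> cos (2 * pi * t)"
        using that \<rho> r unfolding U t_def by (intro cos_monotone_0_pi_le) (auto simp: less_imp_le)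
      ultimately show ?thesis by simp
    qed
    then have "(\<Prod>i\<in>(UNIV :: 'n set). (1 + cos (2 * pi * \<rho>)) / 2) \<le> T z"
      unfolding T_def by (intro prod_mono) (use f01 in auto)
    then show ?thesis by (simp add: p_def)
  qed
  have Ut: "U \<subseteq> torus"
  proof
    fix z assume z: "z \<in> U"
    have "- 1 / 2 < z $ i \<and> z $ i \<le> 1 / 2" for i
    proof -
      have "\<bar>z $ i - x0 $ i\<bar> < \<rho>" using z by (simp add: U)
      then show ?thesis using r1(2)[of i] \<rho>(2) r1(1) unfolding r_def by linarith
    qed
    then show "z \<in> torus" by (simp add: torus_def)
  qed
  define V where "V = measure lborel U"
  have V: "V > 0" and Vf: "emeasure lborel U < \<infinity>"
  proof -
    show "emeasure lborel U < \<infinity>" unfolding U_def by (rule emeasure_lborel_box_finite)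
    have c: "((x0 + (\<chi> i. \<rho>)) - (x0 - (\<chi> i. \<rho>))) \<bullet> b = 2 * \<rho>" if "b \<in> Basis" for b
      using that by (auto simp: Basis_vec_def inner_axis)
    have "(x0 - (\<chi> i. \<rho>)) \<bullet> b \<le> (x0 + (\<chi> i. \<rho>)) \<bullet> b" if "b \<in> Basis" for b
      using c[OF that] \<rho>(1) unfolding inner_diff_left[of "x0 + (\<chi> i. \<rho>)"] by linarith
    then have "measure lborel U = (\<Prod>b\<in>Basis. ((x0 + (\<chi> i. \<rho>)) - (x0 - (\<chi> i. \<rho>))) \<bullet> b)"
      unfolding U_def by (subst measure_lborel_box_eq) auto
    also have "\<dots> > 0" using c \<rho>(1) by (intro prod_pos) auto
    finally have "measure lborel U > 0" .
    then show "V > 0" by (simp add: V_def)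
  qed
  obtain B where B: "\<And>x. x \<in> torus \<Longrightarrow> \<bar>g x\<bar> \<le> B"
    using bounded_on_torus[OF cg] by auto
  have cT: "continuous_on UNIV T" unfolding T_def by (intro continuous_intros) auto
  have [measurable]: "T \<in> Borel" "g \<in> Borel"
    using cT cg by (auto intro: borel_measurable_continuous_onI)
  have zero: "(LBINT x. indicator torus x * (g x * T x ^ N)) = 0" for N
  proof -
    obtain C where C: "\<And>x. x \<in> torus \<Longrightarrow> norm (h x) \<le> C"
      using bounded_on_torus[OF h] by auto
    have int: "integrable lborel (\<lambda>x. indicator torus x *\<^sub>R (?h N x))"
    proof (rule integrable_torus_bounded)
      have "continuous_on UNIV (\<lambda>x. ?h N x)" by (intro continuous_intros h cT)
      then show "(\<lambda>x. ?h N x) \<in> Borel" by (rule borel_measurable_continuous_onI)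
      fix x :: "real ^ 'n" assume x: "x \<in> torus"
      have "norm (h x) \<le> C" by (rule C[OF x])
      moreover have "T x ^ N \<le> 1" "0 \<le> T x ^ N" using T0 T1 by (auto intro: power_le_one)
      ultimately show "norm (?h N x) \<le> C * 1"
        unfolding norm_mult norm_of_real by (intro mult_mono) (auto intro: order_trans[OF norm_ge_zero])
    qed
    have Teq: "(\<lambda>x. complex_of_real (T x ^ N)) = (\<lambda>x. (\<Prod>i\<in>UNIV. (1 + complex_of_real (cos (2 * pi * (x $ i - x0 $ i)))) / 2) ^ N)"
      by (simp add: T_def)
    have "(\<lambda>x. complex_of_real (T x ^ N)) \<in> {f. continuous_on UNIV f \<and>
      (\<forall>m\<in>int_lattice. (TINT x. (h x * f x * ee (m \<bullet> x))) = 0)}"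
      unfolding Teq by (rule torus_poly_orthogonal[OF h orth])
    then have "\<forall>m\<in>int_lattice. (TINT x. (?h N x * ee (m \<bullet> x))) = 0"
      unfolding mem_Collect_eq by (rule conjunct2)
    from bspec[OF this int_lattice_0]
    have "(TINT x. (?h N x * ee (0 \<bullet> x))) = 0" .
    then have z: "(TINT x. (?h N x)) = 0" by simp
    have "(LBINT x. indicator torus x * (g x * T x ^ N)) = (LBINT x. Re (c * (indicator torus x *\<^sub>R (?h N x))))"
      by (intro Bochner_Integration.integral_cong) (auto simp: g_def algebra_simps)
    also have "\<dots> = Re (LBINT x. c * (indicator torus x *\<^sub>R (?h N x)))"
      by (rule integral_Re) (intro integrable_mult_right int)
    also have "\<dots> = 0" unfolding integral_mult_right_zero z by simp
    finally show ?thesis .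
  qed
  \<comment> \<open>Inside the cube of radius r the integrand is nonnegative and at least e p^N on
    U; elsewhere it is at least -|B| q^N. Integration over the torus, whose volume is 1, gives the
    claim.\<close>
  have lower: "e * p ^ N * V - \<bar>B\<bar> * q ^ N \<le> 0" for N
  proof -
    have "(LBINT x. e * p ^ N * indicator U x - \<bar>B\<bar> * q ^ N * indicator torus x) \<le> (LBINT x. indicator torus x * (g x * T x ^ N))"
    proof (rule integral_mono)
      show "integrable lborel (\<lambda>x. e * p ^ N * indicator U x - \<bar>B\<bar> * q ^ N * indicator torus x)"
        using Vf by (intro Bochner_Integration.integrable_diff integrable_mult_right integrable_real_indicator) (auto simp: emeasure_torus)
      have "integrable lborel (\<lambda>x. indicator torus x *\<^sub>R (g x * T x ^ N))"
      proof (rule Bochner_Integration.integrable_bound[where f = "\<lambda>x. indicator torus x *\<^sub>R B"])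
        show "integrable lborel (\<lambda>x :: real ^ 'n. indicator torus x *\<^sub>R B)"
          by (rule integrable_real_indicator[THEN integrable_scaleR_left]) (auto simp: emeasure_torus)
        have "\<bar>g x\<bar> * T x ^ N \<le> \<bar>B\<bar> * 1" if "x \<in> torus" for x
          using B[OF that] T0[of x] T1[of x] by (intro mult_mono) (auto intro: power_le_one)
        then show "AE x in lborel. norm (indicator torus x *\<^sub>R (g x * T x ^ N)) \<le> norm (indicator torus x *\<^sub>R B)"
          by (intro AE_I2) (auto simp: indicator_def abs_mult T0)
      qed measurable
      then show "integrable lborel (\<lambda>x. indicator torus x * (g x * T x ^ N))" by simp
      fix z :: "real ^ 'n"
      show "e * p ^ N * indicator U z - \<bar>B\<bar> * q ^ N * indicator torus z \<le> indicator torus z * (g z * T z ^ N)"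
      proof (cases "z \<in> torus")
        case False
        then have "z \<notin> U" using Ut by auto
        then show ?thesis using False by simp
      next
        case zt: True
        have Bq: "\<bar>B\<bar> * q ^ N \<ge> 0" using q by simp
        show ?thesis
        proof (cases "\<forall>i. \<bar>z $ i - x0 $ i\<bar> < r")
          case True
          then have gz: "g z > e" by (intro near) auto
          have "e * (p ^ N * indicator U z) \<le> g z * T z ^ N"
          proof (rule mult_mono)
            show "p ^ N * indicator U z \<le> T z ^ N"
              using UT[of z] p T0[of z] by (auto simp: indicator_def intro: power_mono)
          qed (use gz e p in auto)
          then show ?thesis using Bq zt by simp
        next
          case False
          then have "z \<notin> U" using \<rho>(2) unfolding U by (meson less_trans)
          have "- (\<bar>B\<bar> * q ^ N) \<le> - (\<bar>g z\<bar> * T z ^ N)"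
            using far[OF zt False] B[OF zt] T0[of z] by (simp, intro mult_mono power_mono) auto
          also have "\<dots> \<le> g z * T z ^ N"
            using T0[of z] mult_right_mono[of "- \<bar>g z\<bar>" "g z" "T z ^ N"] by simp
          finally show ?thesis using \<open>z \<notin> U\<close> zt by simp
        qed
      qed
    qed
    moreover have "(LBINT x. e * p ^ N * indicator U x - \<bar>B\<bar> * q ^ N * indicator torus x)
      = e * p ^ N * V - \<bar>B\<bar> * q ^ N"
      using Vf by (subst Bochner_Integration.integral_diff) (auto simp: V_def measure_def emeasure_torus intro!: integrable_mult_right integrable_real_indicator)
    ultimately show ?thesis unfolding zero by simp
  qed
  \<comment> \<open>After division by p^N the bound \<open>lower\<close> says e V <= |B| (q/p)^N,
    which fails for large N.\<close>
  have "(\<lambda>N. \<bar>B\<bar> * (q / p) ^ N) \<longlonglongrightarrow> \<bar>B\<bar> * 0"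
    using p q by (intro tendsto_intros LIMSEQ_realpow_zero) auto
  moreover have "e * V > 0" using e V by simp
  ultimately have "eventually (\<lambda>N. \<bar>B\<bar> * (q / p) ^ N < e * V) sequentially"
    by (intro order_tendstoD) auto
  then obtain N where N: "\<bar>B\<bar> * (q / p) ^ N < e * V" by (auto simp: eventually_sequentially)
  then have "\<bar>B\<bar> * q ^ N < e * V * p ^ N" using p by (simp add: power_divide field_simps)
  then show False using lower[of N] by (simp add: mult_ac)
qed

section \<open>Functions of polynomial decay\<close>

definition decay :: "real \<Rightarrow> real ^ 'n \<Rightarrow> real" where
  "decay M x = (1 + norm x) powr (- M)"

lemma decay_pos [simp]: "decay M x > 0"
proof -
  have "1 + norm x > 0" by (simp add: add_pos_nonneg)
  then show ?thesis by (simp add: decay_def)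
qed

lemma decay_nonneg [simp]: "decay M x \<ge> 0" by (simp add: less_imp_le)

lemma borel_measurable_decay [measurable]: "decay M \<in> Borel"
  unfolding decay_def by measurable

lemma decay_shift:
  assumes M: "M \<ge> 0"
  shows "decay M x \<le> (1 + norm y) powr M * decay M (x + y)"
proof -
  have "1 + norm (x + y) \<le> 1 + norm x + norm y" using norm_triangle_ineq[of x y] by simp
  also have "\<dots> \<le> (1 + norm x) * (1 + norm y)" by (simp add: algebra_simps)
  finally have "(1 + norm (x + y)) powr M \<le> ((1 + norm x) * (1 + norm y)) powr M"
    using M by (intro powr_mono2) auto
  also have "\<dots> = (1 + norm x) powr M * (1 + norm y) powr M" by (intro powr_mult)
  finally have le: "(1 + norm (x + y)) powr M \<le> (1 + norm x) powr M * (1 + norm y) powr M" .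
  have "1 + norm x > 0" "1 + norm (x + y) > 0" by (simp_all add: add_pos_nonneg)
  then have "(1 + norm x) powr M > 0" "(1 + norm (x + y)) powr M > 0" by simp_all
  then show ?thesis using le
    unfolding decay_def powr_minus by (simp add: divide_simps mult.commute)
qed

lemma nn_integral_half_line_decay:
  assumes "p > 1"
  shows "(\<integral>\<^sup>+r. ennreal ((1 + r) powr (- p)) * indicator {0..} r \<partial>lborel) = ennreal (1 / (p - 1))"
proof -
  have "(\<integral>\<^sup>+r. ennreal ((1 + r) powr (- p)) * indicator {0..} r \<partial>lborel) = ennreal (0 - (- ((1 + 0) powr (1 - p)) / (p - 1)))"
  proof (rule nn_integral_FTC_atLeast[where F = "\<lambda>r. - ((1 + r) powr (1 - p)) / (p - 1)"])
    fix r :: real assume r: "0 \<le> r"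
    have "((\<lambda>r. (1 + r) powr (1 - p)) has_real_derivative (1 - p) * (1 + r) powr (1 - p - 1) * 1) (at r)"
      using r by (intro has_real_derivative_powr[THEN DERIV_chain2]) (auto intro!: derivative_eq_intros)
    then have "((\<lambda>r. - ((1 + r) powr (1 - p)) / (p - 1)) has_real_derivative - ((1 - p) * (1 + r) powr (1 - p - 1) * 1) / (p - 1)) (at r)"
      by (intro DERIV_cdivide DERIV_minus)
    moreover have "- ((1 - p) * (1 + r) powr (1 - p - 1) * 1) / (p - 1) = (1 + r) powr (- p)"
      using assms by (simp add: field_simps)
    ultimately show "((\<lambda>r. - ((1 + r) powr (1 - p)) / (p - 1)) has_real_derivative (1 + r) powr (- p)) (at r)" by simp
  next
    have "filterlim (\<lambda>r::real. 1 + r) at_top at_top" by (intro filterlim_tendsto_add_at_top[OF tendsto_const] filterlim_ident)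
    then have "((\<lambda>r::real. (1 + r) powr (1 - p)) \<longlongrightarrow> 0) at_top"
      using assms by (intro tendsto_neg_powr) auto
    from tendsto_divide[OF tendsto_minus[OF this] tendsto_const[of "p - 1"]]
    show "((\<lambda>r. - ((1 + r) powr (1 - p)) / (p - 1)) \<longlongrightarrow> 0) at_top" using assms by simp
  qed auto
  then show ?thesis by simp
qed

lemma integrable_decay:
  assumes "M > real CARD('n)"
  shows "integrable lborel (decay M :: real ^ 'n \<Rightarrow> real)"
proof -
  define n where "n = CARD('n)"
  have n: "n \<ge> 1" unfolding n_def using zero_less_card_finite[where 'a = 'n] by (simp add: Suc_le_eq)
  define c where "c = 2 * pi powr (real n / 2) * rGamma (real n / 2)"
  have c: "c > 0" using n rGamma_real_pos[of "real n / 2"] by (simp add: c_def)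
  define p where "p = M - real (n - 1)"
  have p: "p > 1" using assms n by (simp add: p_def n_def of_nat_diff)
  have int: "integrable lborel (\<lambda>r. c * ((1 + r) powr (- p) * indicator {0..} r))"
  proof (rule integrable_mult_right, rule integrableI_nonneg)
    have "(\<integral>\<^sup>+ r. ennreal ((1 + r) powr (- p) * indicator {0..} r) \<partial>lborel) = ennreal (1 / (p - 1))"
      unfolding nn_integral_half_line_decay[OF p, symmetric]
      by (intro nn_integral_cong) (auto simp: indicator_def)
    then show "(\<integral>\<^sup>+ r. ennreal ((1 + r) powr (- p) * indicator {0..} r) \<partial>lborel) < \<infinity>" by simp
  qed auto
  have "integrable lborel (\<lambda>r. indicator {0..} r * (radial_weight n 0 r * (1 + r) powr (- M)))"
  proof (rule Bochner_Integration.integrable_bound[OF int])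
    show "AE r in lborel. norm (indicator {0..} r * (radial_weight n 0 r * (1 + r) powr (- M))) \<le> norm (c * ((1 + r) powr (- p) * indicator {0..} r))"
    proof (rule AE_I2)
      fix r :: real
      show "norm (indicator {0..} r * (radial_weight n 0 r * (1 + r) powr (- M))) \<le> norm (c * ((1 + r) powr (- p) * indicator {0..} r))"
      proof (cases "r \<ge> 0")
        case True
        have "r ^ (n - 1) \<le> (1 + r) ^ (n - 1)" using True by (intro power_mono) auto
        also have "\<dots> = (1 + r) powr real (n - 1)" using True by (simp add: powr_realpow)
        finally have "r ^ (n - 1) * (1 + r) powr (- M) \<le> (1 + r) powr real (n - 1) * (1 + r) powr (- M)"
          by (intro mult_right_mono) auto
        also have "\<dots> = (1 + r) powr (- p)" by (simp add: powr_add[symmetric] p_def)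
        finally have "c * (r ^ (n - 1) * (1 + r) powr (- M)) \<le> c * (1 + r) powr (- p)" using c by (intro mult_left_mono) auto
        then show ?thesis using True c rGamma_real_pos[of "real n / 2"] n by (simp add: radial_weight_0 c_def abs_mult mult.assoc)
      qed simp
    qed
  qed measurable
  then show ?thesis unfolding decay_def n_def by (subst integrable_radial_iff) auto
qed

lemma nn_integral_lat_decay:
  assumes M: "M > real CARD('n)"
  shows "(\<integral>\<^sup>+m. ennreal (decay M (m :: real ^ 'n)) \<partial>lat) < \<infinity>"
proof -
  define K where "K = (1 + real CARD('n)) powr M"
  have "(\<integral>\<^sup>+m. ennreal (decay M (m :: real ^ 'n)) \<partial>lat) \<le> (\<integral>\<^sup>+x. ennreal (K * decay M (x :: real ^ 'n)) \<partial>lborel)"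
  proof (rule lattice_sum_le_integral)
    fix x m :: "real ^ 'n" assume x: "x \<in> torus"
    have "decay M m \<le> (1 + norm x) powr M * decay M (m + x)" using M by (intro decay_shift) auto
    also have "\<dots> \<le> K * decay M (x + m)"
      unfolding K_def add.commute[of m x] using norm_torus[OF x] M by (intro mult_right_mono powr_mono2) auto
    finally show "decay M m \<le> K * decay M (x + m)" .
  qed measurable
  also have "\<dots> < \<infinity>"
  proof -
    have e: "K * decay M (x :: real ^ 'n) = norm (K * decay M x)" for x by (simp add: K_def)
    have "integrable lborel (\<lambda>x :: real ^ 'n. K * decay M x)"
      by (rule integrable_mult_right[OF integrable_decay[OF M]])
    then show ?thesis unfolding integrable_iff_bounded by (subst e) blast
  qed
  finally show ?thesis .
qed

lemma integrable_lat_decay: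
  fixes x :: "real ^ 'n"
  assumes M: "M > real CARD('n)"
  shows "integrable lat (\<lambda>m. decay M (x + m))"
proof (rule Bochner_Integration.integrable_bound)
  show "integrable lat (\<lambda>m :: real ^ 'n. (1 + norm x) powr M * decay M m)"
    using nn_integral_lat_decay[OF M] by (intro integrable_mult_right integrableI_nonneg) auto
  show "AE m in lat. norm (decay M (x + m)) \<le> norm ((1 + norm x) powr M * decay M m)"
  proof (rule AE_I2)
    fix m :: "real ^ 'n"
    have "decay M (x + m) \<le> (1 + norm (- x)) powr M * decay M (x + m + - x)" using M by (intro decay_shift) auto
    then show "norm (decay M (x + m)) \<le> norm ((1 + norm x) powr M * decay M m)" by simp
  qed
qed simp

text \<open>The transform over the Borel measure \<open>lborel\<close>, where product measures and
  Fubini are at hand. The passage to \<open>fourier_transform\<close>, an integral over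
  \<open>lebesgue\<close>, is left to the end.\<close>

definition four :: "(real ^ 'n \<Rightarrow> complex) \<Rightarrow> real ^ 'n \<Rightarrow> complex" where
  "four F \<xi> = (LBINT x. F x * ee (- (\<xi> \<bullet> x)))"

lemma integrable_decay_bound:
  fixes F :: "real ^ 'n \<Rightarrow> complex"
  assumes M: "M > real CARD('n)" and [measurable]: "F \<in> Borel"
    and b: "\<And>x. norm (F x) \<le> K * decay M x"
  shows "integrable lborel F"
proof (rule Bochner_Integration.integrable_bound)
  show "integrable lborel (\<lambda>x :: real ^ 'n. K * decay M x)" by (intro integrable_mult_right integrable_decay M)
  show "AE x in lborel. norm (F x) \<le> norm (K * decay M x)"
    using b by (intro AE_I2) (force intro: order_trans[OF b])
qed measurable

lemma integrable_times_ee: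
  fixes F :: "real ^ 'n \<Rightarrow> complex"
  assumes "integrable lborel F" and [measurable]: "g \<in> Borel"
  shows "integrable lborel (\<lambda>x. F x * ee (g x))"
proof (rule Bochner_Integration.integrable_bound[OF assms(1)])
  have [measurable]: "F \<in> Borel" using assms(1) by simp
  show "(\<lambda>x. F x * ee (g x)) \<in> borel_measurable lborel" by measurable
qed (simp add: norm_mult)

lemma integrable_lat_bound:
  fixes F :: "real ^ 'n \<Rightarrow> complex"
  assumes M: "M > real CARD('n)" and b: "\<And>x. norm (F x) \<le> K * decay M x"
  shows "integrable lat (\<lambda>m. F (x + m) * ee (g m))"
proof (rule Bochner_Integration.integrable_bound)
  show "integrable lat (\<lambda>m :: real ^ 'n. K * decay M (x + m))" by (intro integrable_mult_right integrable_lat_decay M)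
  show "AE m in lat. norm (F (x + m) * ee (g m)) \<le> norm (K * decay M (x + m))"
    using b by (intro AE_I2) (force simp: norm_mult intro: order_trans[OF b])
qed simp

lemma continuous_on_lat_sum:
  fixes F :: "real ^ 'n \<Rightarrow> complex"
  assumes M: "M > real CARD('n)" and b: "\<And>x. norm (F x) \<le> K * decay M x" and c: "continuous_on UNIV F"
  shows "continuous_on UNIV (\<lambda>x. \<integral>m. F (x + m) \<partial>lat)"
proof (rule continuous_on_sequentiallyI)
  fix u :: "nat \<Rightarrow> real ^ 'n" and a assume u: "u \<longlonglongrightarrow> a"
  then have "Bseq u" by (intro convergent_imp_Bseq convergentI)
  then obtain R where R: "R > 0" "\<And>k. norm (u k) \<le> R" by (auto simp: Bseq_def)
  have K: "K \<ge> 0"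
    using b[of 0] norm_ge_zero[of "F 0"] by (smt (verit) decay_pos mult_neg_pos)
  show "(\<lambda>k. \<integral>m. F (u k + m) \<partial>lat) \<longlonglongrightarrow> (\<integral>m. F (a + m) \<partial>lat)"
  proof (rule integral_dominated_convergence)
    show "integrable lat (\<lambda>m :: real ^ 'n. K * ((1 + R) powr M * decay M (0 + m)))"
      by (intro integrable_mult_right integrable_lat_decay M)
    show "AE m in lat. (\<lambda>k. F (u k + m)) \<longlonglongrightarrow> F (a + m)"
    proof (rule AE_I2)
      fix m :: "real ^ 'n"
      have "isCont F (a + m)" using c by (simp add: continuous_on_eq_continuous_at)
      then show "(\<lambda>k. F (u k + m)) \<longlonglongrightarrow> F (a + m)"
        by (rule isCont_tendsto_compose) (intro tendsto_intros u)
    qed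
    fix k
    show "AE m in lat. norm (F (u k + m)) \<le> K * ((1 + R) powr M * decay M (0 + m))"
    proof (rule AE_I2)
      fix m :: "real ^ 'n"
      have "norm (F (u k + m)) \<le> K * decay M (u k + m)" by (rule b)
      also have "\<dots> \<le> K * ((1 + norm (- u k)) powr M * decay M (u k + m + - u k))"
        using M K by (intro mult_left_mono decay_shift) auto
      also have "\<dots> \<le> K * ((1 + R) powr M * decay M (0 + m))"
        using K M R(2)[of k] by (intro mult_left_mono mult_mono powr_mono2) auto
      finally show "norm (F (u k + m)) \<le> K * ((1 + R) powr M * decay M (0 + m))" .
    qed
  qed auto
qed

section \<open>Poisson summation and Fourier inversion\<close>

lemma lat_sum_periodic:
  fixes G :: "real ^ 'n \<Rightarrow> complex"
  assumes k: "k \<in> int_lattice"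
  shows "(\<integral>m. G (m + k) \<partial>lat) = (\<integral>m. G m \<partial>lat)"
proof (rule integral_bij_count_space)
  show "bij_betw (\<lambda>m. m + k) int_lattice int_lattice"
    by (rule bij_betwI[where g = "\<lambda>m. m - k"]) (use k in auto)
qed

lemma measurable_lat_pair:
  assumes "\<And>m :: real ^ 'n. m \<in> int_lattice \<Longrightarrow> (\<lambda>x. f (m, x)) \<in> Borel"
  shows "f \<in> borel_measurable (lat \<Otimes>\<^sub>M lborel)"
  by (rule measurable_pair_measure_countable1) (use assms in auto)

lemma integrable_lat_torus:
  fixes f :: "real ^ 'n \<Rightarrow> real ^ 'n \<Rightarrow> complex"
  assumes meas: "\<And>m. m \<in> int_lattice \<Longrightarrow> f m \<in> Borel"
    and b: "\<And>m x. m \<in> int_lattice \<Longrightarrow> x \<in> torus \<Longrightarrow> norm (f m x) \<le> w m"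
    and w: "integrable lat w"
  shows "integrable (lat \<Otimes>\<^sub>M lborel) (\<lambda>(m, x). indicator torus x *\<^sub>R f m x)"
proof (rule integrableI_bounded)
  show m: "(\<lambda>(m, x). indicator torus x *\<^sub>R f m x) \<in> borel_measurable (lat \<Otimes>\<^sub>M lborel)"
    by (rule measurable_lat_pair) (use meas in simp)
  have "(\<integral>\<^sup>+p. ennreal (norm (case p of (m, x) \<Rightarrow> indicator torus x *\<^sub>R f m x)) \<partial>(lat \<Otimes>\<^sub>M lborel))
      = (\<integral>\<^sup>+m. \<integral>\<^sup>+x. ennreal (norm (indicator torus x *\<^sub>R f m x)) \<partial>lborel \<partial>lat)"
    by (subst lborel.nn_integral_fst[symmetric]) (use m in \<open>auto intro: borel_measurable_norm\<close>)
  also have "\<dots> \<le> (\<integral>\<^sup>+m. \<integral>\<^sup>+x. ennreal (norm (w m)) * indicator torus x \<partial>(lborel :: (real ^ 'n) measure) \<partial>lat)"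
    using b by (intro nn_integral_mono) (force simp: indicator_def intro!: ennreal_leI intro: order_trans[OF b])
  also have "\<dots> = (\<integral>\<^sup>+m. ennreal (norm (w m)) \<partial>lat)"
    by (intro nn_integral_cong) (simp add: nn_integral_cmult_indicator emeasure_torus)
  also have "\<dots> < \<infinity>" using w by (simp add: integrable_iff_bounded)
  finally show "(\<integral>\<^sup>+p. ennreal (norm (case p of (m, x) \<Rightarrow> indicator torus x *\<^sub>R f m x)) \<partial>(lat \<Otimes>\<^sub>M lborel)) < \<infinity>" .
qed

text \<open>Both sides are continuous periodic functions of x with the same Fourier coefficients, so
  uniqueness on the torus identifies them at every point and not merely almost everywhere.\<close>

theorem Poisson_summation:
  fixes F :: "real ^ 'n \<Rightarrow> complex"
  assumes M: "M > real CARD('n)" and b: "\<And>x. norm (F x) \<le> K * decay M x" and c: "continuous_on UNIV F"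
    and four: "integrable lat (four F)"
  shows "(\<integral>m. F (x + m) \<partial>lat) = (\<integral>m. four F m * ee (m \<bullet> x) \<partial>lat)"
proof -
  have [measurable]: "F \<in> Borel" using c by (rule borel_measurable_continuous_onI)
  define P where "P x = (\<integral>m. F (x + m) \<partial>lat)" for x
  define S where "S x = (\<integral>m. four F m * ee (m \<bullet> x) \<partial>lat)" for x
  have nint: "integrable lat (\<lambda>m. norm (four F m))" using four by (rule integrable_norm)
  have cP: "continuous_on UNIV P" unfolding P_def by (rule continuous_on_lat_sum[OF M b c])
  have cS: "continuous_on UNIV S"
  proof (rule continuous_on_sequentiallyI)
    fix u :: "nat \<Rightarrow> real ^ 'n" and a assume u: "u \<longlonglongrightarrow> a"
    show "(\<lambda>k. S (u k)) \<longlonglongrightarrow> S a"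
      unfolding S_def
    proof (rule integral_dominated_convergence[OF _ _ nint])
      show "AE m in lat. (\<lambda>k. four F m * ee (m \<bullet> u k)) \<longlonglongrightarrow> four F m * ee (m \<bullet> a)"
      proof (rule AE_I2)
        fix m :: "real ^ 'n"
        have "continuous_on UNIV (\<lambda>x. four F m * ee (m \<bullet> x))" by (intro continuous_intros)
        then have "isCont (\<lambda>x. four F m * ee (m \<bullet> x)) a" by (simp add: continuous_on_eq_continuous_at)
        then show "(\<lambda>k. four F m * ee (m \<bullet> u k)) \<longlonglongrightarrow> four F m * ee (m \<bullet> a)"
          by (rule isCont_tendsto_compose) (rule u)
      qed
    qed (auto simp: norm_mult)
  qed
  define h where "h x = P x - S x" for x
  have ch: "continuous_on UNIV h" unfolding h_def by (intro continuous_intros cP cS)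
  have per: "h (x + k) = h x" if k: "k \<in> int_lattice" for x k
  proof -
    have "P (x + k) = P x"
      using lat_sum_periodic[OF k, of "\<lambda>m. F (x + m)"] unfolding P_def by (simp add: add_ac)
    moreover have "S (x + k) = S x"
      unfolding S_def
    proof (rule Bochner_Integration.integral_cong[OF refl])
      fix m :: "real ^ 'n" assume "m \<in> space lat"
      then show "four F m * ee (m \<bullet> (x + k)) = four F m * ee (m \<bullet> x)"
        using ee_int[OF int_lattice_inner[of m k]] k by (simp add: inner_add_right ee_add)
    qed
    ultimately show ?thesis by (simp add: h_def)
  qed
  \<comment> \<open>A character with integral frequency does not notice the shift by m, so the
    coefficient of the periodization unfolds to the transform on the whole space.\<close>
  have Pk: "(TINT x. (P x * ee (k \<bullet> x))) = four F (- k)" if k: "k \<in> int_lattice" for k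
  proof -
    have int: "integrable lborel (\<lambda>x. F x * ee (k \<bullet> x))"
      by (intro integrable_times_ee integrable_decay_bound[OF M _ b]) auto
    have "four F (- k) = (LBINT x. F x * ee (k \<bullet> x))" by (simp add: four_def)
    also have "\<dots> = (TINT x. (\<integral>m. F (x + m) * ee (k \<bullet> (x + m)) \<partial>lat))"
      by (rule integral_unfold[OF int])
    also have "\<dots> = (TINT x. (P x * ee (k \<bullet> x)))"
    proof (rule Bochner_Integration.integral_cong[OF refl])
      fix x :: "real ^ 'n"
      have "(\<integral>m. F (x + m) * ee (k \<bullet> (x + m)) \<partial>lat) = (\<integral>m. F (x + m) * ee (k \<bullet> x) \<partial>lat)"
      proof (rule Bochner_Integration.integral_cong[OF refl])
        fix m :: "real ^ 'n" assume "m \<in> space lat"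
        then show "F (x + m) * ee (k \<bullet> (x + m)) = F (x + m) * ee (k \<bullet> x)"
          using ee_int[OF int_lattice_inner[of k m]] k by (simp add: inner_add_right ee_add)
      qed
      then show "indicator torus x *\<^sub>R (\<integral>m. F (x + m) * ee (k \<bullet> (x + m)) \<partial>lat) = indicator torus x *\<^sub>R (P x * ee (k \<bullet> x))"
        by (simp add: P_def)
    qed
    finally show ?thesis by simp
  qed
  \<comment> \<open>Only m = -k survives the integration over the torus.\<close>
  have Sk: "(TINT x. (S x * ee (k \<bullet> x))) = four F (- k)" if k: "k \<in> int_lattice" for k
  proof -
    have int: "integrable (lat \<Otimes>\<^sub>M lborel) (\<lambda>(m, x). indicator torus x *\<^sub>R (four F m * ee (m \<bullet> x) * ee (k \<bullet> x)))"
      by (rule integrable_lat_torus[OF _ _ nint]) (auto simp: norm_mult)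
    have "(TINT x. (S x * ee (k \<bullet> x)))
       = (LBINT x. \<integral>m. indicator torus x *\<^sub>R (four F m * ee (m \<bullet> x) * ee (k \<bullet> x)) \<partial>lat)"
      by (simp add: S_def)
    also have "\<dots> = (\<integral>m. \<integral>x. indicator torus x *\<^sub>R (four F m * ee (m \<bullet> x) * ee (k \<bullet> x)) \<partial>lborel \<partial>lat)"
      using lat_lborel.Fubini_integral[OF int] by simp
    also have "\<dots> = (\<integral>m. indicator {- k} m *\<^sub>R four F (- k) \<partial>lat)"
    proof (rule Bochner_Integration.integral_cong[OF refl])
      fix m :: "real ^ 'n" assume "m \<in> space lat"
      then have m: "m + k \<in> int_lattice" using k by auto
      have "(TINT x. (four F m * ee (m \<bullet> x) * ee (k \<bullet> x)))
        = (LBINT x. four F m * (indicator torus x *\<^sub>R ee ((m + k) \<bullet> x)))"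
        by (simp add: inner_add_left ee_add mult.assoc)
      also have "\<dots> = four F m * (if m + k = 0 then 1 else 0)"
        unfolding integral_torus_ee[OF m, symmetric] by (rule integral_mult_right_zero)
      also have "\<dots> = indicator {- k} m *\<^sub>R four F (- k)"
        by (auto simp: indicator_def add_eq_0_iff2)
      finally show "(TINT x. (four F m * ee (m \<bullet> x) * ee (k \<bullet> x))) = indicator {- k} m *\<^sub>R four F (- k)" .
    qed
    also have "\<dots> = measure lat {- k} *\<^sub>R four F (- k)"
      using k by (intro has_bochner_integral_integral_eq[OF has_bochner_integral_indicator]) (auto simp: emeasure_count_space)
    also have "\<dots> = four F (- k)" using k by (simp add: measure_def emeasure_count_space)
    finally show ?thesis .
  qed
  have bnd: "integrable lborel (\<lambda>x. indicator torus x *\<^sub>R (g x * ee (k \<bullet> x)))" if "continuous_on UNIV g" for g :: "real ^ 'n \<Rightarrow> complex" and k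
  proof -
    have c: "continuous_on UNIV (\<lambda>x. g x * ee (k \<bullet> x))" by (intro continuous_intros that)
    have "compact (g ` cball 0 (real CARD('n)))"
      by (intro compact_continuous_image continuous_on_subset[OF that]) auto
    then obtain B where "\<And>y. y \<in> g ` cball 0 (real CARD('n)) \<Longrightarrow> norm y \<le> B"
      by (meson bounded_iff compact_imp_bounded)
    then have "norm (g x * ee (k \<bullet> x)) \<le> B" if "x \<in> torus" for x
      using norm_torus[OF that] by (auto simp: norm_mult)
    then show ?thesis by (intro integrable_torus_bounded borel_measurable_continuous_onI c)
  qed
  have "h x = 0" for x
  proof (rule torus_Fourier_unique[OF ch per])
    fix k :: "real ^ 'n" assume k: "k \<in> int_lattice"
    have "(TINT x. (h x * ee (k \<bullet> x)))
      = (LBINT x. indicator torus x *\<^sub>R (P x * ee (k \<bullet> x)) - indicator torus x *\<^sub>R (S x * ee (k \<bullet> x)))"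
      by (simp add: h_def algebra_simps)
    also have "\<dots> = four F (- k) - four F (- k)"
      unfolding Pk[OF k, symmetric] unfolding Pk[OF k] unfolding Sk[OF k, symmetric]
      by (subst Bochner_Integration.integral_diff[OF bnd[OF cP] bnd[OF cS]]) (simp add: Pk[OF k] Sk[OF k])
    finally show "(TINT x. (h x * ee (k \<bullet> x))) = 0" by simp
  qed
  then show ?thesis by (simp add: h_def P_def S_def)
qed

text \<open>Inversion: integrate the Poisson formula for modulated functions over the unit cube of frequencies.\<close>

theorem Fourier_inversion:
  fixes F :: "real ^ 'n \<Rightarrow> complex"
  assumes M: "M > real CARD('n)" and b: "\<And>x. norm (F x) \<le> K * decay M x" and c: "continuous_on UNIV F"
    and bf: "\<And>\<xi>. norm (four F \<xi>) \<le> K' * decay M \<xi>" and mf [measurable]: "four F \<in> Borel"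
  shows "(LBINT \<xi>. four F \<xi> * ee (\<xi> \<bullet> x)) = F x"
proof -
  have [measurable]: "F \<in> Borel" using c by (rule borel_measurable_continuous_onI)
  \<comment> \<open>Poisson summation for the modulated function y -> F(y) e^(-2 pi i \<xi> y), both
    sides multiplied by the character at x.\<close>
  have pois: "(\<integral>m. F (x + m) * ee (- (\<xi> \<bullet> m)) \<partial>lat) = (\<integral>m. four F (\<xi> + m) * ee ((\<xi> + m) \<bullet> x) \<partial>lat)" for \<xi>
  proof -
    define G where "G y = F y * ee (- (\<xi> \<bullet> y))" for y
    have fG: "four G m = four F (\<xi> + m)" for m
      unfolding four_def G_def
      by (intro Bochner_Integration.integral_cong) (simp_all add: inner_add_left ee_add[symmetric] mult.assoc)
    have "(\<integral>m. G (x + m) \<partial>lat) = (\<integral>m. four G m * ee (m \<bullet> x) \<partial>lat)"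
    proof (rule Poisson_summation[OF M])
      show "norm (G y) \<le> K * decay M y" for y using b[of y] by (simp add: G_def norm_mult)
      show "continuous_on UNIV G" unfolding G_def by (intro continuous_intros c)
      show "integrable lat (four G)"
        using integrable_lat_bound[OF M bf, of \<xi> "\<lambda>_. 0"] unfolding fG[abs_def] by simp
    qed
    then have "ee (\<xi> \<bullet> x) * (\<integral>m. G (x + m) \<partial>lat) = ee (\<xi> \<bullet> x) * (\<integral>m. four F (\<xi> + m) * ee (m \<bullet> x) \<partial>lat)"
      by (simp add: fG)
    moreover have "ee (\<xi> \<bullet> x) * (\<integral>m. G (x + m) \<partial>lat) = (\<integral>m. F (x + m) * ee (- (\<xi> \<bullet> m)) \<partial>lat)"
    proof -
      have "ee (\<xi> \<bullet> x) * ee (- (\<xi> \<bullet> x)) = 1" by (simp add: ee_add[symmetric])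
      then have "ee (\<xi> \<bullet> x) * G (x + m) = F (x + m) * ee (- (\<xi> \<bullet> m))" for m
        by (simp add: G_def inner_add_right ee_add[of "- (\<xi> \<bullet> x)" "- (\<xi> \<bullet> m)", simplified])
      then show ?thesis unfolding integral_mult_right_zero[symmetric] by simp
    qed
    moreover have "ee (\<xi> \<bullet> x) * (\<integral>m. four F (\<xi> + m) * ee (m \<bullet> x) \<partial>lat) = (\<integral>m. four F (\<xi> + m) * ee ((\<xi> + m) \<bullet> x) \<partial>lat)"
      unfolding integral_mult_right_zero[symmetric] by (simp add: inner_add_left ee_add mult_ac)
    ultimately show ?thesis by simp
  qed
  have int: "integrable lborel (\<lambda>\<xi>. four F \<xi> * ee (\<xi> \<bullet> x))"
    by (intro integrable_times_ee integrable_decay_bound[OF M _ bf]) auto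
  have int2: "integrable (lat \<Otimes>\<^sub>M lborel) (\<lambda>(m, \<xi>). indicator torus \<xi> *\<^sub>R (F (x + m) * ee (- (\<xi> \<bullet> m))))"
  proof (rule integrable_lat_torus)
    show "integrable lat (\<lambda>m. norm (F (x + m)))"
      using integrable_lat_bound[OF M b, of x "\<lambda>_. 0"] by (intro integrable_norm) simp
  qed (auto simp: norm_mult)
  have "(LBINT \<xi>. four F \<xi> * ee (\<xi> \<bullet> x))
    = (TINT \<xi>. (\<integral>m. four F (\<xi> + m) * ee ((\<xi> + m) \<bullet> x) \<partial>lat))"
    by (rule integral_unfold[OF int])
  also have "\<dots> = (LBINT \<xi>. \<integral>m. indicator torus \<xi> *\<^sub>R (F (x + m) * ee (- (\<xi> \<bullet> m))) \<partial>lat)"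
    by (simp add: pois[symmetric])
  also have "\<dots> = (\<integral>m. \<integral>\<xi>. indicator torus \<xi> *\<^sub>R (F (x + m) * ee (- (\<xi> \<bullet> m))) \<partial>lborel \<partial>lat)"
    using lat_lborel.Fubini_integral[OF int2] by simp
  \<comment> \<open>The \<xi>-integral over the cube is zero unless m = 0, and the term m = 0 is
    F(x).\<close>
  also have "\<dots> = (\<integral>m. indicator {0 :: real ^ 'n} m *\<^sub>R F x \<partial>lat)"
  proof (rule Bochner_Integration.integral_cong[OF refl])
    fix m :: "real ^ 'n" assume "m \<in> space lat"
    then have m: "- m \<in> int_lattice" by simp
    have "(TINT \<xi>. (F (x + m) * ee (- (\<xi> \<bullet> m))))
      = (LBINT \<xi>. F (x + m) * (indicator torus \<xi> *\<^sub>R ee (- m \<bullet> \<xi>)))"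
      by (simp add: inner_commute)
    also have "\<dots> = F (x + m) * (if - m = 0 then 1 else 0)"
      unfolding integral_torus_ee[OF m, symmetric] by (rule integral_mult_right_zero)
    also have "\<dots> = indicator {0} m *\<^sub>R F x" by (auto simp: indicator_def)
    finally show "(TINT \<xi>. (F (x + m) * ee (- (\<xi> \<bullet> m)))) = indicator {0} m *\<^sub>R F x" .
  qed
  also have "\<dots> = measure lat {0 :: real ^ 'n} *\<^sub>R F x"
    by (intro has_bochner_integral_integral_eq[OF has_bochner_integral_indicator]) (auto simp: emeasure_count_space)
  also have "\<dots> = F x" by (simp add: measure_def emeasure_count_space)
  finally show ?thesis .
qed

section \<open>Inversion integrals\<close>

text \<open>The partial inversion integral $\sigma_R(U)$ at a point of norm $t$, in polar coordinates.\<close>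

definition ball_inv :: "nat \<Rightarrow> real \<Rightarrow> real \<Rightarrow> real \<Rightarrow> real \<Rightarrow> real" where
  "ball_inv n \<beta> a t R = integral {0..R} (\<lambda>s. radial_weight n t s * ball_ft n \<beta> a s)"

lemma continuous_on_radial_weight [continuous_intros]:
  "continuous_on A f \<Longrightarrow> continuous_on A (\<lambda>x. radial_weight n t (f x))" for A :: "'a::topological_space set"
  unfolding radial_weight_def by (intro continuous_intros)

lemma continuous_on_ball_ft [continuous_intros]:
  "continuous_on A f \<Longrightarrow> continuous_on A (\<lambda>x. ball_ft n \<beta> a (f x))" for A :: "'a::topological_space set"
  unfolding ball_ft_def by (intro continuous_intros)

lemma bounded_ratio_Icc:
  fixes f g :: "real \<Rightarrow> real"
  assumes "continuous_on {a..b} f" "continuous_on {a..b} g" "\<And>x. x \<in> {a..b} \<Longrightarrow> g x > 0"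
  shows "\<exists>B\<ge>0. \<forall>x\<in>{a..b}. \<bar>f x\<bar> \<le> B * g x"
proof -
  have "compact ((\<lambda>x. f x / g x) ` {a..b})"
    using assms by (intro compact_continuous_image continuous_intros) force+
  then obtain B where B: "\<And>y. y \<in> (\<lambda>x. f x / g x) ` {a..b} \<Longrightarrow> norm y \<le> B"
    by (meson bounded_iff compact_imp_bounded)
  have "\<bar>f x\<bar> \<le> \<bar>B\<bar> * g x" if x: "x \<in> {a..b}" for x
  proof -
    have "\<bar>f x / g x\<bar> \<le> \<bar>B\<bar>" using B[of "f x / g x"] x by auto
    then show ?thesis using assms(3)[OF x] by (simp add: abs_divide divide_le_eq)
  qed
  then show ?thesis by (intro exI[of _ "\<bar>B\<bar>"]) auto
qed

text \<open>The rescaled asymptotics start at s = 1/c. When this exceeds 1, the gap [1, 1/c] is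
  covered by compactness.\<close>

lemma clifford_asymp_scaled:
  assumes c: "c > 0"
  shows "\<exists>K\<ge>0. \<forall>s\<ge>1. \<bar>clifford \<nu> ((c * s)^2)
     - c powr (- \<nu> - 1 / 2) / sqrt pi * s powr (- \<nu> - 1 / 2) * cos (2 * (c * s) - pi * \<nu> / 2 - pi / 4)\<bar> \<le> K * s powr (- \<nu> - 3 / 2)"
proof -
  let ?D = "\<lambda>s. clifford \<nu> ((c * s)^2)
     - c powr (- \<nu> - 1 / 2) / sqrt pi * s powr (- \<nu> - 1 / 2) * cos (2 * (c * s) - pi * \<nu> / 2 - pi / 4)"
  obtain K where K: "K \<ge> 0" "\<And>z. z \<ge> 1 \<Longrightarrow> \<bar>clifford \<nu> (z^2)
     - z powr (- \<nu> - 1 / 2) * cos (2 * z - pi * \<nu> / 2 - pi / 4) / sqrt pi\<bar> \<le> K * z powr (- \<nu> - 3 / 2)"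
    using clifford_asymp[of \<nu>] unfolding clifford_asymp_def by metis
  have "\<exists>B\<ge>0. \<forall>s\<in>{1..1/c}. \<bar>?D s\<bar> \<le> B * s powr (- \<nu> - 3 / 2)"
    by (intro bounded_ratio_Icc continuous_intros) auto
  then obtain B where B: "B \<ge> 0" "\<And>s. s \<in> {1..1/c} \<Longrightarrow> \<bar>?D s\<bar> \<le> B * s powr (- \<nu> - 3 / 2)" by blast
  define K' where "K' = B + K * c powr (- \<nu> - 3 / 2)"
  have "\<bar>?D s\<bar> \<le> K' * s powr (- \<nu> - 3 / 2)" if s: "s \<ge> 1" for s
  proof (cases "c * s \<ge> 1")
    case True
    have e: "(c * s) powr p = c powr p * s powr p" for p using c s by (intro powr_mult)
    have "\<bar>?D s\<bar> \<le> K * (c * s) powr (- \<nu> - 3 / 2)" using K(2)[OF True] unfolding e by simp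
    also have "\<dots> = (K * c powr (- \<nu> - 3 / 2)) * s powr (- \<nu> - 3 / 2)" unfolding e by simp
    also have "\<dots> \<le> K' * s powr (- \<nu> - 3 / 2)" using B(1) by (intro mult_right_mono) (auto simp: K'_def)
    finally show ?thesis .
  next
    case False
    then have "s \<in> {1..1/c}" using s c by (auto simp: field_simps)
    then have "\<bar>?D s\<bar> \<le> B * s powr (- \<nu> - 3 / 2)" by (rule B(2))
    also have "\<dots> \<le> K' * s powr (- \<nu> - 3 / 2)" using K(1) by (intro mult_right_mono) (auto simp: K'_def)
    finally show ?thesis .
  qed
  moreover have "K' \<ge> 0" using B(1) K(1) by (simp add: K'_def)
  ultimately show ?thesis by blast
qed

lemma ball_ft_bound:
  assumes a: "a > 0"
  shows "\<exists>K>0. \<forall>s\<ge>0. \<bar>ball_ft n \<beta> a s\<bar> \<le> K * (1 + s) powr (- ((real n + 1) / 2 + \<beta>))"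
proof -
  define \<nu> where "\<nu> = real n / 2 + \<beta>"
  obtain K where K: "K > 0" "\<And>z. z \<ge> 0 \<Longrightarrow> \<bar>clifford \<nu> (z^2)\<bar> \<le> K * (1 + z) powr (- \<nu> - 1 / 2)"
    using clifford_bound[of \<nu>] by blast
  define c where "c = pi * a"
  have c: "c > 0" using a by (simp add: c_def)
  \<comment> \<open>With M this compares 1 + c s with 1 + s from both sides; the exponent may have
    either sign.\<close>
  define m where "m = min 1 c"
  define M where "M = max 1 c"
  have mM: "m > 0" "M > 0" using c by (auto simp: m_def M_def)
  define G where "G = \<bar>Gamma (\<beta> + 1) * pi powr (real n / 2) * a powr (real n + 2 * \<beta>)\<bar>"
  define L where "L = G * (K * (m powr (- \<nu> - 1 / 2) + M powr (- \<nu> - 1 / 2))) + 1"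
  have "\<bar>ball_ft n \<beta> a s\<bar> \<le> L * (1 + s) powr (- ((real n + 1) / 2 + \<beta>))" if s: "s \<ge> 0" for s
  proof -
    have e: "- ((real n + 1) / 2 + \<beta>) = - \<nu> - 1 / 2" by (simp add: \<nu>_def field_simps)
    have le: "m * (1 + s) \<le> 1 + c * s" "1 + c * s \<le> M * (1 + s)"
    proof -
      have "m * s \<le> c * s" "c * s \<le> M * s" using s by (auto intro!: mult_right_mono simp: m_def M_def)
      moreover have "m \<le> 1" "1 \<le> M" by (auto simp: m_def M_def)
      ultimately show "m * (1 + s) \<le> 1 + c * s" "1 + c * s \<le> M * (1 + s)" by (auto simp: algebra_simps)
    qed
    have "(1 + c * s) powr (- \<nu> - 1 / 2) \<le> (m powr (- \<nu> - 1 / 2) + M powr (- \<nu> - 1 / 2)) * (1 + s) powr (- \<nu> - 1 / 2)"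
    proof (cases "- \<nu> - 1 / 2 \<ge> 0")
      case True
      have "(1 + c * s) powr (- \<nu> - 1 / 2) \<le> (M * (1 + s)) powr (- \<nu> - 1 / 2)" using True le c s by (intro powr_mono2) auto
      also have "\<dots> = M powr (- \<nu> - 1 / 2) * (1 + s) powr (- \<nu> - 1 / 2)" using mM s by (intro powr_mult)
      finally show ?thesis by (simp add: distrib_right add_increasing)
    next
      case False
      have "(1 + c * s) powr (- \<nu> - 1 / 2) \<le> (m * (1 + s)) powr (- \<nu> - 1 / 2)" using False le c s mM by (intro powr_mono2') auto
      also have "\<dots> = m powr (- \<nu> - 1 / 2) * (1 + s) powr (- \<nu> - 1 / 2)" using mM s by (intro powr_mult)
      finally show ?thesis by (simp add: distrib_right add_increasing2)
    qed
    then have "K * (1 + c * s) powr (- \<nu> - 1 / 2) \<le> K * ((m powr (- \<nu> - 1 / 2) + M powr (- \<nu> - 1 / 2)) * (1 + s) powr (- \<nu> - 1 / 2))"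
      using K(1) by (intro mult_left_mono) auto
    then have "\<bar>clifford \<nu> ((c * s)^2)\<bar> \<le> K * ((m powr (- \<nu> - 1 / 2) + M powr (- \<nu> - 1 / 2)) * (1 + s) powr (- \<nu> - 1 / 2))"
      using K(2)[of "c * s"] c s by simp
    then have "G * \<bar>clifford \<nu> ((c * s)^2)\<bar> \<le> G * (K * ((m powr (- \<nu> - 1 / 2) + M powr (- \<nu> - 1 / 2)) * (1 + s) powr (- \<nu> - 1 / 2)))"
      by (intro mult_left_mono) (auto simp: G_def)
    also have "\<dots> \<le> L * (1 + s) powr (- \<nu> - 1 / 2)"
      unfolding L_def by (simp add: algebra_simps)
    finally show ?thesis unfolding e by (simp add: ball_ft_def G_def \<nu>_def c_def abs_mult)
  qed
  moreover have "L > 0" using K(1) by (simp add: L_def G_def add_nonneg_pos)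
  ultimately show ?thesis by blast
qed

text \<open>Integration by parts with the primitive s^n/2 times the function of order \<nu> + 1. The
  recurrence eliminates the order \<nu> + 2 that differentiation produces.\<close>

lemma integral_clifford_lift:
  assumes n: "n \<ge> 1" and R: "R \<ge> 0"
  shows "integral {0..R} (\<lambda>s. s ^ (n - 1) * clifford \<nu> ((c * s)^2))
    = R ^ n / 2 * clifford (\<nu> + 1) ((c * R)^2)
      + (\<nu> + 1 - real n / 2) * integral {0..R} (\<lambda>s. s ^ (n - 1) * clifford (\<nu> + 1) ((c * s)^2))"
proof -
  let ?c = "\<lambda>s :: real. clifford (\<nu> + 1) ((c * s)^2)"
  let ?f = "\<lambda>\<nu> s. s ^ (n - 1) * clifford \<nu> ((c * s)^2)"
  have "((\<lambda>s. ?f \<nu> s - (\<nu> + 1 - real n / 2) * ?f (\<nu> + 1) s) has_integral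
      (R ^ n / 2 * clifford (\<nu> + 1) ((c * R)^2) - 0 ^ n / 2 * clifford (\<nu> + 1) ((c * 0)^2))) {0..R}"
  proof (rule fundamental_theorem_of_calculus[OF R])
    fix s :: real assume "s \<in> {0..R}"
    have D: "((\<lambda>s. s ^ n / 2 * ?c s) has_real_derivative
       real n * s ^ (n - 1) / 2 * ?c s
       + s ^ n / 2 * (- clifford (\<nu> + 1 + 1) ((c * s)^2) * (2 * (c * s) * c))) (at s within {0..R})"
      by (rule derivative_eq_intros refl DERIV_chain2[OF DERIV_clifford[THEN has_field_derivative_at_within]] | simp add: algebra_simps)+
    have rn: "s ^ n = s * s ^ (n - 1)" using n by (cases n) auto
    have "real n * s ^ (n - 1) / 2 * ?c s
       + s ^ n / 2 * (- clifford (\<nu> + 1 + 1) ((c * s)^2) * (2 * (c * s) * c))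
      = ?f \<nu> s - (\<nu> + 1 - real n / 2) * ?f (\<nu> + 1) s"
    proof -
      have rec: "clifford \<nu> ((c * s)^2) = (\<nu> + 1) * ?c s - (c * s)^2 * clifford (\<nu> + 1 + 1) ((c * s)^2)"
        using clifford_recurrence[of "\<nu> + 1" "(c * s)^2"] by simp
      have gen: "real n * p / 2 * B + s * p / 2 * (- D * (2 * (c * s) * c))
        = p * ((\<nu> + 1) * B - (c * s)^2 * D) - (\<nu> + 1 - real n / 2) * (p * B)" for p B D
        by (simp add: algebra_simps power2_eq_square)
      show ?thesis unfolding rn rec by (rule gen)
    qed
    then show "((\<lambda>s. s ^ n / 2 * ?c s) has_vector_derivative
       ?f \<nu> s - (\<nu> + 1 - real n / 2) * ?f (\<nu> + 1) s) (at s within {0..R})"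
      using D unfolding has_real_derivative_iff_has_vector_derivative by simp
  qed
  then have "integral {0..R} (\<lambda>s. ?f \<nu> s - (\<nu> + 1 - real n / 2) * ?f (\<nu> + 1) s) = R ^ n / 2 * clifford (\<nu> + 1) ((c * R)^2)"
    using n by (subst integral_unique) (auto simp: zero_power)
  moreover have "integral {0..R} (\<lambda>s. ?f \<nu> s - (\<nu> + 1 - real n / 2) * ?f (\<nu> + 1) s)
    = integral {0..R} (?f \<nu>) - (\<nu> + 1 - real n / 2) * integral {0..R} (?f (\<nu> + 1))"
    by (subst integral_diff) (auto intro!: integrable_continuous_real continuous_intros)
  ultimately show ?thesis by linarith
qed

text \<open>The boundary term of the integration by parts in the inversion integral at the centre.
  Its Bessel function carries the Pinsky oscillation.\<close>

definition ball_lead :: "nat \<Rightarrow> real \<Rightarrow> real \<Rightarrow> real \<Rightarrow> real" where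
  "ball_lead n \<beta> a R = pi powr (real n) * rGamma (real n / 2) * Gamma (\<beta> + 1) * a powr (real n + 2 * \<beta>)
     * (R ^ n * clifford (real n / 2 + \<beta> + 1) ((pi * a * R)^2))"

text \<open>At order \<nu> = n/2 + \<beta> the factor of the remaining integral is \<beta> + 1. It
  turns Gamma(\<beta>+1) into Gamma(\<beta>+2), so the remainder is the inversion integral for
  \<beta> + 1, up to the power a^2.\<close>

lemma ball_inv_lift:
  assumes n: "n \<ge> 1" and R: "R \<ge> 0" and \<beta>: "\<beta> > -1" and a: "a > 0"
  shows "ball_inv n \<beta> a 0 R = ball_lead n \<beta> a R + ball_inv n (\<beta> + 1) a 0 R / a^2"
proof -
  define \<kappa> where "\<kappa> b = 2 * pi powr (real n) * rGamma (real n / 2) * Gamma (b + 1) * a powr (real n + 2 * b)" for b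
  have pp: "pi powr (real n) = pi powr (real n / 2) * pi powr (real n / 2)" by (simp add: powr_add[symmetric])
  have J: "ball_inv n b a 0 R = \<kappa> b * integral {0..R} (\<lambda>s. s ^ (n - 1) * clifford (real n / 2 + b) ((pi * a * s)^2))" for b
  proof -
    have "ball_inv n b a 0 R = integral {0..R} (\<lambda>s. \<kappa> b * (s ^ (n - 1) * clifford (real n / 2 + b) ((pi * a * s)^2)))"
      unfolding ball_inv_def
      by (intro integral_cong) (simp add: radial_weight_0 ball_ft_def \<kappa>_def pp)
    then show ?thesis by simp
  qed
  have k1: "\<kappa> \<beta> * (\<beta> + 1) = \<kappa> (\<beta> + 1) / a^2"
  proof -
    have "Gamma (\<beta> + 1 + 1) = (\<beta> + 1) * Gamma (\<beta> + 1)"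
      using \<beta> by (intro Gamma_plus1) (auto elim!: nonpos_Ints_cases)
    moreover have "a powr (real n + 2 * (\<beta> + 1)) = a^2 * a powr (real n + 2 * \<beta>)"
    proof -
      have "real n + 2 * (\<beta> + 1) = 2 + (real n + 2 * \<beta>)" by simp
      then show ?thesis using a by (simp only: powr_add) (simp add: powr_numeral)
    qed
    ultimately show ?thesis using a by (simp add: \<kappa>_def)
  qed
  have "ball_inv n \<beta> a 0 R = \<kappa> \<beta> * (R ^ n / 2 * clifford (real n / 2 + \<beta> + 1) ((pi * a * R)^2)
      + (real n / 2 + \<beta> + 1 - real n / 2) * integral {0..R} (\<lambda>s. s ^ (n - 1) * clifford (real n / 2 + \<beta> + 1) ((pi * a * s)^2)))"
    unfolding J[of \<beta>] by (subst integral_clifford_lift[OF n R]) (rule refl)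
  also have "\<dots> = \<kappa> \<beta> * (R ^ n / 2 * clifford (real n / 2 + \<beta> + 1) ((pi * a * R)^2))
      + (\<kappa> \<beta> * (\<beta> + 1)) * integral {0..R} (\<lambda>s. s ^ (n - 1) * clifford (real n / 2 + (\<beta> + 1)) ((pi * a * s)^2))"
    by (simp add: algebra_simps)
  also have "\<dots> = ball_lead n \<beta> a R + ball_inv n (\<beta> + 1) a 0 R / a^2"
    unfolding k1 J[of "\<beta> + 1"] by (simp add: ball_lead_def \<kappa>_def)
  finally show ?thesis .
qed

text \<open>Bessel asymptotics at the order n/2 + \<beta> + 1. The phase there is the one of the
  theorem minus pi, which is the origin of the sign in front of P.\<close>

lemma ball_lead_asymp:
  assumes n: "n \<ge> 1" and a: "a > 0"
  shows "\<exists>K\<ge>0. \<forall>R\<ge>1. \<bar>ball_lead n \<beta> a R + P_const n \<beta> a * cos (2 * pi * a * R - (real n - 1 + 2 * \<beta>) / 4 * pi) * R powr ((real n - 3) / 2 - \<beta>)\<bar>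
    \<le> K * R powr ((real n - 5) / 2 - \<beta>)"
proof -
  define \<nu> where "\<nu> = real n / 2 + \<beta> + 1"
  define D where "D = pi powr (real n) * rGamma (real n / 2) * Gamma (\<beta> + 1) * a powr (real n + 2 * \<beta>)"
  have c: "pi * a > 0" using a by simp
  obtain K where K: "K \<ge> 0" "\<And>s. s \<ge> 1 \<Longrightarrow> \<bar>clifford \<nu> ((pi * a * s)^2)
     - (pi * a) powr (- \<nu> - 1 / 2) / sqrt pi * s powr (- \<nu> - 1 / 2) * cos (2 * (pi * a * s) - pi * \<nu> / 2 - pi / 4)\<bar> \<le> K * s powr (- \<nu> - 3 / 2)"
    using clifford_asymp_scaled[OF c, of \<nu>] by blast
  have "\<bar>ball_lead n \<beta> a R + P_const n \<beta> a * cos (2 * pi * a * R - (real n - 1 + 2 * \<beta>) / 4 * pi) * R powr ((real n - 3) / 2 - \<beta>)\<bar>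
    \<le> \<bar>D\<bar> * K * R powr ((real n - 5) / 2 - \<beta>)" if R: "R \<ge> 1" for R
  proof -
    have Rn: "R ^ n = R powr real n" using R by (simp add: powr_realpow)
    have e1: "R ^ n * R powr (- \<nu> - 1 / 2) = R powr ((real n - 3) / 2 - \<beta>)"
    proof -
      have "real n + (- \<nu> - 1 / 2) = (real n - 3) / 2 - \<beta>" by (simp add: \<nu>_def field_simps)
      then show ?thesis unfolding Rn by (simp only: powr_add[symmetric])
    qed
    have e2: "R ^ n * R powr (- \<nu> - 3 / 2) = R powr ((real n - 5) / 2 - \<beta>)"
    proof -
      have "real n + (- \<nu> - 3 / 2) = (real n - 5) / 2 - \<beta>" by (simp add: \<nu>_def field_simps)
      then show ?thesis unfolding Rn by (simp only: powr_add[symmetric])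
    qed
    have cs: "cos (2 * (pi * a * R) - pi * \<nu> / 2 - pi / 4) = - cos (2 * pi * a * R - (real n - 1 + 2 * \<beta>) / 4 * pi)"
    proof -
      have "2 * (pi * a * R) - pi * \<nu> / 2 - pi / 4 = (2 * pi * a * R - (real n - 1 + 2 * \<beta>) / 4 * pi) - pi"
        by (simp add: \<nu>_def field_simps)
      moreover have "cos (t - pi) = - cos t" for t :: real by (simp add: cos_diff)
      ultimately show ?thesis by (simp only:)
    qed
    have Pc: "D * ((pi * a) powr (- \<nu> - 1 / 2) / sqrt pi) = P_const n \<beta> a"
    proof -
      have "(pi * a) powr (- \<nu> - 1 / 2) = pi powr (- \<nu> - 1 / 2) * a powr (- \<nu> - 1 / 2)"
        using a by (intro powr_mult)
      moreover have "a powr (real n + 2 * \<beta>) * a powr (- \<nu> - 1 / 2) = a powr ((real n - 3) / 2 + \<beta>)"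
        by (rule powr_mult_powr) (simp add: \<nu>_def field_simps)
      moreover have "pi powr (real n) * pi powr (- \<nu> - 1 / 2) / sqrt pi = pi powr ((real n - 4) / 2 - \<beta>)"
      proof -
        have "real n + (- \<nu> - 1 / 2) - 1 / 2 = (real n - 4) / 2 - \<beta>" by (simp add: \<nu>_def field_simps)
        moreover have "sqrt pi = pi powr (1 / 2)" by (simp add: powr_half_sqrt)
        ultimately show ?thesis by (simp only: powr_add[symmetric] powr_diff[symmetric])
      qed
      moreover have "A * rg * G * a1 * (p * a2 / z) = G * rg * (a1 * a2) * (A * p / z)" for A rg G a1 p a2 z :: real
        by (simp add: divide_inverse mult_ac)
      ultimately have "D * ((pi * a) powr (- \<nu> - 1 / 2) / sqrt pi)
        = Gamma (\<beta> + 1) * rGamma (real n / 2) * a powr ((real n - 3) / 2 + \<beta>) * pi powr ((real n - 4) / 2 - \<beta>)"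
        unfolding D_def by (simp only:)
      then show ?thesis
        unfolding P_const_def rGamma_inverse_Gamma by (simp only: divide_inverse)
    qed
    have "ball_lead n \<beta> a R + P_const n \<beta> a * cos (2 * pi * a * R - (real n - 1 + 2 * \<beta>) / 4 * pi) * R powr ((real n - 3) / 2 - \<beta>)
      = D * (R ^ n * (clifford \<nu> ((pi * a * R)^2)
     - (pi * a) powr (- \<nu> - 1 / 2) / sqrt pi * R powr (- \<nu> - 1 / 2) * cos (2 * (pi * a * R) - pi * \<nu> / 2 - pi / 4)))"
      unfolding cs Pc[symmetric] e1[symmetric] ball_lead_def D_def[symmetric] \<nu>_def[symmetric]
      by (simp add: algebra_simps)
    also have "\<bar>\<dots>\<bar> \<le> \<bar>D\<bar> * (R ^ n * (K * R powr (- \<nu> - 3 / 2)))"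
      unfolding abs_mult using K(2)[OF R] R by (intro mult_left_mono) auto
    also have "\<dots> = \<bar>D\<bar> * K * R powr ((real n - 5) / 2 - \<beta>)" unfolding e2[symmetric] by simp
    finally show ?thesis .
  qed
  moreover have "\<bar>D\<bar> * K \<ge> 0" using K(1) by simp
  ultimately show ?thesis by blast
qed

section \<open>Inversion integrals away from the centre\<close>

lemma converges_at_rate:
  fixes g :: "real \<Rightarrow> real"
  assumes p: "p > 1" and c: "continuous_on {1..} g" and b: "\<And>s. s \<ge> 1 \<Longrightarrow> \<bar>g s\<bar> \<le> K * s powr (- p)"
  shows "\<exists>L. \<forall>R\<ge>1. \<bar>integral {1..R} g - L\<bar> \<le> K / (p - 1) * R powr (1 - p)"
proof -
  define G where "G R = integral {1..R} g" for R
  have cont: "continuous_on {x..y} g" if "1 \<le> x" for x y using c by (rule continuous_on_subset) (use that in auto)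
  have K: "K \<ge> 0" using b[of 1] by simp
  have diff: "\<bar>G S - G R\<bar> \<le> K / (p - 1) * R powr (1 - p)" if R: "1 \<le> R" "R \<le> S" for R S
  proof -
    have "integral {1..R} g + integral {R..S} g = integral {1..S} g"
      using R by (intro Henstock_Kurzweil_Integration.integral_combine integrable_continuous_real cont) auto
    then have "G S - G R = integral {R..S} g" by (simp add: G_def)
    moreover have "norm (integral {R..S} g) \<le> integral {R..S} (\<lambda>s. K * s powr (- p))"
      using R b by (intro integral_norm_bound_integral integrable_continuous_real cont continuous_intros) auto
    ultimately have 1: "\<bar>G S - G R\<bar> \<le> integral {R..S} (\<lambda>s. K * s powr (- p))" by simp
    have hi: "((\<lambda>s. K * s powr (- p)) has_integral (- (K / (p - 1)) * S powr (1 - p) - (- (K / (p - 1)) * R powr (1 - p)))) {R..S}"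
    proof (rule fundamental_theorem_of_calculus)
      fix s assume s: "s \<in> {R..S}"
      have "((\<lambda>s. s powr (1 - p)) has_real_derivative (1 - p) * s powr (1 - p - 1)) (at s)"
        using s R by (intro has_real_derivative_powr) auto
      then have "((\<lambda>s. - (K / (p - 1)) * s powr (1 - p)) has_real_derivative - (K / (p - 1)) * ((1 - p) * s powr (1 - p - 1))) (at s)"
        by (rule DERIV_cmult)
      moreover have "- (K / (p - 1)) * ((1 - p) * s powr (1 - p - 1)) = K * s powr (- p)"
        using p by (simp add: field_simps)
      ultimately show "((\<lambda>s. - (K / (p - 1)) * s powr (1 - p)) has_vector_derivative K * s powr (- p)) (at s within {R..S})"
        by (simp add: has_real_derivative_iff_has_vector_derivative has_vector_derivative_at_within)
    qed (use R in auto)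
    note 1
    also have "integral {R..S} (\<lambda>s. K * s powr (- p)) = K / (p - 1) * R powr (1 - p) - K / (p - 1) * S powr (1 - p)"
      unfolding integral_unique[OF hi] by simp
    also have "\<dots> \<le> K / (p - 1) * R powr (1 - p)" using K p by simp
    finally show ?thesis .
  qed
  \<comment> \<open>Integer endpoints suffice to produce the limit L; \<open>diff\<close> extends
    the rate to all real R.\<close>
  define X where "X k = G (real (Suc k))" for k
  have lim0: "(\<lambda>k. K / (p - 1) * real (Suc k) powr (1 - p)) \<longlonglongrightarrow> 0"
  proof -
    have "filterlim (\<lambda>k. real (Suc k)) at_top sequentially"
      by (rule filterlim_compose[OF filterlim_real_sequentially filterlim_Suc])
    then have "(\<lambda>k. real (Suc k) powr (1 - p)) \<longlonglongrightarrow> 0" using p by (intro tendsto_neg_powr) auto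
    from tendsto_mult_left[OF this, of "K / (p - 1)"] show ?thesis by simp
  qed
  have "Cauchy X"
  proof (rule metric_CauchyI)
    fix e :: real assume e: "e > 0"
    obtain N where N: "K / (p - 1) * real (Suc N) powr (1 - p) < e / 2"
      using order_tendstoD(2)[OF lim0, of "e / 2"] e by (auto simp: eventually_sequentially)
    have "dist (X m) (X k) < e" if "m \<ge> N" "k \<ge> N" for m k
    proof -
      have "\<bar>X m - X N\<bar> \<le> K / (p - 1) * real (Suc N) powr (1 - p)"
        "\<bar>X k - X N\<bar> \<le> K / (p - 1) * real (Suc N) powr (1 - p)"
        unfolding X_def using that by (intro diff; simp)+
      then have "\<bar>X m - X k\<bar> < e" using N by linarith
      then show ?thesis by (simp add: dist_real_def)
    qed
    then show "\<exists>N. \<forall>m\<ge>N. \<forall>k\<ge>N. dist (X m) (X k) < e" by blast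
  qed
  then obtain L where L: "X \<longlonglongrightarrow> L" using Cauchy_convergent convergent_def by blast
  have "\<bar>G R - L\<bar> \<le> K / (p - 1) * R powr (1 - p)" if R: "R \<ge> 1" for R
  proof (rule tendsto_upperbound)
    show "(\<lambda>k. \<bar>G R - X k\<bar>) \<longlonglongrightarrow> \<bar>G R - L\<bar>" by (intro tendsto_intros L)
    show "eventually (\<lambda>k. \<bar>G R - X k\<bar> \<le> K / (p - 1) * R powr (1 - p)) sequentially"
    proof -
      obtain N :: nat where N: "real N \<ge> R" using real_nat_ceiling_ge by blast
      have "\<bar>G R - X k\<bar> \<le> K / (p - 1) * R powr (1 - p)" if "k \<ge> N" for k
        using diff[OF R, of "real (Suc k)"] N that by (auto simp: X_def abs_minus_commute)
      then show ?thesis by (auto simp: eventually_sequentially)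
    qed
  qed simp
  then show ?thesis unfolding G_def by blast
qed

text \<open>For \<beta> <= 0 the power s^(-1-\<beta>) is not integrable at infinity. One integration
  by parts against the oscillation gains a power of s and makes the rest absolutely
  convergent.\<close>

lemma oscillating_integral_rate:
  fixes \<beta> \<omega> \<psi> :: real
  assumes \<beta>: "\<beta> > -1" and \<omega>: "\<omega> \<noteq> 0"
  shows "\<exists>L K. K \<ge> 0 \<and> (\<forall>R\<ge>1. \<bar>integral {1..R} (\<lambda>s. s powr (-1 - \<beta>) * cos (\<omega> * s - \<psi>)) - L\<bar> \<le> K * R powr (-1 - \<beta>))"
proof -
  let ?u = "\<lambda>s. s powr (-1 - \<beta>) * cos (\<omega> * s - \<psi>)"
  \<comment> \<open>The integrand left by the integration by parts; it decays with exponent 2 +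
    \<beta> > 1.\<close>
  define g where "g s = (1 + \<beta>) / \<omega> * (s powr (-2 - \<beta>) * sin (\<omega> * s - \<psi>))" for s
  have "continuous_on {1..} g" unfolding g_def by (intro continuous_intros) auto
  moreover have "\<bar>g s\<bar> \<le> \<bar>(1 + \<beta>) / \<omega>\<bar> * s powr (- (2 + \<beta>))" if "s \<ge> 1" for s
  proof -
    have "\<bar>s powr (-2 - \<beta>) * sin (\<omega> * s - \<psi>)\<bar> \<le> s powr (-2 - \<beta>) * 1"
      unfolding abs_mult by (intro mult_mono) auto
    then show ?thesis unfolding g_def abs_mult[of "(1 + \<beta>) / \<omega>"] by (intro mult_left_mono) auto
  qed
  moreover have "2 + \<beta> > 1" using \<beta> by simp
  ultimately obtain L where L: "\<And>R. R \<ge> 1 \<Longrightarrow> \<bar>integral {1..R} g - L\<bar> \<le> \<bar>(1 + \<beta>) / \<omega>\<bar> / (2 + \<beta> - 1) * R powr (1 - (2 + \<beta>))"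
    using converges_at_rate[of "2 + \<beta>" g "\<bar>(1 + \<beta>) / \<omega>\<bar>"] by blast
  define c where "c = sin (\<omega> - \<psi>) / \<omega>"
  have "\<bar>integral {1..R} (\<lambda>s. ?u s) - (L - c)\<bar>
      \<le> (1 / \<bar>\<omega>\<bar> + \<bar>(1 + \<beta>) / \<omega>\<bar> / (2 + \<beta> - 1)) * R powr (-1 - \<beta>)" if R: "R \<ge> 1" for R
  proof -
    have "((\<lambda>s. ?u s - g s) has_integral
      (R powr (-1 - \<beta>) * (sin (\<omega> * R - \<psi>) / \<omega>) - 1 powr (-1 - \<beta>) * (sin (\<omega> * 1 - \<psi>) / \<omega>))) {1..R}"
    proof (rule fundamental_theorem_of_calculus[OF R])
      fix s assume s: "s \<in> {1..R}"
      have "((\<lambda>s. s powr (-1 - \<beta>) * (sin (\<omega> * s - \<psi>) / \<omega>)) has_real_derivative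
        ((-1 - \<beta>) * s powr (-1 - \<beta> - 1)) * (sin (\<omega> * s - \<psi>) / \<omega>) + (cos (\<omega> * s - \<psi>) * \<omega> / \<omega>) * s powr (-1 - \<beta>)) (at s)"
        using s by (intro DERIV_mult has_real_derivative_powr DERIV_cdivide) (auto intro!: derivative_eq_intros)
      moreover have "((-1 - \<beta>) * s powr (-1 - \<beta> - 1)) * (sin (\<omega> * s - \<psi>) / \<omega>) + (cos (\<omega> * s - \<psi>) * \<omega> / \<omega>) * s powr (-1 - \<beta>)
         = ?u s - g s"
      proof -
        have "-1 - \<beta> - 1 = -2 - \<beta>" by simp
        moreover have "((-1 - \<beta>) * P) * (S / \<omega>) + (C * \<omega> / \<omega>) * Q = Q * C - (1 + \<beta>) / \<omega> * (P * S)" for P Q S C :: real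
          using \<omega> by (simp add: field_simps)
        ultimately show ?thesis unfolding g_def by (simp only:)
      qed
      ultimately show "((\<lambda>s. s powr (-1 - \<beta>) * (sin (\<omega> * s - \<psi>) / \<omega>)) has_vector_derivative
          ?u s - g s) (at s within {1..R})"
        by (simp add: has_real_derivative_iff_has_vector_derivative has_vector_derivative_at_within)
    qed
    then have "integral {1..R} (\<lambda>s. ?u s - g s) = R powr (-1 - \<beta>) * (sin (\<omega> * R - \<psi>) / \<omega>) - c"
      by (simp add: integral_unique c_def)
    moreover have "integral {1..R} (\<lambda>s. ?u s - g s)
      = integral {1..R} (\<lambda>s. ?u s) - integral {1..R} g"
      unfolding g_def by (intro integral_diff integrable_continuous_real continuous_intros) auto
    ultimately have e: "integral {1..R} (\<lambda>s. ?u s) - (L - c)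
       = R powr (-1 - \<beta>) * (sin (\<omega> * R - \<psi>) / \<omega>) + (integral {1..R} g - L)" by linarith
    have "\<bar>R powr (-1 - \<beta>) * (sin (\<omega> * R - \<psi>) / \<omega>)\<bar> \<le> R powr (-1 - \<beta>) * (1 / \<bar>\<omega>\<bar>)"
      unfolding abs_mult by (intro mult_mono) (auto simp: abs_divide intro!: divide_right_mono)
    moreover have "1 - (2 + \<beta>) = -1 - \<beta>" by simp
    ultimately show ?thesis using L[OF R] unfolding e distrib_right by (smt (verit) mult.commute)
  qed
  moreover have "1 / \<bar>\<omega>\<bar> + \<bar>(1 + \<beta>) / \<omega>\<bar> / (2 + \<beta> - 1) \<ge> 0" using \<beta> by simp
  ultimately show ?thesis by blast
qed

text \<open>The sphere integral oscillates with frequency t and the transform with frequency a. The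
  powers multiply to s^(-1-\<beta>), without n, and the product of the two cosines splits into the
  frequencies t - a and t + a; the former degenerates at t = a.\<close>

lemma ball_integrand_asymp:
  fixes n :: nat and a t \<beta> :: real
  assumes n: "n \<ge> 1" and a: "a > 0" and t: "t > 0"
  defines "D \<equiv> pi powr (real n) * Gamma (\<beta> + 1) * a powr (real n + 2 * \<beta>)
     * ((pi * t) powr (- (real n - 1) / 2) / sqrt pi) * ((pi * a) powr (- (real n + 1) / 2 - \<beta>) / sqrt pi)"
    and "\<psi>1 \<equiv> - (pi * (1 + \<beta>) / 2)" and "\<psi>2 \<equiv> pi * (real n + \<beta>) / 2"
  shows "\<exists>K\<ge>0. \<forall>s\<ge>1. \<bar>radial_weight n t s * ball_ft n \<beta> a s
     - D * (s powr (-1 - \<beta>) * cos (2 * pi * (t - a) * s - \<psi>1) + s powr (-1 - \<beta>) * cos (2 * pi * (t + a) * s - \<psi>2))\<bar>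
     \<le> K * s powr (-2 - \<beta>)"
proof -
  let ?p = "\<lambda>s :: real. s powr ((real n - 1) / 2)"
  let ?q = "\<lambda>s :: real. s powr ((real n - 3) / 2)"
  define \<mu>1 \<mu>2 where "\<mu>1 = real n / 2 - 1" and "\<mu>2 = real n / 2 + \<beta>"
  let ?x = "\<lambda>s. 2 * (pi * t * s) - pi * \<mu>1 / 2 - pi / 4"
  let ?y = "\<lambda>s. 2 * (pi * a * s) - pi * \<mu>2 / 2 - pi / 4"
  define A0 where "A0 = 2 * pi powr (real n / 2)"
  define B0 where "B0 = Gamma (\<beta> + 1) * pi powr (real n / 2) * a powr (real n + 2 * \<beta>)"
  define \<alpha>1 where "\<alpha>1 = (pi * t) powr (- \<mu>1 - 1 / 2) / sqrt pi"
  define \<alpha>2 where "\<alpha>2 = (pi * a) powr (- \<mu>2 - 1 / 2) / sqrt pi"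
  have "pi * t > 0" "pi * a > 0" using a t by auto
  then obtain K1 K2 where
    K1: "K1 \<ge> 0" "\<And>s. s \<ge> 1 \<Longrightarrow> \<bar>clifford \<mu>1 ((pi * t * s)^2) - \<alpha>1 * s powr (- \<mu>1 - 1 / 2) * cos (?x s)\<bar> \<le> K1 * s powr (- \<mu>1 - 3 / 2)"
    and K2: "K2 \<ge> 0" "\<And>s. s \<ge> 1 \<Longrightarrow> \<bar>clifford \<mu>2 ((pi * a * s)^2) - \<alpha>2 * s powr (- \<mu>2 - 1 / 2) * cos (?y s)\<bar> \<le> K2 * s powr (- \<mu>2 - 3 / 2)"
    unfolding \<alpha>1_def \<alpha>2_def using clifford_asymp_scaled[of "pi * t" \<mu>1] clifford_asymp_scaled[of "pi * a" \<mu>2] by metis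
  have D: "D = A0 * B0 * \<alpha>1 * \<alpha>2 / 2"
  proof -
    have e: "- \<mu>1 - 1 / 2 = - (real n - 1) / 2" "- \<mu>2 - 1 / 2 = - (real n + 1) / 2 - \<beta>"
      by (simp_all add: \<mu>1_def \<mu>2_def field_simps)
    have pp: "pi powr (real n) = pi powr (real n / 2) * pi powr (real n / 2)" by (simp add: powr_add[symmetric])
    have gen: "(p * p) * G * A * x * y = (2 * p) * (G * p * A) * x * y / 2" for p G A x y :: real by simp
    show ?thesis unfolding D_def A0_def B0_def \<alpha>1_def \<alpha>2_def e pp by (rule gen)
  qed
  define K where "K = (\<bar>A0\<bar> * (\<bar>\<alpha>1\<bar> + K1)) * (\<bar>B0\<bar> * K2) + (\<bar>A0\<bar> * K1) * (\<bar>B0\<bar> * \<bar>\<alpha>2\<bar>)"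
  have "\<bar>radial_weight n t s * ball_ft n \<beta> a s
     - D * (s powr (-1 - \<beta>) * cos (2 * pi * (t - a) * s - \<psi>1) + s powr (-1 - \<beta>) * cos (2 * pi * (t + a) * s - \<psi>2))\<bar>
     \<le> K * s powr (-2 - \<beta>)" if s: "s \<ge> 1" for s
  proof -
    let ?c1 = "cos (?x s)" and ?c2 = "cos (?y s)"
    have sn: "s ^ (n - 1) = s powr (real n - 1)" using s n by (simp add: powr_realpow[symmetric] of_nat_diff)
    have e1: "s ^ (n - 1) * s powr (- \<mu>1 - 1 / 2) = ?p s"
    proof -
      have "real n - 1 + (- \<mu>1 - 1 / 2) = (real n - 1) / 2" by (simp add: \<mu>1_def field_simps)
      then show ?thesis unfolding sn by (simp only: powr_add[symmetric])
    qed
    have e2: "s ^ (n - 1) * s powr (- \<mu>1 - 3 / 2) = ?q s"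
    proof -
      have "real n - 1 + (- \<mu>1 - 3 / 2) = (real n - 3) / 2" by (simp add: \<mu>1_def field_simps)
      then show ?thesis unfolding sn by (simp only: powr_add[symmetric])
    qed
    have p1: "?p s * s powr (- \<mu>2 - 1 / 2) = s powr (-1 - \<beta>)"
      by (rule powr_mult_powr) (simp add: \<mu>2_def field_simps)
    have p2: "?p s * s powr (- \<mu>2 - 3 / 2) = s powr (-2 - \<beta>)"
      by (rule powr_mult_powr) (simp add: \<mu>2_def field_simps)
    have p3: "?q s * s powr (- \<mu>2 - 1 / 2) = s powr (-2 - \<beta>)"
      by (rule powr_mult_powr) (simp add: \<mu>2_def field_simps)
    define X0 where "X0 = A0 * \<alpha>1 * ?p s * ?c1"
    define Y0 where "Y0 = B0 * \<alpha>2 * s powr (- \<mu>2 - 1 / 2) * ?c2"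
    have X: "\<bar>radial_weight n t s - X0\<bar> \<le> \<bar>A0\<bar> * K1 * ?q s"
    proof -
      have "radial_weight n t s - X0 = A0 * (s ^ (n - 1) * (clifford \<mu>1 ((pi * t * s)^2) - \<alpha>1 * s powr (- \<mu>1 - 1 / 2) * ?c1))"
      proof -
        have "pi * s * t = pi * t * s" by simp
        then show ?thesis
          unfolding X0_def e1[symmetric] radial_weight_def A0_def[symmetric] \<mu>1_def[symmetric] by (simp add: algebra_simps)
      qed
      then have "\<bar>radial_weight n t s - X0\<bar> = \<bar>A0\<bar> * (s ^ (n - 1) * \<bar>clifford \<mu>1 ((pi * t * s)^2) - \<alpha>1 * s powr (- \<mu>1 - 1 / 2) * ?c1\<bar>)"
        using s by (simp add: abs_mult)
      also have "\<dots> \<le> \<bar>A0\<bar> * (s ^ (n - 1) * (K1 * s powr (- \<mu>1 - 3 / 2)))"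
        using K1(2)[OF s] s by (intro mult_left_mono) auto
      also have "\<dots> = \<bar>A0\<bar> * K1 * ?q s" unfolding e2[symmetric] by simp
      finally show ?thesis .
    qed
    have Y: "\<bar>ball_ft n \<beta> a s - Y0\<bar> \<le> \<bar>B0\<bar> * K2 * s powr (- \<mu>2 - 3 / 2)"
    proof -
      have "ball_ft n \<beta> a s - Y0 = B0 * (clifford \<mu>2 ((pi * a * s)^2) - \<alpha>2 * s powr (- \<mu>2 - 1 / 2) * ?c2)"
        unfolding Y0_def ball_ft_def B0_def[symmetric] \<mu>2_def[symmetric] by (simp add: algebra_simps)
      then show ?thesis using mult_left_mono[OF K2(2)[OF s], of "\<bar>B0\<bar>"] by (simp add: abs_mult mult.assoc)
    qed
    have cos1: "\<bar>x * cos y\<bar> \<le> \<bar>x\<bar>" for x y :: real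
      using mult_left_mono[OF abs_cos_le_one[of y], of "\<bar>x\<bar>"] by (simp add: abs_mult)
    have X0b: "\<bar>X0\<bar> \<le> \<bar>A0\<bar> * \<bar>\<alpha>1\<bar> * ?p s"
      unfolding X0_def by (rule order_trans[OF cos1]) (simp add: abs_mult)
    have Y0b: "\<bar>Y0\<bar> \<le> \<bar>B0\<bar> * \<bar>\<alpha>2\<bar> * s powr (- \<mu>2 - 1 / 2)"
      unfolding Y0_def by (rule order_trans[OF cos1]) (simp add: abs_mult)
    have "?q s \<le> ?p s" using s by (intro powr_mono) auto
    then have "\<bar>A0\<bar> * K1 * ?q s \<le> \<bar>A0\<bar> * K1 * ?p s"
      using K1(1) by (intro mult_left_mono) auto
    then have Xb: "\<bar>radial_weight n t s\<bar> \<le> (\<bar>A0\<bar> * (\<bar>\<alpha>1\<bar> + K1)) * ?p s"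
      using X X0b by (simp add: algebra_simps) linarith
    have main: "X0 * Y0 = D * (s powr (-1 - \<beta>) * cos (2 * pi * (t - a) * s - \<psi>1) + s powr (-1 - \<beta>) * cos (2 * pi * (t + a) * s - \<psi>2))"
    proof -
      have "?c1 * ?c2 = (cos ((?x s) - (?y s))
        + cos ((?x s) + (?y s))) / 2"
        by (rule cos_times_cos)
      moreover have "(?x s) - (?y s) = 2 * pi * (t - a) * s - \<psi>1"
        by (simp add: \<psi>1_def \<mu>1_def \<mu>2_def field_simps)
      moreover have "(?x s) + (?y s) = 2 * pi * (t + a) * s - \<psi>2"
        by (simp add: \<psi>2_def \<mu>1_def \<mu>2_def field_simps)
      ultimately have cc: "?c1 * ?c2 = (cos (2 * pi * (t - a) * s - \<psi>1) + cos (2 * pi * (t + a) * s - \<psi>2)) / 2" by (simp only:)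
      have "X0 * Y0 = A0 * B0 * \<alpha>1 * \<alpha>2 * (?p s * s powr (- \<mu>2 - 1 / 2)) * (?c1 * ?c2)"
        unfolding X0_def Y0_def by (simp only: mult_ac)
      then show ?thesis unfolding p1 cc D by (simp add: algebra_simps)
    qed
    \<comment> \<open>The difference of products is split so that each summand has one factor small
      by an extra power of s.\<close>
    have "radial_weight n t s * ball_ft n \<beta> a s - X0 * Y0
      = radial_weight n t s * (ball_ft n \<beta> a s - Y0) + (radial_weight n t s - X0) * Y0" by (simp add: algebra_simps)
    also have "\<bar>\<dots>\<bar> \<le> \<bar>radial_weight n t s\<bar> * \<bar>ball_ft n \<beta> a s - Y0\<bar> + \<bar>radial_weight n t s - X0\<bar> * \<bar>Y0\<bar>"
      unfolding abs_mult[symmetric] by (rule abs_triangle_ineq)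
    also have "\<dots> \<le> ((\<bar>A0\<bar> * (\<bar>\<alpha>1\<bar> + K1)) * ?p s) * (\<bar>B0\<bar> * K2 * s powr (- \<mu>2 - 3 / 2))
        + (\<bar>A0\<bar> * K1 * ?q s) * (\<bar>B0\<bar> * \<bar>\<alpha>2\<bar> * s powr (- \<mu>2 - 1 / 2))"
      using K1(1) by (intro add_mono mult_mono Xb Y X Y0b) auto
    also have "\<dots> = (\<bar>A0\<bar> * (\<bar>\<alpha>1\<bar> + K1)) * (\<bar>B0\<bar> * K2) * (?p s * s powr (- \<mu>2 - 3 / 2))
        + (\<bar>A0\<bar> * K1) * (\<bar>B0\<bar> * \<bar>\<alpha>2\<bar>) * (?q s * s powr (- \<mu>2 - 1 / 2))"
      by (simp only: mult_ac)
    also have "\<dots> = K * s powr (-2 - \<beta>)" unfolding p2 p3 K_def by (simp only: distrib_right)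
    finally show ?thesis unfolding main .
  qed
  moreover have "K \<ge> 0" using K1(1) K2(1) by (simp add: K_def)
  ultimately show ?thesis by blast
qed

lemma ball_inv_split:
  assumes R: "R \<ge> 1"
  shows "ball_inv n \<beta> a t R = ball_inv n \<beta> a t 1 + integral {1..R} (\<lambda>s. radial_weight n t s * ball_ft n \<beta> a s)"
  unfolding ball_inv_def
  using R by (intro Henstock_Kurzweil_Integration.integral_combine[symmetric] integrable_continuous_real continuous_intros) auto

text \<open>The t + a part always oscillates and converges. The t - a part does so for t \<noteq> a;
  at t = a it is a pure power, whose integral is a constant plus a multiple of R^(-\<beta>). The
  constant c is left open here and identified later by summation.\<close>

lemma ball_inv_resonant:
  assumes n: "n \<ge> 1" and a: "a > 0" and t: "t > 0" and \<beta>: "\<beta> > -1"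
  shows "\<exists>c K. K \<ge> 0 \<and> (\<forall>R\<ge>1. \<bar>ball_inv n \<beta> a t R
      - (c + (if t = a \<and> \<beta> \<noteq> 0 then L_const \<beta> a * R powr (- \<beta>) else 0))\<bar> \<le> K * R powr (-1 - \<beta>))"
proof -
  let ?r = "\<lambda>R. if t = a \<and> \<beta> \<noteq> 0 then L_const \<beta> a * R powr (- \<beta>) else 0"
  define D where "D = pi powr (real n) * Gamma (\<beta> + 1) * a powr (real n + 2 * \<beta>)
     * ((pi * t) powr (- (real n - 1) / 2) / sqrt pi) * ((pi * a) powr (- (real n + 1) / 2 - \<beta>) / sqrt pi)"
  define \<psi>1 \<psi>2 where "\<psi>1 = - (pi * (1 + \<beta>) / 2)" and "\<psi>2 = pi * (real n + \<beta>) / 2"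
  define f1 where "f1 s = s powr (-1 - \<beta>) * cos (2 * pi * (t - a) * s - \<psi>1)" for s
  define f2 where "f2 s = s powr (-1 - \<beta>) * cos (2 * pi * (t + a) * s - \<psi>2)" for s
  define A where "A s = radial_weight n t s * ball_ft n \<beta> a s" for s
  obtain K0 where K0: "K0 \<ge> 0" "\<And>s. s \<ge> 1 \<Longrightarrow> \<bar>A s - D * (f1 s + f2 s)\<bar> \<le> K0 * s powr (- (2 + \<beta>))"
    using ball_integrand_asymp[OF n a t, of \<beta>] unfolding D_def \<psi>1_def \<psi>2_def f1_def f2_def A_def by auto
  have cf: "continuous_on {1..} f1" "continuous_on {1..} f2" unfolding f1_def f2_def by (intro continuous_intros; simp)+
  have cA: "continuous_on {1..} A" unfolding A_def by (intro continuous_intros)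
  have i: "f1 integrable_on {1..R}" "f2 integrable_on {1..R}" "A integrable_on {1..R}" for R
    by (auto intro!: integrable_continuous_real intro: continuous_on_subset[OF cf(1)] continuous_on_subset[OF cf(2)] continuous_on_subset[OF cA])
  have cg: "continuous_on {1..} (\<lambda>s. A s - D * (f1 s + f2 s))" by (intro continuous_intros cf cA)
  have "2 + \<beta> > 1" using \<beta> by simp
  from converges_at_rate[OF this cg K0(2)] obtain L0 where
    L0: "\<And>R. R \<ge> 1 \<Longrightarrow> \<bar>integral {1..R} (\<lambda>s. A s - D * (f1 s + f2 s)) - L0\<bar> \<le> K0 / (2 + \<beta> - 1) * R powr (1 - (2 + \<beta>))"
    by blast
  have "2 * pi * (t + a) \<noteq> 0" using a t by simp
  from oscillating_integral_rate[OF \<beta> this, of \<psi>2] obtain L2 K2 where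
    L2: "K2 \<ge> 0" "\<And>R. R \<ge> 1 \<Longrightarrow> \<bar>integral {1..R} f2 - L2\<bar> \<le> K2 * R powr (-1 - \<beta>)"
    unfolding f2_def by blast
  have "\<exists>L1 K1. K1 \<ge> 0 \<and> (\<forall>R\<ge>1. \<bar>D * integral {1..R} f1 - (L1 + ?r R)\<bar> \<le> K1 * R powr (-1 - \<beta>))"
  proof (cases "t = a")
    case False
    then have "2 * pi * (t - a) \<noteq> 0" by simp
    from oscillating_integral_rate[OF \<beta> this, of \<psi>1] obtain L1 K1 where
      L1: "K1 \<ge> 0" "\<And>R. R \<ge> 1 \<Longrightarrow> \<bar>integral {1..R} f1 - L1\<bar> \<le> K1 * R powr (-1 - \<beta>)"
      unfolding f1_def by blast
    have "\<bar>D * integral {1..R} f1 - (D * L1 + ?r R)\<bar> \<le> \<bar>D\<bar> * K1 * R powr (-1 - \<beta>)"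
      if "R \<ge> 1" for R
    proof -
      have "D * integral {1..R} f1 - (D * L1 + ?r R) = D * (integral {1..R} f1 - L1)"
        using False by (simp add: algebra_simps)
      then show ?thesis using mult_left_mono[OF L1(2)[OF that], of "\<bar>D\<bar>"] by (simp add: abs_mult)
    qed
    moreover have "\<bar>D\<bar> * K1 \<ge> 0" using L1(1) by simp
    ultimately show ?thesis by blast
  next
    case True
    \<comment> \<open>At resonance the cosine is frozen at its phase, and this value becomes the
      sine in L.\<close>
    have cpsi: "cos (- \<psi>1) = - sin (\<beta> * pi / 2)"
    proof -
      have "- \<psi>1 = \<beta> * pi / 2 + pi / 2" by (simp add: \<psi>1_def field_simps)
      then show ?thesis by (simp only: cos_add) simp
    qed
    have f1: "f1 = (\<lambda>s. - sin (\<beta> * pi / 2) * s powr (-1 - \<beta>))"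
      unfolding f1_def True using cpsi by (auto simp: fun_eq_iff)
    show ?thesis
    \<comment> \<open>For \<beta> = 0 the resonant part vanishes, as its factor is sin 0. The value
      L = 1/2 then reappears as the limit c itself.\<close>
    proof (cases "\<beta> = 0")
      case True
      then have "f1 = (\<lambda>s. 0)" unfolding f1 by simp
      then show ?thesis using True by (intro exI[of _ 0]) auto
    next
      case False
      \<comment> \<open>At t = a the dimension cancels from D, and Gamma(\<beta>+1) (a/pi)^\<beta> /
        pi remains.\<close>
      have Dv: "D * sin (\<beta> * pi / 2) / \<beta> = L_const \<beta> a"
      proof -
        have "(pi * a) powr (- (real n - 1) / 2) * (pi * a) powr (- (real n + 1) / 2 - \<beta>) = (pi * a) powr (- real n - \<beta>)"
          by (rule powr_mult_powr) (simp add: field_simps)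
        also have "\<dots> = pi powr (- real n - \<beta>) * a powr (- real n - \<beta>)" using a by (intro powr_mult)
        finally have e: "(pi * a) powr (- (real n - 1) / 2) * (pi * a) powr (- (real n + 1) / 2 - \<beta>) = pi powr (- real n - \<beta>) * a powr (- real n - \<beta>)" .
        have ea: "a powr (real n + 2 * \<beta>) * a powr (- real n - \<beta>) = a powr \<beta>" by (simp add: powr_add[symmetric])
        have ep: "pi powr (real n) * pi powr (- real n - \<beta>) = pi powr (- \<beta>)" by (simp add: powr_add[symmetric])
        have gen: "P * G * A1 * (x / q) * (y / q) = G * (P * (x * y) * A1) / (q * q)" for P G A1 x y q :: real by simp
        have "D = Gamma (\<beta> + 1) * (pi powr (real n) * (pi powr (- real n - \<beta>) * a powr (- real n - \<beta>)) * a powr (real n + 2 * \<beta>)) / pi"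
          unfolding D_def True gen e by simp
        also have "\<dots> = Gamma (\<beta> + 1) * ((pi powr (real n) * pi powr (- real n - \<beta>)) * (a powr (real n + 2 * \<beta>) * a powr (- real n - \<beta>))) / pi"
          by (simp only: mult_ac)
        also have "\<dots> = Gamma (\<beta> + 1) * (pi powr (- \<beta>) * a powr \<beta>) / pi" unfolding ea ep ..
        also have "pi powr (- \<beta>) * a powr \<beta> = (a / pi) powr \<beta>"
          using powr_divide[of a pi \<beta>] a by (simp add: powr_minus_divide)
        finally have "D = Gamma (\<beta> + 1) * (a / pi) powr \<beta> / pi" .
        then show ?thesis using False by (simp add: L_const_def mult_ac)
      qed
      have "D * integral {1..R} f1 = - L_const \<beta> a + L_const \<beta> a * R powr (- \<beta>)" if R: "R \<ge> 1" for R
      proof -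
        have "((\<lambda>s. s powr (-1 - \<beta>)) has_integral (R powr (- \<beta>) / (- \<beta>) - 1 powr (- \<beta>) / (- \<beta>))) {1..R}"
        proof (rule fundamental_theorem_of_calculus[OF R])
          fix s assume s: "s \<in> {1..R}"
          have "((\<lambda>s. s powr (- \<beta>) / (- \<beta>)) has_real_derivative (- \<beta> * s powr (- \<beta> - 1)) / (- \<beta>)) (at s)"
            using s by (intro DERIV_cdivide has_real_derivative_powr) auto
          moreover have "(- \<beta> * s powr (- \<beta> - 1)) / (- \<beta>) = s powr (-1 - \<beta>)"
          proof -
            have "- \<beta> - 1 = -1 - \<beta>" by simp
            then show ?thesis using False by (simp only:) simp
          qed
          ultimately show "((\<lambda>s. s powr (- \<beta>) / (- \<beta>)) has_vector_derivative s powr (-1 - \<beta>)) (at s within {1..R})"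
            by (simp add: has_real_derivative_iff_has_vector_derivative has_vector_derivative_at_within)
        qed
        then have e: "integral {1..R} f1 = - sin (\<beta> * pi / 2) * (R powr (- \<beta>) / (- \<beta>) - 1 powr (- \<beta>) / (- \<beta>))"
          unfolding f1 by (simp add: integral_unique)
        show ?thesis unfolding Dv[symmetric] e using False by (simp add: field_simps)
      qed
      then show ?thesis using True False by (intro exI[of _ "- L_const \<beta> a"] exI[of _ 0]) auto
    qed
  qed
  then obtain L1 K1 where L1: "K1 \<ge> 0" "\<And>R. R \<ge> 1 \<Longrightarrow> \<bar>D * integral {1..R} f1
     - (L1 + ?r R)\<bar> \<le> K1 * R powr (-1 - \<beta>)"
    by blast
  define K where "K = K0 / (2 + \<beta> - 1) + \<bar>D\<bar> * K2 + K1"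
  have "\<bar>ball_inv n \<beta> a t R - ((ball_inv n \<beta> a t 1 + L0 + D * L2 + L1) + ?r R)\<bar> \<le> K * R powr (-1 - \<beta>)"
    if R: "R \<ge> 1" for R
  proof -
    have "(\<lambda>s. D * (f1 s + f2 s)) integrable_on {1..R}"
      using integrable_on_cmult_left[OF integrable_add[OF i(1) i(2)], of D] by simp
    then have "integral {1..R} (\<lambda>s. A s - D * (f1 s + f2 s)) = integral {1..R} A - integral {1..R} (\<lambda>s. D * (f1 s + f2 s))"
      by (intro integral_diff i)
    also have "integral {1..R} (\<lambda>s. D * (f1 s + f2 s)) = D * integral {1..R} f1 + D * integral {1..R} f2"
      unfolding Henstock_Kurzweil_Integration.integral_mult_right
        Henstock_Kurzweil_Integration.integral_add[OF i(1) i(2)] by (rule distrib_left)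
    finally have e: "integral {1..R} A = integral {1..R} (\<lambda>s. A s - D * (f1 s + f2 s)) + D * integral {1..R} f1 + D * integral {1..R} f2" by simp
    have b2: "\<bar>D * integral {1..R} f2 - D * L2\<bar> \<le> \<bar>D\<bar> * K2 * R powr (-1 - \<beta>)"
      using mult_left_mono[OF L2(2)[OF R], of "\<bar>D\<bar>"] by (simp add: abs_mult right_diff_distrib[symmetric])
    have "1 - (2 + \<beta>) = -1 - \<beta>" by simp
    then have b0: "\<bar>integral {1..R} (\<lambda>s. A s - D * (f1 s + f2 s)) - L0\<bar> \<le> K0 / (2 + \<beta> - 1) * R powr (-1 - \<beta>)"
      using L0[OF R] by (simp only:)
    have "ball_inv n \<beta> a t R = ball_inv n \<beta> a t 1 + integral {1..R} A"
      unfolding A_def by (rule ball_inv_split[OF R])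
    then show ?thesis using b0 b2 L1(2)[OF R] unfolding e K_def distrib_right by linarith
  qed
  moreover have "K \<ge> 0" using K0(1) L2(1) L1(1) \<beta> by (simp add: K_def)
  ultimately show ?thesis by blast
qed

section \<open>Transform and inversion of the ball power\<close>

lemma lborel_integral_uminus:
  fixes f :: "real ^ 'n \<Rightarrow> 'b::{banach, second_countable_topology}"
  assumes "f \<in> Borel"
  shows "(LBINT x. f (- x)) = (LBINT x. f x)"
  using lborel_integral_affine[of f "-1" 0] assms by simp

text \<open>The reflection x -> -x leaves a radial function unchanged and conjugates the character,
  so only the cosine part contributes.\<close>

lemma integral_radial_ee:
  fixes \<xi> :: "real ^ 'n" and f :: "real \<Rightarrow> real"
  assumes f[measurable]: "f \<in> Borel" and int: "integrable lborel (\<lambda>x :: real ^ 'n. f (norm x))"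
  shows "(LBINT x. of_real (f (norm x)) * ee (\<xi> \<bullet> x))
     = of_real (LBINT r. indicator {0..} r * (radial_weight CARD('n) (norm \<xi>) r * f r))"
proof -
  let ?F = "\<lambda>x :: real ^ 'n. complex_of_real (f (norm x))"
  let ?I = "\<integral>x. ?F x * ee (\<xi> \<bullet> x) \<partial>lborel"
  have iF: "integrable lborel ?F" using int by simp
  have i1: "integrable lborel (\<lambda>x. ?F x * ee (\<xi> \<bullet> x))" "integrable lborel (\<lambda>x. ?F x * ee (- (\<xi> \<bullet> x)))"
    by (intro integrable_times_ee iF; measurable)+
  have "?I = (LBINT x. ?F (- x) * ee (\<xi> \<bullet> - x))"
    by (rule lborel_integral_uminus[symmetric]) measurable
  then have I2: "?I = (LBINT x. ?F x * ee (- (\<xi> \<bullet> x)))" by simp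
  have "2 * ?I = (LBINT x. ?F x * ee (\<xi> \<bullet> x) + ?F x * ee (- (\<xi> \<bullet> x)))"
    unfolding Bochner_Integration.integral_add[OF i1] I2[symmetric] by simp
  also have "\<dots> = (LBINT x. of_real (2 * (cos (2 * pi * (\<xi> \<bullet> x)) * f (norm x))))"
    by (intro Bochner_Integration.integral_cong) (auto simp: ee_def complex_eq_iff)
  also have "\<dots> = of_real (LBINT x. 2 * (cos (2 * pi * (\<xi> \<bullet> x)) * f (norm x)))"
  proof (rule integral_of_real)
    show "integrable lborel (\<lambda>x. 2 * (cos (2 * pi * (\<xi> \<bullet> x)) * f (norm x)))"
      using has_bochner_integral_radial(2)[OF f int, of \<xi>] by (intro integrable_mult_right) (simp add: has_bochner_integral_iff)
  qed
  also have "\<dots> = 2 * of_real (LBINT x. cos (2 * pi * (\<xi> \<bullet> x)) * f (norm x))" by simp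
  finally have "?I = of_real (LBINT x. cos (2 * pi * (\<xi> \<bullet> x)) * f (norm x))" by simp
  then show ?thesis
    using has_bochner_integral_integral_eq[OF has_bochner_integral_radial(2)[OF f int, of \<xi>]] by simp
qed

lemma borel_measurable_ball_power [measurable]: "ball_power \<beta> a \<in> Borel"
  unfolding ball_power_eq_profile[abs_def] by measurable

lemma integrable_ball_power: "\<beta> > -1 \<Longrightarrow> a > 0 \<Longrightarrow> integrable lborel (ball_power \<beta> a :: real ^ 'n \<Rightarrow> complex)"
  unfolding ball_power_eq_profile[abs_def] using integrable_ball_profile[of \<beta> a, where 'n = 'n] by simp

lemma four_ball_power:
  fixes \<xi> :: "real ^ 'n"
  assumes \<beta>: "\<beta> > -1" and a: "a > 0"
  shows "four (ball_power \<beta> a) \<xi> = of_real (ball_ft CARD('n) \<beta> a (norm \<xi>))"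
proof -
  have "four (ball_power \<beta> a) \<xi> = (LBINT x. of_real (ball_profile \<beta> a (norm x)) * ee (- \<xi> \<bullet> x))"
    unfolding four_def ball_power_eq_profile by simp
  also have "\<dots> = of_real (LBINT r. indicator {0..} r * (radial_weight CARD('n) (norm (- \<xi>)) r * ball_profile \<beta> a r))"
    by (intro integral_radial_ee integrable_ball_profile \<beta> a) measurable
  also have "(LBINT r. indicator {0..} r * (radial_weight CARD('n) (norm (- \<xi>)) r * ball_profile \<beta> a r))
     = ball_ft CARD('n) \<beta> a (norm \<xi>)"
    using has_bochner_integral_radial_ball_profile[OF card_pos[where 'n = 'n] \<beta> a, of "norm \<xi>"]
    by (simp add: has_bochner_integral_iff)
  finally show ?thesis .
qed

lemma ball_power_decay:
  assumes \<beta>: "\<beta> \<ge> 0" and a: "a > 0" and M: "M \<ge> 0"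
  shows "norm (ball_power \<beta> a x) \<le> a powr (2 * \<beta>) * (1 + a) powr M * decay M x"
proof (cases "norm x < a")
  case True
  have "(a^2 - (norm x)^2) powr \<beta> \<le> (a^2) powr \<beta>"
    using \<beta> True by (intro powr_mono2) (auto simp: power_mono)
  also have "(a^2) powr \<beta> = a powr (2 * \<beta>)" using a powr_powr[of a 2 \<beta>] by (simp add: powr_numeral)
  finally have 1: "(a^2 - (norm x)^2) powr \<beta> \<le> a powr (2 * \<beta>)" .
  have "1 = (1 + a) powr M * (1 + a) powr (- M)" using a by (simp add: powr_add[symmetric])
  also have "\<dots> \<le> (1 + a) powr M * decay M x"
    unfolding decay_def using True M by (intro mult_left_mono powr_mono2') (auto simp: add_pos_nonneg)
  finally have "a powr (2 * \<beta>) * 1 \<le> a powr (2 * \<beta>) * ((1 + a) powr M * decay M x)"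
    by (intro mult_left_mono) auto
  then show ?thesis using 1 True by (simp add: ball_power_def mult.assoc)
next
  case False
  then show ?thesis by (simp add: ball_power_def)
qed

lemma continuous_on_ball_power:
  assumes \<beta>: "\<beta> > 0" and a: "a > 0"
  shows "continuous_on UNIV (ball_power \<beta> a :: real ^ 'n \<Rightarrow> complex)"
proof -
  have "ball_power \<beta> a = (\<lambda>x :: real ^ 'n. complex_of_real (max 0 (a^2 - (norm x)^2) powr \<beta>))"
  proof
    fix x :: "real ^ 'n"
    have "norm x < a \<longleftrightarrow> (norm x)^2 < a^2"
      using a by (auto intro: power_strict_mono dest: power2_less_imp_less)
    then show "ball_power \<beta> a x = complex_of_real (max 0 (a^2 - (norm x)^2) powr \<beta>)"
      using \<beta> by (auto simp: ball_power_def max_def not_less)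
  qed
  moreover have "continuous_on UNIV (\<lambda>x :: real ^ 'n. complex_of_real (max 0 (a^2 - (norm x)^2) powr \<beta>))"
    using \<beta> by (intro continuous_on_of_real continuous_on_powr' continuous_intros) auto
  ultimately show ?thesis by simp
qed

lemma ball_ft_decay:
  assumes a: "a > 0"
  shows "\<exists>K>0. \<forall>\<xi> :: real ^ 'n. \<bar>ball_ft n \<beta> a (norm \<xi>)\<bar> \<le> K * decay ((real n + 1) / 2 + \<beta>) \<xi>"
  using ball_ft_bound[OF a, of n \<beta>] unfolding decay_def by (meson norm_ge_zero)

text \<open>Above the threshold (n - 1)/2 the decay exponent (n + 1)/2 + \<beta> of the transform
  exceeds n, so the transform is integrable; \<beta> > 0 makes the ball power itself
  continuous.\<close>

lemma ball_inversion:
  fixes x :: "real ^ 'n"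
  assumes \<beta>: "\<beta> > 0" "\<beta> > (real CARD('n) - 1) / 2" and a: "a > 0"
  shows "(LBINT \<xi>. of_real (ball_ft CARD('n) \<beta> a (norm \<xi>)) * ee (\<xi> \<bullet> x)) = ball_power \<beta> a x"
    and "integrable lborel (\<lambda>\<xi> :: real ^ 'n. ball_ft CARD('n) \<beta> a (norm \<xi>))"
proof -
  define M where "M = (real CARD('n) + 1) / 2 + \<beta>"
  have M: "M > real CARD('n)" using \<beta> by (simp add: M_def field_simps)
  have \<beta>1: "\<beta> > -1" using \<beta> by simp
  obtain K where K: "K > 0" "\<And>\<xi> :: real ^ 'n. \<bar>ball_ft CARD('n) \<beta> a (norm \<xi>)\<bar> \<le> K * decay M \<xi>"
    using ball_ft_decay[OF a, of "CARD('n)" \<beta>] unfolding M_def by blast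
  have ft: "four (ball_power \<beta> a) = (\<lambda>\<xi> :: real ^ 'n. complex_of_real (ball_ft CARD('n) \<beta> a (norm \<xi>)))"
    using four_ball_power[OF \<beta>1 a] by auto
  have "(LBINT \<xi>. four (ball_power \<beta> a) \<xi> * ee (\<xi> \<bullet> x)) = ball_power \<beta> a x"
  proof (rule Fourier_inversion[OF M])
    show "norm (ball_power \<beta> a x) \<le> a powr (2 * \<beta>) * (1 + a) powr M * decay M x" for x :: "real ^ 'n"
      using \<beta> a M by (intro ball_power_decay) auto
    show "continuous_on UNIV (ball_power \<beta> a :: real ^ 'n \<Rightarrow> complex)"
      by (rule continuous_on_ball_power[OF \<beta>(1) a])
    show "norm (four (ball_power \<beta> a) \<xi>) \<le> K * decay M \<xi>" for \<xi> :: "real ^ 'n"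
      unfolding ft using K(2) by simp
    show "four (ball_power \<beta> a) \<in> borel_measurable (borel :: (real ^ 'n) measure)" unfolding ft by measurable
  qed
  then show "(LBINT \<xi>. of_real (ball_ft CARD('n) \<beta> a (norm \<xi>)) * ee (\<xi> \<bullet> x)) = ball_power \<beta> a x"
    unfolding ft .
  have "integrable lborel (\<lambda>\<xi> :: real ^ 'n. complex_of_real (ball_ft CARD('n) \<beta> a (norm \<xi>)))"
    by (rule integrable_decay_bound[OF M, where K = K]) (use K in auto)
  then show "integrable lborel (\<lambda>\<xi> :: real ^ 'n. ball_ft CARD('n) \<beta> a (norm \<xi>))"
    by (simp only: complex_of_real_integrable_eq)
qed

section \<open>The inversion integral at the centre, for all exponents\<close>

lemma integral_Icc_eq_lborel:
  fixes h :: "real \<Rightarrow> real"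
  assumes "continuous_on {x..y} h"
  shows "integrable lborel (\<lambda>s. indicator {x..y} s * h s)"
    and "(LBINT s. indicator {x..y} s * h s) = integral {x..y} h"
  using borel_integrable_atLeastAtMost'[OF assms] set_borel_integral_eq_integral(2)[OF borel_integrable_atLeastAtMost'[OF assms]]
  by (simp_all add: set_integrable_def set_lebesgue_integral_def)

text \<open>The limit is the value a^(2\<beta>) of the ball power at 0, by genuine Fourier
  inversion. The rate comes from the size s^(n-1) s^(-(n+1)/2-\<beta>) of the integrand; it is not
  yet the best possible and gets improved by the lift.\<close>

lemma ball_inv_base:
  assumes \<beta>: "\<beta> > 0" "\<beta> > (real CARD('n) - 1) / 2" and a: "a > 0"
  shows "\<exists>K\<ge>0. \<forall>R\<ge>1. \<bar>ball_inv CARD('n::finite) \<beta> a 0 R - a powr (2 * \<beta>)\<bar> \<le> K * R powr ((real CARD('n) - 1) / 2 - \<beta>)"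
proof -
  define n where "n = CARD('n)"
  have n: "n \<ge> 1" unfolding n_def by (rule card_pos)
  define h where "h s = radial_weight n 0 s * ball_ft n \<beta> a s" for s
  have ch: "continuous_on A h" for A unfolding h_def by (intro continuous_intros)
  have [measurable]: "h \<in> Borel" unfolding h_def by measurable
  have int: "integrable lborel (\<lambda>\<xi> :: real ^ 'n. ball_ft n \<beta> a (norm \<xi>))"
    unfolding n_def by (rule ball_inversion(2)[OF \<beta> a])
  have "of_real (LBINT r. indicator {0..} r * h r) = (LBINT \<xi>. of_real (ball_ft n \<beta> a (norm \<xi>)) * ee ((0 :: real ^ 'n) \<bullet> \<xi>))"
    using integral_radial_ee[OF _ int, of 0] by (simp add: h_def n_def)
  also have "\<dots> = ball_power \<beta> a (0 :: real ^ 'n)"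
    using ball_inversion(1)[OF \<beta> a, of 0] by (simp add: n_def)
  also have "\<dots> = of_real (a powr (2 * \<beta>))"
    using a powr_powr[of a 2 \<beta>] by (simp add: ball_power_def powr_numeral)
  finally have val: "(LBINT r. indicator {0..} r * h r) = a powr (2 * \<beta>)" by (simp only: of_real_eq_iff)
  have inth: "integrable lborel (\<lambda>r. indicator {0..} r * h r)"
    using int integrable_radial_iff[of "ball_ft n \<beta> a", where 'n = 'n] by (simp add: h_def n_def)
  have lim: "((\<lambda>R. integral {0..R} h) \<longlongrightarrow> a powr (2 * \<beta>)) at_top"
  proof -
    have "((\<lambda>y. \<integral>x. indicator {..y} x *\<^sub>R (indicator {0..} x * h x) \<partial>lborel) \<longlongrightarrow> (LBINT x. indicator {0..} x * h x)) at_top"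
      by (rule tendsto_integral_at_top) (use inth in auto)
    moreover have "(LBINT x. indicator {..y} x *\<^sub>R (indicator {0..} x * h x)) = integral {0..y} h" for y
      unfolding integral_Icc_eq_lborel(2)[OF ch, symmetric]
      by (intro Bochner_Integration.integral_cong) (auto simp: indicator_def)
    ultimately show ?thesis using val by simp
  qed
  obtain K where K: "K > 0" "\<And>s. s \<ge> 0 \<Longrightarrow> \<bar>ball_ft n \<beta> a s\<bar> \<le> K * (1 + s) powr (- ((real n + 1) / 2 + \<beta>))"
    using ball_ft_bound[OF a, of n \<beta>] by blast
  define w where "w = 2 * pi powr (real n / 2) * rGamma (real n / 2)"
  have w: "w > 0" using n rGamma_real_pos[of "real n / 2"] by (simp add: w_def)
  define p where "p = \<beta> - (real n - 3) / 2"
  have p: "p > 1" using \<beta> by (simp add: p_def n_def field_simps)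
  have hb: "\<bar>h s\<bar> \<le> w * K * s powr (- p)" if s: "s \<ge> 1" for s
  proof -
    have sn: "s ^ (n - 1) = s powr (real n - 1)" using s n by (simp add: powr_realpow[symmetric] of_nat_diff)
    have "(1 + s) powr (- ((real n + 1) / 2 + \<beta>)) \<le> s powr (- ((real n + 1) / 2 + \<beta>))"
    proof (rule powr_mono2')
      have "(real n + 1) / 2 + \<beta> \<ge> 0" using \<beta>(1) by (intro add_nonneg_nonneg) auto
      then show "- ((real n + 1) / 2 + \<beta>) \<le> 0" by linarith
    qed (use s in auto)
    then have "K * (1 + s) powr (- ((real n + 1) / 2 + \<beta>)) \<le> K * s powr (- ((real n + 1) / 2 + \<beta>))"
      using K(1) by (intro mult_left_mono) auto
    then have b: "\<bar>ball_ft n \<beta> a s\<bar> \<le> K * s powr (- ((real n + 1) / 2 + \<beta>))" using K(2)[of s] s by linarith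
    have "\<bar>h s\<bar> = w * s powr (real n - 1) * \<bar>ball_ft n \<beta> a s\<bar>"
      using w s unfolding h_def radial_weight_0 w_def[symmetric] sn abs_mult by simp
    also have "\<dots> \<le> w * s powr (real n - 1) * (K * s powr (- ((real n + 1) / 2 + \<beta>)))"
      using w b by (intro mult_left_mono) auto
    also have "\<dots> = w * K * (s powr (real n - 1) * s powr (- ((real n + 1) / 2 + \<beta>)))" by simp
    also have "s powr (real n - 1) * s powr (- ((real n + 1) / 2 + \<beta>)) = s powr (- p)"
      by (rule powr_mult_powr) (simp add: p_def field_simps)
    finally show ?thesis .
  qed
  obtain L where L: "\<And>R. R \<ge> 1 \<Longrightarrow> \<bar>integral {1..R} h - L\<bar> \<le> w * K / (p - 1) * R powr (1 - p)"
    using converges_at_rate[OF p ch hb] by blast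
  have split: "integral {0..R} h = integral {0..1} h + integral {1..R} h" if "R \<ge> 1" for R
    using that by (intro Henstock_Kurzweil_Integration.integral_combine[symmetric] integrable_continuous_real ch) auto
  have b: "\<bar>integral {0..R} h - (integral {0..1} h + L)\<bar> \<le> w * K / (p - 1) * R powr (1 - p)" if "R \<ge> 1" for R
    using L[OF that] split[OF that] by simp
  have z: "((\<lambda>R. w * K / (p - 1) * R powr (1 - p)) \<longlongrightarrow> 0) at_top"
    using tendsto_mult_left[OF tendsto_neg_powr[OF _ filterlim_ident, of "1 - p"], of "w * K / (p - 1)"] p by simp
  have "((\<lambda>R. integral {0..R} h - (integral {0..1} h + L)) \<longlongrightarrow> 0) at_top"
    by (rule Lim_null_comparison[OF _ z]) (use b in \<open>auto simp: eventually_at_top_linorder\<close>)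
  then have "((\<lambda>R. integral {0..R} h) \<longlongrightarrow> integral {0..1} h + L) at_top" by (rule Lim_null[THEN iffD2])
  then have e: "integral {0..1} h + L = a powr (2 * \<beta>)" using lim by (intro tendsto_unique[OF trivial_limit_at_top_linorder])
  have q: "1 - p = (real n - 1) / 2 - \<beta>" by (simp add: p_def field_simps)
  have "w * K / (p - 1) \<ge> 0" using w K(1) p by simp
  then show ?thesis
    using b unfolding e q h_def ball_inv_def[symmetric] n_def by blast
qed

text \<open>An error bound for \<beta> + 1 passes through the lift to \<beta>: the limits fit
  because a^(2\<beta>+2)/a^2 = a^(2\<beta>), and the boundary term is split off explicitly. The
  parameter e leaves the rate open, since the lift is used with two different rates.\<close>

lemma ball_inv_step:
  assumes n: "n \<ge> 1" and \<beta>: "\<beta> > -1" and a: "a > 0"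
    and H: "\<exists>K\<ge>0. \<forall>R\<ge>1. \<bar>ball_inv n (\<beta> + 1) a 0 R - a powr (2 * (\<beta> + 1))\<bar> \<le> K * R powr (e - 1 - \<beta>)"
  shows "\<exists>K\<ge>0. \<forall>R\<ge>1. \<bar>ball_inv n \<beta> a 0 R - a powr (2 * \<beta>) - ball_lead n \<beta> a R\<bar> \<le> K * R powr (e - 1 - \<beta>)"
proof -
  obtain K where K: "K \<ge> 0" "\<And>R. R \<ge> 1 \<Longrightarrow> \<bar>ball_inv n (\<beta> + 1) a 0 R - a powr (2 * (\<beta> + 1))\<bar> \<le> K * R powr (e - 1 - \<beta>)"
    using H by blast
  have a2: "a powr (2 * (\<beta> + 1)) / a^2 = a powr (2 * \<beta>)"
    using a by (simp add: powr_add distrib_left powr_numeral)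
  have "\<bar>ball_inv n \<beta> a 0 R - a powr (2 * \<beta>) - ball_lead n \<beta> a R\<bar> \<le> K / a^2 * R powr (e - 1 - \<beta>)" if R: "R \<ge> 1" for R
  proof -
    have "ball_inv n \<beta> a 0 R - a powr (2 * \<beta>) - ball_lead n \<beta> a R = (ball_inv n (\<beta> + 1) a 0 R - a powr (2 * (\<beta> + 1))) / a^2"
      using R unfolding ball_inv_lift[OF n _ \<beta> a, of R] a2[symmetric] by (subst ball_inv_lift[OF n _ \<beta> a]) (auto simp: diff_divide_distrib)
    then show ?thesis using divide_right_mono[OF K(2)[OF R], of "a\<^sup>2"] by simp
  qed
  moreover have "K / a^2 \<ge> 0" using K(1) by simp
  ultimately show ?thesis by blast
qed

lemma ball_lead_bound:
  assumes n: "n \<ge> 1" and a: "a > 0"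
  shows "\<exists>K\<ge>0. \<forall>R\<ge>1. \<bar>ball_lead n \<beta> a R\<bar> \<le> K * R powr ((real n - 3) / 2 - \<beta>)"
proof -
  obtain K where K: "K \<ge> 0" "\<And>R. R \<ge> 1 \<Longrightarrow> \<bar>ball_lead n \<beta> a R + P_const n \<beta> a * cos (2 * pi * a * R - (real n - 1 + 2 * \<beta>) / 4 * pi) * R powr ((real n - 3) / 2 - \<beta>)\<bar>
    \<le> K * R powr ((real n - 5) / 2 - \<beta>)"
    using ball_lead_asymp[OF n a, of \<beta>] by blast
  have "\<bar>ball_lead n \<beta> a R\<bar> \<le> (K + \<bar>P_const n \<beta> a\<bar>) * R powr ((real n - 3) / 2 - \<beta>)" if R: "R \<ge> 1" for R
  proof -
    have "K * R powr ((real n - 5) / 2 - \<beta>) \<le> K * R powr ((real n - 3) / 2 - \<beta>)"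
      using R K(1) by (intro mult_left_mono powr_mono) auto
    moreover have "\<bar>P_const n \<beta> a * cos (2 * pi * a * R - (real n - 1 + 2 * \<beta>) / 4 * pi) * R powr ((real n - 3) / 2 - \<beta>)\<bar>
      \<le> \<bar>P_const n \<beta> a\<bar> * 1 * R powr ((real n - 3) / 2 - \<beta>)"
      unfolding abs_mult by (intro mult_mono) auto
    ultimately show ?thesis using K(2)[OF R] by (simp add: distrib_right)
  qed
  moreover have "K + \<bar>P_const n \<beta> a\<bar> \<ge> 0" using K(1) by simp
  ultimately show ?thesis by blast
qed

text \<open>Once the remainder is no larger than the boundary term, the latter alone determines the
  size.\<close>

lemma ball_inv_improve:
  assumes n: "n \<ge> 1" and a: "a > 0" and e: "e - 1 \<le> (real n - 3) / 2"
    and H: "\<exists>K\<ge>0. \<forall>R\<ge>1. \<bar>ball_inv n \<beta> a 0 R - a powr (2 * \<beta>) - ball_lead n \<beta> a R\<bar> \<le> K * R powr (e - 1 - \<beta>)"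
  shows "\<exists>K\<ge>0. \<forall>R\<ge>1. \<bar>ball_inv n \<beta> a 0 R - a powr (2 * \<beta>)\<bar> \<le> K * R powr ((real n - 3) / 2 - \<beta>)"
proof -
  obtain K where K: "K \<ge> 0" "\<And>R. R \<ge> 1 \<Longrightarrow> \<bar>ball_inv n \<beta> a 0 R - a powr (2 * \<beta>) - ball_lead n \<beta> a R\<bar> \<le> K * R powr (e - 1 - \<beta>)"
    using H by blast
  obtain L where L: "L \<ge> 0" "\<And>R. R \<ge> 1 \<Longrightarrow> \<bar>ball_lead n \<beta> a R\<bar> \<le> L * R powr ((real n - 3) / 2 - \<beta>)"
    using ball_lead_bound[OF n a, of \<beta>] by blast
  have "\<bar>ball_inv n \<beta> a 0 R - a powr (2 * \<beta>)\<bar> \<le> (K + L) * R powr ((real n - 3) / 2 - \<beta>)" if R: "R \<ge> 1" for R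
  proof -
    have "K * R powr (e - 1 - \<beta>) \<le> K * R powr ((real n - 3) / 2 - \<beta>)"
      using R K(1) e by (intro mult_left_mono powr_mono) auto
    then show ?thesis using K(2)[OF R] L(2)[OF R] by (simp add: distrib_right)
  qed
  moreover have "K + L \<ge> 0" using K(1) L(1) by simp
  ultimately show ?thesis by blast
qed

text \<open>Descent in \<beta>. Q is the expansion with its boundary term, Q' the mere size bound:
  Q' at \<beta> + 1 yields Q at \<beta> through the lift, and Q yields Q' at the same
  \<beta>.\<close>

lemma ball_inv_zero:
  assumes \<beta>: "\<beta> > -1" and a: "a > 0"
  shows "\<exists>K\<ge>0. \<forall>R\<ge>1. \<bar>ball_inv CARD('n::finite) \<beta> a 0 R - a powr (2 * \<beta>) - ball_lead CARD('n) \<beta> a R\<bar> \<le> K * R powr ((real CARD('n) - 5) / 2 - \<beta>)"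
    and "\<exists>K\<ge>0. \<forall>R\<ge>1. \<bar>ball_inv CARD('n::finite) \<beta> a 0 R - a powr (2 * \<beta>)\<bar> \<le> K * R powr ((real CARD('n) - 3) / 2 - \<beta>)"
proof -
  define n where "n = CARD('n)"
  have n: "n \<ge> 1" unfolding n_def by (rule card_pos)
  define Q where "Q \<beta> \<longleftrightarrow> (\<exists>K\<ge>0. \<forall>R\<ge>1. \<bar>ball_inv n \<beta> a 0 R - a powr (2 * \<beta>) - ball_lead n \<beta> a R\<bar> \<le> K * R powr ((real n - 3) / 2 - 1 - \<beta>))" for \<beta>
  define Q' where "Q' \<beta> \<longleftrightarrow> (\<exists>K\<ge>0. \<forall>R\<ge>1. \<bar>ball_inv n \<beta> a 0 R - a powr (2 * \<beta>)\<bar> \<le> K * R powr ((real n - 3) / 2 - \<beta>))" for \<beta>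
  have QQ': "Q' \<beta>" if "Q \<beta>" for \<beta>
    unfolding Q'_def by (rule ball_inv_improve[OF n a _ that[unfolded Q_def]]) (simp add: field_simps)
  have sh: "(real n - 3) / 2 - 1 - \<beta> = (real n - 3) / 2 - (\<beta> + 1)" for \<beta> by simp
  have Q'Q: "Q \<beta>" if "Q' (\<beta> + 1)" "\<beta> > -1" for \<beta>
    unfolding Q_def using that(1) unfolding Q'_def by (intro ball_inv_step[OF n that(2) a]) (simp only: sh)
  \<comment> \<open>The crude rate at \<beta> + 1 has exponent (n - 1)/2 - (\<beta> + 1), which is
    the exponent of the boundary term at \<beta>. One lift therefore gives the sharp size.\<close>
  have base: "Q' \<beta>" if b: "\<beta> > 0" "\<beta> > (real n - 1) / 2" for \<beta>
  proof -
    have sh': "(real n - 1) / 2 - 1 - \<beta> = (real n - 1) / 2 - (\<beta> + 1)" for \<beta> by simp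
    have "\<exists>K\<ge>0. \<forall>R\<ge>1. \<bar>ball_inv n (\<beta> + 1) a 0 R - a powr (2 * (\<beta> + 1))\<bar> \<le> K * R powr ((real n - 1) / 2 - 1 - \<beta>)"
    proof -
      have "\<beta> + 1 > 0" "\<beta> + 1 > (real CARD('n) - 1) / 2" using b by (auto simp: n_def)
      from ball_inv_base[where 'n = 'n, OF this a] show ?thesis unfolding sh' unfolding n_def .
    qed
    then have "\<exists>K\<ge>0. \<forall>R\<ge>1. \<bar>ball_inv n \<beta> a 0 R - a powr (2 * \<beta>) - ball_lead n \<beta> a R\<bar> \<le> K * R powr ((real n - 1) / 2 - 1 - \<beta>)"
      by (rule ball_inv_step[OF n _ a, rotated]) (use b in simp)
    then show ?thesis unfolding Q'_def by (rule ball_inv_improve[OF n a, rotated]) (simp add: field_simps)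
  qed
  \<comment> \<open>N counts the unit steps of the descent, starting above n. After n + 1 of them
    every \<beta> > -1 is reached.\<close>
  have all: "\<forall>\<beta>. \<beta> > -1 \<and> \<beta> > real n - real N \<longrightarrow> Q \<beta>" for N
  proof (induction N)
    case 0
    have "Q \<beta>" if "\<beta> > -1" "\<beta> > real n" for \<beta> using base[of "\<beta> + 1"] that n by (intro Q'Q) auto
    then show ?case by simp
  next
    case (Suc N)
    then show ?case using QQ' Q'Q by (smt (verit) of_nat_Suc)
  qed
  have "Q \<beta>" using all[of "n + 1"] \<beta> by simp
  moreover have "(real n - 3) / 2 - 1 - \<beta> = (real n - 5) / 2 - \<beta>" by (simp add: field_simps)
  ultimately show "\<exists>K\<ge>0. \<forall>R\<ge>1. \<bar>ball_inv CARD('n) \<beta> a 0 R - a powr (2 * \<beta>) - ball_lead CARD('n) \<beta> a R\<bar> \<le> K * R powr ((real CARD('n) - 5) / 2 - \<beta>)"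
    unfolding Q_def n_def by simp
  show "\<exists>K\<ge>0. \<forall>R\<ge>1. \<bar>ball_inv CARD('n::finite) \<beta> a 0 R - a powr (2 * \<beta>)\<bar> \<le> K * R powr ((real CARD('n) - 3) / 2 - \<beta>)"
    using QQ'[OF \<open>Q \<beta>\<close>] unfolding Q'_def n_def .
qed

lemma lborel_integral_scale:
  fixes f :: "real ^ 'n \<Rightarrow> 'b::{banach, second_countable_topology}"
  assumes "f \<in> Borel" and c: "c > 0"
  shows "(LBINT x. f x) = c ^ CARD('n) *\<^sub>R (LBINT x. f (c *\<^sub>R x))"
  using lborel_integral_affine[of f c 0] assms by simp

text \<open>The multiplication formula, by Fubini; the modulation by k on one side becomes a
  translation on the other.\<close>

lemma four_multiplication:
  fixes F G :: "real ^ 'n \<Rightarrow> complex"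
  assumes F: "integrable lborel F" and G: "integrable lborel G"
  shows "(LBINT \<xi>. four F \<xi> * G \<xi> * ee (k \<bullet> \<xi>)) = (LBINT x. F x * four G (x - k))"
proof -
  have [measurable]: "F \<in> Borel" "G \<in> Borel" using F G by auto
  define f where "f = (\<lambda>(x, \<xi>). F x * (G \<xi> * ee (- ((x - k) \<bullet> \<xi>))))"
  have [measurable]: "f \<in> borel_measurable (lborel \<Otimes>\<^sub>M lborel)" unfolding f_def by measurable
  have "integrable (lborel \<Otimes>\<^sub>M lborel) f"
  proof (rule lborel_pair.Fubini_integrable)
    have "(\<lambda>x. \<integral>y. norm (f (x, y)) \<partial>lborel) = (\<lambda>x. norm (F x) * (LBINT y. norm (G y)))"
      by (auto simp: f_def norm_mult)
    then show "integrable lborel (\<lambda>x. \<integral>y. norm (f (x, y)) \<partial>lborel)" using F by simp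
    show "AE x in lborel. integrable lborel (\<lambda>y. f (x, y))"
      unfolding f_def prod.case by (intro AE_I2 integrable_mult_right integrable_times_ee G) measurable
  qed measurable
  then have "(LBINT \<xi>. \<integral>x. f (x, \<xi>) \<partial>lborel) = (LBINT x. \<integral>\<xi>. f (x, \<xi>) \<partial>lborel)"
    by (rule lborel_pair.Fubini_integral[of "\<lambda>x \<xi>. f (x, \<xi>)", simplified])
  moreover have "(LBINT x. f (x, \<xi>)) = four F \<xi> * G \<xi> * ee (k \<bullet> \<xi>)" for \<xi>
  proof -
    have "(LBINT x. f (x, \<xi>)) = (LBINT x. F x * ee (- (\<xi> \<bullet> x)) * (G \<xi> * ee (k \<bullet> \<xi>)))"
    proof (intro Bochner_Integration.integral_cong refl)
      fix x
      have "- ((x - k) \<bullet> \<xi>) = - (\<xi> \<bullet> x) + k \<bullet> \<xi>" by (simp add: inner_diff_left inner_commute[of \<xi> x])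
      then show "f (x, \<xi>) = F x * ee (- (\<xi> \<bullet> x)) * (G \<xi> * ee (k \<bullet> \<xi>))" by (simp only: f_def prod.case ee_add mult_ac)
    qed
    then show ?thesis by (simp add: four_def)
  qed
  moreover have "(LBINT \<xi>. f (x, \<xi>)) = F x * four G (x - k)" for x
    by (simp add: f_def four_def)
  ultimately show ?thesis by simp
qed

section \<open>Abel summation\<close>

text \<open>Integration by parts writes the mean minus c as an average of B - c against the negative
  derivative q of the weight, where B is the partial integral. As q is of size 1/N, the error is
  controlled by the ordinary mean of |B - c| over [0,N].\<close>

lemma Abel_mean:
  fixes A :: "real \<Rightarrow> real"
  assumes A: "continuous_on UNIV A" and lim: "((\<lambda>R. integral {0..R} A) \<longlongrightarrow> c) at_top" and M: "M \<ge> 1"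
  shows "((\<lambda>N. integral {0..N} (\<lambda>s. A s * (1 - (s / N)^2) ^ M)) \<longlongrightarrow> c) at_top"
proof -
  define B where "B R = integral {0..R} A" for R
  have A': "continuous_on S A" for S using A by (rule continuous_on_subset) simp
  have DB: "(B has_real_derivative A s) (at s within {0..N})" if "s \<in> {0..N}" for s N
    unfolding B_def by (rule integral_has_real_derivative[OF A' that])
  have cB: "continuous_on {0..N} B" for N
    using DB by (meson DERIV_continuous continuous_on_eq_continuous_within)
  define g where "g s = \<bar>B s - c\<bar>" for s
  have cg: "continuous_on {0..N} g" for N unfolding g_def by (intro continuous_intros cB)
  have gi: "g integrable_on {0..N}" for N by (rule integrable_continuous_real[OF cg])
  \<comment> \<open>The mean of a function that tends to 0 tends to 0, by l'Hospital's rule.\<close>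
  have mean: "((\<lambda>N. integral {0..N} g / N) \<longlongrightarrow> 0) at_top"
  proof (rule lhospital_at_top_at_top[where g = "\<lambda>N. N" and g' = "\<lambda>_. 1" and f' = g])
    show "\<forall>\<^sub>F N in at_top. DERIV (\<lambda>N. integral {0..N} g) N :> g N"
      using eventually_gt_at_top[of 0]
    proof eventually_elim
      case (elim N)
      then have "((\<lambda>N. integral {0..N} g) has_real_derivative g N) (at N within {0..N + 1})"
        by (intro integral_has_real_derivative[OF cg]) auto
      then show ?case using elim at_within_Icc_at[of 0 N "N + 1"] by simp
    qed
    show "((\<lambda>x. g x / 1) \<longlongrightarrow> 0) at_top"
      using lim unfolding g_def B_def by (simp add: tendsto_rabs_zero_iff LIM_zero)
  qed (auto simp: filterlim_ident)
  have est: "\<bar>integral {0..N} (\<lambda>s. A s * (1 - (s / N)^2) ^ M) - c\<bar> \<le> 2 * real M * (integral {0..N} g / N)" if N: "N > 0" for N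
  proof -
    define q where "q s = real M * (1 - (s / N)^2) ^ (M - 1) * (2 * s / N^2)" for s
    have "((\<lambda>s. (B s - c) * (1 - (s / N)^2) ^ M) has_real_derivative A s * (1 - (s / N)^2) ^ M - (B s - c) * q s) (at s within {0..N})"
      if "s \<in> {0..N}" for s
    proof -
      have "((\<lambda>s. (1 - (s / N)^2) ^ M) has_real_derivative - q s) (at s within {0..N})"
        unfolding q_def using N by (auto intro!: derivative_eq_intros simp: power2_eq_square)
      from DERIV_mult[OF DERIV_diff[OF DB[OF that] DERIV_const] this] show ?thesis by (simp add: algebra_simps)
    qed
    then have "((\<lambda>s. A s * (1 - (s / N)^2) ^ M - (B s - c) * q s) has_integral
      ((B N - c) * (1 - (N / N)^2) ^ M - (B 0 - c) * (1 - (0 / N)^2) ^ M)) {0..N}"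
      using N by (intro fundamental_theorem_of_calculus) (auto simp: has_real_derivative_iff_has_vector_derivative)
    moreover have "(B N - c) * (1 - (N / N)^2) ^ M - (B 0 - c) * (1 - (0 / N)^2) ^ M = c"
      using N M by (simp add: B_def)
    ultimately have "integral {0..N} (\<lambda>s. A s * (1 - (s / N)^2) ^ M - (B s - c) * q s) = c"
      by (simp add: integral_unique)
    moreover have i1: "(\<lambda>s. A s * (1 - (s / N)^2) ^ M) integrable_on {0..N}"
      using N by (intro integrable_continuous_real continuous_intros A') auto
    moreover have i2: "(\<lambda>s. (B s - c) * q s) integrable_on {0..N}"
      unfolding q_def using N by (intro integrable_continuous_real continuous_intros cB) auto
    ultimately have e: "integral {0..N} (\<lambda>s. A s * (1 - (s / N)^2) ^ M) - c = integral {0..N} (\<lambda>s. (B s - c) * q s)"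
      using integral_diff[OF i1 i2] by simp
    have "norm (integral {0..N} (\<lambda>s. (B s - c) * q s)) \<le> integral {0..N} (\<lambda>s. 2 * real M / N * g s)"
    proof (rule integral_norm_bound_integral[OF i2])
      show "(\<lambda>s. 2 * real M / N * g s) integrable_on {0..N}" by (intro integrable_on_mult_right gi)
      fix s assume s: "s \<in> {0..N}"
      have u: "s / N \<in> {0..1}" using s N by simp
      have "(s / N)^2 \<le> 1" using u by (simp add: power_le_one)
      then have "(1 - (s / N)^2) ^ (M - 1) \<in> {0..1}" by (simp add: power_le_one)
      then have "\<bar>q s\<bar> \<le> real M * 1 * (2 / N)"
        unfolding q_def abs_mult using u N by (intro mult_mono) (auto simp: power2_eq_square field_simps)
      then have "\<bar>q s\<bar> * \<bar>B s - c\<bar> \<le> 2 * real M / N * \<bar>B s - c\<bar>" by (intro mult_right_mono) (auto simp: mult.commute)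
      then show "norm ((B s - c) * q s) \<le> 2 * real M / N * g s" by (simp add: g_def abs_mult mult_ac)
    qed
    then show ?thesis unfolding e by simp
  qed
  have "((\<lambda>N. integral {0..N} (\<lambda>s. A s * (1 - (s / N)^2) ^ M) - c) \<longlongrightarrow> 0) at_top"
  proof (rule Lim_null_comparison)
    show "\<forall>\<^sub>F N in at_top. norm (integral {0..N} (\<lambda>s. A s * (1 - (s / N)^2) ^ M) - c) \<le> 2 * real M * (integral {0..N} g / N)"
      using eventually_gt_at_top[of 0] by eventually_elim (unfold real_norm_def, rule est)
    show "((\<lambda>N. 2 * real M * (integral {0..N} g / N)) \<longlongrightarrow> 0) at_top"
      using tendsto_mult_left[OF mean, of "2 * real M"] by simp
  qed
  then show ?thesis by (rule Lim_null[THEN iffD2])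
qed

lemma decay_le_1: "M \<ge> 0 \<Longrightarrow> decay M x \<le> 1"
  using powr_mono[of "- M" 0 "1 + norm x"] by (simp add: decay_def split: if_splits)

text \<open>U may be unbounded away from k, so only integrability is used there. The limit V may
  depend on the direction y: on the sphere the rescaled ball indicator tends to a half-space, not to
  a constant.\<close>

lemma approximate_identity:
  fixes U V :: "real ^ 'n \<Rightarrow> complex" and \<psi> :: "real ^ 'n \<Rightarrow> real"
  assumes U: "integrable lborel U" and \<psi> [measurable]: "\<psi> \<in> Borel"
    and M: "M > real CARD('n)" and b: "\<And>y. \<bar>\<psi> y\<bar> \<le> K * decay M y"
    and r: "r > 0" "\<And>x. norm (x - k) < r \<Longrightarrow> norm (U x) \<le> B"
    and V: "\<And>y. (\<lambda>j. U (y /\<^sub>R real (Suc j) + k)) \<longlonglongrightarrow> V y"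
  shows "(\<lambda>j. \<integral>x. U x * of_real (real (Suc j) ^ CARD('n) * \<psi> (real (Suc j) *\<^sub>R (x - k))) \<partial>lborel)
     \<longlonglongrightarrow> (LBINT y. V y * of_real (\<psi> y))"
proof -
  define n where "n = CARD('n)"
  have [measurable]: "U \<in> Borel" using U by auto
  have K: "K \<ge> 0" using b[of 0] decay_pos[of M "0 :: real ^ 'n"] by (smt (verit) mult_neg_pos)
  have B: "B \<ge> 0" using order_trans[OF norm_ge_zero r(2)[of k]] r(1) by simp
  define S where "S = {x :: real ^ 'n. norm (x - k) < r}"
  have [measurable]: "S \<in> sets borel" unfolding S_def by measurable
  define U1 where "U1 x = indicator S x *\<^sub>R U x" for x
  define U2 where "U2 x = indicator (- S) x *\<^sub>R U x" for x
  have [measurable]: "U1 \<in> Borel" "U2 \<in> Borel"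
    unfolding U1_def U2_def by measurable
  define N where "N j = real (Suc j)" for j
  let ?q = "\<lambda>j x. \<psi> (N j *\<^sub>R (x - k))"
  have N: "N j \<ge> 1" "N j > 0" for j by (auto simp: N_def)
  define T where "T W j = (LBINT x. W x * of_real (N j ^ n * ?q j x))" for W :: "real ^ 'n \<Rightarrow> complex" and j
  have i: "integrable lborel (\<lambda>x. W x * complex_of_real (N j ^ n * ?q j x))"
    if W[measurable]: "W \<in> Borel" and "\<And>x. norm (W x) \<le> norm (U x)" for W j
  proof (rule Bochner_Integration.integrable_bound)
    show "integrable lborel (\<lambda>x. norm (U x) * (N j ^ n * K))" using U by simp
    show "AE x in lborel. norm (W x * complex_of_real (N j ^ n * ?q j x)) \<le> norm (norm (U x) * (N j ^ n * K))"
    proof (rule AE_I2)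
      fix x
      have "\<bar>?q j x\<bar> \<le> K * 1"
        by (rule order_trans[OF b mult_left_mono[OF decay_le_1 K]]) (use M in simp)
      then show "norm (W x * complex_of_real (N j ^ n * ?q j x)) \<le> norm (norm (U x) * (N j ^ n * K))"
        unfolding norm_mult norm_of_real abs_mult using that(2)[of x] N(2)[of j] K by (intro mult_mono) auto
    qed
  qed measurable
  have split: "T U j = T U1 j + T U2 j" for j
  proof -
    have "T U1 j + T U2 j = (LBINT x. U1 x * of_real (N j ^ n * ?q j x) + U2 x * of_real (N j ^ n * ?q j x))"
      unfolding T_def by (intro Bochner_Integration.integral_add[symmetric] i) (auto simp: U1_def U2_def indicator_def)
    also have "\<dots> = T U j"
      unfolding T_def by (intro Bochner_Integration.integral_cong) (auto simp: U1_def U2_def indicator_def)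
    finally show ?thesis by simp
  qed
  \<comment> \<open>Rescaling by N about k removes the factor N^n. The bound B near k gives a
    dominating function, and the pointwise limit is V.\<close>
  have near: "T U1 \<longlonglongrightarrow> (LBINT y. V y * of_real (\<psi> y))"
  proof -
    have e: "T U1 j = (LBINT y. U1 (y /\<^sub>R N j + k) * of_real (\<psi> y))" for j
    proof -
      have "T U1 j = (LBINT x. U1 (x + k) * of_real (N j ^ n * \<psi> (N j *\<^sub>R (x + k - k))))"
        unfolding T_def by (rule lborel_integral_translate[symmetric]) measurable
      also have "\<dots> = (1 / N j) ^ n *\<^sub>R (LBINT y. U1 ((1 / N j) *\<^sub>R y + k) * of_real (N j ^ n * \<psi> (N j *\<^sub>R ((1 / N j) *\<^sub>R y + k - k))))"
        unfolding n_def using N(2)[of j] by (intro lborel_integral_scale) auto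
      also have "\<dots> = (1 / N j) ^ n *\<^sub>R (LBINT y. of_real (N j ^ n) * (U1 (y /\<^sub>R N j + k) * of_real (\<psi> y)))"
        using N(2)[of j] by (intro arg_cong2[where f = scaleR] Bochner_Integration.integral_cong) (auto simp: inverse_eq_divide)
      also have "\<dots> = (LBINT y. U1 (y /\<^sub>R N j + k) * of_real (\<psi> y))"
        using N(2)[of j] by (simp add: scaleR_conv_of_real power_divide)
      finally show ?thesis .
    qed
    show ?thesis unfolding e
    proof (rule integral_dominated_convergence)
      show "integrable lborel (\<lambda>y :: real ^ 'n. B * (K * decay M y))" by (intro integrable_mult_right integrable_decay M)
      show "AE y in lborel. (\<lambda>j. U1 (y /\<^sub>R N j + k) * complex_of_real (\<psi> y)) \<longlonglongrightarrow> V y * complex_of_real (\<psi> y)"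
      proof (intro AE_I2 tendsto_mult tendsto_const)
        fix y :: "real ^ 'n"
        have "(\<lambda>j. norm y * inverse (real (Suc j))) \<longlonglongrightarrow> norm y * 0"
          by (intro tendsto_mult tendsto_const LIMSEQ_inverse_real_of_nat)
        then have "\<forall>\<^sub>F j in sequentially. norm y * inverse (real (Suc j)) < r"
          by (rule order_tendstoD) (use r in simp)
        then have "\<forall>\<^sub>F j in sequentially. U (y /\<^sub>R real (Suc j) + k) = U1 (y /\<^sub>R N j + k)"
          by eventually_elim (auto simp: U1_def S_def N_def mult.commute simp del: of_nat_Suc)
        then show "(\<lambda>j. U1 (y /\<^sub>R N j + k)) \<longlonglongrightarrow> V y"
          using V[of y] by (rule Lim_transform_eventually[rotated])
      qed
      have [measurable]: "V \<in> Borel"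
        by (rule borel_measurable_LIMSEQ_metric[OF _ V]) measurable
      show "(\<lambda>y. V y * complex_of_real (\<psi> y)) \<in> borel_measurable lborel" by measurable
      show "AE y in lborel. norm (U1 (y /\<^sub>R N j + k) * complex_of_real (\<psi> y)) \<le> B * (K * decay M y)" for j
        unfolding norm_mult norm_of_real using r(2) B
        by (intro AE_I2 mult_mono b) (auto simp: U1_def S_def indicator_def)
    qed measurable
  qed
  \<comment> \<open>At distance r or more from k the dilated kernel is O(N^(n-M)) uniformly, and M >
    n.\<close>
  have far: "T U2 \<longlonglongrightarrow> 0"
  proof (rule Lim_null_comparison)
    show "\<forall>\<^sub>F j in sequentially. norm (T U2 j) \<le> (LBINT x. norm (U x)) * (K * r powr (- M)) * N j powr (real n - M)"
    proof (intro always_eventually allI)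
      fix j
      have "norm (T U2 j) \<le> (LBINT x. norm (U x) * (K * r powr (- M) * N j powr (real n - M)))"
        unfolding T_def
      proof (rule order_trans[OF integral_norm_bound], rule integral_mono)
        show "integrable lborel (\<lambda>x. norm (U2 x * complex_of_real (N j ^ n * ?q j x)))"
          by (intro integrable_norm i) (auto simp: U2_def indicator_def)
        show "integrable lborel (\<lambda>x. norm (U x) * (K * r powr (- M) * N j powr (real n - M)))" using U by simp
        fix x :: "real ^ 'n"
        show "norm (U2 x * complex_of_real (N j ^ n * ?q j x)) \<le> norm (U x) * (K * r powr (- M) * N j powr (real n - M))"
        proof (cases "x \<in> S")
          case True
          then show ?thesis using K by (simp add: U2_def)
        next
          case False
          then have xr: "norm (x - k) \<ge> r" by (simp add: S_def)
          have "N j * r \<le> 1 + norm (N j *\<^sub>R (x - k))"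
            using add_increasing[OF zero_le_one mult_left_mono[OF xr less_imp_le[OF N(2)[of j]]]] N(2)[of j] by (simp only: norm_scaleR abs_of_pos)
          then have "decay M (N j *\<^sub>R (x - k)) \<le> (N j * r) powr (- M)"
            unfolding decay_def using M N(2)[of j] r(1) by (intro powr_mono2') auto
          then have "\<bar>?q j x\<bar> \<le> K * (N j powr (- M) * r powr (- M))"
            using b[of "N j *\<^sub>R (x - k)"] K mult_left_mono[of "decay M (N j *\<^sub>R (x - k))" _ K] N(2)[of j] r(1)
            by (fastforce simp: powr_mult)
          then have "N j ^ n * \<bar>?q j x\<bar> \<le> N j powr n * (K * (N j powr (- M) * r powr (- M)))"
            using N(2)[of j] by (simp add: powr_realpow)
          also have "\<dots> = K * r powr (- M) * (N j powr n * N j powr (- M))" by simp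
          also have "N j powr n * N j powr (- M) = N j powr (real n - M)" by (simp add: powr_add[symmetric])
          finally have "norm (U x) * (N j ^ n * \<bar>?q j x\<bar>) \<le> norm (U x) * (K * r powr (- M) * N j powr (real n - M))"
            by (intro mult_left_mono) auto
          then show ?thesis using False N(2)[of j] by (simp add: U2_def norm_mult norm_power abs_mult)
        qed
      qed
      then show "norm (T U2 j) \<le> (LBINT x. norm (U x)) * (K * r powr (- M)) * N j powr (real n - M)" by (simp add: mult.assoc)
    qed
    have "filterlim N at_top sequentially"
      unfolding N_def using filterlim_compose[OF filterlim_real_sequentially filterlim_Suc] .
    then have "(\<lambda>j. N j powr (real n - M)) \<longlonglongrightarrow> 0"
      using M by (intro tendsto_neg_powr) (auto simp: n_def)
    then show "(\<lambda>j. (LBINT x. norm (U x)) * (K * r powr (- M)) * N j powr (real n - M)) \<longlonglongrightarrow> 0"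
      by (rule tendsto_mult_right_zero)
  qed
  show ?thesis using tendsto_add[OF near far] unfolding split[symmetric] by (simp add: T_def N_def n_def)
qed

lemma ball_ft_scale: "N > 0 \<Longrightarrow> ball_ft n \<beta> N s = N powr (real n + 2 * \<beta>) * ball_ft n \<beta> 1 (N * s)"
  by (simp add: ball_ft_def mult_ac)

text \<open>The weight (1 - (s/N)^2)^M is, up to the factor c, the profile of a ball power of radius
  N and exponent M. Its transform is therefore explicit, and the multiplication formula turns the
  mean of the inversion integral into U tested against a dilated kernel.\<close>

lemma integral_ball_ft_profile:
  fixes k :: "real ^ 'n"
  assumes \<beta>: "\<beta> > -1" and a: "a > 0" and M: "M \<ge> 1" and N: "N > 0"
  shows "of_real (integral {0..N} (\<lambda>s. radial_weight CARD('n) (norm k) s * ball_ft CARD('n) \<beta> a s * (1 - (s / N)^2) ^ M))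
    = (LBINT x. ball_power \<beta> a x * of_real (N ^ CARD('n) * ball_ft CARD('n) (real M) 1 (norm (N *\<^sub>R (x - k)))))"
proof -
  define n where "n = CARD('n)"
  define c where "c = N powr (- 2 * real M)"
  have M': "real M > -1" by simp
  have prof: "c * ball_profile (real M) N s = (1 - (s / N)^2) ^ M" if s: "s \<in> {0..<N}" for s
  proof -
    have "s\<^sup>2 < N^2" using s by (intro power_strict_mono) auto
    then have "(N^2 - s^2) powr real M = (N^2 - s^2) ^ M" by (simp add: powr_realpow)
    moreover have "c = inverse ((N^2) ^ M)"
      using N powr_realpow[of N "2 * M"] by (simp add: c_def powr_minus power_mult)
    moreover have "1 - (s / N)^2 = (N^2 - s^2) / N^2" using N by (simp add: power_divide diff_divide_distrib)
    ultimately show ?thesis using s by (simp add: ball_profile_def power_divide divide_simps)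
  qed
  define f where "f s = ball_ft n \<beta> a s * (c * ball_profile (real M) N s)" for s
  have [measurable]: "f \<in> Borel" unfolding f_def by measurable
  obtain K where K: "K > 0" "\<And>s. s \<ge> 0 \<Longrightarrow> \<bar>ball_ft n \<beta> a s\<bar> \<le> K * (1 + s) powr (- ((real n + 1) / 2 + \<beta>))"
    using ball_ft_bound[OF a, of n \<beta>] by blast
  have K1: "\<bar>ball_ft n \<beta> a s\<bar> \<le> K" if "s \<ge> 0" for s
  proof -
    have "(1 + s) powr (- ((real n + 1) / 2 + \<beta>)) \<le> (1 + s) powr 0"
    proof (rule powr_mono)
      have "(real n + 1) / 2 \<ge> 1" using card_pos[where 'n = 'n] by (simp add: n_def)
      then show "- ((real n + 1) / 2 + \<beta>) \<le> 0" using \<beta> by linarith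
    qed (use that in simp)
    then have "K * (1 + s) powr (- ((real n + 1) / 2 + \<beta>)) \<le> K * 1" using K(1) that by (intro mult_left_mono) auto
    then show ?thesis using K(2)[OF that] by simp
  qed
  have intf: "integrable lborel (\<lambda>x :: real ^ 'n. f (norm x))"
  proof (rule Bochner_Integration.integrable_bound)
    show "integrable lborel (\<lambda>x :: real ^ 'n. (K * c) * ball_profile (real M) N (norm x))"
      by (intro integrable_mult_right integrable_ball_profile M' N)
    show "AE x in lborel. norm (f (norm (x :: real ^ 'n))) \<le> norm ((K * c) * ball_profile (real M) N (norm x))"
      unfolding f_def norm_mult mult.assoc using K1 K(1) by (intro AE_I2 mult_right_mono) auto
  qed measurable
  have "of_real (LBINT s. indicator {0..} s * (radial_weight n (norm k) s * f s))
     = (LBINT x. of_real (f (norm x)) * ee (k \<bullet> x))"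
    unfolding n_def by (rule integral_radial_ee[symmetric, OF _ intf]) measurable
  also have "(LBINT s. indicator {0..} s * (radial_weight n (norm k) s * f s))
     = integral {0..N} (\<lambda>s. radial_weight n (norm k) s * ball_ft n \<beta> a s * (1 - (s / N)^2) ^ M)"
  proof -
    have "indicator {0..} s * (radial_weight n (norm k) s * f s)
       = indicator {0..N} s * (radial_weight n (norm k) s * ball_ft n \<beta> a s * (1 - (s / N)^2) ^ M)" for s
    proof -
      consider "s < 0" | "s \<in> {0..<N}" | "s = N" | "s > N" by fastforce
      then show ?thesis
      proof cases
        case 2
        then show ?thesis unfolding f_def prof[OF 2] by (simp add: indicator_def)
      next
        case 3
        then show ?thesis using M N by (simp add: f_def ball_profile_def indicator_def)
      qed (use N in \<open>auto simp: f_def ball_profile_def indicator_def\<close>)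
    qed
    then show ?thesis
      using N by (simp only:) (intro integral_Icc_eq_lborel continuous_intros; simp)
  qed
  also have "(LBINT x. of_real (f (norm x)) * ee (k \<bullet> x))
    = (LBINT x. four (ball_power \<beta> a) x * (of_real c * ball_power (real M) N x) * ee (k \<bullet> x))"
    unfolding four_ball_power[OF \<beta> a] by (simp add: f_def n_def ball_power_eq_profile)
  also have "\<dots> = (LBINT x. ball_power \<beta> a x * four (\<lambda>x. of_real c * ball_power (real M) N x) (x - k))"
    by (intro four_multiplication integrable_ball_power \<beta> a integrable_mult_right M' N)
  also have "\<dots> = (LBINT x. ball_power \<beta> a x * of_real (N ^ n * ball_ft n (real M) 1 (norm (N *\<^sub>R (x - k)))))"
  proof (intro Bochner_Integration.integral_cong refl)
    fix x
    have "four (\<lambda>x. of_real c * ball_power (real M) N x) (x - k) = of_real c * four (ball_power (real M) N) (x - k)"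
      by (simp add: four_def mult.assoc)
    also have "\<dots> = of_real (c * ball_ft n (real M) N (norm (x - k)))"
      unfolding four_ball_power[OF M' N] by (simp add: n_def)
    also have "c * ball_ft n (real M) N (norm (x - k)) = N ^ n * ball_ft n (real M) 1 (norm (N *\<^sub>R (x - k)))"
    proof -
      have "c * N powr (real n + 2 * real M) = N powr real n" unfolding c_def powr_add[symmetric] by simp
      then show ?thesis using N by (simp add: ball_ft_scale[OF N] powr_realpow mult.assoc[symmetric])
    qed
    finally show "ball_power \<beta> a x * four (\<lambda>x. of_real c * ball_power (real M) N x) (x - k)
       = ball_power \<beta> a x * of_real (N ^ n * ball_ft n (real M) 1 (norm (N *\<^sub>R (x - k))))" by simp
  qed
  finally show ?thesis by (simp add: n_def)
qed

text \<open>If the inversion integral converges, its means have the same limit, and the means are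
  computed by the approximate identity. The exponent n + 1 makes the kernel decay faster than the
  power n.\<close>

lemma ball_inv_limit_eq_integral:
  fixes k :: "real ^ 'n" and V :: "real ^ 'n \<Rightarrow> complex"
  assumes \<beta>: "\<beta> > -1" and a: "a > 0" and lim: "(ball_inv CARD('n) \<beta> a (norm k) \<longlongrightarrow> c) at_top"
    and r: "r > 0" "\<And>x. norm (x - k) < r \<Longrightarrow> norm (ball_power \<beta> a x) \<le> B"
    and V: "\<And>y. (\<lambda>j. ball_power \<beta> a (y /\<^sub>R real (Suc j) + k)) \<longlonglongrightarrow> V y"
  shows "of_real c = (LBINT y. V y * of_real (ball_ft CARD('n) (real (CARD('n) + 1)) 1 (norm y)))"
proof -
  define n where "n = CARD('n)"
  have "((\<lambda>N. integral {0..N} (\<lambda>s. radial_weight n (norm k) s * ball_ft n \<beta> a s * (1 - (s / N)^2) ^ (n + 1))) \<longlongrightarrow> c) at_top"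
    using lim by (intro Abel_mean continuous_intros) (auto simp: ball_inv_def[abs_def] n_def)
  moreover have "filterlim (\<lambda>j. real (Suc j)) at_top sequentially"
    using filterlim_compose[OF filterlim_real_sequentially filterlim_Suc] .
  ultimately have "(\<lambda>j. integral {0..real (Suc j)} (\<lambda>s. radial_weight n (norm k) s * ball_ft n \<beta> a s * (1 - (s / real (Suc j))^2) ^ (n + 1))) \<longlonglongrightarrow> c"
    by (rule filterlim_compose)
  then have "(\<lambda>j. complex_of_real (integral {0..real (Suc j)} (\<lambda>s. radial_weight n (norm k) s * ball_ft n \<beta> a s * (1 - (s / real (Suc j))^2) ^ (n + 1)))) \<longlonglongrightarrow> of_real c"
    by (rule tendsto_of_real)
  moreover have "complex_of_real (integral {0..real (Suc j)} (\<lambda>s. radial_weight n (norm k) s * ball_ft n \<beta> a s * (1 - (s / real (Suc j))^2) ^ (n + 1)))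
     = (LBINT x. ball_power \<beta> a x * of_real (real (Suc j) ^ n * ball_ft n (real (n + 1)) 1 (norm (real (Suc j) *\<^sub>R (x - k)))))" for j
    unfolding n_def by (intro integral_ball_ft_profile \<beta> a) auto
  ultimately have l1: "(\<lambda>j. \<integral>x. ball_power \<beta> a x * of_real (real (Suc j) ^ n * ball_ft n (real (n + 1)) 1 (norm (real (Suc j) *\<^sub>R (x - k)))) \<partial>lborel) \<longlonglongrightarrow> of_real c"
    by (simp only:)
  obtain K where K: "\<And>\<xi> :: real ^ 'n. \<bar>ball_ft n (real (n + 1)) 1 (norm \<xi>)\<bar> \<le> K * decay ((real n + 1) / 2 + real (n + 1)) \<xi>"
    using ball_ft_decay[of 1 n "real (n + 1)", where 'n = 'n] by auto
  have "(\<lambda>j. \<integral>x. ball_power \<beta> a x * of_real (real (Suc j) ^ CARD('n) * ball_ft n (real (n + 1)) 1 (norm (real (Suc j) *\<^sub>R (x - k)))) \<partial>lborel)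
     \<longlonglongrightarrow> (LBINT y. V y * of_real (ball_ft n (real (n + 1)) 1 (norm y)))"
    by (rule approximate_identity[OF integrable_ball_power[OF \<beta> a] _ _ K r V])
       (use card_pos[where 'n = 'n] in \<open>auto simp: n_def field_simps\<close>)
  with l1 show ?thesis unfolding n_def by (intro LIMSEQ_unique)
qed

text \<open>At a point of continuity the kernel, of total mass 1, reproduces the value of the ball
  power. On the sphere with \<beta> = 0 the function jumps; the even kernel sees a half-space and
  returns 1/2. Unboundedness near the sphere for \<beta> < 0 explains the last hypothesis.\<close>

lemma ball_inv_limit:
  fixes k :: "real ^ 'n"
  assumes \<beta>: "\<beta> > -1" and a: "a > 0" and lim: "(ball_inv CARD('n) \<beta> a (norm k) \<longlongrightarrow> c) at_top"
    and ok: "norm k \<noteq> a \<or> \<beta> \<ge> 0"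
  shows "c = (if norm k = a \<and> \<beta> = 0 then 1 / 2 else ball_profile \<beta> a (norm k))"
proof -
  define n where "n = CARD('n)"
  define G where "G = (\<lambda>y :: real ^ 'n. ball_ft n (real (n + 1)) 1 (norm y))"
  have M: "real (n + 1) > 0" "real (n + 1) > (real CARD('n) - 1) / 2" "(1::real) > 0"
    using card_pos[where 'n = 'n] by (auto simp: n_def field_simps)
  have "(LBINT \<xi>. complex_of_real (G \<xi>) * ee (\<xi> \<bullet> 0)) = ball_power (real (n + 1)) 1 (0 :: real ^ 'n)"
    unfolding G_def n_def by (rule ball_inversion(1)[OF M[unfolded n_def]])
  then have G1: "(LBINT \<xi>. complex_of_real (G \<xi>)) = 1" by (simp add: ball_power_def)
  have Gi: "integrable lborel G"
    unfolding G_def n_def by (rule ball_inversion(2)[OF M[unfolded n_def]])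
  show ?thesis
  proof (cases "norm k = a \<and> \<beta> = 0")
    case False
    have "isCont (ball_power \<beta> a) k"
    proof (cases "norm k = a")
      case True
      then have "\<beta> > 0" using False ok by auto
      then show ?thesis using continuous_on_ball_power[OF _ a] continuous_on_eq_continuous_at open_UNIV by blast
    next
      case ne: False
      show ?thesis
      proof (cases "norm k < a")
        case True
        then have "k \<in> {x. norm x < a}" by simp
        moreover have "open {x :: real ^ 'n. norm x < a}" by (intro open_Collect_less continuous_intros)
        ultimately have "\<forall>\<^sub>F x in nhds k. norm x < a" using eventually_nhds by blast
        then have "\<forall>\<^sub>F x in nhds k. ball_power \<beta> a x = complex_of_real ((a^2 - (norm x)^2) powr \<beta>)"
          by eventually_elim (simp add: ball_power_def)
        then have ev: "isCont (ball_power \<beta> a) k \<longleftrightarrow> isCont (\<lambda>x. complex_of_real ((a^2 - (norm x)^2) powr \<beta>)) k"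
          by (rule isCont_cong)
        have "(norm k)^2 < a^2" using True by (intro power_strict_mono) auto
        then have "isCont (\<lambda>x. complex_of_real ((a^2 - (norm x)^2) powr \<beta>)) k"
          by (intro continuous_intros) auto
        then show ?thesis using ev by (simp only:)
      next
        case False
        then have "k \<in> {x. norm x > a}" using ne by simp
        moreover have "open {x :: real ^ 'n. norm x > a}" by (intro open_Collect_less continuous_intros)
        ultimately have "\<forall>\<^sub>F x in nhds k. norm x > a" using eventually_nhds by blast
        then have "\<forall>\<^sub>F x in nhds k. ball_power \<beta> a x = 0"
          by eventually_elim (simp add: ball_power_def)
        then have "isCont (ball_power \<beta> a) k \<longleftrightarrow> isCont (\<lambda>x. 0 :: complex) k" by (rule isCont_cong)
        then show ?thesis by simp
      qed
    qed
    then have lim0: "ball_power \<beta> a \<midarrow>k\<rightarrow> ball_power \<beta> a k" by (simp add: isCont_def)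
    then obtain r where r: "r > 0" "\<And>x. x \<noteq> k \<and> norm (x - k) < r \<Longrightarrow> norm (ball_power \<beta> a x - ball_power \<beta> a k) < 1"
      using LIM_D[OF lim0, of 1] by auto
    have b: "norm (ball_power \<beta> a x) \<le> norm (ball_power \<beta> a k) + 1" if "norm (x - k) < r" for x
      using r(2)[of x] that norm_triangle_sub[of "ball_power \<beta> a x" "ball_power \<beta> a k"] by (cases "x = k") auto
    have V: "(\<lambda>j. ball_power \<beta> a (y /\<^sub>R real (Suc j) + k)) \<longlonglongrightarrow> ball_power \<beta> a k" for y :: "real ^ 'n"
    proof (rule isCont_tendsto_compose[OF \<open>isCont (ball_power \<beta> a) k\<close>])
      have "(\<lambda>j. inverse (real (Suc j)) *\<^sub>R y + k) \<longlonglongrightarrow> 0 *\<^sub>R y + k"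
        by (intro tendsto_intros LIMSEQ_inverse_real_of_nat)
      then show "(\<lambda>j. y /\<^sub>R real (Suc j) + k) \<longlonglongrightarrow> k" by simp
    qed
    have "of_real c = (LBINT y. ball_power \<beta> a k * of_real (G y))"
      unfolding G_def n_def by (rule ball_inv_limit_eq_integral[OF \<beta> a lim r(1) b V])
    then have "complex_of_real c = ball_power \<beta> a k" using G1 by simp
    then show ?thesis using False by (auto simp: ball_power_eq_profile)
  next
    case True
    have b: "norm (ball_power \<beta> a x) \<le> 1" for x :: "real ^ 'n" using True by (auto simp: ball_power_def)
    \<comment> \<open>The tangent half-space at k on the side of the ball: in the blow-up at k the
      ball tends to it.\<close>
    define V where "V y = complex_of_real (indicator {y. k \<bullet> y < 0} y)" for y
    have V: "(\<lambda>j. ball_power \<beta> a (y /\<^sub>R real (Suc j) + k)) \<longlonglongrightarrow> V y" for y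
    proof -
      have kk: "k \<bullet> k = a^2" using True by (simp add: power2_norm_eq_inner[symmetric])
      \<comment> \<open>Expansion of the square of |y/N + k| with |k| = a. For large N the sign is
        that of k y, and for k y = 0 the point never lies in the open ball, in agreement with
        V.\<close>
      have pos: "norm (y /\<^sub>R N + k) < a \<longleftrightarrow> 2 * (k \<bullet> y) + (norm y)^2 * inverse N < 0" if N: "N > 0" for N
      proof -
        have "norm (y /\<^sub>R N + k) < a \<longleftrightarrow> (norm (y /\<^sub>R N + k))^2 < a^2"
          using a by (auto intro: power_strict_mono dest: power2_less_imp_less)
        also have "(norm (y /\<^sub>R N + k))^2 = a^2 + (2 * (k \<bullet> y) + (norm y)^2 * inverse N) * inverse N"
          unfolding power2_norm_eq_inner inner_add_left inner_add_right inner_scaleR_left inner_scaleR_right inner_commute[of y k]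
          by (simp add: kk algebra_simps)
        also have "\<dots> < a^2 \<longleftrightarrow> 2 * (k \<bullet> y) + (norm y)^2 * inverse N < 0"
          using N by (simp add: mult_less_0_iff)
        finally show ?thesis .
      qed
      have "\<forall>\<^sub>F j in sequentially. V y = ball_power \<beta> a (y /\<^sub>R real (Suc j) + k)"
      proof (cases "k \<bullet> y < 0")
        case neg: True
        have "(\<lambda>j. 2 * (k \<bullet> y) + (norm y)^2 * inverse (real (Suc j))) \<longlonglongrightarrow> 2 * (k \<bullet> y) + (norm y)^2 * 0"
          by (intro tendsto_intros LIMSEQ_inverse_real_of_nat)
        then have "\<forall>\<^sub>F j in sequentially. 2 * (k \<bullet> y) + (norm y)^2 * inverse (real (Suc j)) < 0"
          by (rule order_tendstoD) (use neg in simp)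
        then show ?thesis
        proof eventually_elim
          case (elim j)
          then have l: "norm (y /\<^sub>R real (Suc j) + k) < a" by (subst pos) auto
          then have "(norm (y /\<^sub>R real (Suc j) + k))^2 < a^2" by (intro power_strict_mono) auto
          with l show ?case using True neg by (simp add: ball_power_def V_def del: of_nat_Suc)
        qed
      next
        case nn: False
        have "\<not> norm (y /\<^sub>R real (Suc j) + k) < a" for j using nn by (subst pos) (auto simp: not_less)
        then show ?thesis using nn by (simp add: ball_power_def V_def del: of_nat_Suc)
      qed
      then show ?thesis by (rule Lim_transform_eventually[OF tendsto_const])
    qed
    have c: "of_real c = (LBINT y. V y * of_real (G y))"
      unfolding G_def n_def by (rule ball_inv_limit_eq_integral[OF \<beta> a lim zero_less_one b V])
    have [measurable]: "G \<in> Borel" "V \<in> Borel" unfolding G_def V_def by measurable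
    have iV: "integrable lborel (\<lambda>y. V (s y) * of_real (G y))" if [measurable]: "s \<in> Borel" for s :: "real ^ 'n \<Rightarrow> real ^ 'n"
      by (rule Bochner_Integration.integrable_bound[OF Gi]) (auto simp: V_def indicator_def)
    \<comment> \<open>The half-space and its reflection carry equal mass, and together they fill the
      space up to a hyperplane of measure zero. So 2c = 1.\<close>
    have "(LBINT y. V y * complex_of_real (G y)) = (LBINT y. V (- y) * of_real (G (- y)))"
      by (rule lborel_integral_uminus[symmetric]) measurable
    also have "\<dots> = (LBINT y. V (- y) * of_real (G y))" by (simp add: G_def)
    finally have c2: "of_real c = (LBINT y. V (- y) * of_real (G y))" using c by simp
    have k0: "k \<noteq> 0" using True a by auto
    have "AE y in lborel. y \<notin> {y. k \<bullet> y = 0}"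
    proof (rule AE_not_in)
      have "{y. k \<bullet> y = 0} \<in> null_sets lebesgue" using negligible_hyperplane[of k 0] k0 by (simp add: negligible_iff_null_sets)
      moreover have "{y. k \<bullet> y = 0} \<in> sets lborel" by measurable
      ultimately show "{y. k \<bullet> y = 0} \<in> null_sets lborel" by (simp add: null_sets_completion_iff)
    qed
    then have "AE y in lborel. V y * of_real (G y) + V (- y) * of_real (G y) = of_real (G y)"
      by eventually_elim (auto simp: V_def indicator_def)
    then have "(LBINT y. V y * of_real (G y) + V (- y) * of_real (G y)) = (LBINT y. complex_of_real (G y))"
      by (intro integral_cong_AE) measurable
    then have "complex_of_real c + of_real c = 1"
      using Bochner_Integration.integral_add[OF iV[of "\<lambda>y. y"] iV[of uminus]] c c2 G1 by simp
    then have "complex_of_real (c + c) = of_real 1" by simp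
    then have "c + c = 1" by (simp only: of_real_eq_iff)
    then show ?thesis using True by simp
  qed
qed

section \<open>Convolutions and finite lattice sums\<close>

lemma integrable_affine:
  fixes f :: "real ^ 'n \<Rightarrow> 'b::{banach, second_countable_topology}"
  assumes f: "integrable lborel f" and c: "c \<noteq> 0"
  shows "integrable lborel (\<lambda>x. f (t + c *\<^sub>R x))"
proof -
  have [measurable]: "f \<in> Borel" using f by auto
  have "integrable (density (distr lborel borel (\<lambda>x :: real ^ 'n. t + c *\<^sub>R x)) (\<lambda>_. ennreal (\<bar>c\<bar> ^ DIM(real ^ 'n)))) f"
    using f c by (subst (asm) lborel_affine[of c t]) auto
  then have "integrable (distr lborel borel (\<lambda>x :: real ^ 'n. t + c *\<^sub>R x)) (\<lambda>x. (\<bar>c\<bar> ^ DIM(real ^ 'n)) *\<^sub>R f x)"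
    by (subst (asm) integrable_density) auto
  then have "integrable (distr lborel borel (\<lambda>x :: real ^ 'n. t + c *\<^sub>R x)) f"
    using c integrable_scaleR_right[of "inverse (\<bar>c\<bar> ^ DIM(real ^ 'n))"] by fastforce
  then show ?thesis by (subst (asm) integrable_distr_eq) auto
qed

lemma lborel_integral_reflect:
  fixes f :: "real ^ 'n \<Rightarrow> 'b::{banach, second_countable_topology}"
  assumes "f \<in> Borel"
  shows "(LBINT x. f (c - x)) = (LBINT x. f x)"
  using lborel_integral_affine[of f "-1" c] assms by simp

lemma integrable_reflect:
  fixes f :: "real ^ 'n \<Rightarrow> 'b::{banach, second_countable_topology}"
  assumes "integrable lborel f"
  shows "integrable lborel (\<lambda>x. f (c - x))"
  using integrable_affine[OF assms, of "-1" c] by simp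

lemma four_convolution:
  fixes F G :: "real ^ 'n \<Rightarrow> complex"
  assumes F: "integrable lborel F" and G: "integrable lborel G"
  shows "four (\<lambda>\<xi>. \<integral>z. F z * G (\<xi> - z) \<partial>lborel) x = four F x * four G x"
proof -
  have [measurable]: "F \<in> Borel" "G \<in> Borel" using F G by auto
  define f where "f = (\<lambda>(z, \<xi>). F z * (G (\<xi> - z) * ee (- (x \<bullet> \<xi>))))"
  have [measurable]: "f \<in> borel_measurable (lborel \<Otimes>\<^sub>M lborel)" unfolding f_def by measurable
  have G': "integrable lborel (\<lambda>\<xi>. G (\<xi> - z))" for z
    using integrable_affine[OF G, of 1 "- z"] by simp
  have tr: "(LBINT \<xi>. h (\<xi> - z)) = (LBINT \<xi>. h \<xi>)"
    if [measurable]: "h \<in> Borel" for h :: "real ^ 'n \<Rightarrow> 'c::{banach, second_countable_topology}" and z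
    using lborel_integral_translate[of h "- z"] by simp
  have "integrable (lborel \<Otimes>\<^sub>M lborel) f"
  proof (rule lborel_pair.Fubini_integrable)
    have "(LBINT \<xi>. norm (f (z, \<xi>))) = norm (F z) * (LBINT y. norm (G y))" for z
      using tr[of "\<lambda>y. norm (G y)" z] by (simp add: f_def norm_mult)
    then show "integrable lborel (\<lambda>z. \<integral>\<xi>. norm (f (z, \<xi>)) \<partial>lborel)" using F by simp
    show "AE z in lborel. integrable lborel (\<lambda>\<xi>. f (z, \<xi>))"
      unfolding f_def prod.case by (intro AE_I2 integrable_mult_right integrable_times_ee G') measurable
  qed measurable
  then have "(LBINT \<xi>. \<integral>z. f (z, \<xi>) \<partial>lborel) = (LBINT z. \<integral>\<xi>. f (z, \<xi>) \<partial>lborel)"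
    by (rule lborel_pair.Fubini_integral[of "\<lambda>z \<xi>. f (z, \<xi>)", simplified])
  moreover have "(LBINT z. f (z, \<xi>)) = (LBINT z. F z * G (\<xi> - z)) * ee (- (x \<bullet> \<xi>))" for \<xi>
    by (simp add: f_def mult.assoc[symmetric])
  moreover have "(LBINT \<xi>. f (z, \<xi>)) = F z * ee (- (x \<bullet> z)) * four G x" for z
  proof -
    have "(LBINT \<xi>. f (z, \<xi>)) = (LBINT \<xi>. F z * ee (- (x \<bullet> z)) * (G (\<xi> - z) * ee (- (x \<bullet> (\<xi> - z)))))"
    proof (intro Bochner_Integration.integral_cong refl)
      fix \<xi>
      have "- (x \<bullet> \<xi>) = - (x \<bullet> z) + - (x \<bullet> (\<xi> - z))" by (simp add: inner_diff_right)
      then have "ee (- (x \<bullet> \<xi>)) = ee (- (x \<bullet> z)) * ee (- (x \<bullet> (\<xi> - z)))" by (simp only: ee_add)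
      then show "f (z, \<xi>) = F z * ee (- (x \<bullet> z)) * (G (\<xi> - z) * ee (- (x \<bullet> (\<xi> - z))))"
        by (simp only: f_def prod.case mult_ac)
    qed
    also have "\<dots> = F z * ee (- (x \<bullet> z)) * (LBINT \<xi>. G (\<xi> - z) * ee (- (x \<bullet> (\<xi> - z))))" by simp
    also have "(LBINT \<xi>. G (\<xi> - z) * ee (- (x \<bullet> (\<xi> - z)))) = four G x"
      unfolding four_def by (rule tr) measurable
    finally show ?thesis .
  qed
  ultimately show ?thesis by (simp add: four_def)
qed

lemma lat_finite_support:
  fixes f :: "real ^ 'n \<Rightarrow> 'b::{banach, second_countable_topology}"
  assumes fin: "finite S" and S: "S \<subseteq> int_lattice" and z: "\<And>m. m \<in> int_lattice \<Longrightarrow> m \<notin> S \<Longrightarrow> f m = 0"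
  shows "integrable lat f" and "(\<integral>m. f m \<partial>lat) = sum f S"
proof -
  have sub: "{m \<in> int_lattice. f m \<noteq> 0} \<subseteq> S" using z by blast
  have "(\<integral>m. f m \<partial>lat) = (\<Sum>m | m \<in> int_lattice \<and> f m \<noteq> 0. f m)"
    by (rule lebesgue_integral_count_space_finite_support[OF finite_subset[OF sub fin]])
  also have "\<dots> = sum f S" using S by (intro sum.mono_neutral_left[OF fin sub]) auto
  finally show "(\<integral>m. f m \<partial>lat) = sum f S" .
  have "integrable lat (\<lambda>m. \<Sum>a\<in>S. indicator {a} m *\<^sub>R f a)"
    using S by (intro Bochner_Integration.integrable_sum integrable_scaleR_left integrable_real_indicator) auto
  moreover have "(\<Sum>a\<in>S. indicator {a} m *\<^sub>R f a) = f m" if "m \<in> int_lattice" for m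
  proof -
    have "(\<Sum>a\<in>S. indicator {a} m *\<^sub>R f a) = (\<Sum>a\<in>S. if a = m then f m else 0)"
      by (intro sum.cong) (auto simp: indicator_def)
    then show ?thesis using z[OF that] by (simp add: sum.delta[OF fin])
  qed
  ultimately show "integrable lat f"
    by (subst (asm) Bochner_Integration.integrable_cong[where g = f]) auto
qed

lemma Poisson_summation_finite:
  fixes F :: "real ^ 'n \<Rightarrow> complex"
  assumes M: "M > real CARD('n)" and b: "\<And>x. norm (F x) \<le> K * decay M x" and c: "continuous_on UNIV F"
    and four: "\<And>x. norm x > r \<Longrightarrow> four F x = 0"
  shows "(\<integral>m. F m \<partial>lat) = (\<Sum>k\<in>{k \<in> int_lattice. norm k \<le> r}. four F k)"
proof -
  let ?A = "{k \<in> int_lattice :: (real ^ 'n) set. norm k \<le> r}"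
  have z: "four F k = 0" if "k \<in> int_lattice" "k \<notin> ?A" for k using that four[of k] by auto
  have L: "integrable lat (four F)" "(\<integral>m. four F m \<partial>lat) = (\<Sum>k\<in>?A. four F k)"
    by (rule lat_finite_support[OF finite_int_lattice_ball _ z]; auto)+
  from Poisson_summation[OF M b c L(1), of 0] show ?thesis by (simp add: L(2))
qed

text \<open>Each of 1 + s and 1 + t is at most the other times 1 + |s - t|; the sign of q decides
  which of the two bounds is raised to the power.\<close>

lemma Peetre_inequality:
  fixes s t q :: real
  assumes s: "s \<ge> 0" and l: "t \<ge> 0"
  shows "(1 + s) powr q \<le> (1 + t) powr q * (1 + \<bar>s - t\<bar>) powr \<bar>q\<bar>"
proof -
  have *: "1 + x \<le> (1 + y) * (1 + \<bar>s - t\<bar>)" if "x \<ge> 0" "y \<ge> 0" "x \<le> y + \<bar>s - t\<bar>" for x y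
  proof -
    have "0 \<le> y * \<bar>s - t\<bar>" using that by simp
    then show ?thesis using that(3) by (simp add: algebra_simps del: zero_le_mult_iff mult_nonneg_nonneg)
  qed
  show ?thesis
  proof (cases "q \<ge> 0")
    case True
    have "(1 + s) powr q \<le> ((1 + t) * (1 + \<bar>s - t\<bar>)) powr q"
      using True s l by (intro powr_mono2 *) auto
    then show ?thesis using True s l by (simp add: powr_mult)
  next
    case False
    have "((1 + s) * (1 + \<bar>s - t\<bar>)) powr q \<le> (1 + t) powr q"
      using False s l by (intro powr_mono2' *) auto
    then have "(1 + s) powr q * (1 + \<bar>s - t\<bar>) powr q \<le> (1 + t) powr q"
      using s by (simp add: powr_mult)
    moreover have "(1 + \<bar>s - t\<bar>) powr q * (1 + \<bar>s - t\<bar>) powr \<bar>q\<bar> = 1"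
      using False by (simp add: powr_add[symmetric])
    ultimately show ?thesis
      using mult_right_mono[of "(1 + s) powr q * (1 + \<bar>s - t\<bar>) powr q" "(1 + t) powr q" "(1 + \<bar>s - t\<bar>) powr \<bar>q\<bar>"]
      by (simp only: mult.assoc mult_1_right powr_ge_zero)
  qed
qed

section \<open>Smooth cutoffs and lattice points\<close>

text \<open>The transform of a square is an autocorrelation, here of a ball power, so it vanishes outside the ball of radius 2.\<close>

definition bump :: "real \<Rightarrow> real ^ 'n \<Rightarrow> real" where
  "bump M x = (ball_ft CARD('n) M 1 (norm x))^2 / (LBINT y. (ball_ft CARD('n) M 1 (norm (y :: real ^ 'n)))^2)"

lemma borel_measurable_bump [measurable]: "bump M \<in> Borel"
  unfolding bump_def by measurable

lemma bump_nonneg: "bump M x \<ge> 0" by (simp add: bump_def)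

lemma continuous_on_bump: "continuous_on A f \<Longrightarrow> continuous_on A (\<lambda>x. bump M (f x))"
  unfolding bump_def divide_inverse by (intro continuous_intros)

lemma bump_decay: "\<exists>K\<ge>0. \<forall>x :: real ^ 'n. bump M x \<le> K * decay (real CARD('n) + 1 + 2 * M) x"
proof -
  let ?c = "\<integral>y. (ball_ft CARD('n) M 1 (norm (y :: real ^ 'n)))^2 \<partial>lborel"
  obtain K where K: "K > 0" "\<And>x :: real ^ 'n. \<bar>ball_ft CARD('n) M 1 (norm x)\<bar> \<le> K * decay ((real CARD('n) + 1) / 2 + M) x"
    using ball_ft_decay[of 1 "CARD('n)" M, where 'n = 'n] by auto
  have c: "?c \<ge> 0" by simp
  have "bump M x \<le> K\<^sup>2 / ?c * decay (real CARD('n) + 1 + 2 * M) x" for x :: "real ^ 'n"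
  proof -
    have "(ball_ft CARD('n) M 1 (norm x))^2 \<le> (K * decay ((real CARD('n) + 1) / 2 + M) x)^2"
      using K(2)[of x] by (metis abs_ge_zero power2_abs power_mono)
    also have "\<dots> = K^2 * decay (real CARD('n) + 1 + 2 * M) x"
    proof -
      have "- ((real CARD('n) + 1) / 2 + M) + - ((real CARD('n) + 1) / 2 + M) = - (real CARD('n) + 1 + 2 * M)"
        by (simp add: field_simps)
      then show ?thesis by (simp only: power2_eq_square decay_def powr_add[symmetric] mult_ac)
    qed
    finally show ?thesis unfolding bump_def using divide_right_mono[OF _ c] by fastforce
  qed
  moreover have "K\<^sup>2 / ?c \<ge> 0" using c by simp
  ultimately show ?thesis by blast
qed

context
  fixes M :: real
  assumes M: "M \<ge> real CARD('n::finite)"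
begin

text \<open>The kernel decays with exponent n + 1 + 2M, so a weight of order 2M leaves the
  integrable rate n + 1; this moment governs the error of the cutoffs. The bound M >= n puts M above
  the inversion threshold (n - 1)/2.\<close>

lemma bump_integrals:
  shows bump_moment_integrable: "integrable lborel (\<lambda>x :: real ^ 'n. (1 + norm x) powr (2 * M) * bump M x)"
    and integrable_bump: "integrable lborel (bump M :: real ^ 'n \<Rightarrow> real)"
    and integral_bump: "(LBINT x. bump M (x :: real ^ 'n)) = 1"
    and four_bump: "norm (x :: real ^ 'n) \<ge> 2 \<Longrightarrow> four (\<lambda>x. complex_of_real (bump M x)) x = 0"
proof -
  let ?m = "\<lambda>x :: real ^ 'n. (1 + norm x) powr (2 * M)"
  define n where "n = CARD('n)"
  have n: "n \<ge> 1" unfolding n_def by (rule card_pos)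
  have n': "real n \<ge> 1" using n by simp
  have M': "M > 0" "M > (real CARD('n) - 1) / 2" "M > -1"
    using M[folded n_def] n' unfolding n_def[symmetric] by (simp_all add: field_simps)
  define G where "G = (\<lambda>y :: real ^ 'n. ball_ft n M 1 (norm y))"
  define c where "c = (LBINT y. (G y)^2)"
  have bump: "bump M y = (G y)^2 / c" for y by (simp add: bump_def G_def c_def n_def)
  have [measurable]: "G \<in> Borel" unfolding G_def by measurable
  obtain K where K: "K > 0" "\<And>y. \<bar>G y\<bar> \<le> K * decay ((real n + 1) / 2 + M) y"
    using ball_ft_decay[of 1 n M, where 'n = 'n] by (auto simp: G_def)
  have Gi: "integrable lborel G"
    unfolding G_def n_def by (rule ball_inversion(2)[OF M'(1,2)]) simp
  have inv: "(LBINT \<xi>. of_real (G \<xi>) * ee (\<xi> \<bullet> x)) = ball_power M 1 x" for x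
    unfolding G_def n_def by (rule ball_inversion(1)[OF M'(1,2)]) simp
  obtain L where L: "L \<ge> 0" "\<And>x :: real ^ 'n. bump M x \<le> L * decay (real n + 1 + 2 * M) x"
    using bump_decay[of M, where 'n = 'n] unfolding n_def by blast
  show m: "integrable lborel (\<lambda>x :: real ^ 'n. ?m x * bump M x)"
  proof (rule Bochner_Integration.integrable_bound)
    show "integrable lborel (\<lambda>x :: real ^ 'n. L * decay (real n + 1) x)"
      by (intro integrable_mult_right integrable_decay) (simp add: n_def)
    show "AE x in lborel. norm ((1 + norm (x :: real ^ 'n)) powr (2 * M) * bump M x) \<le> norm (L * decay (real n + 1) x)"
    proof (rule AE_I2)
      fix x :: "real ^ 'n"
      have "?m x * bump M x \<le> ?m x * (L * decay (real n + 1 + 2 * M) x)"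
        by (intro mult_left_mono L) auto
      also have "\<dots> = L * (?m x * (1 + norm x) powr (- (real n + 1 + 2 * M)))"
        by (simp add: decay_def)
      also have "?m x * (1 + norm x) powr (- (real n + 1 + 2 * M)) = decay (real n + 1) x"
        unfolding powr_add[symmetric] decay_def by simp
      finally show "norm (?m x * bump M x) \<le> norm (L * decay (real n + 1) x)"
        using L(1) by (simp add: bump_nonneg)
    qed
  qed measurable
  show i: "integrable lborel (bump M :: real ^ 'n \<Rightarrow> real)"
  proof (rule Bochner_Integration.integrable_bound[OF m])
    show "AE x in lborel. norm (bump M (x :: real ^ 'n)) \<le> norm (?m x * bump M x)"
    proof (rule AE_I2)
      fix x :: "real ^ 'n"
      have "1 * bump M x \<le> ?m x * bump M x"
        using M' by (intro mult_right_mono bump_nonneg ge_one_powr_ge_zero) auto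
      then show "norm (bump M x) \<le> norm (?m x * bump M x)" by (simp add: bump_nonneg)
    qed
  qed measurable
  have G2: "integrable lborel (\<lambda>y. (G y)^2)"
  proof (rule Bochner_Integration.integrable_bound)
    show "integrable lborel (\<lambda>y. K * G y)" using Gi by simp
    show "AE y in lborel. norm ((G y)^2) \<le> norm (K * G y)"
    proof (rule AE_I2)
      fix y
      have "\<bar>G y\<bar> \<le> K * 1"
        by (rule order_trans[OF K(2) mult_left_mono[OF decay_le_1]]) (use K M' in auto)
      then have "\<bar>G y\<bar> * \<bar>G y\<bar> \<le> K * \<bar>G y\<bar>" by (intro mult_right_mono) auto
      then show "norm ((G y)^2) \<le> norm (K * G y)" using K(1) by (simp add: power2_eq_square abs_mult)
    qed
  qed measurable
  \<comment> \<open>If c were 0, G would vanish almost everywhere, but its inversion integral at 0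
    is the ball power at 0, which is 1.\<close>
  have c0: "c \<noteq> 0"
  proof
    assume "c = 0"
    then have "AE y in lborel. (G y)^2 = 0"
      using integral_nonneg_eq_0_iff_AE[OF G2] by (simp add: c_def)
    then have "AE y in lborel. complex_of_real (G y) * ee (y \<bullet> 0) = 0" by eventually_elim simp
    then have "(LBINT \<xi>. complex_of_real (G \<xi>) * ee (\<xi> \<bullet> 0)) = 0" by (rule integral_eq_zero_AE)
    then show False unfolding inv by (simp add: ball_power_def)
  qed
  have "(LBINT x. bump M (x :: real ^ 'n)) = (LBINT y. (G y)^2) / c" unfolding bump by simp
  then show "(LBINT x. bump M (x :: real ^ 'n)) = 1" using c0 by (simp add: c_def[symmetric])
  \<comment> \<open>The square G G is read as a transform times G; the multiplication formula turns
    it into the integral of two ball powers of radius 1 whose centres have distance |x|. For |x| >=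
    2 their supports do not overlap.\<close>
  show "four (\<lambda>x. complex_of_real (bump M x)) x = 0" if x: "norm x \<ge> 2" for x :: "real ^ 'n"
  proof -
    have ft: "four (ball_power M 1) \<xi> = of_real (G \<xi>)" for \<xi> :: "real ^ 'n"
      unfolding G_def n_def by (rule four_ball_power) (use M' in auto)
    have fG: "four (\<lambda>\<xi>. complex_of_real (G \<xi>)) z = ball_power M 1 (- z)" for z
      unfolding four_def using inv[of "- z"] by (simp add: inner_commute)
    have "four (\<lambda>x. complex_of_real (bump M x)) x
       = (LBINT \<xi>. four (ball_power M 1) \<xi> * of_real (G \<xi>) * ee (- x \<bullet> \<xi>) / of_real c)"
      unfolding four_def[of _ x] ft bump by (simp add: power2_eq_square mult_ac)
    also have "\<dots> = (LBINT \<xi>. four (ball_power M 1) \<xi> * of_real (G \<xi>) * ee (- x \<bullet> \<xi>)) / of_real c" by simp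
    also have "(LBINT \<xi>. four (ball_power M 1) \<xi> * of_real (G \<xi>) * ee (- x \<bullet> \<xi>))
      = (LBINT y. ball_power M 1 y * four (\<lambda>\<xi>. complex_of_real (G \<xi>)) (y - - x))"
      by (intro four_multiplication integrable_ball_power) (use M' Gi in auto)
    also have "\<dots> = (\<integral>y. 0 \<partial>(lborel :: (real ^ 'n) measure))"
    proof (intro Bochner_Integration.integral_cong refl)
      fix y
      have "norm x \<le> norm y + norm (y + x)" using norm_triangle_ineq4[of "y + x" y] by simp
      then have "norm y \<ge> 1 \<or> norm (y + x) \<ge> 1" using x by linarith
      then show "ball_power M 1 y * four (\<lambda>\<xi>. complex_of_real (G \<xi>)) (y - - x) = 0"
        unfolding fG by (auto simp: ball_power_def norm_minus_commute minus_diff_commute)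
    qed
    finally show ?thesis by simp
  qed
qed

end

section \<open>Mollified ball indicators\<close>

definition dilated_bump :: "real \<Rightarrow> real \<Rightarrow> real ^ 'n \<Rightarrow> real" where
  "dilated_bump M b y = b ^ CARD('n) * bump M (b *\<^sub>R y)"

definition cutoff :: "real \<Rightarrow> real \<Rightarrow> real \<Rightarrow> real ^ 'n \<Rightarrow> real" where
  "cutoff M b t \<xi> = (LBINT z. indicator {z. norm z < t} z * dilated_bump M b (\<xi> - z))"

lemma borel_measurable_dilated_bump [measurable]: "dilated_bump M b \<in> Borel"
  unfolding dilated_bump_def by measurable

lemma dilated_bump_nonneg: "b \<ge> 0 \<Longrightarrow> dilated_bump M b y \<ge> 0"
  by (simp add: dilated_bump_def bump_nonneg)

text \<open>Lebesgue measure, the ball and the kernel are all invariant under rotations. Hence the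
  cutoff has a profile on the half-line, and its transforms reduce to one dimension.\<close>

lemma cutoff_radial:
  fixes \<xi> \<xi>' :: "real ^ 'n"
  assumes "norm \<xi> = norm \<xi>'"
  shows "cutoff M b t \<xi> = cutoff M b t \<xi>'"
proof -
  obtain f where f: "orthogonal_transformation f" "f \<xi> = \<xi>'"
    using orthogonal_transformation_exists[OF assms] by blast
  have lin: "linear f" using f(1) by (rule orthogonal_transformation_linear)
  have [measurable]: "f \<in> Borel"
    using lin by (intro borel_measurable_continuous_onI linear_continuous_on linear_linear[THEN iffD2])
  have nf: "norm (f x) = norm x" for x using f(1) by (rule orthogonal_transformation_norm)
  have "cutoff M b t \<xi>' = (\<integral>z. indicator {z. norm z < t} z * dilated_bump M b (\<xi>' - z) \<partial>distr lborel borel f)"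
    unfolding cutoff_def lborel_distr_orthogonal[OF f(1)] ..
  also have "\<dots> = (LBINT z. indicator {z. norm z < t} (f z) * dilated_bump M b (\<xi>' - f z))"
    by (rule integral_distr) measurable
  also have "\<dots> = cutoff M b t \<xi>"
    unfolding cutoff_def f(2)[symmetric] linear_diff[OF lin, symmetric]
    by (intro Bochner_Integration.integral_cong) (auto simp: indicator_def nf dilated_bump_def bump_def)
  finally show ?thesis by simp
qed

context
  fixes M :: real
  assumes M: "M \<ge> real CARD('n::finite)"
begin

lemma integrable_dilated_bump: "b > 0 \<Longrightarrow> integrable lborel (dilated_bump M b :: real ^ 'n \<Rightarrow> real)"
  using integrable_affine[OF integrable_bump[OF M], of b 0] by (simp add: dilated_bump_def[abs_def])

lemma four_dilated_bump:
  fixes x :: "real ^ 'n"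
  assumes b: "b > 0"
  shows "four (\<lambda>y. complex_of_real (dilated_bump M b y)) x = four (\<lambda>y. complex_of_real (bump M y)) (x /\<^sub>R b)"
proof -
  have inn: "(x /\<^sub>R b) \<bullet> (b *\<^sub>R y) = x \<bullet> y" for y using b by simp
  have "four (\<lambda>y. complex_of_real (bump M y)) (x /\<^sub>R b)
    = b ^ CARD('n) *\<^sub>R (LBINT y. complex_of_real (bump M (b *\<^sub>R y)) * ee (- ((x /\<^sub>R b) \<bullet> (b *\<^sub>R y))))"
    unfolding four_def by (rule lborel_integral_scale[OF _ b]) measurable
  also have "\<dots> = (LBINT y. b ^ CARD('n) *\<^sub>R (complex_of_real (bump M (b *\<^sub>R y)) * ee (- ((x /\<^sub>R b) \<bullet> (b *\<^sub>R y)))))"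
    by simp
  also have "\<dots> = four (\<lambda>y. complex_of_real (dilated_bump M b y)) x"
    unfolding four_def inn
    by (intro Bochner_Integration.integral_cong) (auto simp: dilated_bump_def scaleR_conv_of_real)
  finally show ?thesis by simp
qed

lemma integral_dilated_bump: "b > 0 \<Longrightarrow> (LBINT y. dilated_bump M b (y :: real ^ 'n)) = 1"
  using lborel_integral_scale[of "bump M :: real ^ 'n \<Rightarrow> real" b] integral_bump[OF M] by (simp add: dilated_bump_def)

text \<open>Where f does not vanish, the kernel is evaluated at distance at least r from its centre;
  the finite moment of order 2M then bounds the mass by (1 + b r)^(-2M).\<close>

lemma cutoff_moment_bound:
  fixes f :: "real ^ 'n \<Rightarrow> real"
  assumes b: "b > 0" and [measurable]: "f \<in> Borel"
    and f: "\<And>z. \<bar>f z\<bar> \<le> 1" "\<And>z. f z \<noteq> 0 \<Longrightarrow> r \<le> norm (\<xi> - z)" and r: "r \<ge> 0"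
  shows "\<bar>\<integral>z. f z * dilated_bump M b (\<xi> - z) \<partial>lborel\<bar>
    \<le> (LBINT y. (1 + norm (y :: real ^ 'n)) powr (2 * M) * bump M y) * (1 + b * r) powr (- 2 * M)"
proof -
  let ?d = "\<lambda>z. dilated_bump M b (\<xi> - z)"
  define g where "g = (\<lambda>y :: real ^ 'n. (1 + norm y) powr (2 * M) * bump M y)"
  have g: "integrable lborel g" unfolding g_def by (rule bump_moment_integrable[OF M])
  then have [measurable]: "g \<in> Borel" by auto
  have "M \<ge> 0" using M by (rule order_trans[rotated]) simp
  define h where "h y = b ^ CARD('n) * g (b *\<^sub>R y)" for y
  have h: "integrable lborel h" using integrable_affine[OF g, of b 0] b by (simp add: h_def[abs_def])
  have [measurable]: "h \<in> Borel" unfolding h_def by measurable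
  have hg: "(LBINT y. h y) = (LBINT y. g y)" using lborel_integral_scale[of g b] b by (simp add: h_def)
  have "\<bar>\<integral>z. f z * ?d z \<partial>lborel\<bar> \<le> (LBINT z. (1 + b * r) powr (- 2 * M) * h (\<xi> - z))"
  proof (rule order_trans[OF integral_abs_bound], rule integral_mono)
    have "\<bar>f z * ?d z\<bar> \<le> ?d z" for z
      using mult_right_mono[OF f(1)[of z] dilated_bump_nonneg[of b M "\<xi> - z"]] b dilated_bump_nonneg[of b M "\<xi> - z"]
      by (simp add: abs_mult)
    then show "integrable lborel (\<lambda>z. \<bar>f z * ?d z\<bar>)"
      by (intro Bochner_Integration.integrable_bound[OF integrable_reflect[OF integrable_dilated_bump[OF b], of \<xi>]] AE_I2)
         (auto intro: order_trans[OF _ abs_ge_self])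
    show "integrable lborel (\<lambda>z. (1 + b * r) powr (- 2 * M) * h (\<xi> - z))"
      by (intro integrable_mult_right integrable_reflect h)
    fix z
    have h0: "h y \<ge> 0" for y using b by (simp add: h_def g_def bump_nonneg)
    show "\<bar>f z * ?d z\<bar> \<le> (1 + b * r) powr (- 2 * M) * h (\<xi> - z)"
    proof (cases "f z = 0")
      case True
      then show ?thesis using h0 by simp
    next
      case False
      have "(1 + b * r) powr (2 * M) \<le> (1 + norm (b *\<^sub>R (\<xi> - z))) powr (2 * M)"
        using f(2)[OF False] r b \<open>M \<ge> 0\<close> by (intro powr_mono2) auto
      then have "1 \<le> (1 + b * r) powr (- 2 * M) * (1 + norm (b *\<^sub>R (\<xi> - z))) powr (2 * M)"
        using mult_left_mono[of "(1 + b * r) powr (2 * M)" _ "(1 + b * r) powr (- 2 * M)"] r b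
        by (fastforce simp: powr_add[symmetric] add_nonneg_eq_0_iff)
      then have "?d z * 1 \<le> ?d z * ((1 + b * r) powr (- 2 * M) * (1 + norm (b *\<^sub>R (\<xi> - z))) powr (2 * M))"
        using b by (intro mult_left_mono dilated_bump_nonneg) auto
      also have "\<dots> = (1 + b * r) powr (- 2 * M) * h (\<xi> - z)"
        by (simp add: h_def g_def dilated_bump_def mult_ac)
      finally show ?thesis
        using mult_right_mono[OF f(1)[of z] dilated_bump_nonneg[of b M "\<xi> - z"]] b dilated_bump_nonneg[of b M "\<xi> - z"]
        by (simp add: abs_mult)
    qed
  qed
  also have "\<dots> = (LBINT y. g y) * (1 + b * r) powr (- 2 * M)"
    using lborel_integral_reflect[of h \<xi>] by (simp add: hg)
  finally show ?thesis by (simp add: g_def)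
qed

lemma cutoff_integrable:
  fixes \<xi> :: "real ^ 'n"
  assumes b: "b > 0"
  shows "integrable lborel (\<lambda>z. indicator {z. norm z < t} z * dilated_bump M b (\<xi> - z))"
  by (rule Bochner_Integration.integrable_bound[OF integrable_reflect[OF integrable_dilated_bump[OF b], of \<xi>]])
     (auto simp: indicator_def)

text \<open>The kernel has mass 1, so the error is the convolution with the indicator minus its
  value at \<xi>. This difference is nonzero only across the sphere, at distance at least the
  distance of |\<xi>| from t.\<close>

lemma cutoff_approx:
  "\<exists>C\<ge>0. \<forall>b>0. \<forall>t. \<forall>\<xi> :: real ^ 'n.
     \<bar>cutoff M b t \<xi> - indicator {..<t} (norm \<xi>)\<bar> \<le> C * (1 + b * \<bar>norm \<xi> - t\<bar>) powr (- 2 * M)"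
proof (intro exI conjI allI impI)
  let ?C = "\<integral>y. (1 + norm (y :: real ^ 'n)) powr (2 * M) * bump M y \<partial>lborel"
  show "?C \<ge> 0" by (intro integral_nonneg_AE AE_I2) (simp add: bump_nonneg)
  fix b t :: real and \<xi> :: "real ^ 'n" assume b: "b > 0"
  let ?i = "indicator {..<t} (norm \<xi>) :: real"
  define f where "f z = indicator {z. norm z < t} z - ?i" for z :: "real ^ 'n"
  have [measurable]: "f \<in> Borel" unfolding f_def by measurable
  have d: "integrable lborel (\<lambda>z. dilated_bump M b (\<xi> - z))"
    by (rule integrable_reflect[OF integrable_dilated_bump[OF b]])
  have "(LBINT z. ?i * dilated_bump M b (\<xi> - z)) = ?i"
    using lborel_integral_reflect[of "dilated_bump M b" \<xi>] integral_dilated_bump[OF b] by simp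
  then have "cutoff M b t \<xi> - ?i = (LBINT z. f z * dilated_bump M b (\<xi> - z))"
    using Bochner_Integration.integral_diff[OF cutoff_integrable[OF b, of t \<xi>] integrable_mult_right[OF d, of ?i]]
    unfolding f_def left_diff_distrib by (simp add: cutoff_def)
  also have "\<bar>\<dots>\<bar> \<le> ?C * (1 + b * \<bar>norm \<xi> - t\<bar>) powr (- 2 * M)"
  proof (rule cutoff_moment_bound[OF b])
    show "\<bar>norm \<xi> - t\<bar> \<le> norm (\<xi> - z)" if "f z \<noteq> 0" for z
      using that norm_triangle_ineq2[of \<xi> z] norm_triangle_ineq3[of \<xi> z]
      by (cases "norm z < t"; cases "norm \<xi> < t"; auto simp: f_def)
  qed (auto simp: f_def indicator_def)
  finally show "\<bar>cutoff M b t \<xi> - ?i\<bar> \<le> ?C * (1 + b * \<bar>norm \<xi> - t\<bar>) powr (- 2 * M)" .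
qed

lemma cutoff_mono: "b > 0 \<Longrightarrow> t \<le> t' \<Longrightarrow> cutoff M b t \<xi> \<le> cutoff M b t' (\<xi> :: real ^ 'n)"
  unfolding cutoff_def by (intro integral_mono cutoff_integrable) (auto simp: dilated_bump_nonneg indicator_def)

lemma integrable_ball_indicator: "integrable lborel (\<lambda>z :: real ^ 'n. indicator {z. norm z < t} z :: real)"
proof -
  have "{z :: real ^ 'n. norm z < t} = ball 0 t" by auto
  then show ?thesis by (simp only:) (intro integrable_real_indicator emeasure_bounded_finite; simp)
qed

lemma continuous_on_cutoff:
  assumes b: "b > 0"
  shows "continuous_on UNIV (cutoff M b t :: real ^ 'n \<Rightarrow> real)"
proof (rule continuous_on_sequentiallyI)
  fix u :: "nat \<Rightarrow> real ^ 'n" and a assume u: "u \<longlonglongrightarrow> a"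
  obtain K where K: "K \<ge> 0" "\<And>x :: real ^ 'n. bump M x \<le> K * decay (real CARD('n) + 1 + 2 * M) x"
    using bump_decay[of M, where 'n = 'n] by blast
  have "M \<ge> 0" using M by (rule order_trans[rotated]) simp
  have K': "bump M x \<le> K" for x :: "real ^ 'n"
    using K(2)[of x] mult_left_mono[OF decay_le_1[of "real CARD('n) + 1 + 2 * M" x] K(1)] \<open>M \<ge> 0\<close> by simp
  show "(\<lambda>k. cutoff M b t (u k)) \<longlonglongrightarrow> cutoff M b t a"
    unfolding cutoff_def
  proof (rule integral_dominated_convergence)
    show "integrable lborel (\<lambda>z :: real ^ 'n. indicator {z. norm z < t} z * (b ^ CARD('n) * K))"
      by (intro integrable_mult_left integrable_ball_indicator)
    have "continuous_on UNIV (\<lambda>x. dilated_bump M b (x - z))" for z :: "real ^ 'n"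
      unfolding dilated_bump_def by (intro continuous_intros continuous_on_bump)
    then have "isCont (\<lambda>x. dilated_bump M b (x - z)) a" for z by (simp add: continuous_on_eq_continuous_at)
    then have "(\<lambda>k. dilated_bump M b (u k - z)) \<longlonglongrightarrow> dilated_bump M b (a - z)" for z
      by (rule isCont_tendsto_compose) (rule u)
    then show "AE z in lborel. (\<lambda>k. indicator {z. norm z < t} z * dilated_bump M b (u k - z))
        \<longlonglongrightarrow> indicator {z. norm z < t} z * dilated_bump M b (a - z)"
      by (intro AE_I2 tendsto_mult tendsto_const)
    show "AE z in lborel. norm (indicator {z. norm z < t} z * dilated_bump M b (u k - z)) \<le> indicator {z. norm z < t} z * (b ^ CARD('n) * K)" for k
      using b K' by (intro AE_I2) (auto simp: indicator_def dilated_bump_def bump_nonneg)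
  qed measurable
qed

text \<open>The transform of a convolution is a product, and the indicator of the open ball is the
  ball power of exponent 0. The first factor has compact support, which makes the dual sums
  finite.\<close>

lemma four_cutoff:
  fixes x :: "real ^ 'n"
  assumes b: "b > 0" and t: "t > 0"
  shows "four (\<lambda>\<xi>. complex_of_real (cutoff M b t \<xi>)) x
    = four (\<lambda>y. complex_of_real (bump M y)) (x /\<^sub>R b) * of_real (ball_ft CARD('n) 0 t (norm x))"
proof -
  have z: "ball_power 0 t z = complex_of_real (indicator {z. norm z < t} z)" for z :: "real ^ 'n"
  proof (cases "norm z < t")
    case True
    then have "(norm z)^2 < t^2" by (intro power_strict_mono) auto
    then show ?thesis using True by (simp add: ball_power_def)
  qed (simp add: ball_power_def)
  have "four (\<lambda>\<xi>. complex_of_real (cutoff M b t \<xi>)) x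
    = four (\<lambda>\<xi>. \<integral>z. ball_power 0 t z * complex_of_real (dilated_bump M b (\<xi> - z)) \<partial>lborel) x"
    unfolding z of_real_mult[symmetric] integral_of_real[OF cutoff_integrable[OF b]] cutoff_def ..
  also have "\<dots> = four (ball_power 0 t) x * four (\<lambda>y. complex_of_real (dilated_bump M b y)) x"
    by (intro four_convolution integrable_ball_power t) (auto intro: integrable_dilated_bump b)
  also have "four (ball_power 0 t) x = of_real (ball_ft CARD('n) 0 t (norm x))"
    by (rule four_ball_power) (use t in auto)
  finally show ?thesis unfolding four_dilated_bump[OF b] by (simp add: mult.commute)
qed

lemma four_cutoff_eq_0:
  fixes x :: "real ^ 'n"
  assumes b: "b > 0" and t: "t > 0" and x: "norm x \<ge> 2 * b"
  shows "four (\<lambda>\<xi>. complex_of_real (cutoff M b t \<xi>)) x = 0"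
  unfolding four_cutoff[OF b t] using four_bump[OF M, of "x /\<^sub>R b"] b x by (simp add: field_simps)

lemma norm_four_cutoff:
  fixes x :: "real ^ 'n"
  assumes b: "b > 0" and t: "t > 0"
  shows "norm (four (\<lambda>\<xi>. complex_of_real (cutoff M b t \<xi>)) x) \<le> \<bar>ball_ft CARD('n) 0 t (norm x)\<bar>"
    and "four (\<lambda>\<xi>. complex_of_real (cutoff M b t \<xi>)) (0 :: real ^ 'n) = of_real (ball_ft CARD('n) 0 t 0)"
proof -
  have "norm (four (\<lambda>y. complex_of_real (bump M y)) y) \<le> (LBINT y. bump M (y :: real ^ 'n))" for y :: "real ^ 'n"
    unfolding four_def by (rule order_trans[OF integral_norm_bound]) (simp add: norm_mult bump_nonneg)
  then have "norm (four (\<lambda>y. complex_of_real (bump M y)) y) \<le> 1" for y :: "real ^ 'n" using integral_bump[OF M] by simp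
  then show "norm (four (\<lambda>\<xi>. complex_of_real (cutoff M b t \<xi>)) x) \<le> \<bar>ball_ft CARD('n) 0 t (norm x)\<bar>"
    unfolding four_cutoff[OF b t] by (simp add: norm_mult mult_left_le_one_le)
  have "four (\<lambda>y. complex_of_real (bump M y)) (0 :: real ^ 'n) = of_real (LBINT y. bump M (y :: real ^ 'n))"
    by (simp add: four_def)
  then show "four (\<lambda>\<xi>. complex_of_real (cutoff M b t \<xi>)) (0 :: real ^ 'n) = of_real (ball_ft CARD('n) 0 t 0)"
    unfolding four_cutoff[OF b t] integral_bump[OF M] by simp
qed

text \<open>Outside the ball the cutoff coincides with its approximation error. Peetre's inequality
  trades the distance from the sphere for the distance from the origin, with a constant that depends
  on t.\<close>

lemma cutoff_decay:
  assumes b: "b \<ge> 1" and t: "t > 0"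
  shows "\<exists>K\<ge>0. \<forall>\<xi> :: real ^ 'n. \<bar>cutoff M b t \<xi>\<bar> \<le> K * decay (2 * M) \<xi>"
proof -
  obtain C where C: "C \<ge> 0" "\<And>b t (\<xi> :: real ^ 'n). b > 0 \<Longrightarrow>
     \<bar>cutoff M b t \<xi> - indicator {..<t} (norm \<xi>)\<bar> \<le> C * (1 + b * \<bar>norm \<xi> - t\<bar>) powr (- 2 * M)"
    using cutoff_approx by blast
  have "M \<ge> 0" using M by (rule order_trans[rotated]) simp
  have "\<bar>cutoff M b t \<xi>\<bar> \<le> (1 + C) * (1 + t) powr (2 * M) * decay (2 * M) \<xi>" for \<xi> :: "real ^ 'n"
  proof -
    let ?s = "norm \<xi>"
    have "(1 + t) powr (- (2 * M)) \<le> (1 + ?s) powr (- (2 * M)) * (1 + \<bar>t - ?s\<bar>) powr \<bar>- (2 * M)\<bar>"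
      by (rule Peetre_inequality) (use t in auto)
    then have "(1 + t) powr (- (2 * M)) \<le> decay (2 * M) \<xi> * (1 + \<bar>?s - t\<bar>) powr (2 * M)"
      using \<open>M \<ge> 0\<close> by (simp add: decay_def abs_minus_commute)
    then have "(1 + t) powr (2 * M) * ((1 + t) powr (- (2 * M)) * (1 + \<bar>?s - t\<bar>) powr (- (2 * M)))
       \<le> (1 + t) powr (2 * M) * ((decay (2 * M) \<xi> * (1 + \<bar>?s - t\<bar>) powr (2 * M)) * (1 + \<bar>?s - t\<bar>) powr (- (2 * M)))"
      by (intro mult_left_mono mult_right_mono) auto
    moreover have "(1 + t) powr (2 * M) * (1 + t) powr (- (2 * M)) = 1" using t by (simp add: powr_add[symmetric])
    moreover have "(1 + \<bar>?s - t\<bar>) powr (2 * M) * (1 + \<bar>?s - t\<bar>) powr (- (2 * M)) = 1" by (simp add: powr_add[symmetric])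
    ultimately have r: "(1 + \<bar>?s - t\<bar>) powr (- (2 * M)) \<le> (1 + t) powr (2 * M) * decay (2 * M) \<xi>"
      by (simp only: mult.assoc[symmetric] mult_1_left) (simp only: mult.assoc mult_1_right)
    have "(1 + b * \<bar>?s - t\<bar>) powr (- (2 * M)) \<le> (1 + \<bar>?s - t\<bar>) powr (- (2 * M))"
      using b \<open>M \<ge> 0\<close> mult_right_mono[OF b, of "\<bar>?s - t\<bar>"] by (intro powr_mono2') auto
    then have "C * (1 + b * \<bar>?s - t\<bar>) powr (- 2 * M) \<le> C * ((1 + t) powr (2 * M) * decay (2 * M) \<xi>)"
      using r C(1) by (intro mult_left_mono) auto
    moreover have "indicator {..<t} ?s \<le> (1 + t) powr (2 * M) * decay (2 * M) \<xi>"
    proof (cases "?s < t")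
      case True
      have "(1 + t) powr (- (2 * M)) \<le> decay (2 * M) \<xi>"
        unfolding decay_def using True \<open>M \<ge> 0\<close> by (intro powr_mono2') (auto simp: add_pos_nonneg)
      then have "(1 + t) powr (2 * M) * (1 + t) powr (- (2 * M)) \<le> (1 + t) powr (2 * M) * decay (2 * M) \<xi>"
        by (intro mult_left_mono) auto
      then show ?thesis using t True by (simp add: powr_add[symmetric])
    qed (simp add: decay_nonneg)
    moreover have "indicator {..<t} ?s \<ge> (0::real)" by simp
    moreover have "\<bar>cutoff M b t \<xi> - indicator {..<t} ?s\<bar> \<le> C * (1 + b * \<bar>?s - t\<bar>) powr (- 2 * M)"
      using b by (intro C(2)) simp
    ultimately show ?thesis unfolding distrib_right mult_1_left mult.assoc by linarith
  qed
  moreover have "(1 + C) * (1 + t) powr (2 * M) \<ge> 0" using C(1) by simp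
  ultimately show ?thesis by blast
qed

end

section \<open>The cost of smoothing\<close>

lemma integral_kernel:
  fixes b t :: real
  assumes b: "b > 0"
  shows "integrable lborel (\<lambda>s. (1 + b * \<bar>s - t\<bar>) powr (-2))"
    and "(LBINT s. (1 + b * \<bar>s - t\<bar>) powr (-2)) = 2 / b"
proof -
  define f where "f s = (1 + \<bar>s\<bar>) powr (-2)" for s :: real
  define g where "g s = indicator {0..} s * (1 + \<bar>s\<bar>) powr (-2)" for s :: real
  have [measurable]: "g \<in> Borel" unfolding g_def by measurable
  have "(\<integral>\<^sup>+s. ennreal (g s) \<partial>lborel) = (\<integral>\<^sup>+r. ennreal ((1 + r) powr (- 2)) * indicator {0..} r \<partial>lborel)"
    by (intro nn_integral_cong) (auto simp: g_def indicator_def)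
  also have "\<dots> = ennreal 1" using nn_integral_half_line_decay[of 2] by simp
  finally have "has_bochner_integral lborel g 1"
    by (intro has_bochner_integral_nn_integral) (auto simp: g_def)
  then have g: "integrable lborel g" "(LBINT s. g s) = 1" by (auto simp: has_bochner_integral_iff)
  have g': "integrable lborel (\<lambda>s. g (- s))" "(LBINT s. g (- s)) = 1"
    using lborel_integrable_real_affine[OF g(1), of "-1" 0] lborel_integral_real_affine[of "-1" g 0] g(2) by auto
  have ae: "AE s in lborel. g s + g (- s) = f s"
  proof -
    have "AE s in lborel. s \<notin> {0 :: real}" by (intro AE_not_in countable_imp_null_set_lborel) auto
    then show ?thesis by eventually_elim (auto simp: f_def g_def indicator_def)
  qed
  have [measurable]: "f \<in> Borel" unfolding f_def by measurable
  have "integrable lborel (\<lambda>s. g s + g (- s))" by (intro Bochner_Integration.integrable_add g g')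
  then have fi: "integrable lborel f" by (rule integrable_cong_AE_imp) (use ae in auto)
  have fv: "(LBINT s. f s) = 2"
    using integral_cong_AE[OF _ _ ae] Bochner_Integration.integral_add[OF g(1) g'(1)] g(2) g'(2) by simp
  have e: "f (- b * t + b * s) = (1 + b * \<bar>s - t\<bar>) powr (-2)" for s
  proof -
    have "\<bar>- b * t + b * s\<bar> = b * \<bar>s - t\<bar>"
      using b abs_mult[of b "s - t"] by (simp add: right_diff_distrib)
    then show ?thesis unfolding f_def by (simp only:)
  qed
  show "integrable lborel (\<lambda>s. (1 + b * \<bar>s - t\<bar>) powr (-2))"
    using lborel_integrable_real_affine[OF fi, of b "- b * t"] b unfolding e by simp
  show "(LBINT s. (1 + b * \<bar>s - t\<bar>) powr (-2)) = 2 / b"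
    using lborel_integral_real_affine[of b f "- b * t"] b unfolding e fv by (simp add: field_simps)
qed

text \<open>At t = 0 the weight is the full area of the sphere; for t > 0 the oscillation of the
  character halves the exponent. This is why dual points other than 0 contribute only errors of
  order t^(-1-\<beta>) in the cutoff radius t.\<close>

lemma radial_weight_bound:
  assumes n: "n \<ge> 1" and t: "t \<ge> 0"
  shows "\<exists>W\<ge>0. \<forall>s\<ge>0. \<bar>radial_weight n t s\<bar> \<le> W * (1 + s) powr (if t = 0 then real n - 1 else (real n - 1) / 2)"
proof -
  have pw: "s ^ (n - 1) \<le> (1 + s) powr (real n - 1)" if "s \<ge> 0" for s :: real
    using that n power_mono[of s "1 + s" "n - 1"] powr_realpow[of "1 + s" "n - 1"] by (simp add: of_nat_diff)
  show ?thesis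
  proof (cases "t = 0")
    case True
    have "\<bar>radial_weight n t s\<bar> \<le> \<bar>2 * pi powr (real n / 2) * rGamma (real n / 2)\<bar> * (1 + s) powr (real n - 1)" if s: "s \<ge> 0" for s
      unfolding True radial_weight_0 abs_mult[of _ "s ^ (n - 1)"] using pw[OF s] s by (intro mult_left_mono) auto
    then show ?thesis using True by (intro exI[of _ "\<bar>2 * pi powr (real n / 2) * rGamma (real n / 2)\<bar>"]) auto
  next
    case False
    then have t: "t > 0" using t by simp
    \<comment> \<open>\<open>ball_ft\<close> with dimension 0 serves as a plain Bessel function of
      s, of order n/2 - 1 and scaled by t.\<close>
    obtain K where K: "K > 0" "\<And>s. s \<ge> 0 \<Longrightarrow> \<bar>ball_ft 0 (real n / 2 - 1) t s\<bar> \<le> K * (1 + s) powr (- ((real 0 + 1) / 2 + (real n / 2 - 1)))"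
      using ball_ft_bound[OF t, of 0 "real n / 2 - 1"] by blast
    define c where "c = Gamma (real n / 2) * t powr (2 * (real n / 2 - 1))"
    have c: "c > 0" using n t Gamma_real_pos[of "real n / 2"] by (simp add: c_def)
    define D where "D = 2 * pi powr (real n / 2) / c"
    have D: "D \<ge> 0" using c by (simp add: D_def)
    have "\<bar>radial_weight n t s\<bar> \<le> D * K * (1 + s) powr ((real n - 1) / 2)" if s: "s \<ge> 0" for s
    proof -
      have "ball_ft 0 (real n / 2 - 1) t s = c * clifford (real n / 2 - 1) ((pi * s * t)^2)"
        by (simp add: ball_ft_def c_def mult_ac)
      then have "radial_weight n t s = D * (s ^ (n - 1) * ball_ft 0 (real n / 2 - 1) t s)"
        using c by (simp add: radial_weight_def D_def)
      then have "\<bar>radial_weight n t s\<bar> = D * (s ^ (n - 1) * \<bar>ball_ft 0 (real n / 2 - 1) t s\<bar>)"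
        using D s by (simp add: abs_mult)
      also have "\<dots> \<le> D * ((1 + s) powr (real n - 1) * (K * (1 + s) powr (- ((real 0 + 1) / 2 + (real n / 2 - 1)))))"
        using D s K(1) by (intro mult_left_mono mult_mono pw K(2)) auto
      also have "\<dots> = D * K * ((1 + s) powr (real n - 1) * (1 + s) powr (- ((real 0 + 1) / 2 + (real n / 2 - 1))))" by simp
      also have "(1 + s) powr (real n - 1) * (1 + s) powr (- ((real 0 + 1) / 2 + (real n / 2 - 1))) = (1 + s) powr ((real n - 1) / 2)"
        by (rule powr_mult_powr) (simp add: field_simps)
      finally show ?thesis .
    qed
    moreover have "D * K \<ge> 0" using D K(1) by simp
    ultimately show ?thesis using False by auto
  qed
qed

text \<open>A power of 1 + s next to a kernel centred at t may be replaced by the same power of 1 +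
  t; this uses up |x| powers of the kernel.\<close>

lemma Peetre_tail:
  fixes s t x b :: real
  assumes s: "s \<ge> 0" and t: "t \<ge> 0" and b: "b \<ge> 1" and N: "\<bar>x\<bar> + q \<le> N"
  shows "(1 + s) powr x * (1 + b * \<bar>s - t\<bar>) powr (- N) \<le> (1 + t) powr x * (1 + b * \<bar>s - t\<bar>) powr (- q)"
proof -
  have le: "1 + \<bar>s - t\<bar> \<le> 1 + b * \<bar>s - t\<bar>" using mult_right_mono[OF b, of "\<bar>s - t\<bar>"] by simp
  have "(1 + s) powr x \<le> (1 + t) powr x * (1 + b * \<bar>s - t\<bar>) powr \<bar>x\<bar>"
    by (rule order_trans[OF Peetre_inequality[OF s t] mult_left_mono[OF powr_mono2]]) (use le in auto)
  then have "(1 + s) powr x * (1 + b * \<bar>s - t\<bar>) powr (- N)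
      \<le> (1 + t) powr x * (1 + b * \<bar>s - t\<bar>) powr \<bar>x\<bar> * (1 + b * \<bar>s - t\<bar>) powr (- N)"
    by (rule mult_right_mono) simp
  also have "\<dots> = (1 + t) powr x * (1 + b * \<bar>s - t\<bar>) powr (\<bar>x\<bar> - N)"
    by (simp add: powr_add[symmetric] mult.assoc)
  also have "\<dots> \<le> (1 + t) powr x * (1 + b * \<bar>s - t\<bar>) powr (- q)"
  proof (intro mult_left_mono powr_mono)
    show "\<bar>x\<bar> - N \<le> - q" using N by linarith
    show "1 \<le> 1 + b * \<bar>s - t\<bar>" using b by simp
  qed simp
  finally show ?thesis .
qed

lemma lat_kernel_integrable:
  fixes b t :: real
  assumes b: "b \<ge> 1" and t: "t \<ge> 0" and q: "q > real CARD('n)"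
  shows "integrable lat (\<lambda>m :: real ^ 'n. (1 + b * \<bar>norm m - t\<bar>) powr (- q))"
proof (rule Bochner_Integration.integrable_bound)
  show "integrable lat (\<lambda>m :: real ^ 'n. (1 + t) powr q * decay q (0 + m))"
    by (intro integrable_mult_right integrable_lat_decay q)
  show "AE m in lat. norm ((1 + b * \<bar>norm (m :: real ^ 'n) - t\<bar>) powr (- q)) \<le> norm ((1 + t) powr q * decay q (0 + m))"
  proof (rule AE_I2)
    fix m :: "real ^ 'n"
    have q0: "q \<ge> 0" using q by (rule order_trans[OF of_nat_0_le_iff less_imp_le])
    have "(1 + b * \<bar>norm m - t\<bar>) powr (- q) \<le> (1 + t) powr q * (1 + norm m) powr (- q)"
    proof -
      have "(1 + t) powr (- q) * (1 + b * \<bar>norm m - t\<bar>) powr (- q) \<le> (1 + norm m) powr (- q)"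
        using Peetre_tail[OF t norm_ge_zero b, of "- q" 0 q m] q0 b by (simp add: abs_minus_commute split: if_splits)
      then have "(1 + t) powr q * ((1 + t) powr (- q) * (1 + b * \<bar>norm m - t\<bar>) powr (- q)) \<le> (1 + t) powr q * (1 + norm m) powr (- q)"
        by (intro mult_left_mono) auto
      then show ?thesis using t by (simp add: mult.assoc[symmetric] powr_add[symmetric])
    qed
    then show "norm ((1 + b * \<bar>norm m - t\<bar>) powr (- q)) \<le> norm ((1 + t) powr q * decay q (0 + m))"
      by (simp add: decay_def)
  qed
qed simp

lemma ball_partial_sum_eq_lat:
  "(\<Sum>m\<in>{m \<in> int_lattice. norm m < t}. f m) = (\<integral>m. f m * indicator {..<t} (norm m) \<partial>lat)"
  and lat_partial_integrable: "integrable lat (\<lambda>m. f m * indicator {..<t} (norm m))"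
  for f :: "real ^ 'n \<Rightarrow> real"
proof -
  let ?f = "\<lambda>m. f m * indicator {..<t} (norm m)"
  have fin: "finite {m \<in> int_lattice :: (real ^ 'n) set. norm m < t}"
    by (rule finite_subset[OF _ finite_int_lattice_ball[of t]]) auto
  have L: "integrable lat ?f" "(\<integral>m. ?f m \<partial>lat) = sum ?f {m \<in> int_lattice. norm m < t}"
    by (rule lat_finite_support[OF fin]; auto)+
  show "integrable lat ?f" by (rule L(1))
  have "sum ?f {m \<in> int_lattice. norm m < t} = sum f {m \<in> int_lattice. norm m < t}" by (intro sum.cong) auto
  then show "(\<Sum>m\<in>{m \<in> int_lattice. norm m < t}. f m) = (\<integral>m. ?f m \<partial>lat)" unfolding L(2) by simp
qed

text \<open>A weighted count of the lattice points within about 1/b of the sphere of radius t; the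
  exponent n + 1 makes the sum converge. The \<open>itself\<close> argument fixes the dimension,
  which no other argument shows.\<close>

definition kernel_sum :: "'n::finite itself \<Rightarrow> real \<Rightarrow> real \<Rightarrow> real" where
  "kernel_sum _ b t = (\<integral>m. (1 + b * \<bar>norm (m :: real ^ 'n) - t\<bar>) powr (- (real CARD('n) + 1)) \<partial>lat)"

text \<open>Two replacements are made. In the lattice sum the sharp cutoff becomes smooth, at the
  cost of the transform near the sphere times \<open>kernel_sum\<close>; in each dual integral the
  smooth cutoff becomes sharp again, at the cost of the integrand at t times 1/b. C precedes b and K
  follows it: only the dual points k \<noteq> 0, whose number grows with b, need a constant
  depending on b.\<close>

lemma smoothed_lattice_sum:
  assumes \<beta>: "\<beta> > -1" and a: "a > 0"
  shows "\<exists>C\<ge>0. \<forall>b\<ge>1. \<exists>K\<ge>0. \<forall>t\<ge>1.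
     \<bar>(\<Sum>m\<in>{m \<in> int_lattice. norm m < t}. ball_ft CARD('n) \<beta> a (norm (m :: real ^ 'n)))
       - (\<Sum>k\<in>{k \<in> int_lattice. norm k \<le> a + 2 * b}. ball_inv CARD('n) \<beta> a (norm (k :: real ^ 'n)) t)\<bar>
     \<le> C * ((1 + t) powr (- ((real CARD('n) + 1) / 2 + \<beta>)) * kernel_sum TYPE('n) b t
             + 1 / b * (1 + t) powr ((real CARD('n) - 3) / 2 - \<beta>))
       + K * (1 + t) powr (- 1 - \<beta>)"
    (is "\<exists>C\<ge>0. \<forall>b\<ge>1. \<exists>K\<ge>0. \<forall>t\<ge>1. ?Q C b K t")
proof -
  define n where "n = CARD('n)"
  have n: "n \<ge> 1" unfolding n_def by (rule card_pos)
  then have n': "real n \<ge> 1" by simp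
  define p where "p = (real n + 1) / 2 + \<beta>"
  have p: "p \<ge> 0" using n' \<beta> unfolding p_def by (simp add: field_simps)
  define M where "M = real n + p"
  have M: "M \<ge> real CARD('n)" using p by (simp add: M_def n_def)
  have M2: "2 * M > real CARD('n)" using p by (simp add: M_def n_def add_pos_nonneg)
  define B where "B s = ball_ft n \<beta> a s" for s
  let ?S = "\<lambda>t. \<Sum>m\<in>{m \<in> int_lattice. norm m < t}. B (norm (m :: real ^ 'n))"
  have cB: "continuous_on A f \<Longrightarrow> continuous_on A (\<lambda>x. B (f x))" for A :: "'z::topological_space set" and f
    unfolding B_def by (rule continuous_on_ball_ft)
  have [measurable]: "B \<in> Borel" unfolding B_def by measurable
  obtain K where K: "K > 0" "\<And>s. s \<ge> 0 \<Longrightarrow> \<bar>B s\<bar> \<le> K * (1 + s) powr (- p)"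
    using ball_ft_bound[OF a, of n \<beta>] unfolding B_def p_def by blast
  have K1: "\<bar>B s\<bar> \<le> K" if "s \<ge> 0" for s
  proof -
    have "(1 + s) powr (- p) \<le> (1 + s) powr 0" using that p by (intro powr_mono) auto
    then have "K * (1 + s) powr (- p) \<le> K * 1" using K(1) that by (intro mult_left_mono) auto
    then show ?thesis using K(2)[OF that] by simp
  qed
  obtain C0 where C0: "C0 \<ge> 0" "\<And>b t (\<xi> :: real ^ 'n). b > 0 \<Longrightarrow>
     \<bar>cutoff M b t \<xi> - indicator {..<t} (norm \<xi>)\<bar> \<le> C0 * (1 + b * \<bar>norm \<xi> - t\<bar>) powr (- 2 * M)"
    using cutoff_approx[OF M] by blast
  define e where "e r = (if r = 0 then real n - 1 else (real n - 1) / 2)" for r :: real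
  have "\<forall>r\<in>{0..}. \<exists>W\<ge>0. \<forall>s\<ge>0. \<bar>radial_weight n r s\<bar> \<le> W * (1 + s) powr e r"
    using radial_weight_bound[OF n] unfolding e_def by simp
  then have "\<exists>W. \<forall>r\<in>{0..}. W r \<ge> 0 \<and> (\<forall>s\<ge>0. \<bar>radial_weight n r s\<bar> \<le> W r * (1 + s) powr e r)"
    by (rule bchoice)
  then obtain W where W0: "\<forall>r\<in>{0..}. W r \<ge> 0 \<and> (\<forall>s\<ge>0. \<bar>radial_weight n r s\<bar> \<le> W r * (1 + s) powr e r)"
    by blast
  have W: "r \<ge> 0 \<Longrightarrow> W r \<ge> 0" "r \<ge> 0 \<Longrightarrow> s \<ge> 0 \<Longrightarrow> \<bar>radial_weight n r s\<bar> \<le> W r * (1 + s) powr e r" for r s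
    using W0 by auto
  define C where "C = K * C0 + W 0 * K * C0 * 2"
  have C: "C \<ge> 0" using K(1) C0(1) W(1)[of 0] by (simp add: C_def)
  show ?thesis
  proof (rule exI[of _ C], rule conjI[OF C], intro allI impI)
    fix b :: real assume b: "b \<ge> 1"
    then have b0: "b > 0" by simp
    let ?v = "\<lambda>t :: real. 1 / b * (1 + t) powr ((real n - 3) / 2 - \<beta>)"
    let ?A = "{k \<in> int_lattice :: (real ^ 'n) set. norm k \<le> a + 2 * b}"
    \<comment> \<open>The contribution of all dual points other than 0. It depends on b through the
      set of these points.\<close>
    define L where "L = (\<Sum>k\<in>?A - {0}. W (norm k) * K * C0 * 2)"
    have L: "L \<ge> 0" unfolding L_def using W(1) K(1) C0(1) by (intro sum_nonneg) auto
    have main: "\<bar>?S t - (\<Sum>k\<in>?A. ball_inv n \<beta> a (norm k) t)\<bar>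
      \<le> C * ((1 + t) powr (- p) * kernel_sum TYPE('n) b t + ?v t)
         + L * (1 + t) powr (- 1 - \<beta>)" if t1: "t \<ge> 1" for t
    proof -
      have t: "t > 0" using t1 by simp
      define \<phi> where "\<phi> = (cutoff M b t :: real ^ 'n \<Rightarrow> real)"
      define \<theta> where "\<theta> \<xi> = \<phi> \<xi> - indicator {..<t} (norm \<xi>)" for \<xi>
      have \<theta>: "\<bar>\<theta> \<xi>\<bar> \<le> C0 * (1 + b * \<bar>norm \<xi> - t\<bar>) powr (- (2 * M))" for \<xi>
        using C0(2)[OF b0, of t \<xi>] by (simp add: \<theta>_def \<phi>_def)
      have c\<phi>: "continuous_on UNIV \<phi>" unfolding \<phi>_def by (rule continuous_on_cutoff[OF M b0])
      have [measurable]: "\<phi> \<in> Borel" by (rule borel_measurable_continuous_onI[OF c\<phi>])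
      obtain D where D: "D \<ge> 0" "\<And>\<xi>. \<bar>\<phi> \<xi>\<bar> \<le> D * decay (2 * M) \<xi>"
        using cutoff_decay[OF M b t] unfolding \<phi>_def by blast
      define F where "F = (\<lambda>\<xi>. complex_of_real (\<phi> \<xi> * B (norm \<xi>)))"
      have [measurable]: "F \<in> Borel" unfolding F_def by measurable
      have Fb: "norm (F \<xi>) \<le> D * K * decay (2 * M) \<xi>" for \<xi>
      proof -
        have "\<bar>\<phi> \<xi>\<bar> * \<bar>B (norm \<xi>)\<bar> \<le> (D * decay (2 * M) \<xi>) * K"
          using K(1) D(1) by (intro mult_mono D K1) auto
        then show ?thesis by (simp add: F_def norm_mult abs_mult mult_ac)
      qed
      have cF: "continuous_on UNIV F"
        unfolding F_def by (intro continuous_intros c\<phi> cB)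
      have iF: "integrable lborel F" by (rule integrable_decay_bound[OF M2 _ Fb]) measurable
      have i\<phi>: "integrable lborel (\<lambda>\<xi>. complex_of_real (\<phi> \<xi>))"
        by (rule integrable_decay_bound[OF M2, where K = D]) (use D in auto)
      \<comment> \<open>The transform of F is the convolution of the ball power, supported in radius
        a, with the transform of the cutoff, supported in radius 2b.\<close>
      have F0: "four F k = 0" if k: "norm k > a + 2 * b" for k
      proof -
        have "four F k = (LBINT \<xi>. four (ball_power \<beta> a) \<xi> * of_real (\<phi> \<xi>) * ee (- k \<bullet> \<xi>))"
          unfolding four_def[of F] four_ball_power[OF \<beta> a] by (simp add: F_def B_def n_def mult_ac)
        also have "\<dots> = (LBINT x. ball_power \<beta> a x * four (\<lambda>\<xi>. complex_of_real (\<phi> \<xi>)) (x - - k))"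
          by (intro four_multiplication integrable_ball_power \<beta> a i\<phi>)
        also have "\<dots> = (\<integral>x. 0 \<partial>(lborel :: (real ^ 'n) measure))"
        proof (intro Bochner_Integration.integral_cong refl)
          fix x :: "real ^ 'n"
          have "norm k \<le> norm (x + k) + norm x" using norm_triangle_ineq4[of "x + k" x] by simp
          then have "norm x \<ge> a \<or> norm (x - - k) \<ge> 2 * b" using k by auto
          then show "ball_power \<beta> a x * four (\<lambda>\<xi>. complex_of_real (\<phi> \<xi>)) (x - - k) = 0"
            unfolding \<phi>_def using four_cutoff_eq_0[OF M b0 t] by (auto simp: ball_power_def)
        qed
        finally show ?thesis by simp
      qed
      \<comment> \<open>The profile of the cutoff, read off along one coordinate axis.\<close>
      define pr where "pr s = \<phi> (s *\<^sub>R axis undefined 1)" for s :: real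
      have [measurable]: "pr \<in> Borel" unfolding pr_def by measurable
      have pr: "\<phi> \<xi> = pr (norm \<xi>)" for \<xi>
        unfolding pr_def \<phi>_def by (rule cutoff_radial) simp
      have pr': "\<bar>pr s - indicator {..<t} s\<bar> \<le> C0 * (1 + b * \<bar>s - t\<bar>) powr (- (2 * M))" if "s \<ge> 0" for s
        using \<theta>[of "s *\<^sub>R axis undefined 1"] that by (simp add: \<theta>_def pr_def)
      define J where "J k = (LBINT s. indicator {0..} s * (radial_weight n (norm k) s * (pr s * B s)))" for k :: "real ^ 'n"
      have iR: "integrable lborel (\<lambda>\<xi> :: real ^ 'n. pr (norm \<xi>) * B (norm \<xi>))"
        using iF unfolding F_def complex_of_real_integrable_eq pr .
      have FJ: "four F k = of_real (J k)" for k
      proof -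
        have "four F k = (LBINT \<xi>. of_real (pr (norm \<xi>) * B (norm \<xi>)) * ee (- k \<bullet> \<xi>))"
          by (simp add: four_def F_def pr)
        also have "\<dots> = of_real (J k)"
          using integral_radial_ee[of "\<lambda>s. pr s * B s", OF _ iR, of "- k"] by (simp add: J_def n_def)
        finally show ?thesis .
      qed
      have "(\<integral>m. F m \<partial>lat) = (\<Sum>k\<in>?A. four F k)"
        by (rule Poisson_summation_finite[OF M2 Fb cF F0])
      moreover have "(\<integral>m. F m \<partial>lat) = complex_of_real (\<integral>m. \<phi> m * B (norm m) \<partial>lat)"
        unfolding F_def by (rule integral_complex_of_real)
      ultimately have "complex_of_real (\<integral>m. \<phi> m * B (norm m) \<partial>lat) = of_real (\<Sum>k\<in>?A. J k)"
        by (simp only: FJ of_real_sum)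
      then have P: "(\<integral>m. \<phi> m * B (norm m) \<partial>lat) = (\<Sum>k\<in>?A. J k)" by (simp only: of_real_eq_iff)
      have iL: "integrable lat (\<lambda>m. \<phi> m * B (norm m))"
      proof -
        have "integrable lat F" using integrable_lat_bound[OF M2 Fb, of 0 "\<lambda>_. 0"] by simp
        then show ?thesis unfolding F_def complex_of_real_integrable_eq .
      qed
      \<comment> \<open>The error of the lattice sum: by the choice of M the decay of B can be
        evaluated at t, and what remains is \<open>kernel_sum\<close>.\<close>
      have S: "\<bar>?S t - (\<Sum>k\<in>?A. J k)\<bar>
         \<le> K * C0 * ((1 + t) powr (- p) * kernel_sum TYPE('n) b t)"
      proof -
        have e1: "(\<Sum>k\<in>?A. J k) - ?S t
          = (\<integral>m. \<phi> m * B (norm m) - B (norm m) * indicator {..<t} (norm m) \<partial>lat)"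
          unfolding P[symmetric] ball_partial_sum_eq_lat
          by (rule Bochner_Integration.integral_diff[symmetric, OF iL lat_partial_integrable])
        have "\<bar>\<integral>m. \<phi> m * B (norm m) - B (norm m) * indicator {..<t} (norm m) \<partial>lat\<bar> \<le> (\<integral>m. K * C0 * ((1 + t) powr (- p) * (1 + b * \<bar>norm (m :: real ^ 'n) - t\<bar>) powr (- (real n + 1))) \<partial>lat)"
        proof (rule order_trans[OF integral_abs_bound], rule integral_mono)
          show "integrable lat (\<lambda>m. \<bar>\<phi> m * B (norm m) - B (norm m) * indicator {..<t} (norm m)\<bar>)"
            by (intro integrable_abs Bochner_Integration.integrable_diff iL lat_partial_integrable)
          show "integrable lat (\<lambda>m :: real ^ 'n. K * C0 * ((1 + t) powr (- p) * (1 + b * \<bar>norm m - t\<bar>) powr (- (real n + 1))))"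
            using t by (intro integrable_mult_right lat_kernel_integrable b) (auto simp: n_def)
          fix m :: "real ^ 'n"
          have "\<bar>B (norm m)\<bar> * \<bar>\<theta> m\<bar> \<le> (K * (1 + norm m) powr (- p)) * (C0 * (1 + b * \<bar>norm m - t\<bar>) powr (- (2 * M)))"
            using K(1) by (intro mult_mono K(2) \<theta>) auto
          also have "\<dots> = K * C0 * ((1 + norm m) powr (- p) * (1 + b * \<bar>norm m - t\<bar>) powr (- (2 * M)))" by simp
          also have "\<dots> \<le> K * C0 * ((1 + t) powr (- p) * (1 + b * \<bar>norm m - t\<bar>) powr (- (real n + 1)))"
            using K(1) C0(1) t b p n' by (intro mult_left_mono Peetre_tail) (auto simp: M_def)
          finally show "\<bar>\<phi> m * B (norm m) - B (norm m) * indicator {..<t} (norm m)\<bar>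
            \<le> K * C0 * ((1 + t) powr (- p) * (1 + b * \<bar>norm m - t\<bar>) powr (- (real n + 1)))"
            by (simp add: \<theta>_def abs_mult[symmetric] right_diff_distrib mult.commute)
        qed
        then have "\<bar>(\<Sum>k\<in>?A. J k) - ?S t\<bar>
          \<le> K * C0 * ((1 + t) powr (- p) * kernel_sum TYPE('n) b t)"
          unfolding e1[symmetric] by (simp add: kernel_sum_def n_def)
        then show ?thesis by (simp only: abs_minus_commute)
      qed
      \<comment> \<open>The error of a dual integral: the bounds of the weight and of B are
        evaluated at t, and the kernel integrates to 2/b over the line.\<close>
      have JH: "\<bar>J k - ball_inv n \<beta> a (norm k) t\<bar> \<le> W (norm k) * K * C0 * 2 * (1 / b * (1 + t) powr (e (norm k) - p))" for k
      proof -
        let ?w = "radial_weight n (norm k)"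
        let ?D = "\<lambda>s :: real. indicator {0..} s * (?w s * (pr s * B s)) - indicator {0..t} s * (?w s * B s)"
        have cont: "continuous_on X (\<lambda>s. ?w s * B s)" for X unfolding B_def by (intro continuous_intros)
        have H: "ball_inv n \<beta> a (norm k) t = (LBINT s. indicator {0..t} s * (?w s * B s))"
          unfolding ball_inv_def B_def[symmetric] by (rule integral_Icc_eq_lborel(2)[OF cont, symmetric])
        have iJ: "integrable lborel (\<lambda>s. indicator {0..} s * (?w s * (pr s * B s)))"
          using has_bochner_integral_radial(1)[of "\<lambda>s. pr s * B s", OF _ iR, of k] by (simp add: n_def)
        have ae: "AE s in lborel. s \<noteq> t"
          using AE_not_in[OF countable_imp_null_set_lborel[of "{t}"]] by simp
        have e2: "J k - ball_inv n \<beta> a (norm k) t = (LBINT s. ?D s)"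
          unfolding J_def H by (rule Bochner_Integration.integral_diff[symmetric, OF iJ integral_Icc_eq_lborel(1)[OF cont]])
        have "\<bar>\<integral>s. ?D s \<partial>lborel\<bar> \<le> (LBINT s. W (norm k) * K * C0 * (1 + t) powr (e (norm k) - p) * (1 + b * \<bar>s - t\<bar>) powr (- 2))"
        proof (rule order_trans[OF integral_abs_bound], rule integral_mono_AE)
          show "integrable lborel (\<lambda>s. \<bar>?D s\<bar>)"
            by (intro integrable_abs Bochner_Integration.integrable_diff iJ integral_Icc_eq_lborel(1)[OF cont])
          show "integrable lborel (\<lambda>s. W (norm k) * K * C0 * (1 + t) powr (e (norm k) - p) * (1 + b * \<bar>s - t\<bar>) powr (- 2))"
            by (intro integrable_mult_right integral_kernel b0)
          have W0: "W (norm k) \<ge> 0" by (rule W(1)) simp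
          show "AE s in lborel. \<bar>?D s\<bar>
             \<le> W (norm k) * K * C0 * (1 + t) powr (e (norm k) - p) * (1 + b * \<bar>s - t\<bar>) powr (- 2)"
            using ae
          proof eventually_elim
            case (elim s)
            show ?case
            proof (cases "s \<ge> 0")
              case False
              then show ?thesis using K(1) C0(1) W0 by simp
            next
              case True
              have "?D s = ?w s * B s * (pr s - indicator {..<t} s)"
                using True elim by (auto simp: indicator_def right_diff_distrib)
              then have "\<bar>?D s\<bar> = \<bar>?w s\<bar> * \<bar>B s\<bar> * \<bar>pr s - indicator {..<t} s\<bar>"
                by (simp only: abs_mult)
              also have "\<dots> \<le> (W (norm k) * (1 + s) powr e (norm k)) * (K * (1 + s) powr (- p)) * (C0 * (1 + b * \<bar>s - t\<bar>) powr (- (2 * M)))"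
                using True W0 K(1) by (intro mult_mono W K(2) pr') auto
              also have "\<dots> = W (norm k) * K * C0 * ((1 + s) powr (e (norm k) - p) * (1 + b * \<bar>s - t\<bar>) powr (- (2 * M)))"
                by (simp add: powr_diff powr_minus divide_inverse)
              also have "\<dots> \<le> W (norm k) * K * C0 * ((1 + t) powr (e (norm k) - p) * (1 + b * \<bar>s - t\<bar>) powr (- 2))"
              proof (intro mult_left_mono Peetre_tail)
                have "0 \<le> e (norm k)" "e (norm k) \<le> real n - 1" using n' by (auto simp: e_def)
                then show "\<bar>e (norm k) - p\<bar> + 2 \<le> 2 * M" using p n' unfolding M_def by (simp add: abs_le_iff)
              qed (use True t b W0 K(1) C0(1) in auto)
              finally show ?thesis by (simp add: mult.assoc)
            qed
          qed
        qed
        also have "\<dots> = W (norm k) * K * C0 * 2 * (1 / b * (1 + t) powr (e (norm k) - p))"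
          using integral_kernel(2)[OF b0, of t] by simp
        finally show ?thesis unfolding e2 .
      qed
      have "\<bar>(\<Sum>k\<in>?A. J k) - (\<Sum>k\<in>?A. ball_inv n \<beta> a (norm k) t)\<bar> \<le> (\<Sum>k\<in>?A. \<bar>J k - ball_inv n \<beta> a (norm k) t\<bar>)"
        unfolding sum_subtractf[symmetric] by (rule sum_abs)
      also have "\<dots> = \<bar>J 0 - ball_inv n \<beta> a (norm (0 :: real ^ 'n)) t\<bar> + (\<Sum>k\<in>?A - {0}. \<bar>J k - ball_inv n \<beta> a (norm k) t\<bar>)"
        using a b by (intro sum.remove finite_int_lattice_ball) auto
      also have "\<dots> \<le> W 0 * K * C0 * 2 * (?v t) + L * (1 + t) powr (-1 - \<beta>)"
      proof (rule add_mono)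
        have "e 0 - p = (real n - 3) / 2 - \<beta>" by (simp add: e_def p_def field_simps)
        then show "\<bar>J 0 - ball_inv n \<beta> a (norm (0 :: real ^ 'n)) t\<bar> \<le> W 0 * K * C0 * 2 * (?v t)"
          using JH[of 0] by (simp only: norm_zero)
        show "(\<Sum>k\<in>?A - {0}. \<bar>J k - ball_inv n \<beta> a (norm k) t\<bar>) \<le> L * (1 + t) powr (-1 - \<beta>)"
          unfolding L_def sum_distrib_right
        proof (rule sum_mono)
          fix k :: "real ^ 'n" assume k: "k \<in> ?A - {0}"
          then have "e (norm k) - p = -1 - \<beta>" by (simp add: e_def p_def field_simps)
          then have "\<bar>J k - ball_inv n \<beta> a (norm k) t\<bar> \<le> W (norm k) * K * C0 * 2 * (1 / b * (1 + t) powr (-1 - \<beta>))"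
            using JH[of k] by (simp only:)
          also have "\<dots> \<le> W (norm k) * K * C0 * 2 * (1 * (1 + t) powr (-1 - \<beta>))"
            using b W(1)[of "norm k"] K(1) C0(1) by (intro mult_left_mono mult_right_mono) auto
          finally show "\<bar>J k - ball_inv n \<beta> a (norm k) t\<bar> \<le> W (norm k) * K * C0 * 2 * (1 + t) powr (-1 - \<beta>)" by simp
        qed
      qed
      finally have T: "\<bar>(\<Sum>k\<in>?A. J k) - (\<Sum>k\<in>?A. ball_inv n \<beta> a (norm k) t)\<bar>
         \<le> W 0 * K * C0 * 2 * (?v t) + L * (1 + t) powr (-1 - \<beta>)" .
      have A0: "kernel_sum TYPE('n) b t \<ge> 0"
        unfolding kernel_sum_def by (intro integral_nonneg_AE AE_I2) simp
      have gen: "x * u + y * v \<le> (x + y) * (u + v)" if "x \<ge> 0" "y \<ge> 0" "u \<ge> 0" "v \<ge> 0" for x y u v :: real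
        using that by (simp add: algebra_simps)
      have "K * C0 * ((1 + t) powr (- p) * kernel_sum TYPE('n) b t) + W 0 * K * C0 * 2 * (?v t)
        \<le> C * ((1 + t) powr (- p) * kernel_sum TYPE('n) b t + ?v t)"
        unfolding C_def using K(1) C0(1) W(1)[of 0] A0 b by (intro gen) auto
      then show ?thesis using S T by linarith
    qed
    show "\<exists>K\<ge>0. \<forall>t\<ge>1. ?Q C b K t"
      using main L unfolding B_def p_def n_def by blast
  qed
qed

text \<open>Each lattice point is compared with the unit cube around it, for the kernel of scale 1,
  which dominates since b >= 1. In polar coordinates the resulting integral over a shell is of the
  order of the area of the sphere.\<close>

lemma kernel_sum_bound:
  "\<exists>C\<ge>0. \<forall>b\<ge>1. \<forall>t\<ge>0. kernel_sum TYPE('n::finite) b t \<le> C * (1 + t) powr (real CARD('n) - 1)"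
proof -
  define n where "n = CARD('n)"
  have n: "n \<ge> 1" unfolding n_def by (rule card_pos)
  then have n': "real n \<ge> 1" by simp
  let ?P = "\<lambda>t :: real. (1 + t) powr (real n - 1)"
  obtain W where W: "W \<ge> 0" "\<And>s. s \<ge> 0 \<Longrightarrow> \<bar>radial_weight n 0 s\<bar> \<le> W * (1 + s) powr (real n - 1)"
    using radial_weight_bound[OF n, of 0] by auto
  \<comment> \<open>The loss from moving inside the cube: its points have norm at most n, so the
    distance to the sphere changes by at most n.\<close>
  define D where "D = (1 + real n) powr (real n + 1)"
  have "kernel_sum TYPE('n) b t \<le> D * (W * 2) * ?P t" if b: "b \<ge> 1" and t: "t \<ge> 0" for b t
  proof -
    define f where "f s = (1 + \<bar>s - t\<bar>) powr (- (real n + 1))" for s :: real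
    have [measurable]: "f \<in> Borel" unfolding f_def by measurable
    have bd: "\<bar>indicator {0..} s * (radial_weight n 0 s * f s)\<bar> \<le> W * ?P t * (1 + 1 * \<bar>s - t\<bar>) powr (- 2)" for s
    proof (cases "s \<ge> 0")
      case True
      have "\<bar>radial_weight n 0 s\<bar> * f s \<le> W * (1 + s) powr (real n - 1) * f s"
        using True by (intro mult_right_mono W) (auto simp: f_def)
      also have "\<dots> = W * ((1 + s) powr (real n - 1) * (1 + 1 * \<bar>s - t\<bar>) powr (- (real n + 1)))"
        by (simp add: f_def)
      also have "\<dots> \<le> W * (?P t * (1 + 1 * \<bar>s - t\<bar>) powr (- 2))"
        using True t n' W(1) by (intro mult_left_mono Peetre_tail) auto
      finally show ?thesis using True by (simp add: abs_mult f_def)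
    qed (use W(1) in simp)
    have ik: "integrable lborel (\<lambda>s. W * ?P t * (1 + 1 * \<bar>s - t\<bar>) powr (- 2))"
      by (intro integrable_mult_right integral_kernel) simp
    have i1: "integrable lborel (\<lambda>s. indicator {0..} s * (radial_weight n 0 s * f s))"
      by (rule Bochner_Integration.integrable_bound[OF ik]) (use bd W(1) in \<open>auto intro!: AE_I2\<close>)
    then have i2: "integrable lborel (\<lambda>x :: real ^ 'n. f (norm x))"
      by (subst integrable_radial_iff) (auto simp: n_def)
    have "(LBINT x. f (norm (x :: real ^ 'n))) = (LBINT s. indicator {0..} s * (radial_weight n 0 s * f s))"
      using has_bochner_integral_integral_eq[OF has_bochner_integral_radial(2)[OF _ i2, of 0]] by (simp add: n_def)
    also have "\<dots> \<le> (LBINT s. W * ?P t * (1 + 1 * \<bar>s - t\<bar>) powr (- 2))"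
      by (rule integral_mono[OF i1 ik]) (use bd in \<open>auto simp: abs_le_iff\<close>)
    also have "\<dots> = W * 2 * ?P t"
      using integral_kernel(2)[of 1 t] by simp
    finally have int: "(LBINT x. f (norm (x :: real ^ 'n))) \<le> W * 2 * ?P t" .
    define v where "v m = (1 + b * \<bar>norm m - t\<bar>) powr (- (real n + 1))" for m :: "real ^ 'n"
    have iv: "integrable lat v" unfolding v_def by (rule lat_kernel_integrable[OF b t]) (simp add: n_def)
    have "(\<integral>\<^sup>+m. ennreal (v m) \<partial>lat) \<le> (\<integral>\<^sup>+x. ennreal (D * f (norm (x :: real ^ 'n))) \<partial>lborel)"
    proof (rule lattice_sum_le_integral)
      fix x m :: "real ^ 'n" assume x: "x \<in> torus"
      have "norm (x + m) \<le> norm m + real n" "norm m \<le> norm (x + m) + real n"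
        using norm_torus[OF x] norm_triangle_ineq[of x m] norm_triangle_ineq4[of "x + m" x] by (auto simp: n_def)
      then have "\<bar>norm (x + m) - t\<bar> \<le> \<bar>norm m - t\<bar> + real n" by linarith
      moreover have "\<bar>norm m - t\<bar> \<le> b * \<bar>norm m - t\<bar>" using mult_right_mono[OF b, of "\<bar>norm m - t\<bar>"] by simp
      moreover have "0 \<le> real n * (b * \<bar>norm m - t\<bar>)" using b by simp
      ultimately have "1 + \<bar>norm (x + m) - t\<bar> \<le> (1 + real n) * (1 + b * \<bar>norm m - t\<bar>)"
        by (simp only: distrib_left distrib_right mult_1_left mult_1_right)
      then have "((1 + real n) * (1 + b * \<bar>norm m - t\<bar>)) powr (- (real n + 1)) \<le> f (norm (x + m))"
        unfolding f_def by (intro powr_mono2') auto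
      then have "D * ((1 + real n) powr (- (real n + 1)) * v m) \<le> D * f (norm (x + m))"
        using b by (intro mult_left_mono) (auto simp: v_def powr_mult D_def)
      then show "v m \<le> D * f (norm (x + m))"
        unfolding D_def mult.assoc[symmetric] powr_add[symmetric] by simp
    qed measurable
    also have "\<dots> = ennreal (D * (LBINT x. f (norm (x :: real ^ 'n))))"
      using i2 by (subst nn_integral_eq_integral) (auto simp: D_def f_def)
    finally have "ennreal (\<integral>m. v m \<partial>lat) \<le> ennreal (D * (LBINT x. f (norm (x :: real ^ 'n))))"
      by (subst (asm) nn_integral_eq_integral[OF iv]) (simp add: v_def, assumption)
    then have "(\<integral>m. v m \<partial>lat) \<le> D * (LBINT x. f (norm (x :: real ^ 'n)))"
      by (subst (asm) ennreal_le_iff) (auto simp: D_def f_def)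
    also have "\<dots> \<le> D * (W * 2 * ?P t)" by (intro mult_left_mono int) (simp add: D_def)
    finally show ?thesis by (simp add: kernel_sum_def v_def n_def mult.assoc)
  qed
  moreover have "D * (W * 2) \<ge> 0" using W(1) by (simp add: D_def)
  ultimately show ?thesis unfolding n_def by blast
qed

section \<open>Lattice points in thin shells\<close>

lemma ball_indicator_ft_bound:
  assumes s: "s > 0"
  shows "\<exists>K\<ge>0. \<forall>T>0. \<bar>ball_ft n 0 T s\<bar> \<le> K * (1 + T) powr ((real n - 1) / 2)"
proof -
  \<comment> \<open>The roles are exchanged: the frequency s is fixed and the radius T varies.
    Dimension 0 again turns \<open>ball_ft\<close> into a plain Bessel function, now of T.\<close>
  obtain K where K: "K > 0" "\<And>T. T \<ge> 0 \<Longrightarrow> \<bar>ball_ft 0 (real n / 2) s T\<bar> \<le> K * (1 + T) powr (- ((real 0 + 1) / 2 + real n / 2))"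
    using ball_ft_bound[OF s, of 0 "real n / 2"] by blast
  define c where "c = Gamma (real n / 2 + 1) * s powr real n"
  have c: "c > 0" using s Gamma_real_pos[of "real n / 2 + 1"] by (simp add: c_def)
  define D where "D = pi powr (real n / 2) / c"
  have D: "D \<ge> 0" using c by (simp add: D_def)
  have "\<bar>ball_ft n 0 T s\<bar> \<le> D * K * (1 + T) powr ((real n - 1) / 2)" if T: "T > 0" for T
  proof -
    have "ball_ft 0 (real n / 2) s T = c * clifford (real n / 2) ((pi * T * s)^2)"
      by (simp add: ball_ft_def c_def mult_ac)
    then have "ball_ft n 0 T s = D * (T powr real n * ball_ft 0 (real n / 2) s T)"
      using c by (simp add: ball_ft_def D_def)
    then have "\<bar>ball_ft n 0 T s\<bar> = D * (T powr real n * \<bar>ball_ft 0 (real n / 2) s T\<bar>)"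
      using D T by (simp add: abs_mult)
    also have "\<dots> \<le> D * ((1 + T) powr real n * (K * (1 + T) powr (- ((real 0 + 1) / 2 + real n / 2))))"
      using D T K(1) by (intro mult_left_mono mult_mono powr_mono2 K(2)) auto
    also have "\<dots> = D * K * ((1 + T) powr real n * (1 + T) powr (- ((real 0 + 1) / 2 + real n / 2)))" by simp
    also have "(1 + T) powr real n * (1 + T) powr (- ((real 0 + 1) / 2 + real n / 2)) = (1 + T) powr ((real n - 1) / 2)"
      by (rule powr_mult_powr) (simp add: field_simps)
    finally show ?thesis .
  qed
  moreover have "D * K \<ge> 0" using D K(1) by simp
  ultimately show ?thesis by blast
qed

lemma power_diff_le:
  fixes x y :: real
  assumes "0 \<le> y" "y \<le> x"
  shows "x ^ n - y ^ n \<le> real n * (x - y) * x ^ (n - 1)"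
proof (induction n)
  case (Suc n)
  have "x ^ Suc n - y ^ Suc n = x * (x ^ n - y ^ n) + (x - y) * y ^ n" by (simp add: algebra_simps)
  also have "\<dots> \<le> x * (real n * (x - y) * x ^ (n - 1)) + (x - y) * x ^ n"
    using assms Suc by (intro add_mono mult_left_mono power_mono) auto
  also have "x * (real n * (x - y) * x ^ (n - 1)) = real n * (x - y) * x ^ n"
    by (cases n) auto
  finally show ?case by (simp add: algebra_simps)
qed simp

text \<open>The count is dominated by the difference of two smoothed ball counts, at radii t +
  2\<rho> and t - 2\<rho> and with b of order 1/\<rho>. By Poisson each is V T^n plus finitely many
  oscillating terms of order T^((n-1)/2). The volumes differ by O(\<rho> t^(n-1)), and for n >= 2
  the other terms are of lower order.\<close>

lemma lattice_shell_count:
  assumes n2: "CARD('n::finite) \<ge> 2"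
  shows "\<exists>C\<ge>0. \<forall>\<rho>. 0 < \<rho> \<and> \<rho> \<le> 1 \<longrightarrow> (\<forall>\<^sub>F t in at_top.
    real (card {m \<in> int_lattice :: (real ^ 'n) set. \<bar>norm m - t\<bar> \<le> \<rho>}) \<le> C * \<rho> * t powr (real CARD('n) - 1))"
proof -
  define n where "n = CARD('n)"
  have n: "n \<ge> 2" using n2 by (simp add: n_def)
  define M where "M = real n"
  have M: "M \<ge> real CARD('n)" by (simp add: M_def n_def)
  have M2: "2 * M > real CARD('n)" using n by (simp add: M_def n_def)
  obtain C0 where C0: "C0 \<ge> 0" "\<And>b t (\<xi> :: real ^ 'n). b > 0 \<Longrightarrow>
     \<bar>cutoff M b t \<xi> - indicator {..<t} (norm \<xi>)\<bar> \<le> C0 * (1 + b * \<bar>norm \<xi> - t\<bar>) powr (- 2 * M)"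
    using cutoff_approx[OF M] by blast
  \<comment> \<open>Chosen such that C0/(1 + B0) <= 1/4, the accuracy of the cutoffs used in
    \<open>half\<close>.\<close>
  define B0 where "B0 = 4 * C0 + 1"
  have B0: "B0 \<ge> 1" using C0(1) by (simp add: B0_def)
  \<comment> \<open>The volume of the unit ball; V T^n is the term of frequency 0.\<close>
  define V where "V = pi powr (real n / 2) * rGamma (real n / 2 + 1)"
  have V: "V \<ge> 0" using rGamma_real_pos[of "real n / 2 + 1"] by (simp add: V_def)
  define C where "C = 2 * (V * real n * 4 * 2 ^ (n - 1) + 1)"
  have C: "C \<ge> 0" using V by (simp add: C_def)
  define q where "q = (real n - 1) / 2"
  have q: "q > 0" using n by (simp add: q_def)
  have "\<forall>\<^sub>F t in at_top. real (card {m \<in> int_lattice :: (real ^ 'n) set. \<bar>norm m - t\<bar> \<le> \<rho>}) \<le> C * \<rho> * t powr (real n - 1)"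
    if \<rho>: "0 < \<rho>" "\<rho> \<le> 1" for \<rho>
  proof -
    define b where "b = B0 / \<rho>"
    have b: "b \<ge> 1" using B0 \<rho> by (simp add: b_def field_simps)
    then have b0: "b > 0" by simp
    let ?A = "{k \<in> int_lattice :: (real ^ 'n) set. norm k \<le> 2 * b}"
    define A' where "A' = ?A - {0}"
    have finA: "finite A'" unfolding A'_def using finite_int_lattice_ball by blast
    have "\<forall>k\<in>A'. \<exists>K\<ge>0. \<forall>T>0. \<bar>ball_ft n 0 T (norm k)\<bar> \<le> K * (1 + T) powr q"
      unfolding q_def A'_def using ball_indicator_ft_bound by auto
    then have "\<exists>K. \<forall>k\<in>A'. K k \<ge> 0 \<and> (\<forall>T>0. \<bar>ball_ft n 0 T (norm k)\<bar> \<le> K k * (1 + T) powr q)"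
      by (rule bchoice)
    then obtain K where K: "\<And>k. k \<in> A' \<Longrightarrow> K k \<ge> 0" "\<And>k T. k \<in> A' \<Longrightarrow> T > 0 \<Longrightarrow> \<bar>ball_ft n 0 T (norm k)\<bar> \<le> K k * (1 + T) powr q" by blast
    define L where "L = (\<Sum>k\<in>A'. K k)"
    have L: "L \<ge> 0" unfolding L_def by (intro sum_nonneg K)
    define \<Phi> where "\<Phi> T = (\<integral>m. cutoff M b T (m :: real ^ 'n) \<partial>lat)" for T
    have i\<Phi>: "integrable lat (\<lambda>m :: real ^ 'n. cutoff M b T m)"
      and e\<Phi>: "\<bar>\<Phi> T - V * T ^ n\<bar> \<le> L * (1 + T) powr q" if T: "T > 0" for T
    proof -
      define F where "F = (\<lambda>\<xi> :: real ^ 'n. complex_of_real (cutoff M b T \<xi>))"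
      obtain D where D: "D \<ge> 0" "\<And>\<xi> :: real ^ 'n. \<bar>cutoff M b T \<xi>\<bar> \<le> D * decay (2 * M) \<xi>"
        using cutoff_decay[OF M b T] by blast
      have Fb: "norm (F \<xi>) \<le> D * decay (2 * M) \<xi>" for \<xi> using D(2)[of \<xi>] by (simp add: F_def)
      have cF: "continuous_on UNIV F" unfolding F_def by (intro continuous_intros continuous_on_cutoff[OF M b0])
      show "integrable lat (\<lambda>m :: real ^ 'n. cutoff M b T m)"
        using integrable_lat_bound[OF M2 Fb, of 0 "\<lambda>_. 0"] unfolding F_def by (simp add: complex_of_real_integrable_eq)
      have "(\<integral>m. F m \<partial>lat) = (\<Sum>k\<in>?A. four F k)"
        by (rule Poisson_summation_finite[OF M2 Fb cF]) (auto simp: F_def intro!: four_cutoff_eq_0[OF M b0 T])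
      also have "\<dots> = four F 0 + (\<Sum>k\<in>A'. four F k)"
        unfolding A'_def using b by (intro sum.remove finite_int_lattice_ball) auto
      also have "four F 0 = of_real (V * T ^ n)"
        using norm_four_cutoff(2)[OF M b0 T] T
        by (simp add: F_def ball_ft_def V_def clifford_0 n_def powr_realpow mult_ac)
      finally have "complex_of_real (\<Phi> T - V * T ^ n) = (\<Sum>k\<in>A'. four F k)"
        by (simp add: \<Phi>_def F_def integral_complex_of_real)
      then have "\<bar>\<Phi> T - V * T ^ n\<bar> = norm (\<Sum>k\<in>A'. four F k)" by (metis norm_of_real)
      also have "\<dots> \<le> (\<Sum>k\<in>A'. K k * (1 + T) powr q)"
      proof (rule order_trans[OF norm_sum sum_mono])
        fix k assume k: "k \<in> A'"
        show "norm (four F k) \<le> K k * (1 + T) powr q"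
          using norm_four_cutoff(1)[OF M b0 T, of k] K(2)[OF k T] by (simp add: F_def n_def)
      qed
      finally show "\<bar>\<Phi> T - V * T ^ n\<bar> \<le> L * (1 + T) powr q" by (simp add: L_def sum_distrib_right)
    qed
    \<comment> \<open>Since q = (n - 1)/2 is positive, t^q is eventually below any multiple of
      t^(2q) = t^(n-1). Here b, and with it L, is already fixed.\<close>
    have lim: "((\<lambda>t. 2 * L * 4 powr q * t powr (- q)) \<longlongrightarrow> 0) at_top"
      using tendsto_mult_left[OF tendsto_neg_powr[OF _ filterlim_ident, of "- q"], of "2 * L * 4 powr q"] q by simp
    have ev: "\<forall>\<^sub>F t in at_top. 2 * L * 4 powr q * t powr (- q) < \<rho>"
      by (rule order_tendstoD(2)[OF lim \<rho>(1)])
    show ?thesis using ev eventually_ge_at_top[of 3]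
    proof eventually_elim
      case (elim t)
      define S where "S = {m \<in> int_lattice :: (real ^ 'n) set. \<bar>norm m - t\<bar> \<le> \<rho>}"
      have finS: "finite S" by (rule finite_subset[OF _ finite_int_lattice_ball[of "t + \<rho>"]]) (auto simp: S_def)
      have T: "t - 2 * \<rho> > 0" "t + 2 * \<rho> > 0" using elim \<rho> by auto
      \<comment> \<open>Points of the shell have distance at least \<rho> from both spheres, so each
        cutoff is within 1/4 of the sharp indicator, of value 1 for the outer and 0 for the inner
        ball.\<close>
      have half: "1 / 2 \<le> cutoff M b (t + 2 * \<rho>) m - cutoff M b (t - 2 * \<rho>) m" if m: "m \<in> S" for m
      proof -
        have q1: "C0 * (1 + b * r) powr (- 2 * M) \<le> 1 / 4" if r: "r \<ge> \<rho>" for r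
        proof -
          have "B0 \<le> b * r" using r \<rho> B0 by (simp add: b_def field_simps)
          then have "(1 + b * r) powr (- 2 * M) \<le> (1 + B0) powr (- 2 * M)"
            using B0 by (intro powr_mono2') (auto simp: M_def)
          also have "\<dots> \<le> (1 + B0) powr (- 1)" using B0 n by (intro powr_mono) (auto simp: M_def)
          also have "\<dots> = 1 / (1 + B0)" using B0 by (simp add: powr_minus_divide)
          finally have "C0 * (1 + b * r) powr (- 2 * M) \<le> C0 * (1 / (1 + B0))" using C0(1) by (rule mult_left_mono)
          also have "\<dots> \<le> 1 / 4" using C0(1) by (simp add: B0_def field_simps)
          finally show ?thesis .
        qed
        have "\<bar>norm m - t\<bar> \<le> \<rho>" using m by (simp add: S_def)
        then have "norm m < t + 2 * \<rho>" "\<not> norm m < t - 2 * \<rho>" "\<bar>norm m - (t + 2 * \<rho>)\<bar> \<ge> \<rho>" "\<bar>norm m - (t - 2 * \<rho>)\<bar> \<ge> \<rho>"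
          using \<rho>(1) by linarith+
        then show ?thesis
          using C0(2)[OF b0, of "t + 2 * \<rho>" m] C0(2)[OF b0, of "t - 2 * \<rho>" m] q1[of "\<bar>norm m - (t + 2 * \<rho>)\<bar>"] q1[of "\<bar>norm m - (t - 2 * \<rho>)\<bar>"]
          by simp
      qed
      have iS: "integrable lat (\<lambda>m. indicator S m / 2 :: real)" "(\<integral>m. indicator S m / 2 \<partial>lat) = real (card S) / 2"
        using lat_finite_support[OF finS, of "\<lambda>m. indicator S m / 2 :: real"] by (auto simp: S_def)
      then have "real (card S) / 2 = (\<integral>m. indicator S m / 2 \<partial>lat)" by simp
      also have "\<dots> \<le> (\<integral>m. cutoff M b (t + 2 * \<rho>) (m :: real ^ 'n) - cutoff M b (t - 2 * \<rho>) m \<partial>lat)"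
      proof (rule integral_mono)
        show "integrable lat (\<lambda>m. indicator S m / 2 :: real)" by (rule iS)
        show "integrable lat (\<lambda>m :: real ^ 'n. cutoff M b (t + 2 * \<rho>) m - cutoff M b (t - 2 * \<rho>) m)"
          by (intro Bochner_Integration.integrable_diff i\<Phi> T)
        fix m :: "real ^ 'n"
        show "indicator S m / 2 \<le> cutoff M b (t + 2 * \<rho>) m - cutoff M b (t - 2 * \<rho>) m"
          using half cutoff_mono[OF M b0, of "t - 2 * \<rho>" "t + 2 * \<rho>" m] \<rho> by (auto simp: indicator_def)
      qed
      also have "\<dots> = \<Phi> (t + 2 * \<rho>) - \<Phi> (t - 2 * \<rho>)"
        unfolding \<Phi>_def by (intro Bochner_Integration.integral_diff i\<Phi> T)
      also have "\<dots> \<le> V * ((t + 2 * \<rho>) ^ n - (t - 2 * \<rho>) ^ n) + 2 * (L * (4 * t) powr q)"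
      proof -
        have "L * (1 + (t + 2 * \<rho>)) powr q \<le> L * (4 * t) powr q" "L * (1 + (t - 2 * \<rho>)) powr q \<le> L * (4 * t) powr q"
          using L elim \<rho> q by (intro mult_left_mono powr_mono2; simp)+
        then show ?thesis using e\<Phi>[OF T(1)] e\<Phi>[OF T(2)] by (simp add: right_diff_distrib)
      qed
      also have "\<dots> \<le> V * (real n * 4 * \<rho> * (2 ^ (n - 1) * t powr (real n - 1))) + \<rho> * t powr (real n - 1)"
      proof (rule add_mono)
        have "(t + 2 * \<rho>) ^ n - (t - 2 * \<rho>) ^ n \<le> real n * ((t + 2 * \<rho>) - (t - 2 * \<rho>)) * (t + 2 * \<rho>) ^ (n - 1)"
          using T \<rho> by (intro power_diff_le) auto
        also have "\<dots> \<le> real n * ((t + 2 * \<rho>) - (t - 2 * \<rho>)) * (2 * t) ^ (n - 1)"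
          using T \<rho> elim by (intro mult_left_mono power_mono) auto
        also have "\<dots> = real n * 4 * \<rho> * (2 ^ (n - 1) * t powr (real n - 1))"
          using elim n powr_realpow[of t "n - 1"] by (simp add: power_mult_distrib of_nat_diff)
        finally show "V * ((t + 2 * \<rho>) ^ n - (t - 2 * \<rho>) ^ n) \<le> V * (real n * 4 * \<rho> * (2 ^ (n - 1) * t powr (real n - 1)))"
          using V by (rule mult_left_mono)
        have "2 * L * 4 powr q * t powr (- q) * t powr (real n - 1) \<le> \<rho> * t powr (real n - 1)"
          using elim by (intro mult_right_mono) auto
        moreover have "t powr (- q) * t powr (real n - 1) = t powr q"
          by (rule powr_mult_powr) (simp add: q_def field_simps)
        ultimately show "2 * (L * (4 * t) powr q) \<le> \<rho> * t powr (real n - 1)"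
          using elim by (simp add: powr_mult mult.assoc)
      qed
      finally show ?case unfolding S_def[symmetric] C_def by (simp add: algebra_simps)
    qed
  qed
  then show ?thesis using C unfolding n_def by blast
qed

text \<open>Points within \<rho> of the sphere are bounded by the shell count, which is small with
  \<rho>. Outside, b = 1/\<rho>^2 makes the kernel at most 2\<rho> times the kernel of scale 1,
  whose sum is known.\<close>

lemma kernel_sum_small:
  assumes n2: "CARD('n::finite) \<ge> 2" and \<epsilon>: "\<epsilon> > 0"
  shows "\<exists>b\<ge>1. 1 / b \<le> \<epsilon> \<and> (\<forall>\<^sub>F t in at_top. kernel_sum TYPE('n) b t \<le> \<epsilon> * (1 + t) powr (real CARD('n) - 1))"
proof -
  define n where "n = CARD('n)"
  have n: "n \<ge> 2" using n2 by (simp add: n_def)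
  let ?P = "\<lambda>t :: real. (1 + t) powr (real n - 1)"
  obtain C1 where C1: "C1 \<ge> 0" "\<And>b t. b \<ge> 1 \<Longrightarrow> t \<ge> 0 \<Longrightarrow> kernel_sum TYPE('n) b t \<le> C1 * ?P t"
    using kernel_sum_bound[where 'n = 'n] unfolding n_def by blast
  obtain C2 where C2: "C2 \<ge> 0" "\<And>\<rho>. 0 < \<rho> \<Longrightarrow> \<rho> \<le> 1 \<Longrightarrow> (\<forall>\<^sub>F t in at_top.
    real (card {m \<in> int_lattice :: (real ^ 'n) set. \<bar>norm m - t\<bar> \<le> \<rho>}) \<le> C2 * \<rho> * t powr (real n - 1))"
    using lattice_shell_count[OF n2] unfolding n_def by blast
  \<comment> \<open>The two contributions add up to (C2 + 2 C1) \<rho> times the area factor; the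
    extra 1 keeps the denominator positive and also gives \<rho> <= \<epsilon>.\<close>
  define \<rho> where "\<rho> = min (1 / 2) (\<epsilon> / (C2 + 2 * C1 + 1))"
  have \<rho>: "\<rho> > 0" "\<rho> \<le> 1 / 2" "\<rho> \<le> \<epsilon> / (C2 + 2 * C1 + 1)" using \<epsilon> C1(1) C2(1) unfolding \<rho>_def by (simp add: add_nonneg_pos, linarith+)
  have \<rho>\<epsilon>: "(C2 + 2 * C1 + 1) * \<rho> \<le> \<epsilon>" using \<rho>(3) C1(1) C2(1) by (simp add: field_simps)
  define b where "b = 1 / \<rho>\<^sup>2"
  have "\<rho>\<^sup>2 \<le> \<rho>" using \<rho> by (simp add: power2_eq_square mult_le_cancel_right1)
  then have b: "b \<ge> 1" using \<rho> by (simp add: b_def field_simps)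
  have "\<rho> \<le> \<epsilon>"
  proof -
    have "1 * \<rho> \<le> (C2 + 2 * C1 + 1) * \<rho>" using C1(1) C2(1) \<rho>(1) by (intro mult_right_mono) auto
    then show ?thesis using \<rho>\<epsilon> by linarith
  qed
  then have be: "1 / b \<le> \<epsilon>" using \<open>\<rho>\<^sup>2 \<le> \<rho>\<close> by (simp add: b_def)
  have ev: "\<forall>\<^sub>F t in at_top. real (card {m \<in> int_lattice :: (real ^ 'n) set. \<bar>norm m - t\<bar> \<le> \<rho>}) \<le> C2 * \<rho> * t powr (real n - 1)"
    using \<rho> by (intro C2(2)) auto
  have "\<forall>\<^sub>F t in at_top. kernel_sum TYPE('n) b t \<le> \<epsilon> * ?P t"
    using ev eventually_ge_at_top[of 1]
  proof eventually_elim
    case (elim t)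
    define S where "S = {m \<in> int_lattice :: (real ^ 'n) set. \<bar>norm m - t\<bar> \<le> \<rho>}"
    have finS: "finite S" by (rule finite_subset[OF _ finite_int_lattice_ball[of "t + \<rho>"]]) (auto simp: S_def)
    define v where "v b m = (1 + b * \<bar>norm m - t\<bar>) powr (- (real n + 1))" for b and m :: "real ^ 'n"
    have iv: "integrable lat (v b)" if "b \<ge> 1" for b
      unfolding v_def using elim by (intro lat_kernel_integrable that) (auto simp: n_def)
    have iS: "integrable lat (\<lambda>m. indicator S m :: real)" "(\<integral>m. indicator S m \<partial>lat) = real (card S)"
      using lat_finite_support[OF finS, of "\<lambda>m. indicator S m :: real"] by (auto simp: S_def)
    have "kernel_sum TYPE('n) b t = (\<integral>m. v b m \<partial>lat)" by (simp add: kernel_sum_def v_def n_def)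
    also have "\<dots> \<le> (\<integral>m. indicator S m + 2 * \<rho> * v 1 m \<partial>lat)"
    proof (rule integral_mono)
      show "integrable lat (v b)" by (rule iv[OF b])
      show "integrable lat (\<lambda>m. indicator S m + 2 * \<rho> * v 1 m)"
        by (intro Bochner_Integration.integrable_add iS integrable_mult_right iv) simp
      fix m :: "real ^ 'n" assume "m \<in> space lat"
      then have m: "m \<in> int_lattice" by simp
      let ?r = "\<bar>norm m - t\<bar>"
      show "v b m \<le> indicator S m + 2 * \<rho> * v 1 m"
      proof (cases "m \<in> S")
        case True
        have "(1 + b * ?r) powr (- (real n + 1)) \<le> (1 + b * ?r) powr 0" using b by (intro powr_mono) auto
        moreover have "1 + b * ?r > 0" using b by (simp add: add_pos_nonneg)
        moreover have "v 1 m \<ge> 0" by (simp add: v_def)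
        ultimately show ?thesis using True \<rho> by (simp add: v_def add_increasing2)
      next
        case False
        then have r: "?r > \<rho>" using m by (simp add: S_def)
        \<comment> \<open>From r > \<rho> and \<rho> <= 1 follows \<rho>(1 + r) <= 2r; division by
          2\<rho>^2 brings in b r.\<close>
        have "(1 + ?r) / (2 * \<rho>) \<le> 1 + b * ?r"
        proof -
          have "\<rho> * (1 + ?r) \<le> ?r * 1 + ?r * 1"
          proof -
            have "\<rho> * ?r \<le> 1 * ?r" using \<rho> by (intro mult_right_mono) auto
            then show ?thesis using r by (simp add: distrib_left)
          qed
          then have "\<rho> * (1 + ?r) / (2 * \<rho>\<^sup>2) \<le> 2 * ?r / (2 * \<rho>\<^sup>2)" by (intro divide_right_mono) auto
          then show ?thesis using \<rho>(1) by (simp add: b_def power2_eq_square)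
        qed
        then have "v b m \<le> ((1 + ?r) * (1 / (2 * \<rho>))) powr (- (real n + 1))"
          unfolding v_def using \<rho>(1) by (intro powr_mono2') (auto simp: add_pos_nonneg)
        also have "\<dots> = v 1 m * (2 * \<rho>) powr (real n + 1)"
        proof -
          have "1 / (2 * \<rho>) = (2 * \<rho>) powr (- 1)" using \<rho>(1) by (simp add: powr_minus_divide)
          then have "(1 / (2 * \<rho>)) powr (- (real n + 1)) = (2 * \<rho>) powr (real n + 1)"
            by (simp only: powr_powr minus_mult_minus mult_1_left)
          then show ?thesis using \<rho>(1) by (simp only: v_def mult_1_left) (subst powr_mult; simp)
        qed
        also have "(2 * \<rho>) powr (real n + 1) \<le> (2 * \<rho>) powr 1"
          using \<rho> by (intro powr_mono') auto
        then have "v 1 m * (2 * \<rho>) powr (real n + 1) \<le> v 1 m * (2 * \<rho>) powr 1"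
          by (intro mult_left_mono) (auto simp: v_def)
        finally show ?thesis using False \<rho>(1) by (simp add: mult_ac)
      qed
    qed
    also have "\<dots> = real (card S) + 2 * \<rho> * kernel_sum TYPE('n) 1 t"
    proof -
      have "(\<integral>m. v 1 m \<partial>lat) = kernel_sum TYPE('n) 1 t" by (simp add: kernel_sum_def v_def n_def)
      then show ?thesis
        using iS(2) Bochner_Integration.integral_add[OF iS(1) integrable_mult_right[OF iv[of 1], of "2 * \<rho>"]] by simp
    qed
    also have "\<dots> \<le> C2 * \<rho> * ?P t + 2 * \<rho> * (C1 * ?P t)"
    proof (rule add_mono)
      have "C2 * \<rho> * t powr (real n - 1) \<le> C2 * \<rho> * ?P t"
        using C2(1) \<rho>(1) elim n by (intro mult_left_mono powr_mono2) auto
      then show "real (card S) \<le> C2 * \<rho> * ?P t" using elim unfolding S_def by linarith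
      show "2 * \<rho> * kernel_sum TYPE('n) 1 t \<le> 2 * \<rho> * (C1 * ?P t)"
        using \<rho>(1) elim by (intro mult_left_mono C1) auto
    qed
    also have "\<dots> = ((C2 + 2 * C1) * \<rho>) * ?P t" by (simp add: algebra_simps)
    also have "\<dots> \<le> \<epsilon> * ?P t"
      using \<rho>\<epsilon> \<rho>(1) by (intro mult_right_mono) (auto simp: distrib_right)
    finally show ?case .
  qed
  then show ?thesis using b be unfolding n_def by blast
qed

section \<open>Values of the inversion integrals\<close>

lemma tendsto_powr_rate:
  fixes f :: "real \<Rightarrow> real"
  assumes p: "p > 0" and b: "\<And>R. R \<ge> 1 \<Longrightarrow> \<bar>f R - c\<bar> \<le> K * R powr (- p)"
  shows "(f \<longlongrightarrow> c) at_top"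
proof -
  have "((\<lambda>R. K * R powr (- p)) \<longlongrightarrow> 0) at_top"
    using tendsto_mult_left[OF tendsto_neg_powr[OF _ filterlim_ident, of "- p"], of K] p by simp
  then have "((\<lambda>R. f R - c) \<longlongrightarrow> 0) at_top"
    by (rule Lim_null_comparison[rotated]) (use b in \<open>auto simp: eventually_at_top_linorder\<close>)
  then show ?thesis by (rule Lim_null[THEN iffD2])
qed

lemma ball_inv_limit_radius:
  assumes \<beta>: "\<beta> > -1" and a: "a > 0" and t: "t \<ge> 0" and lim: "(ball_inv CARD('n::finite) \<beta> a t \<longlongrightarrow> c) at_top"
    and ok: "t \<noteq> a \<or> \<beta> \<ge> 0"
  shows "c = (if t = a \<and> \<beta> = 0 then 1 / 2 else ball_profile \<beta> a t)"
  using ball_inv_limit[of \<beta> a "t *\<^sub>R axis undefined 1 :: real ^ 'n" c] assms by simp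

text \<open>The asymptotics give convergence with a rate to an unknown constant, and the summation
  argument identifies the constant.\<close>

lemma ball_inv_off_sphere:
  assumes \<beta>: "\<beta> > -1" and a: "a > 0" and t: "t > 0" "t \<noteq> a"
  shows "\<exists>K\<ge>0. \<forall>R\<ge>1. \<bar>ball_inv CARD('n::finite) \<beta> a t R - ball_profile \<beta> a t\<bar> \<le> K * R powr (- 1 - \<beta>)"
proof -
  obtain c K where K: "K \<ge> 0" "\<And>R. R \<ge> 1 \<Longrightarrow> \<bar>ball_inv CARD('n) \<beta> a t R - c\<bar> \<le> K * R powr (- 1 - \<beta>)"
    using ball_inv_resonant[OF card_pos[where 'n = 'n] a t(1) \<beta>] t(2) by auto
  have e: "- (1 + \<beta>) = - 1 - \<beta>" by simp
  have "(ball_inv CARD('n) \<beta> a t \<longlongrightarrow> c) at_top"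
    by (rule tendsto_powr_rate[where p = "1 + \<beta>" and K = K]) (use \<beta> K(2) in \<open>auto simp only: e\<close>)
  then have "c = ball_profile \<beta> a t"
    using ball_inv_limit_radius[OF \<beta> a less_imp_le[OF t(1)], where 'n = 'n] t(2) by auto
  then show ?thesis using K by auto
qed

text \<open>Multiplied by R^\<beta> the resonant term becomes L, and it remains to treat c
  R^\<beta>. For \<beta> < 0 it tends to 0 whatever c is; for \<beta> = 0 the constant is 1/2 = L;
  for \<beta> > 0 it must be 0, and is, because the ball power vanishes on the sphere.\<close>

lemma ball_inv_on_sphere:
  assumes \<beta>: "\<beta> > -1" and a: "a > 0"
  shows "((\<lambda>R. ball_inv CARD('n::finite) \<beta> a a R * R powr \<beta>) \<longlongrightarrow> L_const \<beta> a) at_top"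
proof -
  let ?s = "\<lambda>R. if \<beta> \<noteq> 0 then L_const \<beta> a * R powr (- \<beta>) else 0"
  let ?L = "if \<beta> \<noteq> 0 then L_const \<beta> a else 0"
  let ?B = "ball_inv CARD('n) \<beta> a a"
  obtain c K where K: "K \<ge> 0" "\<And>R. R \<ge> 1 \<Longrightarrow>
      \<bar>?B R - (c + ?s R)\<bar> \<le> K * R powr (- 1 - \<beta>)"
    using ball_inv_resonant[OF card_pos[where 'n = 'n] a a \<beta>] by auto
  have inv1: "((\<lambda>R. K * R powr (- 1)) \<longlongrightarrow> 0) at_top"
    using tendsto_mult_left[OF tendsto_neg_powr[OF _ filterlim_ident, of "- 1"], of K] by simp
  have scaled: "\<bar>?B R * R powr \<beta> - (c * R powr \<beta> + ?L)\<bar> \<le> K * R powr (- 1)" if R: "R \<ge> 1" for R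
  proof -
    have 1: "R powr (- \<beta>) * R powr \<beta> = 1" using R by (simp add: powr_add[symmetric])
    have "- 1 - \<beta> + \<beta> = - 1" by simp
    then have 2: "R powr (- 1 - \<beta>) * R powr \<beta> = R powr (- 1)" by (simp only: powr_add[symmetric])
    have "?B R * R powr \<beta> - (c * R powr \<beta> + ?L)
      = (?B R - (c + ?s R)) * R powr \<beta>"
      using 1 by (simp add: algebra_simps)
    also have "\<bar>\<dots>\<bar> \<le> K * R powr (- 1 - \<beta>) * R powr \<beta>"
      unfolding abs_mult using K(2)[OF R] by (intro mult_mono) (auto simp: K(1))
    also have "\<dots> = K * R powr (- 1)" by (simp only: mult.assoc 2)
    finally show ?thesis .
  qed
  have lim: "((\<lambda>R. ?B R * R powr \<beta> - (c * R powr \<beta> + ?L)) \<longlongrightarrow> 0) at_top"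
    by (rule Lim_null_comparison[OF _ inv1]) (use scaled in \<open>auto simp: eventually_at_top_linorder intro!: exI[of _ 1]\<close>)
  \<comment> \<open>Only for \<beta> >= 0 does the inversion integral itself have to converge, which
    is also the range where its limit on the sphere is known.\<close>
  have cc: "((\<lambda>R. c * R powr \<beta> + ?L) \<longlongrightarrow> L_const \<beta> a) at_top"
  proof (cases "\<beta> < 0")
    case True
    then show ?thesis
      using tendsto_add[OF tendsto_mult_left[OF tendsto_neg_powr[OF True filterlim_ident], of c] tendsto_const] by simp
  next
    case False
    have "((\<lambda>R. ?B R - (c + ?s R)) \<longlongrightarrow> 0) at_top"
      by (rule tendsto_powr_rate[where p = "1 + \<beta>" and K = K]) (use \<beta> K(2) in auto)
    moreover have "((\<lambda>R. c + ?s R) \<longlongrightarrow> c) at_top"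
    proof (cases "\<beta> = 0")
      case ne: False
      then have "- \<beta> < 0" using False by simp
      from tendsto_add[OF tendsto_const tendsto_mult_left[OF tendsto_neg_powr[OF this filterlim_ident], of "L_const \<beta> a"], of c]
      show ?thesis using ne by simp
    qed simp
    ultimately have "(?B \<longlongrightarrow> c) at_top"
      using tendsto_add by fastforce
    then have "c = (if \<beta> = 0 then 1 / 2 else ball_profile \<beta> a a)"
      using ball_inv_limit_radius[OF \<beta> a less_imp_le[OF a], of c, where 'n = 'n] False by auto
    then have "c = (if \<beta> = 0 then L_const \<beta> a else 0)"
      using a by (auto simp: ball_profile_def L_const_def)
    then show ?thesis using a eventually_gt_at_top[of "0::real"]
      by (intro tendsto_eventually) (auto elim!: eventually_mono)
  qed
  show ?thesis using tendsto_add[OF lim cc] by simp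
qed

lemma one_plus_powr_le: "t \<ge> 1 \<Longrightarrow> (1 + t) powr e \<le> 2 powr \<bar>e\<bar> * t powr e" for t e :: real
proof -
  assume t: "t \<ge> 1"
  show ?thesis
  proof (cases "e \<ge> 0")
    case True
    have "(1 + t) powr e \<le> (2 * t) powr e" using True t by (intro powr_mono2) auto
    then show ?thesis using True t by (simp add: powr_mult)
  next
    case False
    have "(1 + t) powr e \<le> t powr e" using False t by (intro powr_mono2') auto
    also have "1 * t powr e \<le> 2 powr \<bar>e\<bar> * t powr e" by (intro mult_right_mono ge_one_powr_ge_zero) auto
    finally show ?thesis by simp
  qed
qed

text \<open>Each dual integral is replaced by its value: the ball power at k, apart from k = 0 and
  |k| = a, where the integral is kept as it stands. Points outside the ball contribute 0, so the
  main part does not depend on b.\<close>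

lemma lattice_partial_sum_asymp:
  assumes \<beta>: "\<beta> > -1" and a: "a > 0"
  shows "\<exists>C\<ge>0. \<forall>b\<ge>1. \<exists>K\<ge>0. \<forall>t\<ge>1.
     \<bar>(\<Sum>m\<in>{m \<in> int_lattice. norm m < t}. ball_ft CARD('n) \<beta> a (norm (m :: real ^ 'n)))
       - ((\<Sum>k\<in>{k \<in> int_lattice. norm k < a}. ball_profile \<beta> a (norm (k :: real ^ 'n)))
          + (ball_inv CARD('n) \<beta> a 0 t - a powr (2 * \<beta>))
          + real (lattice_sphere_count a (0 :: real ^ 'n)) * ball_inv CARD('n) \<beta> a a t)\<bar>
     \<le> C * ((1 + t) powr (- ((real CARD('n) + 1) / 2 + \<beta>)) * kernel_sum TYPE('n) b t
             + 1 / b * (1 + t) powr ((real CARD('n) - 3) / 2 - \<beta>))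
       + K * t powr (- 1 - \<beta>)"
proof -
  define n where "n = CARD('n)"
  define E where "E b t = (1 + t) powr (- ((real n + 1) / 2 + \<beta>)) * kernel_sum TYPE('n) b t
             + 1 / b * (1 + t) powr ((real n - 3) / 2 - \<beta>)" for b t
  define S where "S t = (\<Sum>m\<in>{m \<in> int_lattice. norm m < t}. ball_ft n \<beta> a (norm (m :: real ^ 'n)))" for t
  define P where "P = (\<Sum>k\<in>{k \<in> int_lattice. norm k < a}. ball_profile \<beta> a (norm (k :: real ^ 'n)))"
  define N where "N = real (lattice_sphere_count a (0 :: real ^ 'n))"
  obtain C where C: "C \<ge> 0" "\<And>b. b \<ge> 1 \<Longrightarrow> \<exists>K\<ge>0. \<forall>t\<ge>1.
     \<bar>S t - (\<Sum>k\<in>{k \<in> int_lattice. norm k \<le> a + 2 * b}. ball_inv n \<beta> a (norm (k :: real ^ 'n)) t)\<bar> \<le> C * E b t + K * (1 + t) powr (- 1 - \<beta>)"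
    using smoothed_lattice_sum[OF \<beta> a, where 'n = 'n] unfolding n_def S_def E_def by blast
  have "\<exists>K\<ge>0. \<forall>t\<ge>1. \<bar>S t - (P + (ball_inv n \<beta> a 0 t - a powr (2 * \<beta>)) + N * ball_inv n \<beta> a a t)\<bar> \<le> C * E b t + K * t powr (- 1 - \<beta>)"
    if b: "b \<ge> 1" for b
  proof -
    obtain K where K: "K \<ge> 0" "\<And>t. t \<ge> 1 \<Longrightarrow>
       \<bar>S t - (\<Sum>k\<in>{k \<in> int_lattice. norm k \<le> a + 2 * b}. ball_inv n \<beta> a (norm (k :: real ^ 'n)) t)\<bar> \<le> C * E b t + K * (1 + t) powr (- 1 - \<beta>)"
      using C(2)[OF b] by blast
    define A where "A = {k \<in> int_lattice :: (real ^ 'n) set. norm k \<le> a + 2 * b}"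
    have finA: "finite A" unfolding A_def by (rule finite_int_lattice_ball)
    have A0: "0 \<in> A" using a b by (simp add: A_def)
    \<comment> \<open>The value put in place of the dual integral at k \<noteq> 0; on the sphere
      nothing is replaced.\<close>
    define Q where "Q t k = (if norm k = a then ball_inv n \<beta> a a t else ball_profile \<beta> a (norm k))" for t and k :: "real ^ 'n"
    have "\<forall>k\<in>A - {0}. \<exists>W\<ge>0. \<forall>t\<ge>1. \<bar>ball_inv n \<beta> a (norm k) t - Q t k\<bar> \<le> W * t powr (- 1 - \<beta>)"
    proof
      fix k assume k: "k \<in> A - {0}"
      show "\<exists>W\<ge>0. \<forall>t\<ge>1. \<bar>ball_inv n \<beta> a (norm k) t - Q t k\<bar> \<le> W * t powr (- 1 - \<beta>)"
      proof (cases "norm k = a")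
        case True
        then show ?thesis by (intro exI[of _ 0]) (simp add: Q_def)
      next
        case False
        then show ?thesis using k ball_inv_off_sphere[OF \<beta> a, of "norm k", where 'n = 'n] by (simp add: Q_def n_def)
      qed
    qed
    then have "\<exists>W. \<forall>k\<in>A - {0}. W k \<ge> 0 \<and> (\<forall>t\<ge>1. \<bar>ball_inv n \<beta> a (norm k) t - Q t k\<bar> \<le> W k * t powr (- 1 - \<beta>))"
      by (rule bchoice)
    then obtain W where W: "\<forall>k\<in>A - {0}. W k \<ge> 0 \<and> (\<forall>t\<ge>1. \<bar>ball_inv n \<beta> a (norm k) t - Q t k\<bar> \<le> W k * t powr (- 1 - \<beta>))" by blast
    define L where "L = (\<Sum>k\<in>A - {0}. W k)"
    have L: "L \<ge> 0" unfolding L_def using W by (intro sum_nonneg) auto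
    \<comment> \<open>P includes k = 0, where the profile is a^(2\<beta>), while the sum on the left
      omits it.\<close>
    have sumQ: "(\<Sum>k\<in>A - {0}. Q t k) = P - a powr (2 * \<beta>) + N * ball_inv n \<beta> a a t" for t
    proof -
      have "(\<Sum>k\<in>A - {0}. Q t k) = (\<Sum>k\<in>A - {0}. (if norm k = a then ball_inv n \<beta> a a t else 0) + ball_profile \<beta> a (norm k))"
        by (intro sum.cong) (auto simp: Q_def ball_profile_def)
      also have "\<dots> = (\<Sum>k\<in>A - {0}. if norm k = a then ball_inv n \<beta> a a t else 0) + (\<Sum>k\<in>A - {0}. ball_profile \<beta> a (norm k))"
        by (rule sum.distrib)
      also have "(\<Sum>k\<in>A - {0}. if norm k = a then ball_inv n \<beta> a a t else 0) = (\<Sum>k\<in>{k \<in> A - {0}. norm k = a}. ball_inv n \<beta> a a t)"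
        using finA by (intro sum.inter_filter[symmetric]) auto
      also have "{k \<in> A - {0}. norm k = a} = {m \<in> int_lattice. norm (0 - m) = a}"
        using a b by (auto simp: A_def)
      also have "(\<Sum>k\<in>{m \<in> int_lattice. norm (0 - m :: real ^ 'n) = a}. ball_inv n \<beta> a a t) = N * ball_inv n \<beta> a a t"
        by (simp add: N_def lattice_sphere_count_def)
      also have "(\<Sum>k\<in>A - {0}. ball_profile \<beta> a (norm k)) = (\<Sum>k\<in>A. ball_profile \<beta> a (norm k)) - a powr (2 * \<beta>)"
        using a powr_powr[of a 2 \<beta>] by (simp add: sum_diff1[OF finA] A0 ball_profile_def powr_numeral)
      also have "(\<Sum>k\<in>A. ball_profile \<beta> a (norm k)) = P"
        unfolding P_def using a b by (intro sum.mono_neutral_right finA) (auto simp: A_def ball_profile_def)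
      finally show ?thesis by simp
    qed
    have "\<bar>S t - (P + (ball_inv n \<beta> a 0 t - a powr (2 * \<beta>)) + N * ball_inv n \<beta> a a t)\<bar> \<le> C * E b t + (K + L) * t powr (- 1 - \<beta>)"
      if t: "t \<ge> 1" for t
    proof -
      have "\<bar>(\<Sum>k\<in>A - {0}. ball_inv n \<beta> a (norm k) t) - (\<Sum>k\<in>A - {0}. Q t k)\<bar> \<le> L * t powr (- 1 - \<beta>)"
        unfolding sum_subtractf[symmetric] L_def sum_distrib_right
        by (rule order_trans[OF sum_abs sum_mono]) (use W t in auto)
      moreover have "(\<Sum>k\<in>A. ball_inv n \<beta> a (norm k) t) = ball_inv n \<beta> a 0 t + (\<Sum>k\<in>A - {0}. ball_inv n \<beta> a (norm k) t)"
        using sum.remove[OF finA A0, of "\<lambda>k. ball_inv n \<beta> a (norm k) t"] by simp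
      moreover have "K * (1 + t) powr (- 1 - \<beta>) \<le> K * t powr (- 1 - \<beta>)"
        using K(1) t \<beta> by (intro mult_left_mono powr_mono2') auto
      ultimately show ?thesis
        using K(2)[OF t] unfolding A_def[symmetric] sumQ distrib_right by linarith
    qed
    then show ?thesis using K(1) L by (intro exI[of _ "K + L"]) auto
  qed
  then show ?thesis using C(1) unfolding n_def S_def P_def N_def E_def by blast
qed

section \<open>Fourier data of the periodization\<close>

lemma ball_power_finite_support:
  fixes x :: "real ^ 'n"
  shows "finite {m \<in> int_lattice. ball_power \<beta> a (x + m) \<noteq> 0}"
proof (rule finite_subset[OF _ finite_int_lattice_ball[of "a + norm x"]])
  have "norm m \<le> a + norm x" if "ball_power \<beta> a (x + m) \<noteq> 0" for m
    using that norm_triangle_ineq4[of "x + m" x] by (simp add: ball_power_def split: if_splits)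
  then show "{m \<in> int_lattice. ball_power \<beta> a (x + m) \<noteq> 0} \<subseteq> {m \<in> int_lattice. norm m \<le> a + norm x}" by auto
qed

lemma periodized_eq_sum:
  fixes x :: "real ^ 'n"
  shows "periodized_ball_power \<beta> a x = (\<Sum>m\<in>{m \<in> int_lattice. ball_power \<beta> a (x + m) \<noteq> 0}. ball_power \<beta> a (x + m))"
proof -
  have "periodized_ball_power \<beta> a x = (\<Sum>\<^sub>\<infinity>m\<in>{m \<in> int_lattice. ball_power \<beta> a (x + m) \<noteq> 0}. ball_power \<beta> a (x + m))"
    unfolding periodized_ball_power_def by (rule infsum_cong_neutral) auto
  then show ?thesis by (simp only: infsum_finite[OF ball_power_finite_support])
qed

lemma periodized_eq_integral: "periodized_ball_power \<beta> a x = (\<integral>m. ball_power \<beta> a (x + m) \<partial>lat)" for x :: "real ^ 'n"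
  unfolding periodized_eq_sum by (rule lebesgue_integral_count_space_finite_support[OF ball_power_finite_support, symmetric])

lemma periodized_at_0:
  "periodized_ball_power \<beta> a (0 :: real ^ 'n) = of_real (\<Sum>k\<in>{k \<in> int_lattice. norm k < a}. ball_profile \<beta> a (norm (k :: real ^ 'n)))"
proof -
  have "periodized_ball_power \<beta> a (0 :: real ^ 'n) = (\<Sum>m\<in>{m \<in> int_lattice. norm m < a}. ball_power \<beta> a (m :: real ^ 'n))"
    unfolding periodized_eq_sum
    by (rule sum.mono_neutral_cong_left[OF finite_subset[OF _ finite_int_lattice_ball[of a]]]) (auto simp: ball_power_def split: if_splits)
  then show ?thesis by (simp add: ball_power_eq_profile)
qed

text \<open>The character is periodic for an integral frequency, so the coefficient of the
  periodization unfolds to the transform of the ball power on the whole space.\<close>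

lemma fourier_coeff_periodized:
  fixes m :: "real ^ 'n"
  assumes \<beta>: "\<beta> > -1" and a: "a > 0" and m: "m \<in> int_lattice"
  shows "fourier_coeff (periodized_ball_power \<beta> a) m = of_real (ball_ft CARD('n) \<beta> a (norm m))"
proof -
  define F where "F x = ball_power \<beta> a x * ee (- (m \<bullet> x))" for x
  have iF: "integrable lborel F"
    unfolding F_def by (intro integrable_times_ee integrable_ball_power \<beta> a) measurable
  have [measurable]: "F \<in> Borel" using iF by auto
  have per: "periodized_ball_power \<beta> a x * ee (- (m \<bullet> x)) = (\<integral>k. F (x + k) \<partial>lat)" for x
  proof -
    have "(\<integral>k. F (x + k) \<partial>lat) = (\<integral>k. ball_power \<beta> a (x + k) * ee (- (m \<bullet> x)) \<partial>lat)"
    proof (intro Bochner_Integration.integral_cong refl)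
      fix k :: "real ^ 'n" assume "k \<in> space lat"
      then have "- (m \<bullet> k) \<in> \<int>" using int_lattice_inner[OF m, of k] by simp
      then have "ee (- (m \<bullet> k)) = 1" by (rule ee_int)
      moreover have "- (m \<bullet> (x + k)) = - (m \<bullet> x) + - (m \<bullet> k)" by (simp add: inner_add_right)
      ultimately show "F (x + k) = ball_power \<beta> a (x + k) * ee (- (m \<bullet> x))"
        unfolding F_def by (simp only: ee_add mult_1_right)
    qed
    then show ?thesis by (simp add: periodized_eq_integral)
  qed
  \<comment> \<open>Measurability of the periodized function in x, needed to pass from Lebesgue to
    Borel measure.\<close>
  have "(\<lambda>(x, k). F (x + k)) \<in> borel_measurable (lborel \<Otimes>\<^sub>M lat)"
    using measurable_pair_swap[OF measurable_lat_pair[of "\<lambda>(k, x). F (x + k)"]] by (simp add: case_prod_unfold)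
  then have [measurable]: "(\<lambda>x. \<integral>k. F (x + k) \<partial>lat) \<in> borel_measurable lborel"
    by (intro sigma_finite_measure.borel_measurable_lebesgue_integral sigma_finite_measure_count_space_countable) auto
  have "fourier_coeff (periodized_ball_power \<beta> a) m = (\<integral>x. indicator torus x *\<^sub>R (\<integral>k. F (x + k) \<partial>lat) \<partial>lebesgue)"
    unfolding fourier_coeff_def set_lebesgue_integral_def per[symmetric] by (simp add: ee_def)
  also have "\<dots> = (TINT x. (\<integral>k. F (x + k) \<partial>lat))"
    by (rule integral_completion) measurable
  also have "\<dots> = (LBINT x. F x)" by (rule integral_unfold[OF iF, symmetric])
  also have "\<dots> = four (ball_power \<beta> a) m" by (simp add: four_def F_def)
  finally show ?thesis by (simp add: four_ball_power[OF \<beta> a])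
qed

lemma fourier_partial_sum_periodized:
  assumes \<beta>: "\<beta> > -1" and a: "a > 0"
  shows "fourier_partial_sum R (periodized_ball_power \<beta> a) (0 :: real ^ 'n)
    = of_real (\<Sum>m\<in>{m \<in> int_lattice. norm m < R}. ball_ft CARD('n) \<beta> a (norm (m :: real ^ 'n)))"
  unfolding fourier_partial_sum_def by (simp add: fourier_coeff_periodized[OF \<beta> a])

text \<open>At the point 0 the character is 1, so the integrand over the ball of radius R is radial
  and polar coordinates apply.\<close>

lemma fourier_partial_integral_ball_power:
  assumes \<beta>: "\<beta> > -1" and a: "a > 0"
  shows "fourier_partial_integral R (ball_power \<beta> a) (0 :: real ^ 'n) = of_real (ball_inv CARD('n) \<beta> a 0 R)"
proof -
  define f where "f s = indicator {..<R} s * ball_ft CARD('n) \<beta> a s" for s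
  have [measurable]: "f \<in> Borel" unfolding f_def by measurable
  let ?w = "radial_weight CARD('n) 0"
  have cont: "continuous_on A (\<lambda>s. ?w s * ball_ft CARD('n) \<beta> a s)" for A by (intro continuous_intros)
  have "AE s in lborel. s \<noteq> R" using AE_not_in[OF countable_imp_null_set_lborel[of "{R}"]] by simp
  then have ae: "AE s in lborel. indicator {0..R} s * (?w s * ball_ft CARD('n) \<beta> a s) = indicator {0..} s * (?w s * f s)"
    by eventually_elim (auto simp: f_def indicator_def)
  have "integrable lborel (\<lambda>s. indicator {0..} s * (?w s * f s))"
    by (rule integrable_cong_AE_imp[OF integral_Icc_eq_lborel(1)[OF cont, of 0 R]]) (use ae in auto)
  then have i: "integrable lborel (\<lambda>\<xi> :: real ^ 'n. f (norm \<xi>))" by (subst integrable_radial_iff) auto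
  have ft: "fourier_transform (ball_power \<beta> a) \<xi> = of_real (ball_ft CARD('n) \<beta> a (norm \<xi>))" for \<xi> :: "real ^ 'n"
  proof -
    have "fourier_transform (ball_power \<beta> a) \<xi> = (\<integral>x. ball_power \<beta> a x * ee (- (\<xi> \<bullet> x)) \<partial>lebesgue)"
      by (simp add: fourier_transform_def ee_def)
    also have "\<dots> = four (ball_power \<beta> a) \<xi>" unfolding four_def by (rule integral_completion) measurable
    finally show ?thesis by (simp add: four_ball_power[OF \<beta> a])
  qed
  have "fourier_partial_integral R (ball_power \<beta> a) (0 :: real ^ 'n) = (\<integral>\<xi>. of_real (f (norm (\<xi> :: real ^ 'n))) * ee (0 \<bullet> \<xi>) \<partial>lebesgue)"
    unfolding fourier_partial_integral_def set_lebesgue_integral_def ft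
    by (intro Bochner_Integration.integral_cong) (auto simp: f_def indicator_def)
  also have "\<dots> = (LBINT \<xi>. of_real (f (norm (\<xi> :: real ^ 'n))) * ee (0 \<bullet> \<xi>))"
    by (rule integral_completion) measurable
  also have "\<dots> = of_real (LBINT s. indicator {0..} s * (?w s * f s))"
    using integral_radial_ee[OF _ i, of 0] by simp
  also have "(LBINT s. indicator {0..} s * (?w s * f s)) = (LBINT s. indicator {0..R} s * (?w s * ball_ft CARD('n) \<beta> a s))"
    by (rule integral_cong_AE) (use ae in auto)
  also have "\<dots> = ball_inv CARD('n) \<beta> a 0 R" unfolding ball_inv_def by (rule integral_Icc_eq_lborel(2)[OF cont])
  finally show ?thesis .
qed

section \<open>The two regimes of the exponent\<close>

theorem theorem1p1:
  fixes d :: nat and \<beta> a :: real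
  assumes "CARD('n::finite) = d" and "\<beta> > -1" and "a > 0"
  shows
    "(\<beta> > (real d - 3) / 2 \<longrightarrow>
       (\<exists>\<epsilon> :: real \<Rightarrow> complex. \<epsilon> \<in> o[at_top](\<lambda>_. 1) \<and>
         (\<lambda>R. fourier_partial_sum R (periodized_ball_power \<beta> a) (0 :: real ^ 'n)
              - (periodized_ball_power \<beta> a (0 :: real ^ 'n)
                 + of_nat (lattice_sphere_count a (0 :: real ^ 'n))
                     * (of_real (L_const \<beta> a) + \<epsilon> R) * of_real (R powr (- \<beta>))))
           \<in> O[at_top](\<lambda>R. of_real (R powr ((real d - 3) / 2 - \<beta>)))))
     \<and>
     (d \<ge> 2 \<and> \<beta> \<le> (real d - 3) / 2 \<longrightarrow>
       (\<exists>\<epsilon> :: real \<Rightarrow> complex. \<epsilon> \<in> o[at_top](\<lambda>_. 1) \<and>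
         (\<lambda>R. fourier_partial_sum R (periodized_ball_power \<beta> a) (0 :: real ^ 'n)
              - (periodized_ball_power \<beta> a (0 :: real ^ 'n)
                 + (fourier_partial_integral R (ball_power \<beta> a) (0 :: real ^ 'n)
                    - ball_power \<beta> a (0 :: real ^ 'n))
                 + of_nat (lattice_sphere_count a (0 :: real ^ 'n))
                     * (of_real (L_const \<beta> a) + \<epsilon> R) * of_real (R powr (- \<beta>))))
           \<in> o[at_top](\<lambda>R. of_real (R powr ((real d - 3) / 2 - \<beta>))))
       \<and>
       (\<lambda>R. (fourier_partial_integral R (ball_power \<beta> a) (0 :: real ^ 'n)
              - ball_power \<beta> a (0 :: real ^ 'n))
            - of_real (- P_const d \<beta> a
                * cos (2 * pi * a * R - (real d - 1 + 2 * \<beta>) / 4 * pi)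
                * R powr ((real d - 3) / 2 - \<beta>)))
         \<in> O[at_top](\<lambda>R. of_real (R powr ((real d - 5) / 2 - \<beta>))))"
proof -
  note d = assms(1) and \<beta> = assms(2) and a = assms(3)
  define e where "e = (real d - 3) / 2 - \<beta>"
  have d1: "d \<ge> 1" using card_pos[where 'n = 'n] d by simp
  \<comment> \<open>Decay of the transform times growth of the shell count: both smoothing costs
    have the exponent e.\<close>
  have e1: "- ((real d + 1) / 2 + \<beta>) + (real d - 1) = e" by (simp add: e_def field_simps)
  define S where "S R = (\<Sum>m\<in>{m \<in> int_lattice. norm m < R}. ball_ft d \<beta> a (norm (m :: real ^ 'n)))" for R
  define P where "P = (\<Sum>k\<in>{k \<in> int_lattice. norm k < a}. ball_profile \<beta> a (norm (k :: real ^ 'n)))"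
  define N where "N = real (lattice_sphere_count a (0 :: real ^ 'n))"
  define H where "H t = ball_inv d \<beta> a 0 t - a powr (2 * \<beta>)" for t
  \<comment> \<open>The o(1) of the theorem is defined as the exact deviation on the sphere, so the
    r_d-terms cancel completely in X.\<close>
  define g where "g t = ball_inv d \<beta> a a t * t powr \<beta> - L_const \<beta> a" for t
  define \<epsilon> where "\<epsilon> t = complex_of_real (g t)" for t
  have "(g \<longlongrightarrow> 0) at_top"
    unfolding g_def using ball_inv_on_sphere[OF \<beta> a, where 'n = 'n] d by (simp add: LIM_zero)
  then have "(\<epsilon> \<longlongrightarrow> 0) at_top" unfolding \<epsilon>_def using tendsto_of_real[of g 0 at_top] by simp
  then have \<epsilon>: "\<epsilon> \<in> o[at_top](\<lambda>_. 1)" by (intro smalloI_tendsto) auto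
  let ?X1 = "\<lambda>R. fourier_partial_sum R (periodized_ball_power \<beta> a) (0 :: real ^ 'n)
              - (periodized_ball_power \<beta> a (0 :: real ^ 'n)
                 + of_nat (lattice_sphere_count a (0 :: real ^ 'n))
                     * (of_real (L_const \<beta> a) + \<epsilon> R) * of_real (R powr (- \<beta>)))"
  let ?X2 = "\<lambda>R. fourier_partial_sum R (periodized_ball_power \<beta> a) (0 :: real ^ 'n)
              - (periodized_ball_power \<beta> a (0 :: real ^ 'n)
                 + (fourier_partial_integral R (ball_power \<beta> a) (0 :: real ^ 'n)
                    - ball_power \<beta> a (0 :: real ^ 'n))
                 + of_nat (lattice_sphere_count a (0 :: real ^ 'n))
                     * (of_real (L_const \<beta> a) + \<epsilon> R) * of_real (R powr (- \<beta>)))"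
  let ?X3 = "\<lambda>R. (fourier_partial_integral R (ball_power \<beta> a) (0 :: real ^ 'n)
              - ball_power \<beta> a (0 :: real ^ 'n))
            - of_real (- P_const d \<beta> a
                * cos (2 * pi * a * R - (real d - 1 + 2 * \<beta>) / 4 * pi)
                * R powr ((real d - 3) / 2 - \<beta>))"
  have sphere: "(of_real (L_const \<beta> a) + \<epsilon> R) * of_real (R powr (- \<beta>)) = complex_of_real (ball_inv d \<beta> a a R)" if R: "R \<ge> 1" for R
  proof -
    have "R powr \<beta> * R powr (- \<beta>) = 1" using R by (simp add: powr_add[symmetric])
    then have "(L_const \<beta> a + g R) * R powr (- \<beta>) = ball_inv d \<beta> a a R" by (simp add: g_def mult.assoc)
    then show ?thesis unfolding \<epsilon>_def of_real_add[symmetric] of_real_mult[symmetric] by (simp only:)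
  qed
  have sum_eq: "fourier_partial_sum R (periodized_ball_power \<beta> a) (0 :: real ^ 'n) = of_real (S R)" for R
    unfolding S_def d[symmetric] by (rule fourier_partial_sum_periodized[OF \<beta> a])
  have per_eq: "periodized_ball_power \<beta> a (0 :: real ^ 'n) = of_real P" unfolding P_def by (rule periodized_at_0)
  have int_eq: "fourier_partial_integral R (ball_power \<beta> a) (0 :: real ^ 'n) - ball_power \<beta> a (0 :: real ^ 'n) = of_real (H R)" for R
    unfolding H_def fourier_partial_integral_ball_power[OF \<beta> a] d
    using a powr_powr[of a 2 \<beta>] by (simp add: ball_power_def powr_numeral)
  have N_eq: "of_nat (lattice_sphere_count a (0 :: real ^ 'n)) = complex_of_real N" by (simp add: N_def)
  let ?E = "\<lambda>b t. (1 + t) powr (- ((real d + 1) / 2 + \<beta>)) * kernel_sum TYPE('n) b t + 1 / b * (1 + t) powr e"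
  define X where "X t = S t - (P + H t + N * ball_inv d \<beta> a a t)" for t
  obtain C where C: "C \<ge> 0" "\<And>b. b \<ge> 1 \<Longrightarrow> \<exists>K\<ge>0. \<forall>t\<ge>1. \<bar>X t\<bar>
     \<le> C * ?E b t
       + K * t powr (- 1 - \<beta>)"
    using lattice_partial_sum_asymp[OF \<beta> a, where 'n = 'n] unfolding d X_def S_def P_def H_def N_def e_def by blast
  \<comment> \<open>If 1/b and the normalized shell count are both at most \<eta>, the whole
    smoothing cost is O(\<eta> t^e), with a constant independent of b.\<close>
  have kernel: "C * ?E b t
      \<le> C * (\<eta> + \<eta>) * 2 powr \<bar>e\<bar> * t powr e"
    if "1 / b \<le> \<eta>" "\<eta> \<ge> 0" "t \<ge> 1" and k: "kernel_sum TYPE('n) b t \<le> \<eta> * (1 + t) powr (real d - 1)" for b \<eta> t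
  proof -
    have "(1 + t) powr (- ((real d + 1) / 2 + \<beta>)) * kernel_sum TYPE('n) b t
      \<le> (1 + t) powr (- ((real d + 1) / 2 + \<beta>)) * (\<eta> * (1 + t) powr (real d - 1))"
      by (intro mult_left_mono k) simp
    also have "\<dots> = \<eta> * ((1 + t) powr (- ((real d + 1) / 2 + \<beta>)) * (1 + t) powr (real d - 1))" by simp
    also have "\<dots> = \<eta> * (1 + t) powr e" unfolding powr_add[symmetric] e1 ..
    finally have 1: "(1 + t) powr (- ((real d + 1) / 2 + \<beta>)) * kernel_sum TYPE('n) b t \<le> \<eta> * (1 + t) powr e" .
    have 2: "1 / b * (1 + t) powr e \<le> \<eta> * (1 + t) powr e" using that by (intro mult_right_mono) auto
    have "C * ?E b t
       \<le> C * (\<eta> * (1 + t) powr e + \<eta> * (1 + t) powr e)"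
      using C(1) by (intro mult_left_mono add_mono 1 2)
    also have "\<dots> = C * (\<eta> + \<eta>) * (1 + t) powr e" by (simp add: algebra_simps)
    also have "\<dots> \<le> C * (\<eta> + \<eta>) * (2 powr \<bar>e\<bar> * t powr e)"
      using C(1) that by (intro mult_left_mono one_plus_powr_le) auto
    finally show ?thesis by (simp add: mult.assoc)
  qed
  \<comment> \<open>The difference of the exponents is (d - 1)/2, which is nonnegative for d >=
    1.\<close>
  have le_e: "t powr (- 1 - \<beta>) \<le> t powr e" if "t \<ge> 1" for t
    using that d1 by (intro powr_mono) (auto simp: e_def field_simps)
  have norm_e: "norm (complex_of_real (t powr x)) = t powr x" for t x by simp
  obtain K0 where K0: "K0 \<ge> 0" "\<And>R. R \<ge> 1 \<Longrightarrow> \<bar>H R - ball_lead d \<beta> a R\<bar> \<le> K0 * R powr ((real d - 5) / 2 - \<beta>)"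
    using ball_inv_zero(1)[OF \<beta> a, where 'n = 'n] unfolding d H_def by blast
  obtain K1 where K1: "K1 \<ge> 0" "\<And>R. R \<ge> 1 \<Longrightarrow> \<bar>H R\<bar> \<le> K1 * R powr e"
    using ball_inv_zero(2)[OF \<beta> a, where 'n = 'n] unfolding d H_def e_def by blast
  have part1: "?X1
           \<in> O[at_top](\<lambda>R. of_real (R powr ((real d - 3) / 2 - \<beta>)))"
  proof -
    \<comment> \<open>For the O-statement a fixed scale b = 1 with the plain shell bound is enough,
      and the central term H is absorbed into the error.\<close>
    obtain B where B: "B \<ge> 0" "\<And>t. t \<ge> 0 \<Longrightarrow> kernel_sum TYPE('n) 1 t \<le> B * (1 + t) powr (real d - 1)"
      using kernel_sum_bound[where 'n = 'n] unfolding d by (metis order_refl)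
    obtain K where K: "K \<ge> 0" "\<And>t. t \<ge> 1 \<Longrightarrow> \<bar>X t\<bar>
     \<le> C * ?E 1 t
       + K * t powr (- 1 - \<beta>)"
      using C(2)[of 1] by auto
    have "\<forall>\<^sub>F R in at_top. norm (?X1 R)
        \<le> (C * ((1 + B) + (1 + B)) * 2 powr \<bar>e\<bar> + K + K1) * norm (complex_of_real (R powr ((real d - 3) / 2 - \<beta>)))"
      using eventually_ge_at_top[of 1]
    proof eventually_elim
      case (elim R)
      have "kernel_sum TYPE('n) 1 R \<le> B * (1 + R) powr (real d - 1)" using B(2) elim by simp
      also have "\<dots> \<le> (1 + B) * (1 + R) powr (real d - 1)" by (intro mult_right_mono) auto
      finally have "\<bar>X R\<bar> \<le> C * ((1 + B) + (1 + B)) * 2 powr \<bar>e\<bar> * R powr e + K * R powr (- 1 - \<beta>)"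
        using kernel[of 1 "1 + B" R] K(2)[OF elim] B(1) elim by simp
      moreover have "K * R powr (- 1 - \<beta>) \<le> K * R powr e" using K(1) le_e[OF elim] by (intro mult_left_mono)
      moreover have "S R - (P + N * ball_inv d \<beta> a a R) = X R + H R" by (simp add: X_def)
      ultimately have "\<bar>S R - (P + N * ball_inv d \<beta> a a R)\<bar> \<le> (C * ((1 + B) + (1 + B)) * 2 powr \<bar>e\<bar> + K + K1) * R powr e"
        using K1(2)[OF elim] unfolding distrib_right by linarith
      then show ?case
        unfolding sum_eq per_eq N_eq mult.assoc sphere[OF elim] norm_e e_def[symmetric]
          of_real_mult[symmetric] of_real_add[symmetric] of_real_diff[symmetric] norm_of_real abs_of_nonneg[OF powr_ge_zero] .
    qed
    then show ?thesis by (rule bigoI)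
  qed
  have part2: "?X2
           \<in> o[at_top](\<lambda>R. of_real (R powr ((real d - 3) / 2 - \<beta>)))" if d2: "d \<ge> 2"
  proof (rule landau_o.smallI)
    fix c :: real assume c: "c > 0"
    \<comment> \<open>Makes the smoothing cost at most c/2; the other half of c is for the terms
      whose constant depends on b.\<close>
    define \<eta> where "\<eta> = c / (4 * (C + 1) * 2 powr \<bar>e\<bar>)"
    have \<eta>: "\<eta> > 0" using c C(1) by (simp add: \<eta>_def)
    have "C * (\<eta> + \<eta>) * 2 powr \<bar>e\<bar> = c / 2 * (C / (C + 1))"
    proof -
      have "C * (c / (4 * (C + 1) * w) + c / (4 * (C + 1) * w)) * w = c / 2 * (C / (C + 1))" if "w > 0" for w
        using that C(1) by (simp add: divide_simps)
      from this[of "2 powr \<bar>e\<bar>"] show ?thesis unfolding \<eta>_def by simp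
    qed
    also have "\<dots> \<le> c / 2 * 1" using c C(1) by (intro mult_left_mono) auto
    finally have \<eta>c: "C * (\<eta> + \<eta>) * 2 powr \<bar>e\<bar> \<le> c / 2" by simp
    obtain b where b: "b \<ge> 1" "1 / b \<le> \<eta>" "\<forall>\<^sub>F t in at_top. kernel_sum TYPE('n) b t \<le> \<eta> * (1 + t) powr (real d - 1)"
      using kernel_sum_small[where 'n = 'n, OF _ \<eta>] d2 unfolding d by blast
    obtain K where K: "K \<ge> 0" "\<And>t. t \<ge> 1 \<Longrightarrow> \<bar>X t\<bar>
     \<le> C * ?E b t
       + K * t powr (- 1 - \<beta>)"
      using C(2)[OF b(1)] by auto
    \<comment> \<open>For d >= 2 the gap (d - 1)/2 between the exponents is strict, so the term with
      the constant K, though K depends on b, is eventually negligible.\<close>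
    have neg: "- 1 - \<beta> - e < 0" using d2 by (simp add: e_def field_simps)
    have "((\<lambda>t. K * t powr (- 1 - \<beta> - e)) \<longlongrightarrow> 0) at_top"
      using tendsto_mult_left[OF tendsto_neg_powr[OF neg filterlim_ident], of K] by simp
    then have ev: "\<forall>\<^sub>F t in at_top. K * t powr (- 1 - \<beta> - e) < c / 2" by (rule order_tendstoD) (use c in simp)
    show "\<forall>\<^sub>F R in at_top. norm (?X2 R)
        \<le> c * norm (complex_of_real (R powr ((real d - 3) / 2 - \<beta>)))"
      using eventually_ge_at_top[of 1] b(3) ev
    proof eventually_elim
      case (elim R)
      have "\<bar>X R\<bar> \<le> C * (\<eta> + \<eta>) * 2 powr \<bar>e\<bar> * R powr e + K * R powr (- 1 - \<beta>)"
        using kernel[OF b(2) less_imp_le[OF \<eta>] elim(1,2)] K(2)[OF elim(1)] by simp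
      moreover have "C * (\<eta> + \<eta>) * 2 powr \<bar>e\<bar> * R powr e \<le> c / 2 * R powr e"
        by (intro mult_right_mono \<eta>c) simp
      moreover have "K * R powr (- 1 - \<beta>) \<le> c / 2 * R powr e"
      proof -
        have "K * R powr (- 1 - \<beta> - e) * R powr e \<le> c / 2 * R powr e" using elim(3) by (intro mult_right_mono) auto
        moreover have "- 1 - \<beta> - e + e = - 1 - \<beta>" by simp
        then have "R powr (- 1 - \<beta> - e) * R powr e = R powr (- 1 - \<beta>)" by (simp only: powr_add[symmetric])
        ultimately show ?thesis by (simp only: mult.assoc)
      qed
      moreover have "c * R powr e = c / 2 * R powr e + c / 2 * R powr e" by (simp add: field_simps)
      ultimately have "\<bar>S R - (P + H R + N * ball_inv d \<beta> a a R)\<bar> \<le> c * R powr e"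
        unfolding X_def by linarith
      then show ?case
        unfolding sum_eq per_eq N_eq int_eq mult.assoc sphere[OF elim(1)] norm_e e_def[symmetric]
          of_real_mult[symmetric] of_real_add[symmetric] of_real_diff[symmetric] norm_of_real abs_of_nonneg[OF powr_ge_zero] .
    qed
  qed
  have part3: "?X3
         \<in> O[at_top](\<lambda>R. of_real (R powr ((real d - 5) / 2 - \<beta>)))"
  proof -
    obtain K2 where K2: "\<And>R. R \<ge> 1 \<Longrightarrow> \<bar>ball_lead d \<beta> a R + P_const d \<beta> a * cos (2 * pi * a * R - (real d - 1 + 2 * \<beta>) / 4 * pi) * R powr ((real d - 3) / 2 - \<beta>)\<bar>
      \<le> K2 * R powr ((real d - 5) / 2 - \<beta>)"
      using ball_lead_asymp[OF d1 a, of \<beta>] by blast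
    have "\<forall>\<^sub>F R in at_top. norm (?X3 R)
        \<le> (K0 + K2) * norm (complex_of_real (R powr ((real d - 5) / 2 - \<beta>)))"
      using eventually_ge_at_top[of 1]
    proof eventually_elim
      case (elim R)
      have "\<bar>H R - - P_const d \<beta> a * cos (2 * pi * a * R - (real d - 1 + 2 * \<beta>) / 4 * pi) * R powr ((real d - 3) / 2 - \<beta>)\<bar>
         \<le> (K0 + K2) * R powr ((real d - 5) / 2 - \<beta>)"
        using K0(2)[OF elim] K2[OF elim] unfolding distrib_right by linarith
      then show ?case
        unfolding int_eq norm_e of_real_diff[symmetric] norm_of_real abs_of_nonneg[OF powr_ge_zero] .
    qed
    then show ?thesis by (rule bigoI)
  qed
  show ?thesis using \<epsilon> part1 part2 part3 by blast
qed

end
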